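(* There are no integers $a,b,c$ with $abc\neq 0$ and $\gcd(a,b,c)=1$ satisfying $a^{13}+b^{13}=3c^{7}$. *)

theory Defs
  imports Main
begin

end

theory Submission
  imports Defs "HOL-Analysis.Analysis" "HOL-Number_Theory.Cong" "HOL-Computational_Algebra.Nth_Powers"
begin

text \<open>
  Let \<open>\<theta> = 2 cos(2 \<pi> / 13)\<close> and \<open>\<alpha> = 2 cos(2 \<pi> / 7)\<close>, and let \<open>\<kappa>\<close> generate the cubic subfield of
  \<open>\<rat>(\<theta>)\<close>. A solution forces \<open>a + b\<close> to be \<open>3 d\<^sup>7\<close> or \<open>3 \<cdot> 13\<^sup>6 d\<^sup>7\<close>, and the element
  \<open>(a + b)\<^sup>2 - (2 - \<theta>) a b\<close> of the principal ideal domain \<open>\<int>[\<theta>]\<close> to be a unit times a seventh power, up to a factor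
  \<open>2 - \<theta>\<close>. If 7 does not divide \<open>d\<close>, its norm to \<open>\<rat>(\<surd>13)\<close> is a power of the fundamental unit times a seventh
  power, which is impossible modulo 49 and 43. If 7 divides \<open>d\<close>, a Kummer type lemma absorbs the unit, and the
  difference with the conjugate over \<open>\<rat>(\<kappa>)\<close> expresses \<open>x\<^sup>7 - y\<^sup>7\<close> as a product of small primes
  and a fourteenth power of \<open>d\<close>. Over \<open>\<int>[\<kappa>, \<alpha>]\<close> the element \<open>x\<^sup>7 - y\<^sup>7\<close> factors into \<open>x - y\<close>
  and linear forms in \<open>(x - y)\<^sup>2\<close> and \<open>x y\<close>. These forms are pairwise coprime, hence units times seventh powers, and the
  difference of two of them is again of the form \<open>x\<^sup>7 - y\<^sup>7\<close> by Kummer's lemma. This infinite descent loses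
  primes in every step, since a positivity argument bounds the norms of the factors from below.
\<close>

section \<open>Ring homomorphisms and comaximal elements\<close>

text \<open>Seventh roots in degree nine are taken without a class number. The Galois group of
  \<open>\<rat>(\<kappa>, \<alpha>)\<close> is elementary of order 9, so the norms of x to its four
  cubic subfields multiply to x^3 times the rational norm. As 3 is prime to 7, both the extraction
  of seventh roots and Kummer's lemma reduce to cubic fields, where Minkowski's bound is small and
  the unit rank is 2. Fundamental units are not computed either: units that are independent modulo
  seventh powers, as many as the rank allows, generate all units modulo seventh powers. Coprimality
  is the Bezout relation \<open>comax\<close>, since gcds need not exist. The descent carries (x -
  y)^2 and x y because these lie in \<open>\<int>[\<kappa>]\<close> when x and y are conjugates from
  the sextic ring; moreover (x - y)^2 and (x - y)^2 + 4 x y = (x + y)^2 are totally nonnegative,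
  which is the source of the norm bound. The sieve uses 49 and 43 because both have a unit group of
  order 42: a form of degree 6 does not notice a scaling by seventh powers prime to the modulus, so
  only one residue has to be enumerated.\<close>

definition rhom :: "('a::comm_ring_1 \<Rightarrow> 'b::comm_ring_1) \<Rightarrow> bool" where
  "rhom f \<longleftrightarrow> f 1 = 1 \<and> (\<forall>x y. f (x + y) = f x + f y) \<and> (\<forall>x y. f (x * y) = f x * f y)"

lemma rhomI:
  assumes "f 1 = 1" "\<And>x y. f (x + y) = f x + f y" "\<And>x y. f (x * y) = f x * f y"
  shows "rhom f"
  using assms unfolding rhom_def by blast

lemma rhom_1: "rhom f \<Longrightarrow> f 1 = 1"
  and rhom_add: "rhom f \<Longrightarrow> f (x + y) = f x + f y"
  and rhom_mult: "rhom f \<Longrightarrow> f (x * y) = f x * f y"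
  unfolding rhom_def by blast+

lemma rhom_0: "rhom f \<Longrightarrow> f 0 = 0"
  using rhom_add[of f 0 0] by simp

lemma rhom_uminus: "rhom f \<Longrightarrow> f (- x) = - f x"
  using rhom_add[of f x "- x"] rhom_0[of f] by (simp add: eq_neg_iff_add_eq_0 add.commute)

lemma rhom_diff: "rhom f \<Longrightarrow> f (x - y) = f x - f y"
  using rhom_add[of f x "- y"] rhom_uminus[of f y] by simp

lemma rhom_power: "rhom f \<Longrightarrow> f (x ^ n) = f x ^ n"
  by (induction n) (simp_all add: rhom_1 rhom_mult)

lemma rhom_of_nat: "rhom f \<Longrightarrow> f (of_nat n) = of_nat n"
  by (induction n) (simp_all add: rhom_0 rhom_1 rhom_add)

lemma rhom_of_int: "rhom f \<Longrightarrow> f (of_int n) = of_int n"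
  by (cases n) (simp_all add: rhom_of_nat rhom_uminus rhom_diff rhom_1)

lemma rhom_numeral: "rhom f \<Longrightarrow> f (numeral n) = numeral n"
  using rhom_of_nat[of f "numeral n"] by simp

lemmas rhom_simps = rhom_0 rhom_1 rhom_add rhom_mult rhom_uminus rhom_diff rhom_power
  rhom_of_nat rhom_of_int rhom_numeral

lemma rhom_prod: "rhom f \<Longrightarrow> f (\<Prod>i\<in>A. g i) = (\<Prod>i\<in>A. f (g i))"
  by (induction A rule: infinite_finite_induct) (simp_all add: rhom_simps)

lemma rhom_sum: "rhom f \<Longrightarrow> f (\<Sum>i\<in>A. g i) = (\<Sum>i\<in>A. f (g i))"
  by (induction A rule: infinite_finite_induct) (simp_all add: rhom_simps)

lemma rhom_dvd: "rhom f \<Longrightarrow> x dvd y \<Longrightarrow> f x dvd f y"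
  by (auto simp: dvd_def rhom_simps)

lemma rhom_comp: "rhom f \<Longrightarrow> rhom g \<Longrightarrow> rhom (\<lambda>x. f (g x))"
  by (intro rhomI) (simp_all add: rhom_simps)

lemma rhom_id: "rhom (\<lambda>x. x)"
  by (intro rhomI) auto

definition comax :: "'a::comm_ring_1 \<Rightarrow> 'a \<Rightarrow> bool" where
  "comax x y \<longleftrightarrow> (\<exists>r s. r * x + s * y = 1)"

lemma comaxI: "r * x + s * y = 1 \<Longrightarrow> comax x y"
  unfolding comax_def by blast

lemma comax_sym: "comax x y \<Longrightarrow> comax y x"
  unfolding comax_def by (metis add.commute)

lemma comax_mult:
  assumes "comax x y" "comax x z" shows "comax x (y * z)"
proof -
  obtain r s t u where a: "r * x + s * y = 1" and b: "t * x + u * z = 1"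
    using assms unfolding comax_def by blast
  have "(r * t * x + r * u * z + s * y * t) * x + (s * u) * (y * z)
      = (r * x + s * y) * (t * x + u * z)"
    by (simp add: algebra_simps)
  thus ?thesis using a b by (intro comaxI) simp
qed

lemma comax_one: "comax x 1" "comax 1 x"
  unfolding comax_def by (metis add_0 mult_1 mult_zero_left, metis add.commute add_0 mult_1 mult_zero_left)

lemma comax_power: "comax x y \<Longrightarrow> comax x (y ^ n)"
  by (induction n) (simp_all add: comax_one comax_mult)

lemma comax_powers: "comax x y \<Longrightarrow> comax (x ^ m) (y ^ n)"
  by (meson comax_power comax_sym)

lemma comax_dvd:
  assumes "comax x y" "d dvd y" shows "comax x d"
proof -
  obtain r s where "r * x + s * y = 1" using assms(1) unfolding comax_def by blast
  moreover obtain k where "y = d * k" using assms(2) by (auto simp: dvd_def)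
  ultimately have "r * x + (s * k) * d = 1" by (simp add: algebra_simps)
  thus ?thesis by (rule comaxI)
qed

lemma comax_dvd_left: "comax x y \<Longrightarrow> d dvd x \<Longrightarrow> comax d y"
  using comax_dvd comax_sym by blast

lemma comax_cancel:
  assumes "comax x y" "x dvd y * z" shows "x dvd z"
proof -
  obtain r s where e: "r * x + s * y = 1" using assms(1) unfolding comax_def by blast
  have "z = (r * x + s * y) * z" using e by simp
  also have "\<dots> = x * (r * z) + s * (y * z)" by (simp add: algebra_simps)
  also have "x dvd \<dots>" using assms(2) by (intro dvd_add) auto
  finally show ?thesis .
qed

lemma comax_add:
  assumes "comax x y" shows "comax x (y + x * w)"
proof -
  obtain r s where e: "r * x + s * y = 1" using assms(1) unfolding comax_def by blast
  have "(r - s * w) * x + s * (y + x * w) = 1" using e by (simp add: algebra_simps)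
  thus ?thesis by (rule comaxI)
qed

lemma comax_cong: "comax x y \<Longrightarrow> x dvd y - z \<Longrightarrow> comax x z"
proof -
  assume a: "comax x y" and "x dvd y - z"
  then obtain k where "y - z = x * k" by (auto simp: dvd_def)
  hence "z = y + x * (- k)" by (simp add: algebra_simps)
  with comax_add[OF a, of "- k"] show ?thesis by simp
qed

lemma comax_unit: "comax x y \<Longrightarrow> x dvd y \<Longrightarrow> x dvd 1"
  using comax_cancel[of x y 1] by simp

lemma unit_comax: "x dvd 1 \<Longrightarrow> comax x y"
proof -
  assume "x dvd 1"
  then obtain k where "1 = x * k" by (auto simp: dvd_def)
  hence "k * x + 0 * y = 1" by (simp add: mult.commute)
  thus ?thesis by (rule comaxI)
qed

lemma comax_rhom: "rhom f \<Longrightarrow> comax x y \<Longrightarrow> comax (f x) (f y)"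
  unfolding comax_def by (metis rhom_add rhom_mult rhom_1)

lemma comax_of_int:
  assumes "coprime a (b::int)" shows "comax (of_int a :: 'a::comm_ring_1) (of_int b)"
proof -
  obtain r s where "r * a + s * b = 1"
    using bezout_int[of a b] assms by (auto simp: coprime_iff_gcd_eq_1)
  hence "of_int (r * a + s * b) = (1::'a)" by simp
  thus ?thesis by (intro comaxI[of "of_int r" _ "of_int s"]) simp
qed

section \<open>The cubic ring of conductor 13\<close>

text \<open>Coordinates with respect to the powers of \<open>\<kappa>\<close>, a cubic Gaussian period of conductor 13 with
  \<open>\<kappa>\<^sup>3 + \<kappa>\<^sup>2 - 4 \<kappa> + 1 = 0\<close>.\<close>

datatype c13 = C13 (c0: int) (c1: int) (c2: int)

instantiation c13 :: comm_ring_1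
begin
definition "0 = C13 0 0 0"
definition "1 = C13 1 0 0"
definition "x + y = C13 (c0 x + c0 y) (c1 x + c1 y) (c2 x + c2 y)"
definition "x - y = C13 (c0 x - c0 y) (c1 x - c1 y) (c2 x - c2 y)"
definition "- x = C13 (- c0 x) (- c1 x) (- c2 x)"
definition "x * y = (let d3 = c1 x * c2 y + c2 x * c1 y; d4 = c2 x * c2 y in
  C13 (c0 x * c0 y - d3 + d4) (c0 x * c1 y + c1 x * c0 y + 4 * d3 - 5 * d4)
      (c0 x * c2 y + c1 x * c1 y + c2 x * c0 y - d3 + 5 * d4))"
instance
  by standard
    (simp_all add: zero_c13_def one_c13_def plus_c13_def minus_c13_def uminus_c13_def
      times_c13_def Let_def algebra_simps)
end

lemmas c13_defs = zero_c13_def one_c13_def plus_c13_def minus_c13_def uminus_c13_def times_c13_def Let_def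

lemma of_nat_c13: "of_nat n = C13 (of_nat n) 0 0"
  by (induction n) (simp_all add: c13_defs)

lemma numeral_c13: "numeral n = C13 (numeral n) 0 0"
  using of_nat_c13[of "numeral n"] by simp

lemma of_int_c13: "of_int n = C13 (of_int n) 0 0"
  by (cases n) (simp_all add: of_nat_c13 c13_defs)

section \<open>The cubic ring of conductor 7\<close>

text \<open>Coordinates over \<open>\<int>[\<kappa>]\<close> with respect to the powers of \<open>\<alpha> = 2 cos(2 \<pi> / 7)\<close>, where
  \<open>\<alpha>\<^sup>3 + \<alpha>\<^sup>2 - 2 \<alpha> - 1 = 0\<close>. The conductors are coprime, so this is a maximal order.\<close>

datatype k9 = C7 (a0: c13) (a1: c13) (a2: c13)

instantiation k9 :: comm_ring_1
begin
definition "0 = C7 0 0 0"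
definition "1 = C7 1 0 0"
definition "x + y = C7 (a0 x + a0 y) (a1 x + a1 y) (a2 x + a2 y)"
definition "x - y = C7 (a0 x - a0 y) (a1 x - a1 y) (a2 x - a2 y)"
definition "- x = C7 (- a0 x) (- a1 x) (- a2 x)"
definition "x * y = (let d3 = a1 x * a2 y + a2 x * a1 y; d4 = a2 x * a2 y in
  C7 (a0 x * a0 y + d3 - d4) (a0 x * a1 y + a1 x * a0 y + 2 * d3 - d4)
      (a0 x * a2 y + a1 x * a1 y + a2 x * a0 y - d3 + 3 * d4))"
instance
  by standard
    (simp_all add: zero_k9_def one_k9_def plus_k9_def minus_k9_def uminus_k9_def
      times_k9_def Let_def algebra_simps)
end

lemmas k9_defs = zero_k9_def one_k9_def plus_k9_def minus_k9_def uminus_k9_def times_k9_def Let_def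

lemma of_nat_k9: "of_nat n = C7 (of_nat n) 0 0"
  by (induction n) (simp_all add: k9_defs)

lemma numeral_k9: "numeral n = C7 (numeral n) 0 0"
  using of_nat_k9[of "numeral n"] by simp

lemma of_int_k9: "of_int n = C7 (of_int n) 0 0"
  by (cases n) (simp_all add: of_nat_k9 k9_defs)

section \<open>The sextic ring of conductor 13\<close>

text \<open>Here \<open>\<theta> = 2 cos(2 \<pi> / 13)\<close> is a root of \<open>x\<^sup>2 - \<kappa> x + \<kappa>\<^sub>2\<close>, whose other root is the conjugate of
  \<open>\<theta>\<close> over the cubic subfield.\<close>

abbreviation kap :: "c13" where "kap \<equiv> C13 0 1 0"
abbreviation kap2 :: "c13" where "kap2 \<equiv> C13 (- 3) 1 1"

datatype fq = Fq (f0: "c13") (f1: "c13")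

instantiation fq :: comm_ring_1
begin
definition "0 = Fq 0 0"
definition "1 = Fq 1 0"
definition "x + y = Fq (f0 x + f0 y) (f1 x + f1 y)"
definition "x - y = Fq (f0 x - f0 y) (f1 x - f1 y)"
definition "- x = Fq (- f0 x) (- f1 x)"
definition "x * y = Fq (f0 x * f0 y - kap2 * (f1 x * f1 y))
  (f0 x * f1 y + f1 x * f0 y + kap * (f1 x * f1 y))"
instance
  by standard (simp_all add: zero_fq_def one_fq_def plus_fq_def minus_fq_def uminus_fq_def
      times_fq_def algebra_simps)
end

lemmas fq_defs = zero_fq_def one_fq_def plus_fq_def minus_fq_def uminus_fq_def times_fq_def

lemma of_nat_fq: "of_nat n = Fq (of_nat n) 0"
  by (induction n) (simp_all add: fq_defs)

lemma numeral_fq: "numeral n = Fq (numeral n) 0"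
  using of_nat_fq[of "numeral n"] by simp

lemma of_int_fq: "of_int n = Fq (of_int n) 0"
  by (cases n) (simp_all add: of_nat_fq fq_defs)

section \<open>Automorphisms\<close>

text \<open>The generators of the Galois groups: \<open>\<kappa> \<mapsto> 2 - 2 \<kappa> - \<kappa>\<^sup>2\<close>, \<open>\<alpha> \<mapsto> \<alpha>\<^sup>2 - 2\<close> and
  \<open>\<theta> \<mapsto> \<theta>\<^sup>2 - 2\<close>.\<close>

definition sk13 :: "c13 \<Rightarrow> c13" where
  "sk13 x = C13 (c0 x + 2 * c1 x + c2 x) (3 * c2 x - 2 * c1 x) (c2 x - c1 x)"

lemma rhom_sk13: "rhom sk13"
  by (rule rhomI) (simp_all add: sk13_def c13_defs algebra_simps)

lemma sk13_cube: "sk13 (sk13 (sk13 x)) = x"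
  by (cases x) (simp add: sk13_def)

definition n13 :: "c13 \<Rightarrow> int" where "n13 x = c0 (x * sk13 x * sk13 (sk13 x))"

lemma n13_C13: "x * sk13 x * sk13 (sk13 x) = of_int (n13 x)"
  by (cases x) (simp add: n13_def sk13_def c13_defs of_int_c13 algebra_simps)

definition sa :: "k9 \<Rightarrow> k9" where
  "sa x = C7 (a0 x - 2 * a1 x + 3 * a2 x) (- a2 x) (a1 x - a2 x)"

definition sk :: "k9 \<Rightarrow> k9" where
  "sk x = C7 (sk13 (a0 x)) (sk13 (a1 x)) (sk13 (a2 x))"

lemma rhom_sa: "rhom sa"
  by (rule rhomI) (simp_all add: sa_def k9_defs algebra_simps)

lemma rhom_sk: "rhom sk"
  by (rule rhomI) (simp_all add: sk_def k9_defs rhom_simps[OF rhom_sk13])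

lemma sa_cube: "sa (sa (sa x)) = x"
  by (cases x) (simp add: sa_def)

lemma sk_cube: "sk (sk (sk x)) = x"
  by (cases x) (simp add: sk_def sk13_cube)

lemma sa_sk: "sa (sk x) = sk (sa x)"
  by (cases x) (simp add: sa_def sk_def rhom_simps[OF rhom_sk13])

definition sf :: "fq \<Rightarrow> fq" where
  "sf x = Fq (sk13 (f0 x) - (kap2 + 2) * sk13 (f1 x)) (kap * sk13 (f1 x))"

lemma rhom_sf: "rhom sf"
proof (rule rhomI)
  show "sf (x * y) = sf x * sf y" for x y
    by (cases x; cases y; cases "f0 x"; cases "f1 x"; cases "f0 y"; cases "f1 y")
      (simp add: sf_def fq_defs sk13_def c13_defs numeral_c13 algebra_simps)
qed (simp_all add: sf_def fq_defs rhom_simps[OF rhom_sk13] algebra_simps)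

section \<open>Norms and absence of zero divisors\<close>

text \<open>2 is inert: modulo 2 the cubic of \<kappa> is x^3 + x^2 + 1, which has no root, so the
  norm form has only the trivial zero there.\<close>

lemma even_cubic_form:
  fixes a b c :: int
  assumes "even (n13 (C13 a b c))"
  shows "even a \<and> even b \<and> even c"
  using assms
  by (cases "even a"; cases "even b"; cases "even c")
     (simp_all add: n13_def sk13_def c13_defs)

lemma n13_scale: "n13 (of_int k * x) = k ^ 3 * n13 x"
  by (cases x) (simp add: n13_def sk13_def c13_defs of_int_c13 algebra_simps power3_eq_cube)

lemma n13_mult: "n13 (x * y) = n13 x * n13 y"
proof -
  have "(of_int (n13 (x * y)) :: c13) = of_int (n13 x * n13 y)"
    by (simp only: of_int_mult flip: n13_C13) (simp add: rhom_simps[OF rhom_sk13] mult_ac)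
  thus ?thesis by (simp add: of_int_c13)
qed

text \<open>Infinite descent at 2: a zero of the norm has even coordinates, and halving them gives a
  smaller zero.\<close>

lemma n13_0_iff: "n13 x = 0 \<longleftrightarrow> x = 0"
proof
  show "x = 0 \<Longrightarrow> n13 x = 0" by (simp add: n13_def sk13_def c13_defs)
  show "n13 x = 0 \<Longrightarrow> x = 0"
  proof (induction "nat (\<bar>c0 x\<bar> + \<bar>c1 x\<bar> + \<bar>c2 x\<bar>)" arbitrary: x rule: less_induct)
    case less
    obtain a b c where x: "x = C13 a b c" by (cases x)
    have "even a" "even b" "even c"
      using even_cubic_form[of a b c] less.prems x by auto
    then obtain a' b' c' where abc: "a = 2 * a'" "b = 2 * b'" "c = 2 * c'" by (auto elim!: evenE)
    have x2: "x = of_int 2 * C13 a' b' c'" using x abc by (simp add: numeral_c13 c13_defs)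
    hence n0: "n13 (C13 a' b' c') = 0" using less.prems n13_scale[of 2 "C13 a' b' c'"] by simp
    show ?case
    proof (rule ccontr)
      assume "x \<noteq> 0"
      hence "C13 a' b' c' \<noteq> 0" using x2 by auto
      moreover from this have "nat (\<bar>a'\<bar> + \<bar>b'\<bar> + \<bar>c'\<bar>) < nat (\<bar>c0 x\<bar> + \<bar>c1 x\<bar> + \<bar>c2 x\<bar>)"
        using x abc by (auto simp: zero_c13_def)
      ultimately show False using less.hyps[of "C13 a' b' c'"] n0 by simp
    qed
  qed
qed

lemma c13_no_zero_div:
  fixes x y :: "c13"
  assumes "x \<noteq> 0" "y \<noteq> 0" shows "x * y \<noteq> 0"
  using assms n13_mult[of x y] n13_0_iff by (metis mult_eq_0_iff)

text \<open>The relative norm form for the powers of \<alpha>. It is stated over any commutative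
  ring because it is evaluated on \<open>c13\<close> as well as on integer residues modulo
  5.\<close>

definition n7 :: "'a::comm_ring_1 \<Rightarrow> 'a \<Rightarrow> 'a \<Rightarrow> 'a" where
  "n7 x y z = x*x*x - x*x*y + 5*(x*x*z) - 2*(x*y*y) - x*y*z + 6*(x*z*z)
     + y*y*y - y*y*z - 2*(y*z*z) + z*z*z"

lemma n7_sa: "x * sa x * sa (sa x) = C7 (n7 (a0 x) (a1 x) (a2 x)) 0 0"
  by (cases x) (simp add: n7_def sa_def k9_defs algebra_simps)

text \<open>Reduction modulo the prime \<open>1 + \<kappa>\<close> of norm 5, modulo which the cubic of conductor 7 is irreducible.\<close>

definition psi5 :: "c13 \<Rightarrow> int" where "psi5 x = c0 x - c1 x + c2 x"

lemma psi5_simps: "psi5 (x + y) = psi5 x + psi5 y" "psi5 (x - y) = psi5 x - psi5 y"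
    "psi5 (- x) = - psi5 x" "psi5 (numeral n) = numeral n" "psi5 0 = 0"
  by (simp_all add: psi5_def c13_defs numeral_c13)

lemma psi5_mult: "[psi5 (x * y) = psi5 x * psi5 y] (mod 5)"
proof -
  have "psi5 (x * y) - psi5 x * psi5 y =
      5 * (2 * (c2 x * c2 y) - (c1 x * c2 y + c2 x * c1 y) )"
    by (cases x; cases y) (simp add: psi5_def c13_defs algebra_simps)
  thus ?thesis by (metis cong_iff_dvd_diff dvd_triv_left)
qed

lemma psi5_dvd: "5 dvd psi5 x \<Longrightarrow> \<exists>y. x = (1 + kap) * y"
proof -
  assume "5 dvd psi5 x"
  then obtain k where k: "psi5 x = 5 * k" by (auto simp: dvd_def)
  have "x = (1 + kap) * C13 (c0 x - k) (c2 x) (- k)"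
    using k by (cases x) (simp add: psi5_def c13_defs)
  thus ?thesis by blast
qed

lemma n7_mod5:
  assumes "5 dvd n7 a b (c::int)" shows "5 dvd a \<and> 5 dvd b \<and> 5 dvd c"
proof -
  have r: "[n7 a b c = n7 (a mod 5) (b mod 5) (c mod 5)] (mod 5)"
    unfolding n7_def by (intro cong_add cong_diff cong_mult cong_refl) (simp_all add: cong_def)
  have "\<forall>x\<in>{0,1,2,3,4::int}. \<forall>y\<in>{0,1,2,3,4}. \<forall>z\<in>{0,1,2,3,4}.
      n7 x y z mod 5 = 0 \<longrightarrow> x = 0 \<and> y = 0 \<and> z = 0"
    by (simp add: n7_def)
  moreover have "x mod 5 \<in> {0,1,2,3,4::int}" for x :: int
  proof -
    have "x mod 5 = 0 \<or> x mod 5 = 1 \<or> x mod 5 = 2 \<or> x mod 5 = 3 \<or> x mod 5 = 4" by presburger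
    thus ?thesis by blast
  qed
  moreover have "n7 (a mod 5) (b mod 5) (c mod 5) mod 5 = 0"
    using r assms unfolding cong_def dvd_eq_mod_eq_0 by simp
  ultimately show ?thesis by (metis dvd_eq_mod_eq_0)
qed

lemma psi5_n7: "[psi5 (n7 x y z) = n7 (psi5 x) (psi5 y) (psi5 z)] (mod 5)"
proof -
  have m2: "[psi5 (u * v) = s * t] (mod 5)" if "[psi5 u = s] (mod 5)" "[psi5 v = t] (mod 5)" for u v s t
    by (rule cong_trans[OF psi5_mult cong_mult[OF that]])
  show ?thesis unfolding n7_def psi5_simps
    by (intro cong_add cong_diff m2 cong_refl) (simp_all add: psi5_simps)
qed

text \<open>The same descent with the prime 1 + \<kappa>. The prime 2 would not do, since its
  residue field with 8 elements contains roots of the cubic of \<alpha>.\<close>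

lemma n7_0:
  fixes x y z :: "c13"
  assumes "n7 x y z = 0" shows "x = 0 \<and> y = 0 \<and> z = 0"
  using assms
proof (induction "nat (\<bar>n13 x\<bar> + \<bar>n13 y\<bar> + \<bar>n13 z\<bar>)" arbitrary: x y z rule: less_induct)
  case less
  have "5 dvd n7 (psi5 x) (psi5 y) (psi5 z)"
    using psi5_n7[of x y z] less.prems by (simp add: psi5_simps cong_def dvd_eq_mod_eq_0)
  then obtain x' y' z' where e: "x = (1 + kap) * x'" "y = (1 + kap) * y'" "z = (1 + kap) * z'"
    using n7_mod5 psi5_dvd by metis
  have "n7 x y z = (1 + kap) * ((1 + kap) * ((1 + kap) * n7 x' y' z'))"
    unfolding e n7_def by (simp add: algebra_simps)
  moreover have "1 + kap \<noteq> 0" by (simp add: c13_defs)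
  ultimately have n0: "n7 x' y' z' = 0" using less.prems c13_no_zero_div by metis
  have "n13 (1 + kap) = - 5" by (simp add: n13_def sk13_def c13_defs)
  hence s: "\<bar>n13 x\<bar> = 5 * \<bar>n13 x'\<bar>" "\<bar>n13 y\<bar> = 5 * \<bar>n13 y'\<bar>" "\<bar>n13 z\<bar> = 5 * \<bar>n13 z'\<bar>"
    unfolding e by (simp_all add: n13_mult abs_mult)
  show ?case
  proof (rule ccontr)
    assume "\<not> ?case"
    hence "n13 x \<noteq> 0 \<or> n13 y \<noteq> 0 \<or> n13 z \<noteq> 0" by (simp add: n13_0_iff)
    hence "\<bar>n13 x\<bar> > 0 \<or> \<bar>n13 y\<bar> > 0 \<or> \<bar>n13 z\<bar> > 0" by simp
    moreover have "nat (A + B + C) < nat (X + Y + Z)"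
      if "X = 5 * A" "Y = 5 * B" "Z = 5 * C" "X > 0 \<or> Y > 0 \<or> Z > 0"
        "A \<ge> 0" "B \<ge> 0" "C \<ge> 0" for A B C X Y Z :: int
      using that by linarith
    ultimately have "nat (\<bar>n13 x'\<bar> + \<bar>n13 y'\<bar> + \<bar>n13 z'\<bar>) < nat (\<bar>n13 x\<bar> + \<bar>n13 y\<bar> + \<bar>n13 z\<bar>)"
      using s by simp
    from less.hyps[OF this n0] have "x' = 0 \<and> y' = 0 \<and> z' = 0" .
    with \<open>\<not> ?case\<close> e show False by simp
  qed
qed

instance c13 :: idom
  by standard (rule c13_no_zero_div)

instance k9 :: idom
proof
  fix x y :: k9
  assume n: "x \<noteq> 0" "y \<noteq> 0"
  show "x * y \<noteq> 0"
  proof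
    assume "x * y = 0"
    hence "(x * y) * sa (x * y) * sa (sa (x * y)) = 0" by simp
    hence "(x * sa x * sa (sa x)) * (y * sa y * sa (sa y)) = 0"
      by (simp add: rhom_simps[OF rhom_sa] mult_ac)
    hence "C7 (n7 (a0 x) (a1 x) (a2 x)) 0 0 * C7 (n7 (a0 y) (a1 y) (a2 y)) 0 0 = 0"
      by (simp only: n7_sa)
    moreover have "C7 p 0 0 * C7 q 0 0 = C7 (p * q) 0 0" for p q
      by (simp add: times_k9_def Let_def)
    ultimately have "n7 (a0 x) (a1 x) (a2 x) * n7 (a0 y) (a1 y) (a2 y) = 0"
      by (simp only: zero_k9_def k9.inject)
    hence "n7 (a0 x) (a1 x) (a2 x) = 0 \<or> n7 (a0 y) (a1 y) (a2 y) = 0" by simp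
    thus False using n n7_0 by (metis k9.collapse zero_k9_def)
  qed
qed

definition fbar :: "fq \<Rightarrow> fq" where "fbar x = Fq (f0 x + kap * f1 x) (- f1 x)"
definition nf13 :: "fq \<Rightarrow> c13" where
  "nf13 x = f0 x * f0 x + kap * f0 x * f1 x + kap2 * (f1 x * f1 x)"

lemma rhom_fbar: "rhom fbar"
  by (rule rhomI) (simp_all add: fbar_def fq_defs algebra_simps)

lemma fbar_mult: "x * fbar x = Fq (nf13 x) 0"
  by (cases x) (simp add: fbar_def fq_defs nf13_def algebra_simps)

lemma square_eq_13:
  fixes m n :: int
  assumes "m * m = 13 * (n * n)" shows "n = 0"
proof (rule ccontr)
  assume "n \<noteq> 0"
  have p: "prime (13::int)" by simp
  have "m \<noteq> 0" using assms \<open>n \<noteq> 0\<close> by auto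
  have "multiplicity 13 (m * m) = 2 * multiplicity 13 m"
    using p \<open>m \<noteq> 0\<close> by (subst prime_elem_multiplicity_mult_distrib) auto
  moreover have "multiplicity 13 (13 * (n * n)) = 1 + 2 * multiplicity 13 n"
    using p \<open>n \<noteq> 0\<close> by (simp add: prime_elem_multiplicity_mult_distrib)
  ultimately show False using assms by (metis Suc_eq_plus1_left double_not_eq_Suc_double)
qed

text \<open>The discriminant of \<theta> over the cubic ring has norm 13, so a nontrivial zero would
  make 13 times a nonzero square a square.\<close>

lemma nf13_0: "nf13 x = 0 \<Longrightarrow> x = 0"
proof -
  assume a: "nf13 x = 0"
  let ?u = "2 * f0 x + kap * f1 x"
  have D: "kap * kap - 4 * kap2 = C13 12 (- 4) (- 3)" by (simp add: c13_defs numeral_c13)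
  have "?u * ?u = 4 * nf13 x + (kap * kap - 4 * kap2) * (f1 x * f1 x)"
    by (simp add: nf13_def algebra_simps)
  hence "?u * ?u = C13 12 (- 4) (- 3) * (f1 x * f1 x)" using a D by simp
  hence "n13 ?u * n13 ?u = n13 (C13 12 (- 4) (- 3)) * (n13 (f1 x) * n13 (f1 x))"
    by (metis n13_mult)
  moreover have "n13 (C13 12 (- 4) (- 3)) = 13" by (simp add: n13_def sk13_def c13_defs)
  ultimately have "n13 (f1 x) = 0" using square_eq_13 by simp
  hence q: "f1 x = 0" by (simp add: n13_0_iff)
  with a have "f0 x = 0" by (simp add: nf13_def)
  with q show "x = 0" by (metis fq.collapse zero_fq_def)
qed

lemma fq_embed: "Fq p 0 * Fq q 0 = Fq (p * q) 0" "Fq p 0 + Fq q 0 = Fq (p + q) 0"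
  by (simp_all add: fq_defs)

instance fq :: idom
proof
  fix x y :: fq
  assume n: "x \<noteq> 0" "y \<noteq> 0"
  show "x * y \<noteq> 0"
  proof
    assume "x * y = 0"
    hence "(x * fbar x) * (y * fbar y) = 0" by (metis mult.left_commute mult.assoc mult_zero_left)
    hence "nf13 x * nf13 y = 0" by (simp only: fbar_mult fq_embed) (simp add: zero_fq_def)
    thus False using n nf13_0 by auto
  qed
qed

lemma sf_sq_fbar: "sf (sf (sf x)) = fbar x"
  by (cases x; cases "f0 x"; cases "f1 x") (simp add: sf_def fbar_def sk13_def c13_defs numeral_c13)

section \<open>Minkowski's theorem for products of linear forms\<close>

text \<open>Octahedra suit products of linear forms: by the inequality of arithmetic and geometric
  means, a bound for the sum of the absolute values bounds their product.\<close>

definition octa :: "real \<Rightarrow> (real^'n) set" where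
  "octa r = {x. (\<Sum>k\<in>UNIV. \<bar>x $ k\<bar>) < r}"

lemma bounded_octa: "bounded (octa r :: (real^'n) set)"
proof (rule boundedI)
  fix x :: "real^'n" assume "x \<in> octa r"
  thus "norm x \<le> r" using norm_le_l1_cart[of x] by (simp add: octa_def)
qed

lemma open_octa: "open (octa r :: (real^'n) set)"
  unfolding octa_def by (intro open_Collect_less continuous_intros)

lemma octa_lmeasurable: "(octa r :: (real^'n) set) \<in> lmeasurable"
  using bounded_octa open_octa lmeasurable_open by blast

text \<open>The images of the open standard simplex under the 2^n sign changes are disjoint and lie
  in the octahedron. Minkowski's argument only uses this lower bound.\<close>

lemma octa_1_volume:
  "2 ^ CARD('n::{finite,wellorder}) / fact CARD('n::{finite,wellorder}) \<le> measure lebesgue (octa 1 :: (real^'n::{finite,wellorder}) set)"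
proof -
  let ?S = "convex hull (insert 0 Basis) :: (real^'n::{finite,wellorder}) set"
  define S where "S = interior ?S"
  have bS: "bounded ?S" by (intro bounded_convex_hull) (simp add: finite_imp_bounded)
  have S_eq: "S = {x. (\<forall>k. 0 < x $ k) \<and> (\<Sum>k\<in>UNIV. x $ k) < 1}"
  proof -
    have "(\<Sum>i\<in>Basis. x \<bullet> i) = (\<Sum>k\<in>UNIV. x $ k)" for x :: "real^'n::{finite,wellorder}"
    proof -
      have "(\<Sum>i\<in>Basis. x \<bullet> i) = (\<Sum>i\<in>(\<lambda>k. axis k (1::real)) ` (UNIV :: 'n::{finite,wellorder} set). x \<bullet> i)"
        by (rule sum.cong) (auto simp: Basis_vec_def)
      also have "\<dots> = (\<Sum>k\<in>UNIV. x $ k)"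
        by (subst sum.reindex) (auto simp: inj_on_def axis_eq_axis inner_axis)
      finally show ?thesis .
    qed
    moreover have "(\<forall>i\<in>Basis. 0 < x \<bullet> i) \<longleftrightarrow> (\<forall>k. 0 < x $ k)" for x :: "real^'n::{finite,wellorder}"
      by (auto simp: Basis_vec_def inner_axis)
    ultimately show ?thesis unfolding S_def interior_std_simplex by simp
  qed
  have volS: "measure lebesgue S = 1 / fact CARD('n::{finite,wellorder})"
  proof -
    have "measure lebesgue S = measure lebesgue ?S"
      unfolding S_def by (intro measure_interior bS negligible_convex_frontier convex_convex_hull)
    also have "\<dots> = measure lborel ?S"
      by (intro measure_completion) (simp add: finite_imp_compact compact_convex_hull borel_compact)
    finally show ?thesis by (simp add: content_std_simplex)
  qed
  have Sm: "S \<in> lmeasurable"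
    unfolding S_def using bS bounded_subset interior_subset by (metis lmeasurable_open open_interior)
  define D where "D s x = (\<chi> k. s k * x $ k)" for s :: "'n::{finite,wellorder} \<Rightarrow> real" and x :: "real^'n::{finite,wellorder}"
  have linD: "linear (D s)" for s
    by (rule linearI) (auto simp: D_def vec_eq_iff algebra_simps)
  define E where "E = PiE UNIV (\<lambda>_::'n::{finite,wellorder}. {1, -1::real})"
  have finE: "finite E" unfolding E_def by (intro finite_PiE) auto
  have cardE: "card E = 2 ^ CARD('n::{finite,wellorder})" unfolding E_def by (simp add: card_PiE numeral_2_eq_2)
  have sgn: "s k = 1 \<or> s k = -1" if "s \<in> E" for s k using that by (auto simp: E_def PiE_def Pi_def)
  have vol: "measure lebesgue (D s ` S) = 1 / fact CARD('n::{finite,wellorder})" if s: "s \<in> E" for s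
  proof -
    have m: "matrix (D s) = (\<chi> i j. if i = j then s i else 0)"
      by (auto simp: matrix_def D_def axis_def vec_eq_iff)
    have "det (matrix (D s)) = (\<Prod>i\<in>UNIV. s i)"
      unfolding m by (subst det_diagonal) auto
    moreover have "\<bar>\<Prod>i\<in>UNIV. s i\<bar> = 1"
      unfolding abs_prod using sgn[OF s] by (intro prod.neutral ballI) (metis abs_minus_cancel abs_one)
    ultimately show ?thesis using measure_linear_image[OF linD Sm, of s] volS by simp
  qed
  have disj: "pairwise (\<lambda>s t. disjnt (D s ` S) (D t ` S)) E"
  proof (rule pairwiseI)
    fix s t assume st: "s \<in> E" "t \<in> E" "s \<noteq> t"
    then obtain k where k: "s k \<noteq> t k" by blast
    show "disjnt (D s ` S) (D t ` S)"
      unfolding disjnt_def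
    proof (rule equals0I)
      fix z assume "z \<in> D s ` S \<inter> D t ` S"
      then obtain x y where "x \<in> S" "y \<in> S" "D s x = D t y" by auto
      hence "s k * x $ k = t k * y $ k" "x $ k > 0" "y $ k > 0"
        unfolding D_def S_eq by (auto simp: vec_eq_iff)
      thus False using sgn[OF st(1), of k] sgn[OF st(2), of k] k by auto
    qed
  qed
  have "2 ^ CARD('n::{finite,wellorder}) / fact CARD('n::{finite,wellorder}) = (\<Sum>s\<in>E. measure lebesgue (D s ` S))"
    using vol cardE by simp
  also have "\<dots> = measure lebesgue (\<Union>s\<in>E. D s ` S)"
    by (rule measure_UNION'[symmetric, OF finE _ disj]) (rule measurable_linear_image[OF linD Sm])
  also have "\<dots> \<le> measure lebesgue (octa 1 :: (real^'n::{finite,wellorder}) set)"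
  proof (rule measure_mono_fmeasurable)
    show "(\<Union>s\<in>E. D s ` S) \<subseteq> octa 1"
    proof safe
      fix s x assume s: "s \<in> E" and x: "x \<in> S"
      have "\<bar>s k * x $ k\<bar> = x $ k" for k
        using sgn[OF s, of k] x by (auto simp: S_eq less_imp_le)
      thus "D s x \<in> octa 1" using x by (simp add: octa_def D_def S_eq)
    qed
    show "(\<Union>s\<in>E. D s ` S) \<in> sets lebesgue"
      by (intro sets.finite_UN finE fmeasurableD measurable_linear_image[OF linD Sm])
  qed (rule octa_lmeasurable)
  finally show ?thesis .
qed

lemma octa_volume:
  assumes "r > 0"
  shows "(2 * r) ^ CARD('n::{finite,wellorder}) / fact CARD('n::{finite,wellorder}) \<le> measure lebesgue (octa r :: (real^'n::{finite,wellorder}) set)"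
proof -
  have eq: "octa r = (*\<^sub>R) r ` (octa 1 :: (real^'n::{finite,wellorder}) set)"
  proof safe
    fix x :: "real^'n::{finite,wellorder}" assume "x \<in> octa r"
    hence "(1 / r) *\<^sub>R x \<in> octa 1" using assms
      by (simp add: octa_def abs_mult flip: sum_divide_distrib)
    moreover have "x = r *\<^sub>R ((1 / r) *\<^sub>R x)" using assms by simp
    ultimately show "x \<in> (*\<^sub>R) r ` octa 1" by blast
  next
    fix x :: "real^'n::{finite,wellorder}" assume "x \<in> octa 1"
    thus "r *\<^sub>R x \<in> octa r" using assms
      by (simp add: octa_def abs_mult flip: sum_distrib_left)
  qed
  have "measure lebesgue (octa r :: (real^'n::{finite,wellorder}) set) = r ^ CARD('n::{finite,wellorder}) * measure lebesgue (octa 1 :: (real^'n::{finite,wellorder}) set)"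
    unfolding eq using assms measure_lebesgue_affine[of r 0 "octa 1 :: (real^'n::{finite,wellorder}) set"] by (simp add: image_def)
  thus ?thesis using octa_1_volume[where 'n="'n::{finite,wellorder}"] assms
    by (simp add: power_mult_distrib field_simps)
qed

section \<open>Blichfeldt's principle for several translates\<close>

definition zvec :: "(real^'n) set" where "zvec = {c. \<forall>k. c $ k \<in> \<int>}"

lemma zvec_diff: "a \<in> zvec \<Longrightarrow> b \<in> zvec \<Longrightarrow> a - b \<in> zvec"
  by (auto simp: zvec_def)

lemma finite_zvec_bounded: "finite {c \<in> (zvec :: (real^'n) set). \<forall>k. \<bar>c $ k\<bar> \<le> R}"
proof -
  let ?P = "PiE (UNIV :: 'n set) (\<lambda>_. {-\<lfloor>R\<rfloor>-1..\<lfloor>R\<rfloor>+1})"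
  have "{c \<in> (zvec :: (real^'n) set). \<forall>k. \<bar>c $ k\<bar> \<le> R} \<subseteq> (\<lambda>f. \<chi> k. real_of_int (f k)) ` ?P"
  proof
    fix c :: "real^'n" assume c: "c \<in> {c \<in> zvec. \<forall>k. \<bar>c $ k\<bar> \<le> R}"
    have "c = (\<chi> k. real_of_int \<lfloor>c $ k\<rfloor>)" using c by (auto simp: zvec_def vec_eq_iff)
    moreover have "(\<lambda>k. \<lfloor>c $ k\<rfloor>) \<in> ?P"
    proof -
      have "- \<lfloor>R\<rfloor> - 1 \<le> \<lfloor>c $ k\<rfloor> \<and> \<lfloor>c $ k\<rfloor> \<le> \<lfloor>R\<rfloor> + 1" for k
      proof -
        have "\<bar>c $ k\<bar> \<le> R" using c by blast
        thus ?thesis by linarith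
      qed
      thus ?thesis by auto
    qed
    ultimately show "c \<in> (\<lambda>f. \<chi> k. real_of_int (f k)) ` ?P" by (rule image_eqI)
  qed
  thus ?thesis by (rule finite_subset) (intro finite_imageI finite_PiE, auto)
qed

text \<open>Modulo \<open>zvec\<close> the m translates of \<open>D\<close> have total volume above
  that of the unit cube, so two of them overlap. A translate may also overlap itself, hence the
  alternative \<open>c \<noteq> 0\<close>.\<close>

lemma blichfeldt:
  fixes D :: "(real^'n::{finite,wellorder}) set" and q :: "nat \<Rightarrow> real^'n::{finite,wellorder}"
  assumes D: "D \<in> lmeasurable" "bounded D" and m: "1 < real m * measure lebesgue D"
  shows "\<exists>i<m. \<exists>j<m. \<exists>u\<in>D. \<exists>v\<in>D. \<exists>c\<in>zvec. q i + u = q j + v + c \<and> (i \<noteq> j \<or> c \<noteq> 0)"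
proof (rule ccontr)
  assume neg: "\<not> ?thesis"
  define Q :: "(real^'n::{finite,wellorder}) set" where "Q = {x. \<forall>k. 0 \<le> x $ k \<and> x $ k < 1}"
  have Q_sub: "Q \<subseteq> cbox 0 1" by (auto simp: Q_def mem_box_cart less_imp_le)
  have Q_sets: "Q \<in> sets lebesgue"
  proof -
    have h: "{x :: real^'n::{finite,wellorder}. 0 \<le> x $ k} \<inter> {x. x $ k < 1} \<in> sets lebesgue" for k
    proof -
      have "closed {x :: real^'n::{finite,wellorder}. 0 \<le> x $ k}" by (intro closed_Collect_le continuous_intros)
      moreover have "open {x :: real^'n::{finite,wellorder}. x $ k < 1}" by (intro open_Collect_less continuous_intros)
      ultimately show ?thesis by (intro sets.Int sets_completionI_sets) (simp_all only: sets_lborel borel_closed borel_open)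
    qed
    have "Q = (\<Inter>k\<in>UNIV. {x. 0 \<le> x $ k} \<inter> {x. x $ k < 1})" by (auto simp: Q_def)
    also have "\<dots> \<in> sets lebesgue" by (intro sets.finite_INT h) auto
    finally show ?thesis .
  qed
  have Qm: "Q \<in> lmeasurable"
    by (rule fmeasurableI2[OF lmeasurable_cbox Q_sub Q_sets])
  have Q1: "measure lebesgue Q \<le> 1"
  proof -
    have "measure lebesgue Q \<le> measure lebesgue (cbox 0 (1::real^'n::{finite,wellorder}))"
      by (rule measure_mono_fmeasurable[OF Q_sub Q_sets lmeasurable_cbox])
    also have "\<dots> = 1"
    proof -
      have "cbox 0 (1::real^'n::{finite,wellorder}) \<noteq> {}" by (auto simp: interval_ne_empty_cart)
      thus ?thesis by (simp add: content_cbox_cart)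
    qed
    finally show ?thesis .
  qed
  obtain B where B: "\<And>x. x \<in> D \<Longrightarrow> norm x \<le> B" using D(2) by (auto simp: bounded_iff)
  \<comment> \<open>Finitely many lattice vectors suffice to cut the bounded set
    \<open>q i + D\<close> into pieces of the cube.\<close>
  define Cs where "Cs i = {c \<in> (zvec :: (real^'n::{finite,wellorder}) set). \<forall>k. \<bar>c $ k\<bar> \<le> norm (q i) + B + 1}" for i
  have finC: "finite (Cs i)" for i unfolding Cs_def by (rule finite_zvec_bounded)
  define A where "A i c = Q \<inter> (+) (q i - c) ` D" for i c
  have tr: "(+) a ` D \<in> lmeasurable" for a by (rule measurable_translation[OF D(1)])
  have Am: "A i c \<in> lmeasurable" for i c unfolding A_def by (intro fmeasurable.Int Qm tr)
  have sumC: "(\<Sum>c\<in>Cs i. measure lebesgue (A i c)) = measure lebesgue D" for i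
  proof -
    \<comment> \<open>The pieces moved back partition \<open>D\<close>: they are disjoint because
      the cube \<open>Q\<close> is half open.\<close>
    define T where "T c = (+) (c - q i) ` A i c" for c
    have "measure lebesgue (A i c) = measure lebesgue (T c)" for c
      unfolding T_def by (rule measure_translation[symmetric])
    hence "(\<Sum>c\<in>Cs i. measure lebesgue (A i c)) = (\<Sum>c\<in>Cs i. measure lebesgue (T c))" by simp
    also have "\<dots> = measure lebesgue (\<Union>c\<in>Cs i. T c)"
    proof (rule measure_UNION'[symmetric, OF finC])
      show "T c \<in> lmeasurable" for c unfolding T_def by (rule measurable_translation[OF Am])
      show "pairwise (\<lambda>c d. disjnt (T c) (T d)) (Cs i)"
      proof (rule pairwiseI)
        fix c d assume cd: "c \<in> Cs i" "d \<in> Cs i" "c \<noteq> d"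
        show "disjnt (T c) (T d)" unfolding disjnt_def
        proof (rule equals0I)
          fix z assume "z \<in> T c \<inter> T d"
          then obtain x y where xy: "x \<in> Q" "y \<in> Q" "z = c - q i + x" "z = d - q i + y"
            by (auto simp: T_def A_def)
          hence e: "c - d = y - x" by (simp add: algebra_simps)
          have "(c - d) $ k = 0" for k
          proof -
            have "(c - d) $ k \<in> \<int>" using cd by (auto simp: Cs_def zvec_def)
            moreover have "\<bar>(c - d) $ k\<bar> < 1" unfolding e using xy(1,2) 
              by (simp add: Q_def abs_less_iff) (smt (verit, best))
            moreover have "z = 0" if "\<bar>real_of_int z\<bar> < 1" for z using that by linarith
            ultimately show ?thesis by (metis Ints_cases of_int_0)
          qed
          hence "c = d" by (simp add: vec_eq_iff)
          thus False using cd by simp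
        qed
      qed
    qed
    also have "(\<Union>c\<in>Cs i. T c) = D"
    proof safe
      fix c x assume "x \<in> T c" thus "x \<in> D" by (auto simp: T_def A_def algebra_simps)
    next
      fix x assume x: "x \<in> D"
      define c :: "real^'n::{finite,wellorder}" where "c = (\<chi> k. real_of_int \<lfloor>(q i + x) $ k\<rfloor>)"
      have "\<bar>c $ k\<bar> \<le> norm (q i) + B + 1" for k
      proof -
        have "\<bar>(q i + x) $ k\<bar> \<le> norm (q i + x)" by (rule component_le_norm_cart)
        also have "\<dots> \<le> norm (q i) + B" using B[OF x] norm_triangle_ineq[of "q i" x] by linarith
        finally show ?thesis unfolding c_def by simp linarith
      qed
      hence "c \<in> Cs i" by (auto simp: Cs_def zvec_def c_def)
      moreover have "q i + x - c \<in> Q"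
        unfolding Q_def c_def by (auto simp: less_imp_le) linarith+
      hence "q i + x - c \<in> A i c" using x by (auto simp: A_def algebra_simps image_iff)
      hence "x \<in> T c" unfolding T_def by (intro image_eqI[of _ _ "q i + x - c"]) auto
      ultimately show "x \<in> (\<Union>c\<in>Cs i. T c)" by blast
    qed
    finally show ?thesis .
  qed
  let ?I = "SIGMA i:{..<m}. Cs i"
  have "real m * measure lebesgue D = (\<Sum>i<m. \<Sum>c\<in>Cs i. measure lebesgue (A i c))"
    by (simp add: sumC)
  also have "\<dots> = (\<Sum>p\<in>?I. measure lebesgue (A (fst p) (snd p)))"
    by (subst sum.Sigma) (auto simp: finC case_prod_beta)
  also have "\<dots> = measure lebesgue (\<Union>p\<in>?I. A (fst p) (snd p))"
  proof (rule measure_UNION'[symmetric])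
    show "finite ?I" using finC by auto
    show "pairwise (\<lambda>p p'. disjnt (A (fst p) (snd p)) (A (fst p') (snd p'))) ?I"
    proof (rule pairwiseI)
      fix p p' assume p: "p \<in> ?I" "p' \<in> ?I" "p \<noteq> p'"
      obtain i c j d where ij: "p = (i, c)" "p' = (j, d)" by fastforce
      show "disjnt (A (fst p) (snd p)) (A (fst p') (snd p'))" unfolding disjnt_def ij fst_conv snd_conv
      proof (rule equals0I)
        fix z assume "z \<in> A i c \<inter> A j d"
        then obtain u v where uv: "u \<in> D" "v \<in> D" "z = q i - c + u" "z = q j - d + v"
          by (auto simp: A_def)
        have "q i + u = q j + v + (c - d)" using uv(3,4) by (simp add: algebra_simps)
        moreover have "c - d \<in> zvec" using p ij by (auto simp: Cs_def intro: zvec_diff)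
        moreover have "i \<noteq> j \<or> c - d \<noteq> 0" using p ij by auto
        ultimately show False using neg uv(1,2) p ij by blast
      qed
    qed
  qed (rule Am)
  also have "\<dots> \<le> measure lebesgue Q"
  proof (rule measure_mono_fmeasurable[OF _ _ Qm])
    show "(\<Union>p\<in>?I. A (fst p) (snd p)) \<subseteq> Q" by (auto simp: A_def)
    show "(\<Union>p\<in>?I. A (fst p) (snd p)) \<in> sets lebesgue"
      using finC by (intro sets.finite_UN fmeasurableD Am) auto
  qed
  finally show False using Q1 m by linarith
qed

text \<open>The inequality of arithmetic and geometric means, in the form
  \<open>x \<le> exp (x - 1)\<close>.\<close>

lemma prod_less_one:
  fixes x :: "'n::finite \<Rightarrow> real"
  assumes "\<And>k. 0 \<le> x k" "(\<Sum>k\<in>UNIV. x k) < CARD('n)"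
  shows "(\<Prod>k\<in>UNIV. x k) < 1"
proof -
  have "(\<Prod>k\<in>UNIV. x k) \<le> (\<Prod>k\<in>UNIV. exp (x k - 1))"
  proof (rule prod_mono)
    fix k
    show "0 \<le> x k \<and> x k \<le> exp (x k - 1)" using assms(1)[of k] exp_ge_add_one_self[of "x k - 1"] by simp
  qed
  also have "\<dots> = exp ((\<Sum>k\<in>UNIV. x k) - CARD('n))" by (simp add: exp_sum sum_subtractf flip: exp_sum)
  also have "\<dots> < 1" using assms(2) by simp
  finally show ?thesis .
qed

text \<open>Two points of the octahedron of radius n/2 differ by a vector of 1-norm below n, so its
  coordinates have product below 1. Using m points lowers the requirement on \<open>det W\<close> by
  the factor m, at the price of not knowing which pair is hit.\<close>

lemma minkowski_approx:
  fixes W :: "real^'n::{finite,wellorder}^'n::{finite,wellorder}" and p :: "nat \<Rightarrow> real^'n::{finite,wellorder}"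
  assumes det: "det W \<noteq> 0" and m: "\<bar>det W\<bar> < real m * (real CARD('n::{finite,wellorder}) ^ CARD('n::{finite,wellorder}) / fact CARD('n::{finite,wellorder}))"
  shows "\<exists>i<m. \<exists>j<m. \<exists>c\<in>zvec. (i \<noteq> j \<or> c \<noteq> 0) \<and> (\<Prod>k\<in>UNIV. \<bar>(p i - p j - W *v c) $ k\<bar>) < 1"
proof -
  obtain V where V: "W ** V = mat 1" "V ** W = mat 1"
    using det invertible_det_nz[of W] by (auto simp: invertible_def)
  have WV: "W *v (V *v x) = x" for x using V by (simp add: matrix_vector_mul_assoc)
  let ?C = "octa (real CARD('n::{finite,wellorder}) / 2) :: (real^'n::{finite,wellorder}) set"
  define D where "D = (*v) V ` ?C"
  have lin: "linear ((*v) V)" by (rule matrix_vector_mul_linear)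
  have "det V * det W = 1" using V(2) by (metis det_I det_mul)
  hence detV: "\<bar>det V\<bar> = 1 / \<bar>det W\<bar>" using det by (simp add: field_simps flip: abs_mult)
  have volC: "real CARD('n::{finite,wellorder}) ^ CARD('n::{finite,wellorder}) / fact CARD('n::{finite,wellorder}) \<le> measure lebesgue ?C"
    using octa_volume[of "real CARD('n::{finite,wellorder}) / 2", where 'n="'n::{finite,wellorder}"] by simp
  have "measure lebesgue D = \<bar>det V\<bar> * measure lebesgue ?C"
    unfolding D_def by (subst measure_linear_image[OF lin octa_lmeasurable]) simp
  hence "measure lebesgue D = measure lebesgue ?C / \<bar>det W\<bar>" using detV by simp
  moreover have "\<bar>det W\<bar> < real m * measure lebesgue ?C"
    using m volC by (meson mult_left_mono of_nat_0_le_iff order_less_le_trans)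
  ultimately have "1 < real m * measure lebesgue D"
    using det by (simp add: less_divide_eq)
  moreover have "D \<in> lmeasurable" unfolding D_def by (rule measurable_linear_image[OF lin octa_lmeasurable])
  moreover have "bounded D" unfolding D_def
    by (intro bounded_linear_image bounded_octa linear_conv_bounded_linear[THEN iffD1] lin)
  ultimately obtain i j u v c where *: "i < m" "j < m" "u \<in> D" "v \<in> D" "c \<in> zvec"
     "V *v p i + u = V *v p j + v + c" "i \<noteq> j \<or> c \<noteq> 0"
    using blichfeldt[of D m "\<lambda>i. V *v p i"] by blast
  obtain u' v' where uv: "u = V *v u'" "v = V *v v'" "u' \<in> ?C" "v' \<in> ?C"
    using *(3,4) by (auto simp: D_def)
  have "W *v (V *v p i + u) = W *v (V *v p j + v + c)" using *(6) by simp
  hence "p i + u' = p j + v' + W *v c"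
    by (simp add: uv matrix_vector_right_distrib WV)
  hence e: "p i - p j - W *v c = v' - u'" by (simp add: algebra_simps)
  have "(\<Sum>k\<in>UNIV. \<bar>(v' - u') $ k\<bar>) \<le> (\<Sum>k\<in>UNIV. \<bar>v' $ k\<bar> + \<bar>u' $ k\<bar>)"
    by (intro sum_mono) (simp add: abs_triangle_ineq4)
  also have "\<dots> < CARD('n::{finite,wellorder})" using uv(3,4) by (simp add: octa_def sum.distrib)
  finally have "(\<Prod>k\<in>UNIV. \<bar>(v' - u') $ k\<bar>) < 1" by (intro prod_less_one) auto
  thus ?thesis using * e by metis
qed

section \<open>Multiplicatively dependent units\<close>

text \<open>The easy half of Dirichlet's unit theorem. The logarithms of a unit sum to zero, so n -
  1 of them control it, while exponent vectors have n coordinates; the pigeonhole principle gives a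
  relation.\<close>

lemma units_dependent:
  fixes e :: "nat \<Rightarrow> 'a::comm_ring_1 \<Rightarrow> real" and u :: "nat \<Rightarrow> 'a"
  assumes hom: "\<And>i x y. i < n \<Longrightarrow> e i (x * y) = e i x * e i y" "\<And>i. i < n \<Longrightarrow> e i 1 = 1"
    and U: "1 \<in> U" "\<And>x y. x \<in> U \<Longrightarrow> y \<in> U \<Longrightarrow> x * y \<in> U" "\<And>x. x \<in> U \<Longrightarrow> \<exists>y\<in>U. x * y = 1"
    and norm: "\<And>x. x \<in> U \<Longrightarrow> (\<Prod>i<n. \<bar>e i x\<bar>) = 1"
    and fin: "\<And>C. finite {x \<in> U. \<forall>i<n. \<bar>e i x\<bar> \<le> C}"
    and u: "\<And>j. j < n \<Longrightarrow> u j \<in> U" and n: "n > 0"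
  shows "\<exists>d :: nat \<Rightarrow> int. (\<exists>j<n. d j \<noteq> 0) \<and> (\<Prod>j<n. e 0 (u j) powi d j) = 1"
proof -
  have nz: "e i x \<noteq> 0" if "i < n" "x \<in> U" for i x
    using norm[OF that(2)] that(1) by (metis abs_0 finite_lessThan lessThan_iff prod_zero_iff zero_neq_one)
  define L where "L i x = ln \<bar>e i x\<bar>" for i x
  have L_mult: "L i (x * y) = L i x + L i y" if "i < n" "x \<in> U" "y \<in> U" for i x y
    unfolding L_def using nz[OF that(1)] that hom(1)[OF that(1)] by (simp add: abs_mult ln_mult)
  have L_1: "L i 1 = 0" if "i < n" for i using hom(2)[OF that] by (simp add: L_def)
  have U_pow: "x ^ k \<in> U" if "x \<in> U" for x k using that by (induction k) (auto intro: U)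
  have L_pow: "L i (x ^ k) = real k * L i x" if "i < n" "x \<in> U" for i x k
    using that by (induction k) (auto simp: L_1 L_mult U_pow algebra_simps)
  have U_prod: "(\<Prod>j\<in>J. f j) \<in> U" if "\<And>j. j \<in> J \<Longrightarrow> f j \<in> U" for f and J :: "nat set"
    using that by (induction J rule: infinite_finite_induct) (auto intro: U)
  have L_prod: "L i (\<Prod>j\<in>J. f j) = (\<Sum>j\<in>J. L i (f j))"
    if "i < n" "finite J" "\<And>j. j \<in> J \<Longrightarrow> f j \<in> U" for i f and J :: "nat set"
    using that(2,3) by (induction J rule: finite_induct) (auto simp: L_1 L_mult U_prod that(1))
  have L_sum: "(\<Sum>i<n. L i x) = 0" if "x \<in> U" for x
    unfolding L_def using norm[OF that] nz[OF _ that] by (subst ln_prod[symmetric]) auto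
  define X where "X k = (\<Prod>j<n. u j ^ k j)" for k :: "nat \<Rightarrow> nat"
  have XU: "X k \<in> U" for k unfolding X_def by (intro U_prod U_pow u) simp
  define inv where "inv x = (SOME y. y \<in> U \<and> x * y = 1)" for x
  have inv: "inv x \<in> U" "x * inv x = 1" if "x \<in> U" for x
    using someI_ex[of "\<lambda>y. y \<in> U \<and> x * y = 1"] U(3)[OF that] unfolding inv_def by blast+
  have L_inv: "L i (inv x) = - L i x" if "i < n" "x \<in> U" for i x
    using L_mult[OF that(1) that(2) inv(1)[OF that(2)]] inv(2)[OF that(2)] L_1[OF that(1)] by simp
  obtain A :: nat where A: "(\<Sum>i<n. \<Sum>j<n. \<bar>L i (u j)\<bar>) \<le> real A" using real_arch_simple by blast
  define W where "W = {x \<in> U. \<forall>i<n. \<bar>e i x\<bar> \<le> exp (real n)}"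
  have finW: "finite W" unfolding W_def by (rule fin)
  \<comment> \<open>Chosen so that \<open>(2 * A * T + 3) ^ (n - 1) * card W\<close> is at most
    \<open>T * (T + 1) ^ (n - 1)\<close>, which is below the number \<open>(T + 1) ^ n\<close> of
    exponent vectors.\<close>
  define T where "T = card W * (2 * A + 3) ^ (n - 1)"
  define K where "K = PiE {..<n} (\<lambda>_. {0..T})"
  define box where "box k = restrict (\<lambda>i. \<lfloor>L i (X k)\<rfloor>) {..<n-1}" for k
  define Bx where "Bx = PiE {..<n-1} (\<lambda>_. {- int (A * T) - 1 .. int (A * T) + 1})"
  have boxB: "box k \<in> Bx" if "k \<in> K" for k
  proof -
    have "\<bar>L i (X k)\<bar> \<le> real (A * T)" if i: "i < n - 1" for i
    proof -
      have "L i (X k) = (\<Sum>j<n. real (k j) * L i (u j))"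
        unfolding X_def using i by (subst L_prod) (auto simp: U_pow u L_pow intro!: sum.cong)
      also have "\<bar>\<dots>\<bar> \<le> (\<Sum>j<n. \<bar>real (k j) * L i (u j)\<bar>)" by (rule sum_abs)
      also have "\<dots> \<le> (\<Sum>j<n. real T * \<bar>L i (u j)\<bar>)"
        using \<open>k \<in> K\<close> by (intro sum_mono) (auto simp: K_def PiE_def Pi_def abs_mult intro!: mult_right_mono)
      also have "\<dots> = real T * (\<Sum>j<n. \<bar>L i (u j)\<bar>)" by (simp add: sum_distrib_left)
      also have "(\<Sum>j<n. \<bar>L i (u j)\<bar>) \<le> (\<Sum>i<n. \<Sum>j<n. \<bar>L i (u j)\<bar>)"
        using i by (intro member_le_sum) (auto intro: sum_nonneg)
      finally show ?thesis using A
        by (smt (verit, best) mult.commute mult_left_mono of_nat_0_le_iff of_nat_mult)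
    qed
    hence "- int (A * T) - 1 \<le> \<lfloor>L i (X k)\<rfloor> \<and> \<lfloor>L i (X k)\<rfloor> \<le> int (A * T) + 1" if "i < n - 1" for i
    proof -
      assume *: "\<And>i. i < n - 1 \<Longrightarrow> \<bar>L i (X k)\<bar> \<le> real (A * T)"
      have "\<bar>L i (X k)\<bar> \<le> real_of_int (int (A * T))" using *[OF that] by simp
      thus ?thesis by linarith
    qed
    thus ?thesis unfolding Bx_def box_def by auto
  qed
  define residue_pair where "residue_pair b = (SOME k. k \<in> K \<and> box k = b)" for b
  have residue_pair: "residue_pair (box k) \<in> K \<and> box (residue_pair (box k)) = box k" if "k \<in> K" for k
    unfolding residue_pair_def by (rule someI[of _ k]) (use that in auto)
  \<comment> \<open>Dividing by a fixed representative of the same box leaves a unit with bounded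
    conjugates, an element of the finite set \<open>W\<close>. Equal values of \<open>F\<close> give
    equal units.\<close>
  define F where "F k = (box k, X k * inv (X (residue_pair (box k))))" for k
  have FW: "F k \<in> Bx \<times> W" if k: "k \<in> K" for k
  proof -
    let ?r = "residue_pair (box k)" and ?y = "X k * inv (X (residue_pair (box k)))"
    have yU: "?y \<in> U" by (intro U XU inv)
    have Ly: "L i ?y = L i (X k) - L i (X ?r)" if "i < n" for i
      using that by (simp add: L_mult XU inv L_inv)
    have b: "\<bar>L i ?y\<bar> \<le> 1" if i: "i < n - 1" for i
    proof -
      have "box ?r i = box k i" using residue_pair[OF k] by simp
      hence "\<lfloor>L i (X ?r)\<rfloor> = \<lfloor>L i (X k)\<rfloor>" using i by (simp add: box_def)
      moreover have "\<bar>a - b\<bar> \<le> 1" if "\<lfloor>b\<rfloor> = \<lfloor>a\<rfloor>" for a b :: real using that by linarith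
      ultimately show ?thesis using Ly i by simp
    qed
    have n': "n = Suc (n - 1)" using n by simp
    have "L (n - 1) ?y = - (\<Sum>i<n-1. L i ?y)"
    proof -
      have "(\<Sum>i<n. L i ?y) = (\<Sum>i<n-1. L i ?y) + L (n - 1) ?y" by (metis n' sum.lessThan_Suc)
      thus ?thesis using L_sum[OF yU] by linarith
    qed
    also have "\<dots> \<le> (\<Sum>i<n-1. \<bar>L i ?y\<bar>)"
      using sum_abs[of "\<lambda>i. L i ?y" "{..<n-1}"] by linarith
    also have "\<dots> \<le> (\<Sum>i<n-1. 1)" by (intro sum_mono b) simp
    finally have b': "L (n - 1) ?y \<le> real (n - 1)" by simp
    have "L i ?y \<le> real n" if "i < n" for i
    proof (cases "i < n - 1")
      case True
      thus ?thesis using b[OF True] by linarith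
    next
      case False
      hence "i = n - 1" using that by simp
      thus ?thesis using b' by simp
    qed
    hence "\<bar>e i ?y\<bar> \<le> exp (real n)" if "i < n" for i
      using that nz[OF that yU] unfolding L_def
      by (metis exp_le_cancel_iff exp_ln zero_less_abs_iff)
    thus ?thesis using boxB[OF k] yU by (auto simp: F_def W_def)
  qed
  have finBx: "finite Bx" unfolding Bx_def by (intro finite_PiE) auto
  have cardBx: "card Bx = (2 * A * T + 3) ^ (n - 1)"
  proof -
    have "card Bx = card {- int (A * T) - 1 .. int (A * T) + 1} ^ (n - 1)"
      unfolding Bx_def by (subst card_PiE) auto
    also have "card {- int (A * T) - 1 .. int (A * T) + 1} = 2 * A * T + 3" by (simp add: nat_eq_iff)
    finally show ?thesis .
  qed
  have cardK: "card K = (T + 1) ^ n" unfolding K_def by (simp add: card_PiE)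
  have "card (F ` K) \<le> card (Bx \<times> W)"
    by (intro card_mono finite_cartesian_product finBx finW image_subsetI FW)
  also have "\<dots> = (2 * A * T + 3) ^ (n - 1) * card W" by (simp add: card_cartesian_product cardBx)
  also have "\<dots> \<le> ((2 * A + 3) * (T + 1)) ^ (n - 1) * card W"
    by (intro mult_right_mono power_mono) (auto simp: algebra_simps)
  also have "\<dots> = T * (T + 1) ^ (n - 1)" by (simp only: T_def power_mult_distrib mult_ac)
  also have "\<dots> < (T + 1) * (T + 1) ^ (n - 1)" by simp
  also have "\<dots> = card K" using n cardK by (metis One_nat_def Suc_pred power_Suc)
  finally have "\<not> inj_on F K" by (rule pigeonhole)
  then obtain k k' where kk: "k \<in> K" "k' \<in> K" "k \<noteq> k'" "F k = F k'" by (auto simp: inj_on_def)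
  hence "box k = box k'" "X k * inv (X (residue_pair (box k))) = X k' * inv (X (residue_pair (box k)))"
    by (auto simp: F_def)
  moreover have "X k * inv (X r) * X r = X k" for k r
    using inv(2)[OF XU[of r]] by (metis mult.assoc mult.commute mult.right_neutral)
  ultimately have XX: "X k = X k'" by metis
  have e0: "e 0 (X k) = (\<Prod>j<n. e 0 (u j) ^ k j)" for k
  proof -
    have "e 0 (x ^ m) = e 0 x ^ m" for x m by (induction m) (simp_all add: hom n)
    moreover have "e 0 (\<Prod>j\<in>J. f j) = (\<Prod>j\<in>J. e 0 (f j))" for f and J :: "nat set"
      by (induction J rule: infinite_finite_induct) (simp_all add: hom n)
    ultimately show ?thesis by (simp add: X_def)
  qed
  define d where "d j = int (k j) - int (k' j)" for j
  have nz0: "e 0 (u j) \<noteq> 0" if "j < n" for j using nz[OF n u[OF that]] .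
  have "(\<Prod>j<n. e 0 (u j) powi d j) = (\<Prod>j<n. e 0 (u j) ^ k j / e 0 (u j) ^ k' j)"
    by (intro prod.cong refl) (use nz0 in \<open>simp add: d_def power_int_diff\<close>)
  also have "\<dots> = e 0 (X k) / e 0 (X k')" by (simp add: e0 prod_dividef)
  also have "\<dots> = 1" using nz[OF n XU] XX by simp
  finally have "(\<Prod>j<n. e 0 (u j) powi d j) = 1" .
  moreover have "\<exists>j<n. d j \<noteq> 0"
  proof (rule ccontr)
    assume "\<not> ?thesis"
    hence "k j = k' j" if "j < n" for j using that by (auto simp: d_def)
    hence "k = k'" using kk(1,2) by (intro PiE_ext[of k "{..<n}" _ k']) (auto simp: K_def)
    thus False using kk(3) by simp
  qed
  ultimately show ?thesis by blast
qed

lemma real_power7_inj: "x ^ 7 = y ^ 7 \<Longrightarrow> x = (y::real)"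
  by (metis odd_numeral odd_real_root_power_cancel)

text \<open>Some relation between the \<eta> and \<open>u\<close> has an exponent prime to 7.
  Independence of the \<eta> modulo seventh powers forces the exponent of \<open>u\<close> to be
  prime to 7, and inverting it modulo 7 solves for \<open>u\<close>.\<close>

lemma generates_mod_seventh_powers:
  fixes G :: "real set" and \<eta> :: "nat \<Rightarrow> real"
  assumes G: "0 \<notin> G" "1 \<in> G" "\<And>x y. x \<in> G \<Longrightarrow> y \<in> G \<Longrightarrow> x * y \<in> G" "\<And>x. x \<in> G \<Longrightarrow> inverse x \<in> G"
    and dep: "\<And>f. (\<And>j. j < Suc r \<Longrightarrow> f j \<in> G) \<Longrightarrow>
       \<exists>d :: nat \<Rightarrow> int. (\<exists>j<Suc r. d j \<noteq> 0) \<and> (\<Prod>j<Suc r. f j powi d j) = 1"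
    and \<eta>: "\<And>i. i < r \<Longrightarrow> \<eta> i \<in> G"
    and ind: "\<And>m g. (\<And>i. i < r \<Longrightarrow> m i < (7::nat)) \<Longrightarrow> g \<in> G \<Longrightarrow> (\<Prod>i<r. \<eta> i ^ m i) = g ^ 7 \<Longrightarrow>
       (\<forall>i<r. m i = 0)"
    and u: "u \<in> G"
  shows "\<exists>m g. (\<forall>i. m i < (7::nat)) \<and> g \<in> G \<and> u = (\<Prod>i<r. \<eta> i ^ m i) * g ^ 7"
proof -
  have nz: "x \<noteq> 0" if "x \<in> G" for x using that G(1) by auto
  have G_pow: "x ^ k \<in> G" if "x \<in> G" for x k using that by (induction k) (auto intro: G)
  have G_powi: "x powi k \<in> G" if "x \<in> G" for x k
    using G_pow[OF that] G_pow[OF G(4)[OF that]] by (simp add: power_int_def)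
  have G_prod: "(\<Prod>j\<in>J. f j) \<in> G" if "\<And>j. j \<in> J \<Longrightarrow> f j \<in> G" for f and J :: "nat set"
    using that by (induction J rule: infinite_finite_induct) (auto intro: G)
  define f where "f j = (if j < r then \<eta> j else u)" for j
  have f: "f j \<in> G" for j using \<eta> u by (simp add: f_def)
  define R where "R d \<longleftrightarrow> (\<exists>j<Suc r. d j \<noteq> 0) \<and> (\<Prod>j<Suc r. f j powi d j) = 1" for d :: "nat \<Rightarrow> int"
  have "\<exists>d. R d" unfolding R_def by (rule dep) (rule f)
  then obtain d where d: "R d" and
    min: "\<And>d'. R d' \<Longrightarrow> (\<Sum>j<Suc r. nat \<bar>d j\<bar>) \<le> (\<Sum>j<Suc r. nat \<bar>d' j\<bar>)"
    using exists_least_iff[of "\<lambda>k. \<exists>d. R d \<and> (\<Sum>j<Suc r. nat \<bar>d j\<bar>) = k"]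
    by (metis linorder_not_less)
  \<comment> \<open>In a relation of minimal size the exponents are not all divisible by 7: real
    seventh roots are unique, so such a relation could be divided by 7.\<close>
  have n7: "\<exists>j<Suc r. \<not> 7 dvd d j"
  proof (rule ccontr)
    assume "\<not> ?thesis"
    hence a: "7 * (d j div 7) = d j" if "j < Suc r" for j using that by auto
    define d' where "d' j = d j div 7" for j
    have "(\<Prod>j<Suc r. f j powi d' j) ^ 7 = (\<Prod>j<Suc r. f j powi d j)"
      unfolding prod_power_distrib
    proof (rule prod.cong)
      fix j assume "j \<in> {..<Suc r}"
      hence "d j = d' j * 7" using a[of j] unfolding d'_def by (metis lessThan_iff mult.commute)
      thus "(f j powi d' j) ^ 7 = f j powi d j"
        by (metis of_nat_numeral power_int_mult power_int_of_nat)
    qed simp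
    hence "(\<Prod>j<Suc r. f j powi d' j) ^ 7 = 1 ^ 7" using d by (simp only: R_def) simp
    hence "(\<Prod>j<Suc r. f j powi d' j) = 1" by (rule real_power7_inj)
    moreover obtain j0 where j0: "j0 < Suc r" "d j0 \<noteq> 0" using d by (auto simp: R_def)
    moreover have "d' j0 \<noteq> 0" using a[OF j0(1)] j0(2) by (auto simp: d'_def)
    ultimately have "R d'" by (auto simp: R_def)
    moreover have "(\<Sum>j<Suc r. nat \<bar>d' j\<bar>) < (\<Sum>j<Suc r. nat \<bar>d j\<bar>)"
    proof (rule sum_strict_mono_ex1)
      show "\<forall>j\<in>{..<Suc r}. nat \<bar>d' j\<bar> \<le> nat \<bar>d j\<bar>" using a by (auto simp: d'_def)
      show "\<exists>j\<in>{..<Suc r}. nat \<bar>d' j\<bar> < nat \<bar>d j\<bar>" 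
      proof (rule bexI[of _ j0])
        show "nat \<bar>d' j0\<bar> < nat \<bar>d j0\<bar>" using a[OF j0(1)] j0(2) unfolding d'_def by linarith
      qed (use j0 in simp)
    qed simp
    ultimately show False using min by fastforce
  qed
  define m where "m j = nat (d j mod 7)" for j
  define q where "q j = d j div 7" for j
  define g where "g = inverse (\<Prod>j<Suc r. f j powi q j)"
  have gG: "g \<in> G" unfolding g_def by (intro G G_prod G_powi f)
  have split: "f j powi d j = f j ^ m j * (f j powi q j) ^ 7" for j
  proof -
    have "d j = int (m j) + q j * 7" by (simp add: m_def q_def)
    hence "f j powi d j = f j powi int (m j) * f j powi (q j * 7)"
      using nz[OF f] by (metis power_int_add)
    also have "f j powi (q j * 7) = (f j powi q j) ^ 7"
      by (metis of_nat_numeral power_int_mult power_int_of_nat)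
    finally show ?thesis by simp
  qed
  have "1 = (\<Prod>j<Suc r. f j ^ m j) * (\<Prod>j<Suc r. f j powi q j) ^ 7"
    using d unfolding R_def by (simp only: split prod.distrib prod_power_distrib)
  hence rel: "(\<Prod>j<Suc r. f j ^ m j) = g ^ 7"
    unfolding g_def by (metis inverse_unique mult.commute power_inverse)
  have rel': "(\<Prod>i<r. \<eta> i ^ m i) * u ^ m r = g ^ 7"
  proof -
    have "(\<Prod>j<r. f j ^ m j) = (\<Prod>i<r. \<eta> i ^ m i)" by (intro prod.cong) (auto simp: f_def)
    thus ?thesis using rel by (simp add: f_def)
  qed
  have m7: "m j < 7" for j using pos_mod_bound[of 7 "d j"] by (simp add: m_def nat_less_iff)
  have m0: "m j = 0 \<Longrightarrow> 7 dvd d j" for j by (simp add: m_def dvd_eq_mod_eq_0)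
  have mr: "m r \<noteq> 0"
  proof
    assume 0: "m r = 0"
    hence "(\<Prod>i<r. \<eta> i ^ m i) = g ^ 7" using rel' by simp
    from ind[OF m7 gG this] have "\<forall>i<r. m i = 0" .
    hence "m j = 0" if "j < Suc r" for j using that 0 by (auto simp: less_Suc_eq)
    thus False using n7 m0 by blast
  qed
  have "coprime (m r) 7"
  proof -
    have "prime (7::nat)" by simp
    moreover have "\<not> 7 dvd m r" using m7[of r] mr by (auto dest: dvd_imp_le)
    ultimately show ?thesis by (metis coprime_commute prime_imp_coprime)
  qed
  then obtain s t where st: "s * m r = 1 + 7 * t"
    using mr by (metis add.commute bezout_nat coprime_imp_gcd_eq_1 mult.commute)
  \<comment> \<open>The power \<open>s\<close> makes the exponent of \<open>u\<close> congruent to 1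
    modulo 7. The inverse of the product of the \<eta> is its sixth power times a seventh power,
    which avoids negative exponents.\<close>
  define g' where "g' = inverse (\<Prod>i<r. \<eta> i ^ (m i * s)) * g ^ s * inverse (u ^ t)"
  have pow6: "(\<Prod>i<r. \<eta> i ^ (6 * (m i * s))) = (\<Prod>i<r. \<eta> i ^ (m i * s)) ^ 6"
    by (simp add: prod_power_distrib mult.commute flip: power_mult)
  have "u * (u ^ t) ^ 7 = u ^ (s * m r)" by (simp add: st power_mult mult.commute[of 7 t] power_add)
  moreover have "(\<Prod>i<r. \<eta> i ^ (m i * s)) * u ^ (s * m r) = (g ^ s) ^ 7"
  proof -
    have "(\<Prod>i<r. \<eta> i ^ (m i * s)) * u ^ (s * m r) = ((\<Prod>i<r. \<eta> i ^ m i) * u ^ m r) ^ s"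
      by (simp add: power_mult_distrib prod_power_distrib power_mult mult.commute[of s])
    thus ?thesis using rel' by (simp add: mult.commute flip: power_mult)
  qed
  moreover have nzp: "(\<Prod>i<r. \<eta> i ^ (m i * s)) \<noteq> 0" using nz \<eta> by auto
  moreover have nzu: "u ^ t \<noteq> 0" using nz[OF u] by simp
  moreover have algebra: "U = P ^ 6 * (inverse P * H * inverse V) ^ 7"
    if "U * V ^ 7 = UU" "P * UU = H ^ 7" "P \<noteq> 0" "V \<noteq> 0" for U V UU P H :: real
  proof -
    have "P ^ 6 * (inverse P * H * inverse V) ^ 7 = P ^ 6 * H ^ 7 / (P ^ 7 * V ^ 7)"
      by (simp add: power_mult_distrib field_simps)
    also have "H ^ 7 = P * (U * V ^ 7)" using that by simp
    also have "P ^ 6 * (P * (U * V ^ 7)) / (P ^ 7 * V ^ 7) = U"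
      using that(3,4) by (simp add: field_simps power_numeral_reduce)
    finally show ?thesis ..
  qed
  ultimately have "u = (\<Prod>i<r. \<eta> i ^ (m i * s)) ^ 6 *
      (inverse (\<Prod>i<r. \<eta> i ^ (m i * s)) * g ^ s * inverse (u ^ t)) ^ 7"
    by blast
  hence "u = (\<Prod>i<r. \<eta> i ^ (6 * (m i * s))) * g' ^ 7"
    using pow6 unfolding g'_def by (simp only:)
  moreover have "g' \<in> G" unfolding g'_def by (intro G G_prod G_pow gG u \<eta>) simp
  ultimately obtain M h where M: "u = (\<Prod>i<r. \<eta> i ^ M i) * h ^ 7" "h \<in> G"
    by (rule that[of "\<lambda>i. 6 * (m i * s)"])
  have "\<eta> i ^ M i = \<eta> i ^ (M i mod 7) * (\<eta> i ^ (M i div 7)) ^ 7" for i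
    by (metis mult.commute mod_mult_div_eq power_add power_mult)
  hence "u = (\<Prod>i<r. \<eta> i ^ (M i mod 7)) * ((\<Prod>i<r. \<eta> i ^ (M i div 7)) * h) ^ 7"
    unfolding power_mult_distrib prod_power_distrib mult.assoc[symmetric]
    by (subst M(1)) (simp only: prod.distrib mult.assoc)
  moreover have "(\<Prod>i<r. \<eta> i ^ (M i div 7)) * h \<in> G" by (intro G G_prod G_pow \<eta> M) simp
  moreover have "\<forall>i. M i mod 7 < 7" by simp
  ultimately show ?thesis
    by (intro exI[of _ "\<lambda>i. M i mod 7"] exI[of _ "(\<Prod>i<r. \<eta> i ^ (M i div 7)) * h"] conjI)
qed

section \<open>Residue rings and seventh roots\<close>

lemma freshman_prime:
  fixes x y :: "'a::comm_ring_1"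
  assumes p: "prime (p::nat)"
  shows "of_nat p dvd (x + y) ^ p - x ^ p - y ^ p"
proof -
  have p1: "p > 1" using p prime_gt_1_nat by blast
  have "(x + y) ^ p = (\<Sum>k\<le>p. of_nat (p choose k) * x ^ k * y ^ (p - k))" by (rule binomial_ring)
  also have "{..p} = insert 0 (insert p {1..<p})" using p1 by auto
  also have "(\<Sum>k\<in>\<dots>. of_nat (p choose k) * x ^ k * y ^ (p - k))
      = y ^ p + (x ^ p + (\<Sum>k\<in>{1..<p}. of_nat (p choose k) * x ^ k * y ^ (p - k)))"
    using p1 by (subst sum.insert, simp, simp, subst sum.insert) simp_all
  finally have "(x + y) ^ p - x ^ p - y ^ p = (\<Sum>k\<in>{1..<p}. of_nat (p choose k) * x ^ k * y ^ (p - k))"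
    by simp
  also have "of_nat p dvd \<dots>"
  proof (intro dvd_sum dvd_mult2)
    fix k assume "k \<in> {1..<p}"
    hence "p dvd p choose k" using p by (intro dvd_choose_prime) auto
    thus "(of_nat p :: 'a) dvd of_nat (p choose k)" by (auto simp: dvd_def)
  qed
  finally show ?thesis .
qed

lemma dvd_power_diff: "(q::'a::comm_ring_1) dvd u - v \<Longrightarrow> q dvd u ^ m - v ^ m"
proof (induction m)
  case (Suc m)
  have "u ^ Suc m - v ^ Suc m = u ^ m * (u - v) + (u ^ m - v ^ m) * v" by (simp add: algebra_simps)
  thus ?case using Suc by (metis dvd_add dvd_mult dvd_mult2)
qed simp

lemma freshman:
  fixes x y q :: "'a::comm_ring_1"
  assumes p: "prime (p::nat)" and q: "q dvd of_nat p"
  shows "q dvd (x + y) ^ (p ^ k) - x ^ (p ^ k) - y ^ (p ^ k)"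
proof (induction k)
  case (Suc k)
  let ?X = "x ^ (p ^ k)" and ?Y = "y ^ (p ^ k)"
  have "(x + y) ^ (p ^ Suc k) - x ^ (p ^ Suc k) - y ^ (p ^ Suc k)
      = (((x + y) ^ (p ^ k)) ^ p - (?X + ?Y) ^ p) + ((?X + ?Y) ^ p - ?X ^ p - ?Y ^ p)"
    by (simp add: mult.commute[of p] flip: power_mult)
  moreover have "q dvd ((x + y) ^ (p ^ k)) ^ p - (?X + ?Y) ^ p"
    by (rule dvd_power_diff) (use Suc in \<open>simp add: diff_diff_eq\<close>)
  moreover have "q dvd (?X + ?Y) ^ p - ?X ^ p - ?Y ^ p"
    using q freshman_prime[OF p] dvd_trans by blast
  ultimately show ?case by (metis dvd_add)
qed simp

lemma freshman3:
  fixes x y z q :: "'a::comm_ring_1"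
  assumes p: "prime (p::nat)" and q: "q dvd of_nat p"
  shows "q dvd (x + y + z) ^ (p ^ k) - (x ^ (p ^ k) + y ^ (p ^ k) + z ^ (p ^ k))"
proof -
  have "(x + y + z) ^ (p ^ k) - (x ^ (p ^ k) + y ^ (p ^ k) + z ^ (p ^ k)) =
     ((x + y + z) ^ (p ^ k) - (x + y) ^ (p ^ k) - z ^ (p ^ k)) + ((x + y) ^ (p ^ k) - x ^ (p ^ k) - y ^ (p ^ k))"
    by simp
  thus ?thesis using freshman[OF p q] by (metis dvd_add)
qed

text \<open>The elements \<open>d\<^sub>i\<close> and \<open>\<delta>\<^sub>i\<close> are 7 and 13 times the dual of the power basis.\<close>

definition tr13 :: "c13 \<Rightarrow> int" where "tr13 x = 3 * c0 x - c1 x + 9 * c2 x"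
definition tr7 :: "k9 \<Rightarrow> c13" where "tr7 x = 3 * a0 x - a1 x + 5 * a2 x"

lemma tr13_eq: "x + sk13 x + sk13 (sk13 x) = of_int (tr13 x)"
  by (cases x) (simp add: tr13_def sk13_def c13_defs of_int_c13)

lemma tr7_eq: "x + sa x + sa (sa x) = C7 (tr7 x) 0 0"
  by (cases x) (simp add: tr7_def sa_def k9_defs algebra_simps)

definition del :: "nat \<Rightarrow> c13" where
  "del i = (if i = 0 then C13 17 (-7) (-5) else if i = 1 then C13 (-7) 6 3 else C13 (-5) 3 2)"
definition dd :: "nat \<Rightarrow> k9" where
  "dd i = (if i = 0 then C7 7 (-1) (-3) else if i = 1 then C7 (-1) 2 1 else C7 (-3) 1 2)"

lemma del_dual: "tr13 (del 0 * x) = 13 * c0 x" "tr13 (del 1 * x) = 13 * c1 x" "tr13 (del 2 * x) = 13 * c2 x"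
  by (cases x; simp add: tr13_def del_def c13_defs)+

lemma dd_dual: "tr7 (dd 0 * x) = 7 * a0 x" "tr7 (dd 1 * x) = 7 * a1 x" "tr7 (dd 2 * x) = 7 * a2 x"
  by (cases x; simp add: tr7_def dd_def k9_defs algebra_simps)+

abbreviation al :: k9 where "al \<equiv> C7 0 1 0"

text \<open>The expansion of 7 x by traces against the dual basis, with the two conjugates of x
  replaced by free variables, whose coefficients vanish. In this form it serves every automorphism
  that agrees with \<open>sa\<close> on \<alpha>.\<close>

lemma dd_dual_shift:
  "(dd 0 * x + sa (dd 0) * y + sa (sa (dd 0)) * z) + al * (dd 1 * x + sa (dd 1) * y + sa (sa (dd 1)) * z)
    + al^2 * (dd 2 * x + sa (dd 2) * y + sa (sa (dd 2)) * z) = 7 * x"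
  by (cases x; cases y; cases z)
     (simp add: dd_def sa_def k9_defs power2_eq_square numeral_k9 algebra_simps)

lemma of_int_dvd_c13: "of_int n dvd x \<longleftrightarrow> n dvd c0 x \<and> n dvd c1 x \<and> n dvd c2 x"
proof
  assume "of_int n dvd x"
  thus "n dvd c0 x \<and> n dvd c1 x \<and> n dvd c2 x"
    by (auto simp: dvd_def of_int_c13 c13_defs)
next
  assume "n dvd c0 x \<and> n dvd c1 x \<and> n dvd c2 x"
  then obtain a b c where "c0 x = n * a" "c1 x = n * b" "c2 x = n * c" by (auto simp: dvd_def)
  hence "x = of_int n * C13 a b c" by (cases x) (simp add: of_int_c13 c13_defs)
  thus "of_int n dvd x" by simp
qed

lemma C7_dvd_k9: "C7 q 0 0 dvd x \<longleftrightarrow> q dvd a0 x \<and> q dvd a1 x \<and> q dvd a2 x"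
proof
  assume "C7 q 0 0 dvd x"
  thus "q dvd a0 x \<and> q dvd a1 x \<and> q dvd a2 x" by (auto simp: dvd_def k9_defs)
next
  assume "q dvd a0 x \<and> q dvd a1 x \<and> q dvd a2 x"
  then obtain a b c where "a0 x = q * a" "a1 x = q * b" "a2 x = q * c" by (auto simp: dvd_def)
  hence "x = C7 q 0 0 * C7 a b c" by (cases x) (simp add: k9_defs)
  thus "C7 q 0 0 dvd x" by simp
qed

lemma rhom_C7: "rhom (\<lambda>q. C7 q 0 0)"
  by (rule rhomI) (simp_all add: k9_defs)

definition reduced_mod :: "'a::comm_ring_1 \<Rightarrow> bool" where
  "reduced_mod q \<longleftrightarrow> (\<forall>x n. q dvd x ^ n \<longrightarrow> q dvd x \<or> n = 0)"

lemma reduced_modD: "reduced_mod q \<Longrightarrow> q dvd x ^ n \<Longrightarrow> n > 0 \<Longrightarrow> q dvd x"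
  unfolding reduced_mod_def by auto

lemma power_dvd_mono: "q dvd (x::'a::comm_ring_1) ^ n \<Longrightarrow> n \<le> m \<Longrightarrow> q dvd x ^ m"
  by (meson dvd_trans le_imp_power_dvd)

lemma p_power_ge: "prime (p::nat) \<Longrightarrow> n \<le> p ^ n"
  by (meson less_imp_le less_exp prime_ge_2_nat power_mono le_trans zero_le)

text \<open>If x is nilpotent modulo p, so is every multiple b x, and by additivity of p-th powers
  the trace of b x is nilpotent, hence divisible by p. The trace form is nondegenerate modulo p
  unless p = 13.\<close>

lemma reduced_c13:
  assumes p: "prime (p::nat)" "p \<noteq> 13"
  shows "reduced_mod (of_nat p :: c13)"
  unfolding reduced_mod_def
proof (intro allI impI)
  fix x :: c13 and n assume d: "of_nat p dvd x ^ n"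
  have key: "int p dvd tr13 (b * x)" for b
  proof -
    let ?q = "p ^ n" and ?y = "b * x"
    have d1: "of_nat p dvd ?y ^ ?q"
      using power_dvd_mono[OF d p_power_ge[OF p(1)]] by (simp add: power_mult_distrib)
    have "of_nat p dvd sk13 (?y ^ ?q)" "of_nat p dvd sk13 (sk13 (?y ^ ?q))"
      using d1 rhom_dvd[OF rhom_sk13] rhom_of_nat[OF rhom_sk13] by metis+
    hence d2: "of_nat p dvd ?y ^ ?q + sk13 ?y ^ ?q + sk13 (sk13 ?y) ^ ?q"
      using d1 by (simp add: rhom_simps[OF rhom_sk13])
    have "of_nat p dvd (?y + sk13 ?y + sk13 (sk13 ?y)) ^ ?q - (?y ^ ?q + sk13 ?y ^ ?q + sk13 (sk13 ?y) ^ ?q)"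
      by (rule freshman3[OF p(1)]) simp
    hence "of_nat p dvd (?y + sk13 ?y + sk13 (sk13 ?y)) ^ ?q"
      using d2 by (metis diff_add_cancel dvd_add)
    hence "of_int (int p) dvd (of_int (tr13 ?y ^ ?q) :: c13)" by (simp add: tr13_eq)
    hence "int p dvd tr13 ?y ^ ?q" by (subst (asm) of_int_dvd_c13) (simp add: of_int_c13)
    thus ?thesis using p(1) by (metis prime_dvd_power prime_nat_int_transfer)
  qed
  have "\<not> int p dvd 13" 
  proof
    assume "int p dvd 13"
    hence "p dvd 13" by (metis int_dvd_int_iff of_nat_numeral)
    moreover have "prime (13::nat)" by simp
    ultimately show False using p primes_dvd_imp_eq by blast
  qed
  hence "int p dvd c" if "int p dvd 13 * c" for c
    using that p(1) by (metis prime_dvd_mult_iff prime_nat_int_transfer)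
  hence "int p dvd c0 x \<and> int p dvd c1 x \<and> int p dvd c2 x"
    using key[of "del 0"] key[of "del 1"] key[of "del 2"] unfolding del_dual by blast
  thus "of_nat p dvd x \<or> n = 0" using of_int_dvd_c13[of "int p" x] by simp
qed

lemma reduced_k9:
  assumes p: "prime (p::nat)" "p \<noteq> 7" and q: "reduced_mod q" "q dvd of_nat p"
  shows "reduced_mod (C7 q 0 0)"
  unfolding reduced_mod_def
proof (intro allI impI)
  fix x :: k9 and n assume d: "C7 q 0 0 dvd x ^ n"
  have qp: "C7 q 0 0 dvd of_nat p" using rhom_dvd[OF rhom_C7 q(2)] by (simp add: rhom_of_nat[OF rhom_C7])
  have sq: "sa (C7 q 0 0) = C7 q 0 0" by (simp add: sa_def)
  have key: "q dvd tr7 (b * x)" for b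
  proof -
    let ?q = "p ^ n" and ?y = "b * x"
    have d1: "C7 q 0 0 dvd ?y ^ ?q"
      using power_dvd_mono[OF d p_power_ge[OF p(1)]] by (simp add: power_mult_distrib)
    have "C7 q 0 0 dvd sa (?y ^ ?q)" "C7 q 0 0 dvd sa (sa (?y ^ ?q))"
      using d1 rhom_dvd[OF rhom_sa] sq by metis+
    hence d2: "C7 q 0 0 dvd ?y ^ ?q + sa ?y ^ ?q + sa (sa ?y) ^ ?q"
      using d1 by (simp add: rhom_simps[OF rhom_sa])
    have "C7 q 0 0 dvd (?y + sa ?y + sa (sa ?y)) ^ ?q - (?y ^ ?q + sa ?y ^ ?q + sa (sa ?y) ^ ?q)"
      by (rule freshman3[OF p(1) qp])
    hence "C7 q 0 0 dvd (?y + sa ?y + sa (sa ?y)) ^ ?q"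
      using d2 by (metis diff_add_cancel dvd_add)
    hence "C7 q 0 0 dvd C7 (tr7 ?y ^ ?q) 0 0" by (simp add: tr7_eq rhom_power[OF rhom_C7])
    hence "q dvd tr7 ?y ^ ?q" by (subst (asm) C7_dvd_k9) simp
    moreover have "?q > 0" using p(1) prime_gt_0_nat by simp
    ultimately show ?thesis using q(1) reduced_modD by blast
  qed
  have "coprime (int p) 7"
  proof -
    have "prime (7::nat)" by simp
    hence "coprime p 7" using p primes_coprime by blast
    thus ?thesis by (metis coprime_int_iff of_nat_numeral)
  qed
  hence "comax (of_int (int p) :: c13) (of_int 7)" by (rule comax_of_int)
  hence "comax (7 :: c13) q" using comax_dvd_left[of _ 7 q] q(2) comax_sym by fastforce
  hence "q dvd c" if "q dvd 7 * c" for c using that comax_cancel comax_sym by blast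
  hence "q dvd a0 x \<and> q dvd a1 x \<and> q dvd a2 x"
    using key[of "dd 0"] key[of "dd 1"] key[of "dd 2"] unfolding dd_dual by blast
  thus "C7 q 0 0 dvd x \<or> n = 0" using C7_dvd_k9 by simp
qed


text \<open>The prime of \<open>\<int>[\<kappa>]\<close> above 13, with residue map \<open>\<kappa> \<mapsto> 4\<close>.\<close>

abbreviation rho0 :: c13 where "rho0 \<equiv> C13 1 (-1) 1"

definition psi13 :: "c13 \<Rightarrow> int" where "psi13 x = c0 x + 4 * c1 x + 16 * c2 x"

lemma psi13_mult: "13 dvd psi13 (x * y) - psi13 x * psi13 y"
proof -
  have "psi13 (x * y) - psi13 x * psi13 y =
      13 * (- 5 * (c1 x * c2 y + c2 x * c1 y) - 15 * (c2 x * c2 y))"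
    by (cases x; cases y) (simp add: psi13_def c13_defs algebra_simps)
  thus ?thesis by simp
qed

lemma rho0_dvd_iff: "rho0 dvd x \<longleftrightarrow> 13 dvd psi13 x"
proof
  assume "rho0 dvd x"
  then obtain k where k: "x = rho0 * k" by (auto simp: dvd_def)
  have "psi13 rho0 = 13" by (simp add: psi13_def)
  hence "13 dvd psi13 x - 13 * psi13 k" using psi13_mult[of rho0 k] k by simp
  thus "13 dvd psi13 x" by (simp add: dvd_diff_left_iff)
next
  assume "13 dvd psi13 x"
  then obtain k where k: "psi13 x = 13 * k" by (auto simp: dvd_def)
  have "x = rho0 * (of_int k * C13 17 (-2) (-3) + of_int (c1 x) * C13 (-5) 1 1 + of_int (c2 x) * C13 (-21) 3 4)"
    using k by (cases x) (simp add: psi13_def c13_defs of_int_c13)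
  thus "rho0 dvd x" by (rule dvdI)
qed

lemma psi13_power: "13 dvd psi13 (x ^ n) - psi13 x ^ n"
proof (induction n)
  case (Suc n)
  have "psi13 (x ^ Suc n) - psi13 x ^ Suc n = (psi13 (x * x ^ n) - psi13 x * psi13 (x ^ n))
      + psi13 x * (psi13 (x ^ n) - psi13 x ^ n)" by (simp add: algebra_simps)
  thus ?case using Suc psi13_mult by (metis dvd_add dvd_mult)
qed (simp add: psi13_def c13_defs)

lemma reduced_rho0: "reduced_mod rho0"
  unfolding reduced_mod_def
proof (intro allI impI)
  fix x n assume "rho0 dvd x ^ n"
  hence "13 dvd psi13 (x ^ n)" by (simp add: rho0_dvd_iff)
  hence "13 dvd psi13 x ^ n" using psi13_power[of x n] by (simp add: dvd_diff_right_iff)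
  moreover have "prime (13::int)" by simp
  ultimately show "rho0 dvd x \<or> n = 0" using prime_dvd_power rho0_dvd_iff by blast
qed

text \<open>The element \<open>2 - \<alpha>\<close> above 7, with residue map \<open>\<alpha> \<mapsto> 2\<close>.\<close>

abbreviation pi0 :: k9 where "pi0 \<equiv> C7 2 (-1) 0"

definition psi7 :: "k9 \<Rightarrow> c13" where "psi7 x = a0 x + 2 * a1 x + 4 * a2 x"

lemma psi7_mult: "7 dvd psi7 (x * y) - psi7 x * psi7 y"
proof -
  have "psi7 (x * y) - psi7 x * psi7 y = 7 * (- (a1 x * a2 y + a2 x * a1 y) - a2 x * a2 y)"
    by (cases x; cases y) (simp add: psi7_def k9_defs algebra_simps)
  thus ?thesis by simp
qed

lemma pi0_dvd_iff: "pi0 dvd x \<longleftrightarrow> 7 dvd psi7 x"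
proof
  assume "pi0 dvd x"
  then obtain k where k: "x = pi0 * k" by (auto simp: dvd_def)
  have "psi7 pi0 = 0" by (simp add: psi7_def)
  thus "7 dvd psi7 x" using psi7_mult[of pi0 k] k by simp
next
  assume "7 dvd psi7 x"
  then obtain k where k: "psi7 x = 7 * k" by (auto simp: dvd_def)
  have "x = pi0 * (C7 k 0 0 * C7 4 3 1 - C7 (a1 x) 0 0 - C7 (a2 x) 0 0 * (al + 2))"
  proof -
    have "a0 x = 7 * k - 2 * a1 x - 4 * a2 x" using k by (simp add: psi7_def algebra_simps)
    then show ?thesis
      by (cases x) (simp add: k9_defs numeral_k9 algebra_simps del: mult_cancel_left)
  qed
  thus "pi0 dvd x" by (rule dvdI)
qed

lemma psi7_power: "7 dvd psi7 (x ^ n) - psi7 x ^ n"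
proof (induction n)
  case (Suc n)
  have "psi7 (x ^ Suc n) - psi7 x ^ Suc n = (psi7 (x * x ^ n) - psi7 x * psi7 (x ^ n))
      + psi7 x * (psi7 (x ^ n) - psi7 x ^ n)" by (simp add: algebra_simps)
  thus ?case using Suc psi7_mult by (metis dvd_add dvd_mult)
qed (simp add: psi7_def k9_defs)

lemma dvd_diff_trans: "(q::'a::comm_ring_1) dvd x - y \<Longrightarrow> q dvd x \<longleftrightarrow> q dvd y"
  by (metis diff_add_cancel dvd_add dvd_add_right_iff)

lemma reduced_pi0: "reduced_mod pi0"
  unfolding reduced_mod_def
proof (intro allI impI)
  fix x n assume "pi0 dvd x ^ n"
  hence "7 dvd psi7 (x ^ n)" by (simp add: pi0_dvd_iff)
  hence "7 dvd psi7 x ^ n" using psi7_power[of x n] dvd_diff_trans by blast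
  moreover have "reduced_mod (of_nat 7 :: c13)" by (rule reduced_c13) auto
  ultimately show "pi0 dvd x \<or> n = 0" using reduced_modD[of 7 "psi7 x" n] pi0_dvd_iff by auto
qed

lemma dvd_times_unit:
  assumes "u * v = (1::'a::comm_ring_1)" "a dvd s" shows "a * u dvd s"
proof -
  obtain t where "s = a * t" using assms(2) by (auto simp: dvd_def)
  also have "a * t = (a * t) * (u * v)" using assms(1) by simp
  also have "\<dots> = a * u * (v * t)" by (simp only: mult_ac)
  finally show ?thesis by (metis dvd_triv_left)
qed

lemma reduced_power_dvd:
  fixes R s :: "'a::idom"
  assumes R: "reduced_mod R" "R \<noteq> 0"
  shows "R ^ (7 * k) dvd s ^ 7 \<Longrightarrow> R ^ k dvd s"
proof (induction k arbitrary: s)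
  case (Suc k)
  have "R dvd R ^ (7 * Suc k)" by (rule dvd_power) simp
  hence "R dvd s ^ 7" using Suc.prems dvd_trans by blast
  hence "R dvd s" by (rule reduced_modD[OF R(1)]) simp
  then obtain t where t: "s = R * t" by (auto simp: dvd_def)
  have "R ^ (7 * Suc k) = R ^ 7 * R ^ (7 * k)" by (simp flip: power_add)
  moreover have "s ^ 7 = R ^ 7 * t ^ 7" by (simp add: t power_mult_distrib)
  ultimately have "R ^ (7 * k) dvd t ^ 7" using Suc.prems R(2) by (metis dvd_mult_cancel_left power_not_zero)
  hence "R ^ k dvd t" by (rule Suc.IH)
  thus ?case by (simp add: t)
qed simp

text \<open>The residue rings of the ramified primes 7 and 13 contain nilpotents. These primes are
  units times cubes of \<open>pi0\<close> and \<open>rho0\<close>, whose residue rings are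
  reduced.\<close>

lemma prime_root7_k9:
  assumes p: "prime (p::nat)" and d: "of_nat p ^ 7 dvd (s::k9) ^ 7"
  shows "of_nat p dvd s"
proof -
  have C: "(of_nat p :: k9) = C7 (of_nat p) 0 0" by (rule of_nat_k9)
  consider "p = 7" | "p = 13" | "p \<noteq> 7" "p \<noteq> 13" by blast
  thus ?thesis
  proof cases
    case 1
    have 7: "(7::k9) = pi0 ^ 3 * C7 3 7 3" "C7 3 7 3 * C7 1 (-2) 1 = 1"
      by (simp_all add: power3_eq_cube k9_defs numeral_k9)
    have "pi0 ^ (7 * 3) dvd s ^ 7"
    proof -
      have "(7::k9) ^ 7 = pi0 ^ (7 * 3) * (C7 3 7 3) ^ 7" 
        by (subst 7(1)) (simp only: power_mult_distrib flip: power_mult, simp)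
      thus ?thesis using d 1 by (metis dvd_mult_left of_nat_numeral)
    qed
    hence "pi0 ^ 3 dvd s" by (rule reduced_power_dvd[OF reduced_pi0, rotated]) (simp add: k9_defs)
    hence "pi0 ^ 3 * C7 3 7 3 dvd s" by (rule dvd_times_unit[OF 7(2)])
    thus ?thesis using 7(1) 1 by simp
  next
    case 2
    let ?R = "C7 rho0 0 0"
    have 13: "(13::k9) = ?R ^ 3 * C7 (C13 28 (-8) (-7)) 0 0" "C7 (C13 28 (-8) (-7)) 0 0 * C7 (C13 3 (-13) 8) 0 0 = 1"
      by (simp_all add: power3_eq_cube k9_defs numeral_k9 c13_defs numeral_c13)
    have "?R ^ (7 * 3) dvd s ^ 7"
    proof -
      have "(13::k9) ^ 7 = ?R ^ (7 * 3) * (C7 (C13 28 (-8) (-7)) 0 0) ^ 7" 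
        by (subst 13(1)) (simp only: power_mult_distrib flip: power_mult, simp)
      thus ?thesis using d 2 by (metis dvd_mult_left of_nat_numeral)
    qed
    moreover have "reduced_mod ?R"
      by (rule reduced_k9[of 13]) (auto simp: reduced_rho0 rho0_dvd_iff psi13_def numeral_c13)
    ultimately have "?R ^ 3 dvd s" by (rule reduced_power_dvd[rotated 2]) (simp add: k9_defs c13_defs)
    hence "?R ^ 3 * C7 (C13 28 (-8) (-7)) 0 0 dvd s" by (rule dvd_times_unit[OF 13(2)])
    thus ?thesis using 13(1) 2 by simp
  next
    case 3
    have "reduced_mod (of_nat p :: k9)" unfolding C
      by (rule reduced_k9[OF p 3(1)]) (auto intro: reduced_c13[OF p 3(2)])
    moreover have "of_nat p dvd s ^ 7"
      using d dvd_power[of 7 "of_nat p :: k9"] dvd_trans by fastforce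
    ultimately show ?thesis by (rule reduced_modD) simp
  qed
qed

lemma nat_root7_k9: "n > 0 \<Longrightarrow> of_nat n ^ 7 dvd (s::k9) ^ 7 \<Longrightarrow> of_nat n dvd s"
proof (induction n arbitrary: s rule: less_induct)
  case (less n)
  show ?case
  proof (cases "n = 1")
    case False
    then obtain p where p: "prime p" "p dvd n" using prime_factor_nat by blast
    then obtain m where m: "n = p * m" by (auto simp: dvd_def)
    have m0: "m > 0" "m < n" using m less.prems(1) prime_gt_1_nat[OF p(1)] by auto
    have "of_nat p ^ 7 dvd s ^ 7" using less.prems(2) by (auto simp: m power_mult_distrib dest: dvd_mult_left)
    hence "of_nat p dvd s" by (rule prime_root7_k9[OF p(1)])
    then obtain t where t: "s = of_nat p * t" by (auto simp: dvd_def)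
    have pn: "(of_nat p :: k9) \<noteq> 0" using prime_gt_0_nat[OF p(1)] by (simp add: of_nat_k9 of_nat_c13 k9_defs c13_defs)
    hence "of_nat m ^ 7 dvd t ^ 7" using less.prems(2) by (simp add: m t power_mult_distrib)
    hence "of_nat m dvd t" using less.IH m0 by blast
    thus ?thesis by (simp add: m t)
  qed simp
qed

section \<open>The absolute norm in degree nine\<close>

definition n9 :: "k9 \<Rightarrow> int" where "n9 x = n13 (n7 (a0 x) (a1 x) (a2 x))"

lemma n9_eq: "(let y = x * sa x * sa (sa x) in y * sk y * sk (sk y)) = of_int (n9 x)"
  unfolding Let_def n7_sa n9_def of_int_k9 by (simp add: sk_def k9_defs rhom_0[OF rhom_sk13] flip: n13_C13)

lemma dvd_n9: "x dvd of_int (n9 x)"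
  unfolding n9_eq[symmetric] Let_def by (simp add: dvd_mult2 mult.assoc)

lemma of_int_eq_k9: "(of_int a :: k9) = of_int b \<longleftrightarrow> a = b"
  by (simp add: of_int_k9 of_int_c13)

lemma n9_mult: "n9 (x * y) = n9 x * n9 y"
proof -
  have "(of_int (n9 (x * y)) :: k9) = of_int (n9 x * n9 y)"
    by (simp only: of_int_mult flip: n9_eq)
       (simp add: Let_def rhom_simps[OF rhom_sk] rhom_simps[OF rhom_sa] mult_ac)
  thus ?thesis by (simp only: of_int_eq_k9)
qed

lemma n9_0_iff: "n9 x = 0 \<longleftrightarrow> x = 0"
proof
  assume "n9 x = 0"
  hence "n7 (a0 x) (a1 x) (a2 x) = 0" by (simp add: n9_def n13_0_iff)
  thus "x = 0" using n7_0 by (metis k9.collapse zero_k9_def)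
qed (simp add: n9_def n7_def zero_k9_def n13_0_iff)

text \<open>Multiplication by the cofactor of a in its norm replaces a by a rational integer, which
  is treated prime by prime. This is how seventh powers are divided without unique factorisation in
  \<open>k9\<close>.\<close>

lemma root7_k9:
  fixes a b :: k9
  assumes "a ^ 7 dvd b ^ 7" shows "a dvd b"
proof (cases "a = 0")
  case True
  thus ?thesis using assms by (simp add: zero_power)
next
  case False
  obtain a' where a': "of_int (n9 a) = a * a'" using dvd_n9[of a] by (auto simp: dvd_def)
  define n where "n = nat \<bar>n9 a\<bar>"
  have n0: "n > 0" using False by (simp add: n_def n9_0_iff)
  have eq: "of_nat n = a * a' \<or> of_nat n = - (a * a')" 
  proof -
    have "(of_nat n :: k9) = of_int \<bar>n9 a\<bar>" unfolding n_def by (rule of_nat_nat) simp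
    moreover have "\<bar>n9 a\<bar> = n9 a \<or> \<bar>n9 a\<bar> = - n9 a" by linarith
    ultimately show ?thesis using a' by (metis of_int_minus)
  qed
  hence "of_nat n ^ 7 dvd (b * a') ^ 7"
    using assms by (auto simp: power_mult_distrib mult_dvd_mono)
  hence "of_nat n dvd b * a'" by (rule nat_root7_k9[OF n0])
  hence "a * a' dvd b * a'" using eq by auto
  moreover have "a' \<noteq> 0" using a' False by (metis mult_zero_right n9_0_iff of_int_eq_k9 of_int_0)
  ultimately show ?thesis by simp
qed

section \<open>Real embeddings and cubic subfields\<close>

text \<open>One root of each cubic is enough: the fields are Galois, and all other embeddings arise
  by composition with the automorphisms.\<close>

definition kr :: real where "kr = (SOME k. 0 \<le> k \<and> k \<le> 1 \<and> k^3 + k^2 - 4*k + 1 = 0)"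
definition ar :: real where "ar = (SOME a. 1 \<le> a \<and> a \<le> 2 \<and> a^3 + a^2 - 2*a - 1 = 0)"

lemma kr: "0 \<le> kr" "kr \<le> 1" "kr^3 + kr^2 - 4*kr + 1 = 0"
proof -
  have "\<exists>k\<ge>0. k \<le> 1 \<and> k^3 + k^2 - 4*k + 1 = (0::real)"
  proof -
    have c: "continuous_on {0..1} (\<lambda>k::real. k^3 + k^2 - 4*k + 1)" by (intro continuous_intros)
    show ?thesis by (rule IVT2'[OF _ _ _ c]) simp_all
  qed
  hence "0 \<le> kr \<and> kr \<le> 1 \<and> kr^3 + kr^2 - 4*kr + 1 = 0"
    unfolding kr_def by (rule someI_ex)
  thus "0 \<le> kr" "kr \<le> 1" "kr^3 + kr^2 - 4*kr + 1 = 0" by blast+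
qed

lemma ar: "1 \<le> ar" "ar \<le> 2" "ar^3 + ar^2 - 2*ar - 1 = 0"
proof -
  have "\<exists>a\<ge>1. a \<le> 2 \<and> a^3 + a^2 - 2*a - 1 = (0::real)"
  proof -
    have c: "continuous_on {1..2} (\<lambda>a::real. a^3 + a^2 - 2*a - 1)" by (intro continuous_intros)
    show ?thesis by (rule IVT'[OF _ _ _ c]) simp_all
  qed
  hence "1 \<le> ar \<and> ar \<le> 2 \<and> ar^3 + ar^2 - 2*ar - 1 = 0"
    unfolding ar_def by (rule someI_ex)
  thus "1 \<le> ar" "ar \<le> 2" "ar^3 + ar^2 - 2*ar - 1 = 0" by blast+
qed

definition e13 :: "c13 \<Rightarrow> real" where "e13 x = c0 x + c1 x * kr + c2 x * kr^2"
definition e9 :: "k9 \<Rightarrow> real" where "e9 x = e13 (a0 x) + e13 (a1 x) * ar + e13 (a2 x) * ar^2"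

lemma rhom_e13: "rhom e13"
proof (rule rhomI)
  fix x y
  show "e13 (x * y) = e13 x * e13 y"
  proof -
    obtain a b c d e f where xy: "x = C13 a b c" "y = C13 d e f" by (metis c13.exhaust)
    show ?thesis using kr(3) unfolding xy e13_def times_c13_def Let_def c13.sel of_int_add of_int_mult of_int_diff of_int_numeral
      by algebra
  qed
qed (simp_all add: e13_def c13_defs algebra_simps)

lemma rhom_e9: "rhom e9"
proof (rule rhomI)
  fix x y
  show "e9 (x * y) = e9 x * e9 y"
    using ar(3) unfolding e9_def times_k9_def Let_def k9.sel rhom_simps[OF rhom_e13] by algebra
qed (simp_all add: e9_def k9_defs rhom_simps[OF rhom_e13] algebra_simps)

lemma e9_C7: "e9 (C7 q 0 0) = e13 q" by (simp add: e9_def rhom_0[OF rhom_e13])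

lemma e9_0_iff: "e9 x = 0 \<longleftrightarrow> x = 0"
proof
  assume "e9 x = 0"
  hence "e9 (of_int (n9 x)) = 0"
    by (simp add: n9_eq[symmetric] Let_def rhom_simps[OF rhom_sk] rhom_simps[OF rhom_sa] rhom_simps[OF rhom_e9])
  thus "x = 0" by (simp add: rhom_of_int[OF rhom_e9] n9_0_iff)
qed (simp add: rhom_0[OF rhom_e9])

lemma e9_inj: "e9 x = e9 y \<longleftrightarrow> x = y"
  using e9_0_iff[of "x - y"] by (simp add: rhom_diff[OF rhom_e9])

text \<open>Up to the factor 13 the coordinates are traces against the dual basis, so a bound on the
  conjugates bounds them.\<close>

lemma finite_c13_bounded: "finite {y. \<forall>j<3. \<bar>e13 ((sk13 ^^ j) y)\<bar> \<le> C}"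
proof -
  define M where "M = (\<Sum>i<3. \<Sum>j<3. \<bar>e13 ((sk13 ^^ j) (del i))\<bar>)"
  define B where "B = \<lfloor>3 * M * \<bar>C\<bar>\<rfloor>"
  let ?S = "(\<lambda>(a, b, c). C13 a b c) ` ({-B..B} \<times> {-B..B} \<times> {-B..B})"
  have "{y. \<forall>j<3. \<bar>e13 ((sk13 ^^ j) y)\<bar> \<le> C} \<subseteq> ?S"
  proof
    fix y assume "y \<in> {y. \<forall>j<3. \<bar>e13 ((sk13 ^^ j) y)\<bar> \<le> C}"
    hence y: "\<bar>e13 ((sk13 ^^ j) y)\<bar> \<le> C" if "j < 3" for j using that by blast
    have tr: "\<bar>tr13 (del i * y)\<bar> \<le> B" if i: "i < 3" for i
    proof -
      have Mi: "\<bar>e13 ((sk13 ^^ j) (del i))\<bar> \<le> M" if "j < 3" for j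
      proof -
        have "\<bar>e13 ((sk13 ^^ j) (del i))\<bar> \<le> (\<Sum>j<3. \<bar>e13 ((sk13 ^^ j) (del i))\<bar>)"
          using that by (intro member_le_sum) auto
        also have "\<dots> \<le> M" unfolding M_def using i by (intro member_le_sum) (auto intro: sum_nonneg)
        finally show ?thesis .
      qed
      have "real_of_int (tr13 (del i * y)) = e13 (of_int (tr13 (del i * y)))"
        by (simp add: rhom_of_int[OF rhom_e13])
      also have "\<dots> = (\<Sum>j<3. e13 ((sk13 ^^ j) (del i)) * e13 ((sk13 ^^ j) y))"
        by (simp add: tr13_eq[symmetric] rhom_simps[OF rhom_e13] rhom_simps[OF rhom_sk13] numeral_3_eq_3)
      finally have "\<bar>real_of_int (tr13 (del i * y))\<bar> \<le> (\<Sum>j<3. \<bar>e13 ((sk13 ^^ j) (del i)) * e13 ((sk13 ^^ j) y)\<bar>)"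
        by (simp add: sum_abs)
      also have "\<dots> \<le> (\<Sum>j<(3::nat). M * \<bar>C\<bar>)"
        unfolding abs_mult using Mi y by (intro sum_mono mult_mono) (auto intro: order_trans[OF abs_ge_zero] order_trans[OF y abs_ge_self])
      finally have "\<bar>real_of_int (tr13 (del i * y))\<bar> \<le> 3 * M * \<bar>C\<bar>" by simp
      thus ?thesis unfolding B_def by linarith
    qed
    have "\<bar>c0 y\<bar> \<le> B \<and> \<bar>c1 y\<bar> \<le> B \<and> \<bar>c2 y\<bar> \<le> B"
      using tr[of 0] tr[of 1] tr[of 2] unfolding del_dual by linarith
    thus "y \<in> ?S" by (cases y) (auto simp: image_iff)
  qed
  thus ?thesis by (rule finite_subset) auto
qed

lemma sk_C7: "(sk ^^ j) (C7 q 0 0) = C7 ((sk13 ^^ j) q) 0 0"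
  by (induction j) (simp_all add: sk_def rhom_0[OF rhom_sk13])

lemma rhom_funpow: "rhom f \<Longrightarrow> rhom (f ^^ j)" for f :: "'a::comm_ring_1 \<Rightarrow> 'a"
proof (induction j)
  case (Suc j)
  thus ?case using rhom_comp[of f "f ^^ j"] by (simp add: o_def)
qed (simp add: rhom_id id_def)

lemma finite_k9_bounded: "finite {x. \<forall>i<3. \<forall>j<3. \<bar>e9 ((sk ^^ j) ((sa ^^ i) x))\<bar> \<le> C}"
proof -
  define M where "M = (\<Sum>l<3. \<Sum>i<3. \<Sum>j<3. \<bar>e9 ((sk ^^ j) ((sa ^^ i) (dd l)))\<bar>)"
  define B where "B = 3 * M * \<bar>C\<bar>"
  let ?F = "{y. \<forall>j<3. \<bar>e13 ((sk13 ^^ j) y)\<bar> \<le> B}"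
  let ?S = "(\<lambda>(a, b, c). C7 a b c) ` (?F \<times> ?F \<times> ?F)"
  have "{x. \<forall>i<3. \<forall>j<3. \<bar>e9 ((sk ^^ j) ((sa ^^ i) x))\<bar> \<le> C} \<subseteq> ?S"
  proof
    fix x assume "x \<in> {x. \<forall>i<3. \<forall>j<3. \<bar>e9 ((sk ^^ j) ((sa ^^ i) x))\<bar> \<le> C}"
    hence x: "\<bar>e9 ((sk ^^ j) ((sa ^^ i) x))\<bar> \<le> C" if "i < 3" "j < 3" for i j using that by blast
    have tr: "\<bar>e13 ((sk13 ^^ j) (tr7 (dd l * x)))\<bar> \<le> B" if l: "l < 3" and j: "j < 3" for l j
    proof -
      have Ml: "\<bar>e9 ((sk ^^ j) ((sa ^^ i) (dd l)))\<bar> \<le> M" if "i < 3" for i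
      proof -
        have "\<bar>e9 ((sk ^^ j) ((sa ^^ i) (dd l)))\<bar> \<le> (\<Sum>j<3. \<bar>e9 ((sk ^^ j) ((sa ^^ i) (dd l)))\<bar>)"
          using j by (intro member_le_sum) auto
        also have "\<dots> \<le> (\<Sum>i<3. \<Sum>j<3. \<bar>e9 ((sk ^^ j) ((sa ^^ i) (dd l)))\<bar>)"
          using that by (intro member_le_sum) (auto intro: sum_nonneg)
        also have "\<dots> \<le> M" unfolding M_def using l by (intro member_le_sum) (auto intro!: sum_nonneg)
        finally show ?thesis .
      qed
      have rj: "rhom (sk ^^ j)" by (rule rhom_funpow[OF rhom_sk])
      have "e13 ((sk13 ^^ j) (tr7 (dd l * x))) = e9 ((sk ^^ j) (C7 (tr7 (dd l * x)) 0 0))"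
        by (simp add: sk_C7 e9_C7)
      also have "\<dots> = (\<Sum>i<3. e9 ((sk ^^ j) ((sa ^^ i) (dd l))) * e9 ((sk ^^ j) ((sa ^^ i) x)))"
        by (simp add: tr7_eq[symmetric] rhom_simps[OF rhom_e9] rhom_simps[OF rhom_sa] rhom_simps[OF rj] numeral_3_eq_3)
      finally have "\<bar>e13 ((sk13 ^^ j) (tr7 (dd l * x)))\<bar> \<le> (\<Sum>i<3. \<bar>e9 ((sk ^^ j) ((sa ^^ i) (dd l))) * e9 ((sk ^^ j) ((sa ^^ i) x))\<bar>)"
        by (simp add: sum_abs)
      also have "\<dots> \<le> (\<Sum>i<(3::nat). M * \<bar>C\<bar>)"
        unfolding abs_mult using Ml x j by (intro sum_mono mult_mono) (auto intro: order_trans[OF abs_ge_zero] order_trans[OF x abs_ge_self])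
      finally show ?thesis by (simp add: B_def)
    qed
    have c: "e13 ((sk13 ^^ j) (7 * y)) = 7 * e13 ((sk13 ^^ j) y)" for j y
      using rhom_funpow[OF rhom_sk13, of j] by (simp add: rhom_simps rhom_simps[OF rhom_e13])
    have "a0 x \<in> ?F" "a1 x \<in> ?F" "a2 x \<in> ?F"
      using tr[of 0] tr[of 1] tr[of 2] unfolding dd_dual c by fastforce+
    thus "x \<in> ?S" by (cases x) (auto simp: image_iff)
  qed
  thus ?thesis by (rule finite_subset) (use finite_c13_bounded[of B] in auto)
qed

lemma fixed_int: "sa y = y \<Longrightarrow> sk y = y \<Longrightarrow> \<exists>k. y = of_int k"
proof -
  assume a: "sa y = y" and k: "sk y = y"
  obtain p q r where y: "y = C7 p q r" by (cases y)
  have e: "- r = q" "q - r = r" using a unfolding y by (auto simp: sa_def)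
  have "r = 0" using e by (cases r; cases q) (auto simp: c13_defs)
  hence y': "y = C7 p 0 0" using y e(1) by simp
  have "sk13 p = p" using k y' by (simp add: sk_def)
  hence "p = of_int (c0 p)" by (cases p) (simp add: sk13_def of_int_c13)
  thus ?thesis using y' by (metis of_int_k9)
qed

text \<open>The fixed ring of \<open>\<tau>\<close> is a cubic ring on which \<open>\<rho>\<close> acts as a generator of the Galois group, and the
  conjugates of \<open>\<omega>\<close> span a sublattice of covolume at most 91. The nine-dimensional field has four cubic subfields.\<close>

locale cubic_subfield =
  fixes \<tau> \<rho> :: "k9 \<Rightarrow> k9" and \<omega> :: k9 and s1 s2 :: int
  assumes hom: "rhom \<tau>" "rhom \<rho>"
    and cube: "\<tau> (\<tau> (\<tau> x)) = x" "\<rho> (\<rho> (\<rho> x)) = x"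
    and comm: "\<tau> (\<rho> x) = \<rho> (\<tau> x)"
    and fixed: "\<tau> y = y \<Longrightarrow> \<rho> y = y \<Longrightarrow> \<exists>k. y = of_int k"
    and conj: "\<tau> x = x \<Longrightarrow> \<exists>m<3. (sk ^^ j) ((sa ^^ i) x) = (\<rho> ^^ m) x"
    and dual: "\<exists>cc bb :: nat \<Rightarrow> k9. \<forall>x y z. (\<Sum>i<3. cc i * (bb i * x + \<tau> (bb i) * y + \<tau> (\<tau> (bb i)) * z)) = 91 * x"
    and omega: "\<tau> \<omega> = \<omega>" "\<omega> + \<rho> \<omega> + \<rho> (\<rho> \<omega>) = of_int s1"
      "\<omega> * \<rho> \<omega> + \<rho> \<omega> * \<rho> (\<rho> \<omega>) + \<rho> (\<rho> \<omega>) * \<omega> = of_int s2"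
    and disc: "0 < \<bar>s1 * (s1^2 - 3 * s2)\<bar>" "\<bar>s1 * (s1^2 - 3 * s2)\<bar> \<le> 91"
begin

lemma rho_pow_hom: "rhom (\<rho> ^^ m)" by (rule rhom_funpow[OF hom(2)])

lemma norm_int:
  assumes "\<tau> x = x"
  shows "\<exists>k. x * \<rho> x * \<rho> (\<rho> x) = of_int k"
  by (rule fixed) (use assms in \<open>simp_all add: rhom_simps[OF hom(1)] rhom_simps[OF hom(2)] comm cube mult_ac\<close>)

lemma prod_emb:
  "of_int k = x * \<rho> x * \<rho> (\<rho> x) \<Longrightarrow> real_of_int k = (\<Prod>m<3. e9 ((\<rho> ^^ m) x))"
proof -
  assume "of_int k = x * \<rho> x * \<rho> (\<rho> x)"
  hence "e9 (of_int k) = e9 (x * \<rho> x * \<rho> (\<rho> x))" by simp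
  thus ?thesis by (simp add: rhom_simps[OF rhom_e9] numeral_3_eq_3)
qed

lemma unit_int: "of_int k dvd (1::k9) \<Longrightarrow> \<bar>k\<bar> = 1"
proof -
  assume "of_int k dvd (1::k9)"
  hence "C7 (of_int k) 0 0 dvd (1::k9)" by (simp add: of_int_k9)
  hence "of_int k dvd (1::c13)" by (simp add: C7_dvd_k9 one_k9_def)
  hence "k dvd 1" by (simp add: of_int_dvd_c13 one_c13_def)
  thus ?thesis by simp
qed

definition U where "U = {x. x dvd 1 \<and> \<tau> x = x}"

lemma U_norm: "x \<in> U \<Longrightarrow> (\<Prod>m<3. \<bar>e9 ((\<rho> ^^ m) x)\<bar>) = 1"
proof -
  assume x: "x \<in> U"
  hence "\<tau> x = x" by (simp add: U_def)
  then obtain k where k: "x * \<rho> x * \<rho> (\<rho> x) = of_int k" using norm_int by blast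
  have "x dvd 1" using x by (simp add: U_def)
  hence "\<rho> x dvd 1" "\<rho> (\<rho> x) dvd 1" using rhom_dvd[OF hom(2), of _ 1] rhom_1[OF hom(2)] by metis+
  hence "of_int k dvd (1::k9)" using \<open>x dvd 1\<close> k by (metis mult_1 mult_dvd_mono)
  hence "\<bar>k\<bar> = 1" by (rule unit_int)
  thus ?thesis using prod_emb[OF k[symmetric]] by (simp flip: abs_prod)
qed

lemma U_mult: "x \<in> U \<Longrightarrow> y \<in> U \<Longrightarrow> x * y \<in> U"
  by (auto simp: U_def rhom_simps[OF hom(1)] intro: mult_dvd_mono[of _ 1 _ 1, simplified])

lemma U_1: "1 \<in> U" by (simp add: U_def rhom_1[OF hom(1)])

lemma U_inv: "x \<in> U \<Longrightarrow> \<exists>y\<in>U. x * y = 1"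
proof -
  assume x: "x \<in> U"
  then obtain y where y: "x * y = 1" by (auto simp: U_def dvd_def)
  have "x * \<tau> y = \<tau> (x * y)" using x by (simp add: U_def rhom_simps[OF hom(1)])
  also have "\<dots> = x * y" using y by (simp add: rhom_1[OF hom(1)])
  finally have "x * \<tau> y = x * y" .
  hence "\<tau> y = y" using y by (metis mult_cancel_left mult_zero_left zero_neq_one)
  moreover have "y dvd 1" using y by (metis dvd_triv_right)
  ultimately show ?thesis using y by (auto simp: U_def)
qed

lemma U_finite: "finite {x \<in> U. \<forall>m<3. \<bar>e9 ((\<rho> ^^ m) x)\<bar> \<le> C}"
proof (rule finite_subset[OF _ finite_k9_bounded[of C]], safe)
  fix i j :: nat and x assume "x \<in> U" and b: "\<forall>m<3. \<bar>e9 ((\<rho> ^^ m) x)\<bar> \<le> C"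
  hence "\<tau> x = x" by (simp add: U_def)
  then obtain m where "m < 3" "(sk ^^ j) ((sa ^^ i) x) = (\<rho> ^^ m) x" using conj by blast
  thus "\<bar>e9 ((sk ^^ j) ((sa ^^ i) x))\<bar> \<le> C" using b by simp
qed

lemma U_dependent:
  assumes "\<And>j. j < 3 \<Longrightarrow> u j \<in> U"
  shows "\<exists>d :: nat \<Rightarrow> int. (\<exists>j<3. d j \<noteq> 0) \<and> (\<Prod>j<3. e9 (u j) powi d j) = 1"
proof -
  have "\<exists>d :: nat \<Rightarrow> int. (\<exists>j<3. d j \<noteq> 0) \<and> (\<Prod>j<3. e9 ((\<rho> ^^ 0) (u j)) powi d j) = 1"
    by (rule units_dependent[where U = U and e = "\<lambda>m x. e9 ((\<rho> ^^ m) x)"])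
       (simp_all add: rhom_simps[OF rho_pow_hom] rhom_simps[OF rhom_e9] U_mult U_1 U_inv U_norm U_finite assms)
  thus ?thesis by simp
qed

lemma U_generated:
  assumes eta: "\<eta>0 \<in> U" "\<eta>1 \<in> U"
    and ind: "\<And>m0 m1 v. m0 < (7::nat) \<Longrightarrow> m1 < (7::nat) \<Longrightarrow> v \<in> U \<Longrightarrow> \<eta>0 ^ m0 * \<eta>1 ^ m1 = v ^ 7 \<Longrightarrow> m0 = 0 \<and> m1 = 0"
    and u: "u \<in> U"
  shows "\<exists>m0 m1 v. m0 < 7 \<and> m1 < 7 \<and> v \<in> U \<and> u = \<eta>0 ^ m0 * \<eta>1 ^ m1 * v ^ 7"
proof -
  let ?eta = "\<lambda>i::nat. if i = 0 then e9 \<eta>0 else e9 \<eta>1"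
  have two: "(\<Prod>i<(2::nat). ?eta i ^ m i) = e9 (\<eta>0 ^ m 0 * \<eta>1 ^ m 1)" for m :: "nat \<Rightarrow> nat"
    by (simp add: numeral_2_eq_2 rhom_simps[OF rhom_e9])
  have "\<exists>m g. (\<forall>i. m i < (7::nat)) \<and> g \<in> e9 ` U \<and> e9 u = (\<Prod>i<2. ?eta i ^ m i) * g ^ 7"
  proof (rule generates_mod_seventh_powers)
    show "0 \<notin> e9 ` U" by (auto simp: U_def e9_0_iff dest: sym)
    show "1 \<in> e9 ` U" using U_1 rhom_1[OF rhom_e9] by (metis image_eqI)
    show "x * y \<in> e9 ` U" if "x \<in> e9 ` U" "y \<in> e9 ` U" for x y
      using that U_mult by (auto simp: image_iff) (metis rhom_mult[OF rhom_e9])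
    show "inverse x \<in> e9 ` U" if x: "x \<in> e9 ` U" for x
    proof -
      obtain z where z: "z \<in> U" "x = e9 z" using x by blast
      obtain y where y: "y \<in> U" "z * y = 1" using U_inv[OF z(1)] by auto
      have "x * e9 y = 1" using z y by (metis rhom_1[OF rhom_e9] rhom_mult[OF rhom_e9])
      hence "inverse x = e9 y" by (rule inverse_unique)
      thus ?thesis using y by auto
    qed
    show "\<exists>d :: nat \<Rightarrow> int. (\<exists>j<Suc 2. d j \<noteq> 0) \<and> (\<Prod>j<Suc 2. f j powi d j) = 1"
      if f: "\<And>j. j < Suc 2 \<Longrightarrow> f j \<in> e9 ` U" for f
    proof -
      have "\<forall>j. \<exists>x. j < 3 \<longrightarrow> x \<in> U \<and> f j = e9 x" using f by (auto simp: numeral_3_eq_3 numeral_2_eq_2)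
      then obtain w where w: "\<And>j. j < 3 \<Longrightarrow> w j \<in> U \<and> f j = e9 (w j)" by metis
      from U_dependent[of w] w obtain d :: "nat \<Rightarrow> int" where "\<exists>j<3. d j \<noteq> 0" "(\<Prod>j<3. e9 (w j) powi d j) = 1" by blast
      moreover have "(\<Prod>j<3. e9 (w j) powi d j) = (\<Prod>j<3. f j powi d j)" using w by (intro prod.cong) auto
      ultimately show ?thesis by (auto simp: numeral_3_eq_3 numeral_2_eq_2)
    qed
    show "?eta i \<in> e9 ` U" for i using eta by auto
    show "\<forall>i<2. m i = 0" if m: "\<And>i. i < 2 \<Longrightarrow> m i < (7::nat)" and g: "g \<in> e9 ` U" 
      and e: "(\<Prod>i<2. ?eta i ^ m i) = g ^ 7" for m g
    proof -
      obtain v where v: "v \<in> U" "g = e9 v" using g by auto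
      have "e9 (\<eta>0 ^ m 0 * \<eta>1 ^ m 1) = e9 (v ^ 7)" using e v by (simp only: two rhom_power[OF rhom_e9])
      hence "\<eta>0 ^ m 0 * \<eta>1 ^ m 1 = v ^ 7" by (simp only: e9_inj)
      with ind[of "m 0" "m 1" v] m v show ?thesis by (auto simp: less_2_cases_iff)
    qed
    show "e9 u \<in> e9 ` U" using u by auto
  qed
  then obtain m g v where m: "\<forall>i. m i < (7::nat)" and v: "v \<in> U" "g = e9 v"
    and e: "e9 u = (\<Prod>i<2. ?eta i ^ m i) * g ^ 7"
    by auto
  have "e9 u = e9 (\<eta>0 ^ m 0 * \<eta>1 ^ m 1 * v ^ 7)"
    using e v unfolding two by (simp add: rhom_simps[OF rhom_e9])
  hence "u = \<eta>0 ^ m 0 * \<eta>1 ^ m 1 * v ^ 7" by (simp only: e9_inj)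
  thus ?thesis using m v by blast
qed

end

lemma comax_dvd_both:
  assumes "comax a b" "(n::'a::comm_ring_1) dvd x * a" "n dvd x * b" shows "n dvd x"
proof -
  obtain r s where e: "r * a + s * b = 1" using assms(1) unfolding comax_def by blast
  have "x = x * (r * a + s * b)" by (simp add: e)
  also have "\<dots> = r * (x * a) + s * (x * b)" by (simp add: algebra_simps)
  finally have "x = r * (x * a) + s * (x * b)" .
  thus ?thesis using assms(2,3) by (metis dvd_add dvd_mult)
qed

lemma prod_less_3: "(\<Prod>m<(3::nat). f m) = f 0 * f 1 * (f 2 :: 'a::comm_monoid_mult)"
  by (simp add: numeral_3_eq_3 numeral_2_eq_2 mult.assoc)

context cubic_subfield
begin

definition nr :: "k9 \<Rightarrow> int" where "nr x = c0 (a0 (x * \<rho> x * \<rho> (\<rho> x)))"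

lemma nr: "\<tau> x = x \<Longrightarrow> x * \<rho> x * \<rho> (\<rho> x) = of_int (nr x)"
proof -
  assume "\<tau> x = x"
  then obtain k where "x * \<rho> x * \<rho> (\<rho> x) = of_int k" using norm_int by blast
  thus ?thesis by (simp add: nr_def of_int_k9 of_int_c13)
qed

lemma nr_real: "\<tau> x = x \<Longrightarrow> real_of_int (nr x) = e9 x * e9 (\<rho> x) * e9 (\<rho> (\<rho> x))"
  using prod_emb[of "nr x" x] nr[of x] by (simp add: prod_less_3 numeral_2_eq_2)

lemma rho_0_iff: "\<rho> x = 0 \<longleftrightarrow> x = 0"
  using cube(2)[of x] rhom_0[OF hom(2)] by metis

lemma nr_0_iff: "\<tau> x = x \<Longrightarrow> nr x = 0 \<longleftrightarrow> x = 0"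
proof -
  assume "\<tau> x = x"
  hence "nr x = 0 \<longleftrightarrow> x * \<rho> x * \<rho> (\<rho> x) = 0" using nr of_int_eq_k9[of "nr x" 0] by simp
  thus ?thesis by (simp add: rho_0_iff)
qed

text \<open>Minkowski's argument for the points s \<beta> / \<alpha> with s = 0, ..., 20 and the
  lattice spanned by the conjugates of \<omega>. The covolume is at most 91, and 21 * 3^3 / 3! =
  94.5, whereas 20 points would only give 90.\<close>

lemma approx:
  assumes fx: "\<tau> \<beta> = \<beta>" "\<tau> \<alpha> = \<alpha>" and nz: "\<alpha> \<noteq> 0"
  shows "\<exists>s t. 0 < s \<and> s \<le> 20 \<and> \<tau> t = t \<and> \<bar>nr (of_nat s * \<beta> - t * \<alpha>)\<bar> < \<bar>nr \<alpha>\<bar>"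
proof -
  define w0 w1 w2 where "w0 = e9 \<omega>" and "w1 = e9 (\<rho> \<omega>)" and "w2 = e9 (\<rho> (\<rho> \<omega>))"
  define W :: "real^3^3" where "W = vector [vector [w0, w1, w2], vector [w1, w2, w0], vector [w2, w0, w1]]"
  have e1: "w0 + w1 + w2 = of_int s1"
    using arg_cong[OF omega(2), of e9] by (simp add: rhom_simps[OF rhom_e9] w0_def w1_def w2_def)
  have e2: "w0 * w1 + w1 * w2 + w2 * w0 = of_int s2"
    using arg_cong[OF omega(3), of e9] by (simp add: rhom_simps[OF rhom_e9] w0_def w1_def w2_def)
  have "det W = - ((w0 + w1 + w2) * ((w0 + w1 + w2)^2 - 3 * (w0 * w1 + w1 * w2 + w2 * w0)))"
    by (simp add: W_def det_3 vector_3 power2_eq_square algebra_simps)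
  hence det: "det W = of_int (- (s1 * (s1^2 - 3 * s2)))" by (simp add: e1 e2)
  have det0: "det W \<noteq> 0" using disc(1) det by (metis abs_zero neg_equal_0_iff_equal of_int_eq_0_iff order_less_irrefl)
  have "\<bar>det W\<bar> = of_int \<bar>s1 * (s1^2 - 3 * s2)\<bar>" unfolding det by (metis abs_minus_cancel of_int_abs)
  also have "\<dots> \<le> of_int 91" by (rule of_int_le_iff[THEN iffD2, OF disc(2)])
  also have "\<dots> < real 21 * (real CARD(3) ^ CARD(3) / fact CARD(3))" by (simp add: fact_numeral)
  finally have less: "\<bar>det W\<bar> < real 21 * (real CARD(3) ^ CARD(3) / fact CARD(3))" .
  define y0 y1 y2 where "y0 = e9 \<beta> / e9 \<alpha>" and "y1 = e9 (\<rho> \<beta>) / e9 (\<rho> \<alpha>)"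
    and "y2 = e9 (\<rho> (\<rho> \<beta>)) / e9 (\<rho> (\<rho> \<alpha>))"
  define p :: "nat \<Rightarrow> real^3" where "p s = vector [real s * y0, real s * y1, real s * y2]" for s
  obtain i j c where ij: "i < 21" "j < 21" and c: "c \<in> zvec" "i \<noteq> j \<or> c \<noteq> 0"
    and P: "(\<Prod>k\<in>UNIV. \<bar>(p i - p j - W *v c) $ k\<bar>) < 1"
    using minkowski_approx[OF det0 less, of p] by blast
  have "\<forall>k. \<exists>b. c $ k = of_int b" 
  proof
    fix k
    have "c $ k \<in> \<int>" using c(1) by (simp add: zvec_def)
    thus "\<exists>b. c $ k = of_int b" by (rule Ints_cases) blast
  qed
  then obtain f where f: "\<And>k. c $ k = of_int (f k)" by metis
  define b1 b2 b3 where "b1 = f 1" and "b2 = f 2" and "b3 = f 3"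
  have b: "c $ 1 = of_int b1" "c $ 2 = of_int b2" "c $ 3 = of_int b3"
    unfolding b1_def b2_def b3_def by (rule f)+
  define t where "t = of_int b1 * \<omega> + of_int b2 * \<rho> \<omega> + of_int b3 * \<rho> (\<rho> \<omega>)"
  have tt: "\<tau> t = t" by (simp add: t_def rhom_simps[OF hom(1)] comm omega(1))
  have Wc: "(W *v c) $ 1 = e9 t" "(W *v c) $ 2 = e9 (\<rho> t)" "(W *v c) $ 3 = e9 (\<rho> (\<rho> t))"
    by (simp_all add: W_def matrix_vector_mult_def sum_3 vector_3 b t_def rhom_simps[OF rhom_e9]
        rhom_simps[OF hom(2)] cube w0_def w1_def w2_def)
  define d where "d = real i - real j"
  have P': "\<bar>d * y0 - e9 t\<bar> * \<bar>d * y1 - e9 (\<rho> t)\<bar> * \<bar>d * y2 - e9 (\<rho> (\<rho> t))\<bar> < 1"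
  proof -
    have e: "(p i - p j - W *v c) $ 1 = d * y0 - e9 t" "(p i - p j - W *v c) $ 2 = d * y1 - e9 (\<rho> t)"
      "(p i - p j - W *v c) $ 3 = d * y2 - e9 (\<rho> (\<rho> t))"
      unfolding vector_minus_component Wc p_def vector_3 d_def left_diff_distrib by (rule refl)+
    have pr: "(\<Prod>k\<in>UNIV. f k) = f 1 * f 2 * f 3" for f :: "3 \<Rightarrow> real"
      unfolding UNIV_3 by (simp add: ac_simps)
    show ?thesis using P by (simp only: pr e)
  qed
  \<comment> \<open>Equal indices would produce a nonzero element \<open>t\<close> of the lattice
    with norm below 1.\<close>
  have ij': "i \<noteq> j"
  proof
    assume "i = j"
    hence "c \<noteq> 0" "d = 0" using c by (auto simp: d_def)
    have "t \<noteq> 0"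
    proof
      assume "t = 0"
      hence "W *v c = 0" using Wc
        by (simp add: vec_eq_iff forall_3 rhom_0[OF rhom_e9] rhom_0[OF hom(2)])
      thus False using det0 \<open>c \<noteq> 0\<close> by (metis invertible_det_nz invertible_left_inverse matrix_left_invertible_ker)
    qed
    hence "\<bar>nr t\<bar> \<ge> 1" using nr_0_iff[OF tt] by linarith
    moreover have "real_of_int \<bar>nr t\<bar> < 1" using P' \<open>d = 0\<close> nr_real[OF tt] by (simp add: abs_mult)
    ultimately show False by linarith
  qed
  have nzs: "e9 \<alpha> \<noteq> 0" "e9 (\<rho> \<alpha>) \<noteq> 0" "e9 (\<rho> (\<rho> \<alpha>)) \<noteq> 0" using nz by (simp_all add: e9_0_iff rho_0_iff)
  have main: "\<bar>nr (of_nat s * \<beta> - t' * \<alpha>)\<bar> < \<bar>nr \<alpha>\<bar>"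
    if st: "\<tau> t' = t'" "\<bar>real s * y0 - e9 t'\<bar> * \<bar>real s * y1 - e9 (\<rho> t')\<bar> * \<bar>real s * y2 - e9 (\<rho> (\<rho> t'))\<bar> < 1" for s t'
  proof -
    have f: "\<tau> (of_nat s * \<beta> - t' * \<alpha>) = of_nat s * \<beta> - t' * \<alpha>"
      using fx st by (simp add: rhom_simps[OF hom(1)])
    have "real_of_int (nr (of_nat s * \<beta> - t' * \<alpha>)) =
       (real s * e9 \<beta> - e9 t' * e9 \<alpha>) * (real s * e9 (\<rho> \<beta>) - e9 (\<rho> t') * e9 (\<rho> \<alpha>))
        * (real s * e9 (\<rho> (\<rho> \<beta>)) - e9 (\<rho> (\<rho> t')) * e9 (\<rho> (\<rho> \<alpha>)))"
      unfolding nr_real[OF f] by (simp add: rhom_simps[OF hom(2)] rhom_simps[OF rhom_e9])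
    also have "\<dots> = (real s * y0 - e9 t') * (real s * y1 - e9 (\<rho> t')) * (real s * y2 - e9 (\<rho> (\<rho> t'))) * nr \<alpha>"
      unfolding nr_real[OF fx(2)] y0_def y1_def y2_def using nzs by (simp add: field_simps)
    finally have "\<bar>real_of_int (nr (of_nat s * \<beta> - t' * \<alpha>))\<bar> =
      (\<bar>real s * y0 - e9 t'\<bar> * \<bar>real s * y1 - e9 (\<rho> t')\<bar> * \<bar>real s * y2 - e9 (\<rho> (\<rho> t'))\<bar>) * \<bar>real_of_int (nr \<alpha>)\<bar>"
      by (simp add: abs_mult)
    moreover have "\<bar>real_of_int (nr \<alpha>)\<bar> > 0" using nr_0_iff[OF fx(2)] nz by simp
    ultimately have "\<bar>real_of_int (nr (of_nat s * \<beta> - t' * \<alpha>))\<bar> < \<bar>real_of_int (nr \<alpha>)\<bar>"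
      using mult_strict_right_mono[OF st(2) \<open>\<bar>real_of_int (nr \<alpha>)\<bar> > 0\<close>] by simp
    thus ?thesis by linarith
  qed
  show ?thesis
  proof (cases "i > j")
    case True
    have "real (i - j) = d" using True by (simp add: d_def)
    hence "\<bar>nr (of_nat (i - j) * \<beta> - t * \<alpha>)\<bar> < \<bar>nr \<alpha>\<bar>" using main[OF tt, of "i - j"] P' by simp
    thus ?thesis using True ij tt by (intro exI[of _ "i - j"] exI[of _ t]) auto
  next
    case False
    have d: "real (j - i) = - d" using False by (simp add: d_def)
    have m: "\<bar>- d * y - - v\<bar> = \<bar>d * y - v\<bar>" for y v :: real by simp
    have tm: "\<tau> (- t) = - t" using tt by (simp add: rhom_simps[OF hom(1)])
    have "\<bar>nr (of_nat (j - i) * \<beta> - (- t) * \<alpha>)\<bar> < \<bar>nr \<alpha>\<bar>"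
      by (rule main[OF tm]) (use P' in \<open>simp only: d rhom_uminus[OF hom(2)] rhom_uminus[OF rhom_e9] m\<close>)
    thus ?thesis using False ij ij' tm by (intro exI[of _ "j - i"] exI[of _ "- t"]) auto
  qed
qed

text \<open>The ideal J = (g, z) satisfies J^7 = (g). Let \<alpha> be a smallest element of the norm
  of J, intersected with the fixed ring. By \<open>approx\<close> it divides \<open>fact 20\<close>
  times every other element, so \<alpha>^7 is the norm of g up to a factor \<mu> that divides a
  fixed number.\<close>

lemma norm_seventh_power:
  assumes gh: "g * h = z ^ 7" "comax g h" and g0: "g \<noteq> 0"
  shows "\<exists>\<alpha> \<mu>. \<alpha> \<noteq> 0 \<and> \<tau> \<alpha> = \<alpha> \<and> g * \<tau> g * \<tau> (\<tau> g) * \<mu> = \<alpha> ^ 7 \<and> \<mu> dvd of_nat (fact 20 * 91) ^ 7"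
proof -
  note ht = rhom_simps[OF hom(1)]
  define N where "N = g * \<tau> g * \<tau> (\<tau> g)"
  have tau0: "\<tau> x = 0 \<longleftrightarrow> x = 0" for x using cube(1)[of x] rhom_0[OF hom(1)] by metis
  have N0: "N \<noteq> 0" using g0 by (simp add: N_def tau0)
  \<comment> \<open>With u, v, w in \<open>{g, z}\<close> these products generate the norm of the
    ideal J.\<close>
  define Y where "Y u v w = u * \<tau> v * \<tau> (\<tau> w)" for u v w
  define S where "S = {g, z}"
  \<comment> \<open>The cofactor of g in \<open>u ^ 7\<close>: it is \<open>g ^ 6\<close> for g and
    h for z, and these two are comaximal.\<close>
  define cf where "cf u = (if u = g then g ^ 6 else h)" for u
  have cf: "u ^ 7 = g * cf u" if "u \<in> S" for u
    using that gh(1) by (auto simp: S_def cf_def simp flip: power_Suc)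
  define C where "C u v w = cf u * \<tau> (cf v) * \<tau> (\<tau> (cf w))" for u v w
  have YC: "Y u v w ^ 7 = N * C u v w" if "u \<in> S" "v \<in> S" "w \<in> S" for u v w
  proof -
    have "Y u v w ^ 7 = u ^ 7 * \<tau> (v ^ 7) * \<tau> (\<tau> (w ^ 7))" by (simp add: Y_def ht power_mult_distrib)
    also have "\<dots> = N * C u v w" using cf that by (simp add: N_def C_def ht mult_ac)
    finally show ?thesis .
  qed
  have gd: "g dvd u' * u ^ 6" if "u' \<in> S" "u \<in> S" for u' u
  proof (cases "u' = g \<or> u = g")
    case False
    hence "u' * u ^ 6 = z ^ 7" using that by (auto simp: S_def simp flip: power_Suc)
    thus ?thesis using gh(1) by (metis dvd_triv_left)
  qed (auto intro: dvd_power dvd_mult)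
  have Nd: "N dvd Y u' v' w' * Y u v w ^ 6"
    if "u' \<in> S" "v' \<in> S" "w' \<in> S" "u \<in> S" "v \<in> S" "w \<in> S" for u v w u' v' w'
  proof -
    have "N dvd (u' * u ^ 6) * \<tau> (v' * v ^ 6) * \<tau> (\<tau> (w' * w ^ 6))"
      unfolding N_def using that by (intro mult_dvd_mono rhom_dvd[OF hom(1)] gd)
    also have "\<dots> = Y u' v' w' * Y u v w ^ 6" by (simp add: Y_def ht power_mult_distrib mult_ac)
    finally show ?thesis .
  qed
  \<comment> \<open>As the seventh power of the norm of J is (N), membership in it is tested by
    multiplying with its sixth power; this needs no arithmetic of ideals.\<close>
  define I where "I = {x. \<tau> x = x \<and> (\<forall>u\<in>S. \<forall>v\<in>S. \<forall>w\<in>S. N dvd x * Y u v w ^ 6)}"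
  have "N \<in> I"
  proof -
    have "N = Y g g g" by (simp add: N_def Y_def)
    moreover have "\<tau> N = N" by (simp add: N_def ht cube mult_ac)
    ultimately show ?thesis using Nd by (auto simp: I_def S_def)
  qed
  hence ex: "\<exists>x. x \<in> I \<and> x \<noteq> 0" using N0 by blast
  obtain \<alpha> where \<alpha>: "\<alpha> \<in> I" "\<alpha> \<noteq> 0" and min: "\<And>x. x \<in> I \<Longrightarrow> x \<noteq> 0 \<Longrightarrow> nat \<bar>nr \<alpha>\<bar> \<le> nat \<bar>nr x\<bar>"
    using ex_has_least_nat[of "\<lambda>x. x \<in> I \<and> x \<noteq> 0" N "\<lambda>x. nat \<bar>nr x\<bar>"] ex \<open>N \<in> I\<close> N0 by blast
  have \<alpha>f: "\<tau> \<alpha> = \<alpha>" using \<alpha> by (simp add: I_def)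
  define L :: k9 where "L = of_nat (fact 20)"
  have dvdI: "\<alpha> dvd L * \<beta>" if \<beta>: "\<beta> \<in> I" for \<beta>
  proof -
    have \<beta>f: "\<tau> \<beta> = \<beta>" using \<beta> by (simp add: I_def)
    obtain s t where st: "0 < s" "s \<le> 20" "\<tau> t = t" "\<bar>nr (of_nat s * \<beta> - t * \<alpha>)\<bar> < \<bar>nr \<alpha>\<bar>"
      using approx[OF \<beta>f \<alpha>f \<alpha>(2)] by blast
    have "of_nat s * \<beta> - t * \<alpha> \<in> I"
      unfolding I_def
    proof (safe)
      show "\<tau> (of_nat s * \<beta> - t * \<alpha>) = of_nat s * \<beta> - t * \<alpha>" by (simp add: ht \<beta>f \<alpha>f st)
      fix u v w assume "u \<in> S" "v \<in> S" "w \<in> S"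
      hence a: "N dvd \<beta> * Y u v w ^ 6" "N dvd \<alpha> * Y u v w ^ 6" using \<alpha> \<beta> by (auto simp: I_def)
      have "N dvd of_nat s * (\<beta> * Y u v w ^ 6) - t * (\<alpha> * Y u v w ^ 6)"
        by (rule dvd_diff[OF dvd_mult[OF a(1)] dvd_mult[OF a(2)]])
      thus "N dvd (of_nat s * \<beta> - t * \<alpha>) * Y u v w ^ 6" by (simp add: algebra_simps)
    qed
    hence "of_nat s * \<beta> - t * \<alpha> = 0" using min[of "of_nat s * \<beta> - t * \<alpha>"] st(4) by linarith
    hence "\<alpha> dvd of_nat s * \<beta>" by simp
    moreover have "(of_nat s :: k9) dvd L"
    proof -
      have "s dvd fact 20" using st by (intro dvd_fact) auto
      then obtain r where r: "fact 20 = s * r" by (auto simp: dvd_def)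
      have "L = of_nat (s * r)" unfolding L_def by (simp only: r)
      thus ?thesis by simp
    qed
    ultimately show ?thesis by (meson dvd_refl dvd_trans mult_dvd_mono)
  qed
  \<comment> \<open>By \<open>dual\<close>, 91 times an element is a combination of traces to the
    fixed ring. The traces of \<open>bb i * Y u v w\<close> lie in \<open>I\<close>, so \<alpha>
    divides each \<open>L * 91 * Y u v w\<close>.\<close>
  obtain cc bb :: "nat \<Rightarrow> k9" where dual':
    "\<And>x y z. (\<Sum>i<3. cc i * (bb i * x + \<tau> (bb i) * y + \<tau> (\<tau> (bb i)) * z)) = 91 * x"
    using dual by blast
  have dvdY: "\<alpha> dvd L * 91 * Y u v w" if uvw: "u \<in> S" "v \<in> S" "w \<in> S" for u v w
  proof -
    let ?y = "Y u v w"
    have ty: "\<tau> ?y = Y w u v" "\<tau> (\<tau> ?y) = Y v w u" by (simp_all add: Y_def ht cube mult_ac)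
    have inI: "bb i * ?y + \<tau> (bb i) * \<tau> ?y + \<tau> (\<tau> (bb i)) * \<tau> (\<tau> ?y) \<in> I" for i
      unfolding I_def
    proof safe
      show "\<tau> (bb i * ?y + \<tau> (bb i) * \<tau> ?y + \<tau> (\<tau> (bb i)) * \<tau> (\<tau> ?y)) =
        bb i * ?y + \<tau> (bb i) * \<tau> ?y + \<tau> (\<tau> (bb i)) * \<tau> (\<tau> ?y)"
        by (simp only: ht cube) (simp only: add_ac)
      fix u' v' w' assume s: "u' \<in> S" "v' \<in> S" "w' \<in> S"
      have "N dvd bb i * (?y * Y u' v' w' ^ 6) + \<tau> (bb i) * (Y w u v * Y u' v' w' ^ 6)
           + \<tau> (\<tau> (bb i)) * (Y v w u * Y u' v' w' ^ 6)"
        by (rule dvd_add[OF dvd_add[OF dvd_mult[OF Nd] dvd_mult[OF Nd]] dvd_mult[OF Nd]]) (rule s uvw)+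
      thus "N dvd (bb i * ?y + \<tau> (bb i) * \<tau> ?y + \<tau> (\<tau> (bb i)) * \<tau> (\<tau> ?y)) * Y u' v' w' ^ 6"
        unfolding ty(2) unfolding ty(1) by (simp only: distrib_right mult.assoc)
    qed
    have "\<alpha> dvd (\<Sum>i<3. cc i * (L * (bb i * ?y + \<tau> (bb i) * \<tau> ?y + \<tau> (\<tau> (bb i)) * \<tau> (\<tau> ?y))))"
      by (rule dvd_sum, rule dvd_mult, rule dvdI, rule inI)
    also have "\<dots> = L * (\<Sum>i<3. cc i * (bb i * ?y + \<tau> (bb i) * \<tau> ?y + \<tau> (\<tau> (bb i)) * \<tau> (\<tau> ?y)))"
      by (simp add: sum_distrib_left mult.left_commute)
    finally show ?thesis by (simp only: dual' mult.assoc)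
  qed
  have cS: "g \<in> S" "z \<in> S" "\<exists>u\<in>S. cf u = h"
  proof -
    show "\<exists>u\<in>S. cf u = h"
    proof (cases "z = g")
      case True
      hence "g * h = g * g ^ 6" using gh(1) by (simp add: eval_nat_numeral)
      hence "h = g ^ 6" using g0 by simp
      thus ?thesis by (auto simp: S_def cf_def)
    qed (auto simp: S_def cf_def)
  qed (auto simp: S_def)
  \<comment> \<open>The k-th powers of the products of cofactors generate the unit ideal, so
    divisibility may be checked after multiplication by each of them.\<close>
  have comax_elim: "n dvd x" if H: "\<And>u v w. u \<in> S \<Longrightarrow> v \<in> S \<Longrightarrow> w \<in> S \<Longrightarrow> n dvd x * C u v w ^ k" for n x and k :: nat
  proof -
    obtain z' where z': "z' \<in> S" "cf z' = h" using cS by blast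
    have cg: "cf g = g ^ 6" by (simp add: cf_def)
    have co: "comax (cf g ^ k) (cf z' ^ k)" unfolding cg z' using comax_powers[OF gh(2), of "6 * k" k] by (simp add: power_mult)
    have co1: "comax (\<tau> (cf g) ^ k) (\<tau> (cf z') ^ k)" using comax_rhom[OF hom(1) co] by (simp add: ht)
    have co2: "comax (\<tau> (\<tau> (cf g)) ^ k) (\<tau> (\<tau> (cf z')) ^ k)" using comax_rhom[OF hom(1) co1] by (simp add: ht)
    have st1: "n dvd (x * cf u ^ k) * \<tau> (cf v) ^ k" if "u \<in> S" "v \<in> S" for u v
    proof (rule comax_dvd_both[OF co2])
      show "n dvd x * cf u ^ k * \<tau> (cf v) ^ k * \<tau> (\<tau> (cf g)) ^ k" 
        using H[of u v g] that cS by (simp add: C_def power_mult_distrib mult.assoc)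
      show "n dvd x * cf u ^ k * \<tau> (cf v) ^ k * \<tau> (\<tau> (cf z')) ^ k" 
        using H[of u v z'] that z' by (simp add: C_def power_mult_distrib mult.assoc)
    qed
    have st2: "n dvd x * cf u ^ k" if "u \<in> S" for u
      by (rule comax_dvd_both[OF co1]) (use st1 that cS z' in blast)+
    show ?thesis by (rule comax_dvd_both[OF co]) (use st2 cS z' in blast)+
  qed
  have "N dvd \<alpha> ^ 7"
  proof (rule comax_elim[of _ _ 6])
    fix u v w assume uvw: "u \<in> S" "v \<in> S" "w \<in> S"
    have "N dvd \<alpha> * Y u v w ^ 6" using \<alpha> uvw by (auto simp: I_def)
    then obtain e where e: "\<alpha> * Y u v w ^ 6 = N * e" by (auto simp: dvd_def)
    have "N ^ 6 * (\<alpha> ^ 7 * C u v w ^ 6) = \<alpha> ^ 7 * (N * C u v w) ^ 6" by (simp add: power_mult_distrib mult_ac)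
    also have "\<dots> = (\<alpha> * Y u v w ^ 6) ^ 7"
      unfolding YC[OF uvw, symmetric] by (simp add: power_mult_distrib flip: power_mult)
    also have "\<dots> = N ^ 6 * (N * e ^ 7)" unfolding e by (simp add: power_mult_distrib eval_nat_numeral mult_ac)
    finally have "\<alpha> ^ 7 * C u v w ^ 6 = N * e ^ 7" using N0 by simp
    thus "N dvd \<alpha> ^ 7 * C u v w ^ 6" by simp
  qed
  then obtain \<mu> where \<mu>: "\<alpha> ^ 7 = N * \<mu>" by (auto simp: dvd_def)
  have "\<mu> dvd (L * 91) ^ 7"
  proof (rule comax_elim[of _ _ 1])
    fix u v w assume uvw: "u \<in> S" "v \<in> S" "w \<in> S"
    obtain e where e: "L * 91 * Y u v w = \<alpha> * e" using dvdY[OF uvw] by (auto simp: dvd_def)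
    have "N * ((L * 91) ^ 7 * C u v w) = (L * 91 * Y u v w) ^ 7"
      by (simp add: power_mult_distrib YC[OF uvw] mult_ac)
    also have "\<dots> = N * (\<mu> * e ^ 7)" unfolding e by (simp add: power_mult_distrib \<mu> mult_ac)
    finally have "(L * 91) ^ 7 * C u v w = \<mu> * e ^ 7" using N0 by simp
    thus "\<mu> dvd (L * 91) ^ 7 * C u v w ^ 1" by simp
  qed
  moreover have "L * 91 = of_nat (fact 20 * 91)" unfolding L_def by (simp only: of_nat_mult of_nat_numeral)
  ultimately show ?thesis using \<mu> \<alpha> \<alpha>f unfolding N_def by metis
qed

end

section \<open>Small prime elements\<close>

lemma n13_poly: "n13 (C13 a b c) = a*a*a - a*a*b + 9*(a*a*c) - 4*(a*b*b) + 7*(a*b*c) + 14*(a*c*c)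
   - b*b*b + b*b*c + 4*(b*c*c) + c*c*c"
  by (simp add: n13_def sk13_def c13_defs algebra_simps)

definition n13p :: "int \<Rightarrow> int \<Rightarrow> int \<Rightarrow> int" where
  "n13p a b c = a*a*a - a*a*b + 9*(a*a*c) - 4*(a*b*b) + 7*(a*b*c) + 14*(a*c*c)
   - b*b*b + b*b*c + 4*(b*c*c) + c*c*c"

text \<open>No projective zero of the norm form modulo p. The points to test are (a : 1 : 0) and (a
  : b : 1); at (1 : 0 : 0) the form is 1.\<close>

definition inert_check :: "int \<Rightarrow> bool" where
  "inert_check p \<longleftrightarrow> list_all (\<lambda>a. n13p a 1 0 mod p \<noteq> 0 \<and>
     list_all (\<lambda>b. n13p a b 1 mod p \<noteq> 0) [0..p - 1]) [0..p - 1]"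

lemma inert_checks: "inert_check 2" "inert_check 3" "inert_check 7" "inert_check 11" "inert_check 17" "inert_check 19"
  by code_simp+

lemma n13_mod: "[a = a'] (mod m) \<Longrightarrow> [b = b'] (mod m) \<Longrightarrow> [c = c'] (mod m) \<Longrightarrow> [n13 (C13 a b c) = n13 (C13 a' b' c')] (mod m)"
  unfolding n13_poly by (intro cong_add cong_diff cong_mult cong_refl)

lemma inert_n13:
  assumes p: "prime p" "inert_check (int p)" and d: "int p dvd n13 x"
  shows "of_nat p dvd x"
proof -
  obtain a b c where x: "x = C13 a b c" by (cases x)
  have p0: "int p > 0" using p(1) prime_gt_0_nat by simp
  have inv: "\<exists>v. [y * v = 1] (mod int p)" if "\<not> int p dvd y" for y
    using that p(1) by (metis cong_solve_coprime_int coprime_commute prime_imp_coprime prime_nat_int_transfer)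
  have sc: "int p dvd n13 (C13 (v * a) (v * b) (v * c))" for v
  proof -
    have "C13 (v * a) (v * b) (v * c) = of_int v * x" by (simp add: x of_int_c13 c13_defs)
    thus ?thesis using d by (simp add: n13_scale)
  qed
  have red: "\<exists>a'. a' \<in> set [0..int p - 1] \<and> [y = a'] (mod int p)" for y
    using p0 pos_mod_bound[OF p0, of y] by (intro exI[of _ "y mod int p"]) (auto simp: cong_def)
  have "int p dvd c"
  proof (rule ccontr)
    assume "\<not> int p dvd c"
    then obtain v where v: "[c * v = 1] (mod int p)" using inv by blast
    obtain a' b' where ab: "a' \<in> set [0..int p - 1]" "[v * a = a'] (mod int p)" "b' \<in> set [0..int p - 1]" "[v * b = b'] (mod int p)"
      using red by metis
    have "[n13 (C13 (v * a) (v * b) (v * c)) = n13 (C13 (a') (b') 1)] (mod int p)"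
      by (rule n13_mod[OF ab(2,4)]) (use v in \<open>simp add: mult.commute\<close>)
    hence "n13 (C13 (a') (b') 1) mod int p = 0" using sc[of v] by (simp add: cong_def dvd_eq_mod_eq_0)
    thus False using p(2) ab by (auto simp: inert_check_def list_all_iff n13p_def n13_poly)
  qed
  hence c0: "[c = 0] (mod int p)" by (simp add: cong_0_iff)
  have "int p dvd b"
  proof (rule ccontr)
    assume "\<not> int p dvd b"
    then obtain v where v: "[b * v = 1] (mod int p)" using inv by blast
    obtain a' where ab: "a' \<in> set [0..int p - 1]" "[v * a = a'] (mod int p)" using red by metis
    have "[n13 (C13 (v * a) (v * b) (v * c)) = n13 (C13 (a') 1 0)] (mod int p)"
      by (rule n13_mod[OF ab(2)]) (use v c0 cong_mult[OF cong_refl c0, of v] in \<open>simp_all add: mult.commute\<close>)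
    hence "n13 (C13 (a') 1 0) mod int p = 0" using sc[of v] by (simp add: cong_def dvd_eq_mod_eq_0)
    thus False using p(2) ab by (auto simp: inert_check_def list_all_iff n13p_def n13_poly)
  qed
  hence b0: "[b = 0] (mod int p)" by (simp add: cong_0_iff)
  have "[n13 (C13 a b c) = n13 (C13 a 0 0)] (mod int p)" by (rule n13_mod[OF cong_refl b0 c0])
  hence "int p dvd a * a * a" using d x by (simp add: n13_poly cong_dvd_iff)
  hence "int p dvd a" using p(1) by (metis prime_dvd_mult_iff prime_nat_int_transfer)
  thus ?thesis using \<open>int p dvd b\<close> \<open>int p dvd c\<close> of_int_dvd_c13[of "int p" x] by (simp add: x)
qed

lemma inert_prime:
  assumes p: "prime p" "inert_check (int p)" and d: "of_nat p dvd (x::c13) * y"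
  shows "of_nat p dvd x \<or> of_nat p dvd y"
proof -
  obtain z where z: "x * y = of_nat p * z" using d by (auto simp: dvd_def)
  have "n13 x * n13 y = int p ^ 3 * n13 z"
    using arg_cong[OF z, of n13] n13_scale[of "int p" z] by (simp add: n13_mult)
  hence "int p dvd n13 x * n13 y" by (simp add: power3_eq_cube)
  hence "int p dvd n13 x \<or> int p dvd n13 y" using p(1) by (metis prime_dvd_mult_iff prime_nat_int_transfer)
  thus ?thesis using inert_n13[OF p] by blast
qed

definition eval_al :: "c13 \<Rightarrow> k9 \<Rightarrow> c13" where "eval_al r x = a0 x + a1 x * r + a2 x * (r * r)"

lemma eval_al_mult:
  "eval_al r x * eval_al r y - eval_al r (x * y) = (r*r*r + r*r - 2*r - 1) * ((a1 x * a2 y + a2 x * a1 y) + a2 x * a2 y * (r - 1))"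
  by (cases x; cases y) (simp add: eval_al_def k9_defs algebra_simps)

lemma eval_al_eq: "x = C7 (eval_al r x) 0 0 + (al - C7 r 0 0) * (C7 (a1 x) 0 0 + C7 (a2 x) 0 0 * (al + C7 r 0 0))"
  by (cases x) (simp add: eval_al_def k9_defs algebra_simps)

text \<open>The residue field of \<pi> is that of the inert prime p of
  \<open>\<int>[\<kappa>]\<close>, with p^3 elements. It contains a root \<open>r\<close> of the
  cubic of \<alpha>, and \<alpha> \<mapsto> r is the residue map.\<close>

lemma prime_elem_via_root:
  assumes p: "prime p" "inert_check (int p)" and f: "of_nat p dvd r*r*r + r*r - 2*r - 1"
    and w: "of_nat p dvd eval_al r \<pi>" "\<pi> dvd of_nat p" "\<pi> dvd al - C7 r 0 0"
  shows "prime_elem \<pi>"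
proof -
  have hom: "of_nat p dvd eval_al r x * eval_al r y - eval_al r (x * y)" for x y unfolding eval_al_mult using f by (rule dvd_mult2)
  have iff: "\<pi> dvd x \<longleftrightarrow> of_nat p dvd eval_al r x" for x
  proof
    assume "\<pi> dvd x"
    then obtain y where y: "x = \<pi> * y" by (auto simp: dvd_def)
    have "of_nat p dvd eval_al r \<pi> * eval_al r y" using w(1) by (rule dvd_mult2)
    thus "of_nat p dvd eval_al r x" using dvd_diff_trans[OF hom[of \<pi> y]] y by simp
  next
    assume "of_nat p dvd eval_al r x"
    hence "C7 (of_nat p) 0 0 dvd C7 (eval_al r x) 0 0" by (rule rhom_dvd[OF rhom_C7])
    hence "\<pi> dvd C7 (eval_al r x) 0 0" using w(2) by (metis dvd_trans of_nat_k9)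
    thus "\<pi> dvd x" using w(3) by (subst eval_al_eq[of x r]) (intro dvd_add dvd_mult2)
  qed
  have p1: "\<not> of_nat p dvd (1::c13)"
  proof
    assume "of_nat p dvd (1::c13)"
    hence "int p dvd 1" using of_int_dvd_c13[of "int p" 1] by (simp add: one_c13_def)
    thus False using p(1) by simp
  qed
  show ?thesis
  proof (rule prime_elemI)
    show "\<pi> \<noteq> 0" using w(2) p(1) prime_gt_0_nat[OF p(1)] by (auto simp: of_nat_k9 of_nat_c13 k9_defs c13_defs numeral_c13)
    show "\<not> \<pi> dvd 1" using iff[of 1] p1 by (simp add: eval_al_def one_k9_def)
    fix x y assume "\<pi> dvd x * y"
    hence "of_nat p dvd eval_al r (x * y)" by (simp add: iff)
    hence "of_nat p dvd eval_al r x * eval_al r y" using dvd_diff_trans[OF hom] by blast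
    thus "\<pi> dvd x \<or> \<pi> dvd y" using inert_prime[OF p] iff by blast
  qed
qed

lemma prime_elem_auto:
  assumes f: "rhom f" "\<And>x. f (f (f x)) = x" and p: "prime_elem \<pi>"
  shows "prime_elem (f \<pi>)"
proof (rule prime_elemI)
  have inj: "f a dvd f b \<longleftrightarrow> a dvd b" for a b
    using rhom_dvd[OF f(1)] f(2) by metis
  show "f \<pi> \<noteq> 0" using p f rhom_0[OF f(1)] by (metis prime_elem_def)
  show "\<not> f \<pi> dvd 1" using p inj[of \<pi> 1] rhom_1[OF f(1)] by (simp add: prime_elem_def)
  fix x y assume "f \<pi> dvd x * y"
  moreover have "x * y = f (f (f (x * y)))" by (simp add: f)
  ultimately have "\<pi> dvd f (f (x * y))" using inj by metis
  hence "\<pi> dvd f (f x) * f (f y)" by (simp add: rhom_simps[OF f(1)])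
  hence "\<pi> dvd f (f x) \<or> \<pi> dvd f (f y)" using p by (simp add: prime_elem_dvd_mult_iff)
  thus "f \<pi> dvd x \<or> f \<pi> dvd y" using inj f(2) by metis
qed

section \<open>Explicit primes above the rational primes below 20\<close>

definition pi2 :: k9 where "pi2 = C7 (C13 0 (-1) 0) (C13 1 0 0) (C13 0 0 0)"
definition pi3 :: k9 where "pi3 = C7 (C13 1 0 0) (C13 0 1 0) (C13 0 0 0)"
definition pi7 :: k9 where "pi7 = C7 (C13 2 0 0) (C13 (-1) 0 0) (C13 0 0 0)"
definition pi11 :: k9 where "pi11 = C7 (C13 0 (-1) 1) (C13 0 (-1) 0) (C13 1 0 0)"
definition pi17 :: k9 where "pi17 = C7 (C13 (-1) (-1) 0) (C13 1 0 1) (C13 1 (-1) 1)"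
definition pi19 :: k9 where "pi19 = C7 (C13 0 (-1) (-1)) (C13 0 0 1) (C13 1 (-1) 0)"
definition pi5 :: k9 where "pi5 = C7 (C13 1 1 0) 0 0"
definition pi13 :: k9 where "pi13 = C7 (C13 1 0 0) (C13 0 (-1) 0) (C13 0 0 0)"

lemma prime_pi2: "prime_elem pi2"
proof (rule prime_elem_via_root[of 2 "C13 0 1 0"])
  show "of_nat 2 dvd eval_al (C13 0 1 0) pi2"
    using of_int_dvd_c13[of 2] by (simp add: eval_al_def pi2_def c13_defs)
  show "of_nat 2 dvd (C13 0 1 0) * (C13 0 1 0) * (C13 0 1 0) + (C13 0 1 0) * (C13 0 1 0) - 2 * (C13 0 1 0) - 1"
    using of_int_dvd_c13[of 2] by (simp add: c13_defs numeral_c13)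
  show "pi2 dvd of_nat 2"
    by (rule dvdI[of _ _ "C7 (C13 (-2) (-1) 0) (C13 3 (-4) (-2)) (C13 2 (-2) (-1))"]) (simp add: pi2_def k9_defs c13_defs numeral_k9 numeral_c13)
  show "pi2 dvd al - C7 (C13 0 1 0) 0 0"
    by (rule dvdI[of _ _ "C7 (C13 1 0 0) (C13 0 0 0) (C13 0 0 0)"]) (simp add: pi2_def k9_defs c13_defs numeral_c13)
qed (simp_all add: inert_checks)

lemma prime_pi3: "prime_elem pi3"
proof (rule prime_elem_via_root[of 3 "C13 (-1) 1 1"])
  show "of_nat 3 dvd eval_al (C13 (-1) 1 1) pi3"
    using of_int_dvd_c13[of 3] by (simp add: eval_al_def pi3_def c13_defs)
  show "of_nat 3 dvd (C13 (-1) 1 1) * (C13 (-1) 1 1) * (C13 (-1) 1 1) + (C13 (-1) 1 1) * (C13 (-1) 1 1) - 2 * (C13 (-1) 1 1) - 1"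
    using of_int_dvd_c13[of 3] by (simp add: c13_defs numeral_c13)
  show "pi3 dvd of_nat 3"
    by (rule dvdI[of _ _ "C7 (C13 2 3 1) (C13 (-1) 0 0) (C13 1 (-2) (-1))"]) (simp add: pi3_def k9_defs c13_defs numeral_k9 numeral_c13)
  show "pi3 dvd al - C7 (C13 (-1) 1 1) 0 0"
    by (rule dvdI[of _ _ "C7 (C13 2 (-4) (-2)) (C13 1 0 0) (C13 (-1) 2 1)"]) (simp add: pi3_def k9_defs c13_defs numeral_c13)
qed (simp_all add: inert_checks)

lemma prime_pi7: "prime_elem pi7"
proof (rule prime_elem_via_root[of 7 "C13 2 0 0"])
  show "of_nat 7 dvd eval_al (C13 2 0 0) pi7"
    using of_int_dvd_c13[of 7] by (simp add: eval_al_def pi7_def c13_defs)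
  show "of_nat 7 dvd (C13 2 0 0) * (C13 2 0 0) * (C13 2 0 0) + (C13 2 0 0) * (C13 2 0 0) - 2 * (C13 2 0 0) - 1"
    using of_int_dvd_c13[of 7] by (simp add: c13_defs numeral_c13)
  show "pi7 dvd of_nat 7"
    by (rule dvdI[of _ _ "C7 (C13 4 0 0) (C13 3 0 0) (C13 1 0 0)"]) (simp add: pi7_def k9_defs c13_defs numeral_k9 numeral_c13)
  show "pi7 dvd al - C7 (C13 2 0 0) 0 0"
    by (rule dvdI[of _ _ "C7 (C13 (-1) 0 0) (C13 0 0 0) (C13 0 0 0)"]) (simp add: pi7_def k9_defs c13_defs numeral_c13)
qed (simp_all add: inert_checks)

lemma prime_pi11: "prime_elem pi11"
proof (rule prime_elem_via_root[of 11 "C13 (-1) (-4) 1"])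
  show "of_nat 11 dvd eval_al (C13 (-1) (-4) 1) pi11"
    using of_int_dvd_c13[of 11] by (simp add: eval_al_def pi11_def c13_defs)
  show "of_nat 11 dvd (C13 (-1) (-4) 1) * (C13 (-1) (-4) 1) * (C13 (-1) (-4) 1) + (C13 (-1) (-4) 1) * (C13 (-1) (-4) 1) - 2 * (C13 (-1) (-4) 1) - 1"
    using of_int_dvd_c13[of 11] by (simp add: c13_defs numeral_c13)
  show "pi11 dvd of_nat 11"
    by (rule dvdI[of _ _ "C7 (C13 100 (-29) (-25)) (C13 (-22) 13 8) (C13 (-42) 16 12)"]) (simp add: pi11_def k9_defs c13_defs numeral_k9 numeral_c13)
  show "pi11 dvd al - C7 (C13 (-1) (-4) 1) 0 0"
    by (rule dvdI[of _ _ "C7 (C13 14 (-2) (-3)) (C13 (-3) 4 2) (C13 (-6) 3 2)"]) (simp add: pi11_def k9_defs c13_defs numeral_c13)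
qed (simp_all add: inert_checks)

lemma prime_pi17: "prime_elem pi17"
proof (rule prime_elem_via_root[of 17 "C13 (-2) (-8) (-6)"])
  show "of_nat 17 dvd eval_al (C13 (-2) (-8) (-6)) pi17"
    using of_int_dvd_c13[of 17] by (simp add: eval_al_def pi17_def c13_defs)
  show "of_nat 17 dvd (C13 (-2) (-8) (-6)) * (C13 (-2) (-8) (-6)) * (C13 (-2) (-8) (-6)) + (C13 (-2) (-8) (-6)) * (C13 (-2) (-8) (-6)) - 2 * (C13 (-2) (-8) (-6)) - 1"
    using of_int_dvd_c13[of 17] by (simp add: c13_defs numeral_c13)
  show "pi17 dvd of_nat 17"
    by (rule dvdI[of _ _ "C7 (C13 (-2) (-12) 8) (C13 14 0 (-5)) (C13 (-1) 6 (-3))"]) (simp add: pi17_def k9_defs c13_defs numeral_k9 numeral_c13)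
  show "pi17 dvd al - C7 (C13 (-2) (-8) (-6)) 0 0"
    by (rule dvdI[of _ _ "C7 (C13 3 (-18) 9) (C13 2 6 (-2)) (C13 (-1) 8 (-4))"]) (simp add: pi17_def k9_defs c13_defs numeral_c13)
qed (simp_all add: inert_checks)

lemma prime_pi19: "prime_elem pi19"
proof (rule prime_elem_via_root[of 19 "C13 (-2) (-3) (-4)"])
  show "of_nat 19 dvd eval_al (C13 (-2) (-3) (-4)) pi19"
    using of_int_dvd_c13[of 19] by (simp add: eval_al_def pi19_def c13_defs)
  show "of_nat 19 dvd (C13 (-2) (-3) (-4)) * (C13 (-2) (-3) (-4)) * (C13 (-2) (-3) (-4)) + (C13 (-2) (-3) (-4)) * (C13 (-2) (-3) (-4)) - 2 * (C13 (-2) (-3) (-4)) - 1"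
    using of_int_dvd_c13[of 19] by (simp add: c13_defs numeral_c13)
  show "pi19 dvd of_nat 19"
    by (rule dvdI[of _ _ "C7 (C13 (-85) 27 22) (C13 31 (-13) (-9)) (C13 47 (-17) (-13))"]) (simp add: pi19_def k9_defs c13_defs numeral_k9 numeral_c13)
  show "pi19 dvd al - C7 (C13 (-2) (-3) (-4)) 0 0"
    by (rule dvdI[of _ _ "C7 (C13 (-11) 2 2) (C13 6 (-4) (-2)) (C13 7 (-3) (-2))"]) (simp add: pi19_def k9_defs c13_defs numeral_c13)
qed (simp_all add: inert_checks)

text \<open>The cubic of \<alpha> stays irreducible modulo the prime 1 + \<kappa> of norm 5, so
  divisibility is detected by the relative norm modulo 5.\<close>

lemma prime_pi5: "prime_elem pi5"
proof -
  have k1: "kap + 1 = C13 1 1 0" by (simp add: c13_defs)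
  have iff5: "C13 1 1 0 dvd y \<longleftrightarrow> 5 dvd psi5 y" for y
  proof
    assume "C13 1 1 0 dvd y"
    then obtain z where "y = C13 1 1 0 * z" by (auto simp: dvd_def)
    thus "5 dvd psi5 y" using psi5_mult[of "C13 1 1 0" z] by (simp add: psi5_def cong_0_iff)
  next
    assume "5 dvd psi5 y"
    thus "C13 1 1 0 dvd y" using psi5_dvd[of y] k1 by (auto simp: add.commute)
  qed
  have iff: "pi5 dvd x \<longleftrightarrow> 5 dvd psi5 (n7 (a0 x) (a1 x) (a2 x))" for x
  proof
    assume "pi5 dvd x"
    hence "C13 1 1 0 dvd a0 x" "C13 1 1 0 dvd a1 x" "C13 1 1 0 dvd a2 x" by (auto simp: pi5_def C7_dvd_k9)
    hence z: "[psi5 (a0 x) = 0] (mod 5)" "[psi5 (a1 x) = 0] (mod 5)" "[psi5 (a2 x) = 0] (mod 5)"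
      by (simp_all add: iff5 cong_0_iff)
    have "[n7 (psi5 (a0 x)) (psi5 (a1 x)) (psi5 (a2 x)) = n7 0 0 0] (mod 5)"
      unfolding n7_def by (intro cong_add cong_diff cong_mult cong_refl z)
    hence "[psi5 (n7 (a0 x) (a1 x) (a2 x)) = 0] (mod 5)"
      using psi5_n7 cong_trans by (fastforce simp: n7_def)
    thus "5 dvd psi5 (n7 (a0 x) (a1 x) (a2 x))" by (simp add: cong_0_iff)
  next
    assume "5 dvd psi5 (n7 (a0 x) (a1 x) (a2 x))"
    hence "5 dvd n7 (psi5 (a0 x)) (psi5 (a1 x)) (psi5 (a2 x))" using psi5_n7 cong_dvd_iff by blast
    from n7_mod5[OF this] show "pi5 dvd x" by (simp add: pi5_def C7_dvd_k9 iff5)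
  qed
  have n7m: "n7 (a0 (x * y)) (a1 (x * y)) (a2 (x * y)) = n7 (a0 x) (a1 x) (a2 x) * n7 (a0 y) (a1 y) (a2 y)" for x y
  proof -
    have "(x * y) * sa (x * y) * sa (sa (x * y)) = (x * sa x * sa (sa x)) * (y * sa y * sa (sa y))"
      by (simp add: rhom_simps[OF rhom_sa] mult_ac)
    thus ?thesis unfolding n7_sa by (simp add: rhom_mult[OF rhom_C7, symmetric])
  qed
  show ?thesis
  proof (rule prime_elemI)
    show "pi5 \<noteq> 0" by (simp add: pi5_def k9_defs c13_defs numeral_c13)
    show "\<not> pi5 dvd 1" by (simp add: iff one_k9_def n7_def psi5_def c13_defs numeral_c13)
    fix x y assume "pi5 dvd x * y"
    hence "5 dvd psi5 (n7 (a0 x) (a1 x) (a2 x) * n7 (a0 y) (a1 y) (a2 y))" by (simp add: iff n7m)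
    hence "5 dvd psi5 (n7 (a0 x) (a1 x) (a2 x)) * psi5 (n7 (a0 y) (a1 y) (a2 y))"
      using psi5_mult cong_dvd_iff by blast
    moreover have "prime (5::int)" by simp
    ultimately show "pi5 dvd x \<or> pi5 dvd y" unfolding iff by (simp add: prime_dvd_mult_iff)
  qed
qed

definition eval_al_13 :: "k9 \<Rightarrow> int" where "eval_al_13 x = psi13 (a0 x) + 10 * psi13 (a1 x) + 100 * psi13 (a2 x)"

text \<open>The element is 1 - \<kappa> \<alpha>. Its residue map sends \<kappa> to 4, the triple
  root of its cubic modulo 13, and \<alpha> to 10, so the element itself goes to -39.\<close>

lemma prime_pi13: "prime_elem pi13"
proof -
  have m: "[psi13 (x * y) = psi13 x * psi13 y] (mod 13)" for x y
    using psi13_mult by (simp add: cong_iff_dvd_diff)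
  have ad: "psi13 (x + y) = psi13 x + psi13 y" "psi13 (x - y) = psi13 x - psi13 y" "psi13 (numeral n * x) = numeral n * psi13 x" for x y n
    by (simp_all add: psi13_def c13_defs numeral_c13 algebra_simps)
  have hom: "[eval_al_13 (x * y) = eval_al_13 x * eval_al_13 y] (mod 13)" for x y
  proof -
    define p0 p1 p2 q0 q1 q2 where d: "p0 = psi13 (a0 x)" "p1 = psi13 (a1 x)" "p2 = psi13 (a2 x)"
      "q0 = psi13 (a0 y)" "q1 = psi13 (a1 y)" "q2 = psi13 (a2 y)"
    have "[eval_al_13 (x * y) = (p0 * q0 + (p1 * q2 + p2 * q1) - p2 * q2) + 10 * (p0 * q1 + p1 * q0 + 2 * (p1 * q2 + p2 * q1) - p2 * q2)
       + 100 * (p0 * q2 + p1 * q1 + p2 * q0 - (p1 * q2 + p2 * q1) + 3 * (p2 * q2))] (mod 13)"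
      unfolding eval_al_13_def times_k9_def Let_def k9.sel ad d
      by (intro cong_add cong_diff cong_mult m cong_refl)
    moreover have "(p0 * q0 + (p1 * q2 + p2 * q1) - p2 * q2) + 10 * (p0 * q1 + p1 * q0 + 2 * (p1 * q2 + p2 * q1) - p2 * q2)
       + 100 * (p0 * q2 + p1 * q1 + p2 * q0 - (p1 * q2 + p2 * q1) + 3 * (p2 * q2))
        = eval_al_13 x * eval_al_13 y - 13 * (83 * (p1 * q2 + p2 * q1) + 747 * (p2 * q2))"
      by (simp add: eval_al_13_def d algebra_simps)
    ultimately have "[eval_al_13 (x * y) = eval_al_13 x * eval_al_13 y - 13 * (83 * (p1 * q2 + p2 * q1) + 747 * (p2 * q2))] (mod 13)"
      by (simp only:)
    moreover have "[eval_al_13 x * eval_al_13 y - 13 * (83 * (p1 * q2 + p2 * q1) + 747 * (p2 * q2)) = eval_al_13 x * eval_al_13 y] (mod 13)"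
      by (simp add: cong_iff_dvd_diff)
    ultimately show ?thesis by (rule cong_trans)
  qed
  have kd: "pi13 dvd C7 (kap - 4) 0 0"
    by (rule dvdI[of _ _ "C7 (C13 (-3) (-4) 4) (C13 (-2) 3 0) (C13 (-1) 3 (-1))"])
       (simp add: pi13_def k9_defs c13_defs numeral_c13)
  have ald: "pi13 dvd al - C7 10 0 0"
    by (rule dvdI[of _ _ "C7 (C13 (-9) (-6) 7) (C13 (-4) 7 1) (C13 (-2) 6 (-1))"])
       (simp add: pi13_def k9_defs c13_defs numeral_c13)
  have d13: "pi13 dvd of_int 13"
    by (rule dvdI[of _ _ "C7 (C13 12 7 (-9)) (C13 7 (-10) (-2)) (C13 3 (-8) 1)"])
       (simp add: pi13_def k9_defs c13_defs numeral_c13 numeral_k9)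
  have cd: "pi13 dvd C7 (q - of_int (psi13 q)) 0 0" for q
  proof -
    have "q - of_int (psi13 q) = (kap - 4) * (of_int (c1 q) + of_int (c2 q) * (kap + 4))"
      by (cases q) (simp add: psi13_def c13_defs numeral_c13 of_int_c13)
    hence "C7 (q - of_int (psi13 q)) 0 0 = C7 (kap - 4) 0 0 * C7 (of_int (c1 q) + of_int (c2 q) * (kap + 4)) 0 0"
      by (simp only: rhom_mult[OF rhom_C7])
    thus ?thesis using kd by (simp only: dvd_mult2)
  qed
  have iff: "pi13 dvd x \<longleftrightarrow> 13 dvd eval_al_13 x" for x
  proof
    assume "pi13 dvd x"
    then obtain y where y: "x = pi13 * y" by (auto simp: dvd_def)
    have "eval_al_13 pi13 = - 39" by (simp add: eval_al_13_def pi13_def psi13_def)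
    hence "[eval_al_13 x = - 39 * eval_al_13 y] (mod 13)" using hom[of pi13 y] y by simp
    thus "13 dvd eval_al_13 x" by (rule cong_dvd_iff[THEN iffD2]) (simp add: dvd_mult2)
  next
    assume "13 dvd eval_al_13 x"
    have 1: "pi13 dvd x - C7 (eval_al 10 x) 0 0"
      using eval_al_eq[of x 10] ald by (metis add_diff_cancel_left' dvd_mult2)
    have 2: "pi13 dvd C7 (eval_al 10 x) 0 0 - of_int (psi13 (eval_al 10 x))"
      using cd[of "eval_al 10 x"] by (simp add: rhom_diff[OF rhom_C7] of_int_k9)
    have "[psi13 (eval_al 10 x) = eval_al_13 x] (mod 13)"
    proof -
      have "eval_al 10 x = a0 x + 10 * a1 x + 100 * a2 x" by (simp add: eval_al_def mult.commute)
      thus ?thesis by (simp add: eval_al_13_def ad)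
    qed
    hence "13 dvd psi13 (eval_al 10 x)" using \<open>13 dvd eval_al_13 x\<close> cong_dvd_iff by blast
    hence "of_int 13 dvd (of_int (psi13 (eval_al 10 x)) :: k9)" by (auto simp: dvd_def)
    hence "pi13 dvd of_int (psi13 (eval_al 10 x))" using d13 dvd_trans by blast
    thus "pi13 dvd x" using 1 2 by (metis dvd_diff_trans)
  qed
  show ?thesis
  proof (rule prime_elemI)
    show "pi13 \<noteq> 0" by (simp add: pi13_def k9_defs c13_defs numeral_c13)
    show "\<not> pi13 dvd 1" by (simp add: iff one_k9_def eval_al_13_def psi13_def c13_defs)
    fix x y assume "pi13 dvd x * y"
    hence "13 dvd eval_al_13 x * eval_al_13 y" using hom cong_dvd_iff iff by blast
    moreover have "prime (13::int)" by simp
    ultimately show "pi13 dvd x \<or> pi13 dvd y" unfolding iff using prime_dvd_mult_iff by blast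
  qed
qed

text \<open>Minkowski's theorem only makes \<open>s \<beta> - t \<alpha>\<close> smaller than \<open>\<alpha>\<close> for some \<open>0 < s \<le> 20\<close>, so one
  prime element above each rational prime below 20 is needed to remove the factor \<open>s\<close>.\<close>

definition small_primes :: "k9 list" where
  "small_primes = [pi2, sk pi2, sk (sk pi2), pi3, sk pi3, sk (sk pi3), pi5, sk pi5, sk (sk pi5), pi7,
    pi11, sk pi11, sk (sk pi11), pi13, sa pi13, sa (sa pi13), pi17, sk pi17, sk (sk pi17), pi19, sk pi19, sk (sk pi19)]"

lemma small_primes_prime: "q \<in> set small_primes \<Longrightarrow> prime_elem q"
  using prime_pi2 prime_pi3 prime_pi5 prime_pi7 prime_pi11 prime_pi13 prime_pi17 prime_pi19
    prime_elem_auto[OF rhom_sk sk_cube] prime_elem_auto[OF rhom_sa sa_cube]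
  unfolding small_primes_def by auto

lemma split2: "2 dvd pi2 * sk pi2 * sk (sk pi2)"
  by (rule dvdI[of _ _ "C7 (C13 1 0 0) (C13 (-1) 0 0) (C13 0 0 0)"]) (simp add: pi2_def sk_def sk13_def k9_defs c13_defs numeral_k9 numeral_c13)
lemma split3: "3 dvd pi3 * sk pi3 * sk (sk pi3)"
  by (rule dvdI[of _ _ "C7 (C13 0 0 0) (C13 (-1) 0 0) (C13 (-1) 0 0)"]) (simp add: pi3_def sk_def sk13_def k9_defs c13_defs numeral_k9 numeral_c13)
lemma split5: "5 dvd pi5 * sk pi5 * sk (sk pi5)"
  by (rule dvdI[of _ _ "C7 (C13 (-1) 0 0) (C13 0 0 0) (C13 0 0 0)"]) (simp add: pi5_def sk_def sk13_def k9_defs c13_defs numeral_k9 numeral_c13)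
lemma split11: "11 dvd pi11 * sk pi11 * sk (sk pi11)"
  by (rule dvdI[of _ _ "C7 (C13 (-2) 0 0) (C13 (-3) 0 0) (C13 4 0 0)"]) (simp add: pi11_def sk_def sk13_def k9_defs c13_defs numeral_k9 numeral_c13)
lemma split17: "17 dvd pi17 * sk pi17 * sk (sk pi17)"
  by (rule dvdI[of _ _ "C7 (C13 1 0 0) (C13 3 0 0) (C13 2 0 0)"]) (simp add: pi17_def sk_def sk13_def k9_defs c13_defs numeral_k9 numeral_c13)
lemma split19: "19 dvd pi19 * sk pi19 * sk (sk pi19)"
  by (rule dvdI[of _ _ "C7 (C13 (-1) 0 0) (C13 (-1) 0 0) (C13 1 0 0)"]) (simp add: pi19_def sk_def sk13_def k9_defs c13_defs numeral_k9 numeral_c13)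
lemma split7: "7 dvd pi7 ^ 3"
  by (rule dvdI[of _ _ "C7 (C13 1 0 0) (C13 (-2) 0 0) (C13 1 0 0)"]) (simp add: pi7_def power3_eq_cube k9_defs c13_defs numeral_k9 numeral_c13)
lemma split13: "13 dvd (pi13 * sa pi13 * sa (sa pi13)) ^ 3"
  by (rule dvdI[of _ _ "C7 (C13 1 (-3) (-1)) (C13 0 0 0) (C13 0 0 0)"]) (simp add: pi13_def power3_eq_cube sa_def k9_defs c13_defs numeral_k9 numeral_c13)

section \<open>Coprime factors of seventh powers\<close>

lemma funpow_mod3: "f (f (f x)) = x \<Longrightarrow> (f ^^ j) x = (f ^^ (j mod 3)) x"
proof -
  assume "f (f (f x)) = x"
  hence "(f ^^ 3) x = x" by (simp add: numeral_3_eq_3)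
  thus ?thesis using funpow_mod_eq by metis
qed

lemma sk_sa_pow: "(sk ^^ j) (sa x) = sa ((sk ^^ j) x)"
  by (induction j) (simp_all add: sa_sk)

lemma sa_pow_sk: "(sa ^^ i) (sk x) = sk ((sa ^^ i) x)"
  by (induction i) (simp_all add: sa_sk)

lemma sk_dd: "sk (dd i) = dd i"
  by (simp add: dd_def sk_def rhom_simps[OF rhom_sk13])

abbreviation kap9 :: k9 where "kap9 \<equiv> C7 kap 0 0"

lemma dual_via_al:
  assumes "\<And>i. \<tau> (dd i) = sa (dd i)" "\<And>i. \<tau> (sa (dd i)) = sa (sa (dd i))"
  shows "\<exists>cc bb :: nat \<Rightarrow> k9. \<forall>x y z. (\<Sum>i<3. cc i * (bb i * x + \<tau> (bb i) * y + \<tau> (\<tau> (bb i)) * z)) = 91 * x"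
proof (rule exI[of _ "\<lambda>i. 13 * al ^ i"], rule exI[of _ dd], intro allI)
  fix x y z :: k9
  let ?t = "\<lambda>i. dd i * x + sa (dd i) * y + sa (sa (dd i)) * z"
  have "(\<Sum>i<3. 13 * al ^ i * (dd i * x + \<tau> (dd i) * y + \<tau> (\<tau> (dd i)) * z)) = 13 * (?t 0 + al * ?t 1 + al^2 * ?t 2)"
    by (simp only: assms) (simp add: numeral_3_eq_3 numeral_2_eq_2 distrib_left mult.assoc)
  also have "\<dots> = 91 * x" by (simp only: dd_dual_shift) simp
  finally show "(\<Sum>i<3. 13 * al ^ i * (dd i * x + \<tau> (dd i) * y + \<tau> (\<tau> (dd i)) * z)) = 91 * x" .
qed

lemma del_dual_shift:
  fixes x y z :: k9
  defines "e \<equiv> \<lambda>i. C7 (del i) 0 0"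
  shows "(e 0 * x + sk (e 0) * y + sk (sk (e 0)) * z) + kap9 * (e 1 * x + sk (e 1) * y + sk (sk (e 1)) * z)
    + kap9^2 * (e 2 * x + sk (e 2) * y + sk (sk (e 2)) * z) = 13 * x"
proof -
  have "e 0 + kap9 * e 1 + kap9^2 * e 2 = 13"
    by (simp add: e_def del_def k9_defs c13_defs power2_eq_square numeral_k9 numeral_c13)
  moreover have "sk (e 0) + kap9 * sk (e 1) + kap9^2 * sk (e 2) = 0"
    by (simp add: e_def del_def sk_def sk13_def k9_defs c13_defs power2_eq_square numeral_k9 numeral_c13)
  moreover have "sk (sk (e 0)) + kap9 * sk (sk (e 1)) + kap9^2 * sk (sk (e 2)) = 0"
    by (simp add: e_def del_def sk_def sk13_def k9_defs c13_defs power2_eq_square numeral_k9 numeral_c13)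
  moreover have "(e 0 * x + sk (e 0) * y + sk (sk (e 0)) * z) + kap9 * (e 1 * x + sk (e 1) * y + sk (sk (e 1)) * z)
    + kap9^2 * (e 2 * x + sk (e 2) * y + sk (sk (e 2)) * z) =
    (e 0 + kap9 * e 1 + kap9^2 * e 2) * x + (sk (e 0) + kap9 * sk (e 1) + kap9^2 * sk (e 2)) * y
     + (sk (sk (e 0)) + kap9 * sk (sk (e 1)) + kap9^2 * sk (sk (e 2))) * z"
    by (simp add: algebra_simps)
  ultimately show ?thesis by simp
qed

text \<open>The lattice covolume is the conductor: 1 + 12 = 13 here, 1 + 6 = 7 for \<open>B\<close>,
  and 1 + 90 = 91 for \<open>C\<close> and \<open>D\<close>.\<close>

interpretation A: cubic_subfield sa sk kap9 "-1" "-4"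
proof
  show "\<exists>m<3. (sk ^^ j) ((sa ^^ i) x) = (sk ^^ m) x" if "sa x = x" for i j x
  proof -
    have "(sa ^^ i) x = x" using that by (induction i) auto
    thus ?thesis using funpow_mod3[where f = sk, OF sk_cube] by (metis mod_less_divisor zero_less_numeral)
  qed
  show "\<exists>cc bb :: nat \<Rightarrow> k9. \<forall>x y z. (\<Sum>i<3. cc i * (bb i * x + sa (bb i) * y + sa (sa (bb i)) * z)) = 91 * x"
    by (rule dual_via_al) (rule refl)+
  show "\<exists>k. y = of_int k" if "sa y = y" "sk y = y" for y using fixed_int[OF that] .
qed (simp_all add: rhom_sa rhom_sk sa_cube sk_cube sa_sk sa_def sk_def sk13_def
       rhom_simps[OF rhom_sk13] k9_defs c13_defs numeral_k9 numeral_c13 of_int_k9 of_int_c13)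

interpretation B: cubic_subfield sk sa al "-1" "-2"
proof
  show "\<exists>m<3. (sk ^^ j) ((sa ^^ i) x) = (sa ^^ m) x" if "sk x = x" for i j x
  proof -
    have "(sk ^^ j) x = x" for j using that by (induction j) auto
    moreover have "(sk ^^ j) ((sa ^^ i) x) = (sa ^^ i) ((sk ^^ j) x)" by (induction i) (simp_all add: sk_sa_pow)
    ultimately show ?thesis using funpow_mod3[where f = sa, OF sa_cube] by (metis mod_less_divisor zero_less_numeral)
  qed
  show "\<exists>cc bb :: nat \<Rightarrow> k9. \<forall>x y z. (\<Sum>i<3. cc i * (bb i * x + sk (bb i) * y + sk (sk (bb i)) * z)) = 91 * x"
  proof (rule exI[of _ "\<lambda>i. 7 * kap9 ^ i"], rule exI[of _ "\<lambda>i. C7 (del i) 0 0"], intro allI)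
    fix x y z :: k9
    let ?e = "\<lambda>i. C7 (del i) 0 0"
    let ?t = "\<lambda>i. ?e i * x + sk (?e i) * y + sk (sk (?e i)) * z"
    have "(\<Sum>i<3. 7 * kap9 ^ i * ?t i) = 7 * (?t 0 + kap9 * ?t 1 + kap9^2 * ?t 2)"
      by (simp add: numeral_3_eq_3 numeral_2_eq_2 distrib_left mult.assoc)
    also have "\<dots> = 91 * x" by (simp only: del_dual_shift) simp
    finally show "(\<Sum>i<3. 7 * kap9 ^ i * ?t i) = 91 * x" .
  qed
  show "\<exists>k. y = of_int k" if "sk y = y" "sa y = y" for y using fixed_int[OF that(2,1)] .
qed (simp_all add: rhom_sa rhom_sk sa_cube sk_cube sa_sk sa_def sk_def sk13_def
       rhom_simps[OF rhom_sk13] k9_defs c13_defs numeral_k9 numeral_c13 of_int_k9 of_int_c13)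

definition sc :: "k9 \<Rightarrow> k9" where "sc x = sa (sk x)"
definition sd :: "k9 \<Rightarrow> k9" where "sd x = sa (sk (sk x))"

lemma rhom_sc: "rhom sc" and rhom_sd: "rhom sd"
  using rhom_comp[OF rhom_sa rhom_sk] rhom_comp[OF rhom_sa rhom_comp[OF rhom_sk rhom_sk]]
  by (simp_all add: sc_def[abs_def] sd_def[abs_def])

lemma sk_sa: "sk (sa x) = sa (sk x)" by (simp add: sa_sk)

lemma sc_fixed: "sc x = x \<Longrightarrow> (sa ^^ i) x = (sk ^^ (2 * i)) x"
proof (induction i)
  case (Suc i)
  have "sa x = sk (sk x)" using Suc.prems unfolding sc_def by (metis sk_cube sa_sk)
  hence "(sa ^^ Suc i) x = sk (sk ((sa ^^ i) x))" 
    by (metis comp_apply funpow_Suc_right sa_pow_sk)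
  thus ?case using Suc by simp
qed simp

lemma sd_fixed: "sd x = x \<Longrightarrow> (sa ^^ i) x = (sk ^^ i) x"
proof (induction i)
  case (Suc i)
  have "sa x = sk x" using Suc.prems unfolding sd_def by (metis sk_cube sa_sk)
  hence "(sa ^^ Suc i) x = sk ((sa ^^ i) x)" 
    by (metis comp_apply funpow_Suc_right sa_pow_sk)
  thus ?case using Suc by simp
qed simp

text \<open>The two cubic fields of conductor 91.\<close>

interpretation C: cubic_subfield sc sk "C7 (C13 (-7) 5 3) (C13 3 0 (-1)) (C13 5 (-3) (-2))" 1 "-30"
proof
  show "\<exists>m<3. (sk ^^ j) ((sa ^^ i) x) = (sk ^^ m) x" if "sc x = x" for i j x
    unfolding sc_fixed[OF that] using funpow_mod3[where f = sk, OF sk_cube]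
    by (metis comp_apply funpow_add mod_less_divisor zero_less_numeral)
  show "\<exists>cc bb :: nat \<Rightarrow> k9. \<forall>x y z. (\<Sum>i<3. cc i * (bb i * x + sc (bb i) * y + sc (sc (bb i)) * z)) = 91 * x"
    by (rule dual_via_al) (simp_all add: sc_def sk_dd sk_sa)
  show "\<exists>k. y = of_int k" if "sc y = y" "sk y = y" for y
    using fixed_int[of y] that by (simp add: sc_def)
  show "sc (sc (sc x)) = x" for x by (simp add: sc_def sk_sa sa_cube sk_cube)
  show "sc (sk x) = sk (sc x)" for x by (simp add: sc_def sk_sa)
qed (simp_all add: rhom_sc rhom_sk sk_cube sc_def sa_def sk_def sk13_def
       rhom_simps[OF rhom_sk13] k9_defs c13_defs numeral_k9 numeral_c13 of_int_k9 of_int_c13)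

interpretation D: cubic_subfield sd sk "C7 (C13 8 (-4) (-3)) (C13 (-2) 3 1) (C13 (-5) 3 2)" 1 "-30"
proof
  show "\<exists>m<3. (sk ^^ j) ((sa ^^ i) x) = (sk ^^ m) x" if "sd x = x" for i j x
    unfolding sd_fixed[OF that] using funpow_mod3[where f = sk, OF sk_cube]
    by (metis comp_apply funpow_add mod_less_divisor zero_less_numeral)
  show "\<exists>cc bb :: nat \<Rightarrow> k9. \<forall>x y z. (\<Sum>i<3. cc i * (bb i * x + sd (bb i) * y + sd (sd (bb i)) * z)) = 91 * x"
    by (rule dual_via_al) (simp_all add: sd_def sk_dd sk_sa)
  show "\<exists>k. y = of_int k" if "sd y = y" "sk y = y" for y
    using fixed_int[of y] that by (simp add: sd_def)
  show "sd (sd (sd x)) = x" for x by (simp add: sd_def sk_sa sa_cube sk_cube)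
  show "sd (sk x) = sk (sd x)" for x by (simp add: sd_def sk_sa)
qed (simp_all add: rhom_sd rhom_sk sk_cube sd_def sa_def sk_def sk13_def
       rhom_simps[OF rhom_sk13] k9_defs c13_defs numeral_k9 numeral_c13 of_int_k9 of_int_c13)

lemma n9_eq': "of_int (n9 x) = x * sa x * sa (sa x) * sk (x * sa x * sa (sa x)) * sk (sk (x * sa x * sa (sa x)))"
  using n9_eq[of x] by (simp add: Let_def)

text \<open>This reduces factorisation questions in degree nine to the four cubic subfields.\<close>

lemma norms_identity:
  "(x * sa x * sa (sa x)) * (x * sk x * sk (sk x)) * (x * sc x * sc (sc x)) * (x * sd x * sd (sd x))
    = x ^ 3 * of_int (n9 x)"
  unfolding n9_eq' sc_def sd_def
  by (simp only: rhom_simps[OF rhom_sa] rhom_simps[OF rhom_sk] sk_sa sa_cube sk_cube power3_eq_cube mult_ac)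


text \<open>480 = 3 * 8 * 20: each of the eight rational primes divides the cube of the product, the
  cube being due to 7 and 13, and no prime exponent in 20! * 91 exceeds 20.\<close>

lemma small_primes_dvd:
  fixes P :: k9
  defines "P \<equiv> prod_list small_primes"
  shows "of_nat (fact 20 * 91) dvd P ^ 480"
proof -
  have P: "P = (pi2 * sk pi2 * sk (sk pi2)) * (pi3 * sk pi3 * sk (sk pi3)) * (pi5 * sk pi5 * sk (sk pi5)) * pi7
     * (pi11 * sk pi11 * sk (sk pi11)) * (pi13 * sa pi13 * sa (sa pi13)) * (pi17 * sk pi17 * sk (sk pi17)) * (pi19 * sk pi19 * sk (sk pi19))"
    by (simp add: P_def small_primes_def mult.assoc)
  have c: "q dvd P ^ 3" if "q dvd d" "d dvd P" for q d
    using that by (meson dvd_power dvd_trans zero_less_numeral)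
  have c3: "q dvd P ^ 3" if "q dvd d ^ 3" "d dvd P" for q d
    using that by (meson dvd_power_same dvd_trans)
  have "2 dvd P ^ 3" "3 dvd P ^ 3" "5 dvd P ^ 3" "7 dvd P ^ 3" "11 dvd P ^ 3" "13 dvd P ^ 3" "17 dvd P ^ 3" "19 dvd P ^ 3"
    using c[OF split2] c[OF split3] c[OF split5] c3[OF split7] c[OF split11] c3[OF split13] c[OF split17] c[OF split19]
    unfolding P by (simp_all add: mult_ac)
  hence "2 * 3 * 5 * 7 * 11 * 13 * 17 * 19 dvd P ^ 3 * P ^ 3 * P ^ 3 * P ^ 3 * P ^ 3 * P ^ 3 * P ^ 3 * P ^ 3"
    by (intro mult_dvd_mono)
  hence "(2 * 3 * 5 * 7 * 11 * 13 * 17 * 19) ^ 20 dvd (P ^ 24) ^ 20"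
    by (intro dvd_power_same) (simp flip: power_add)
  moreover have "of_nat (fact 20 * 91) dvd ((2 * 3 * 5 * 7 * 11 * 13 * 17 * 19) ^ 20 :: k9)"
  proof -
    have "fact 20 * 91 dvd ((2 * 3 * 5 * 7 * 11 * 13 * 17 * 19) ^ 20 :: nat)"
      by (simp add: fact_numeral)
    then obtain r where r: "(2 * 3 * 5 * 7 * 11 * 13 * 17 * 19) ^ 20 = fact 20 * 91 * (r :: nat)" by (rule dvdE)
    have "((2 * 3 * 5 * 7 * 11 * 13 * 17 * 19) ^ 20 :: k9) = of_nat ((2 * 3 * 5 * 7 * 11 * 13 * 17 * 19) ^ 20)"
      by (simp only: of_nat_power of_nat_mult of_nat_numeral)
    also have "\<dots> = of_nat (fact 20 * 91) * of_nat r" unfolding r by (rule of_nat_mult)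
    finally show ?thesis by (rule dvdI)
  qed
  ultimately have "of_nat (fact 20 * 91) dvd (P ^ 24) ^ 20" by (rule dvd_trans[rotated])
  thus ?thesis by (simp only: power_mult[symmetric]) simp
qed

lemma prime_product_factor:
  fixes M :: "'a::idom"
  assumes "\<And>q. q \<in> set qs \<Longrightarrow> prime_elem q" "M dvd prod_list qs" "\<not> M dvd 1"
  shows "\<exists>q\<in>set qs. q dvd M"
  using assms
proof (induction qs)
  case (Cons q qs)
  show ?case
  proof (cases "q dvd M")
    case False
    obtain N where N: "q * prod_list qs = M * N" using Cons.prems(2) by (metis dvdE prod_list.Cons)
    have "q dvd M * N" unfolding N[symmetric] by simp
    hence "q dvd N" using False Cons.prems(1)[of q] by (simp add: prime_elem_dvd_mult_iff)
    then obtain N' where N': "N = q * N'" by (auto simp: dvd_def)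
    have "q \<noteq> 0" using Cons.prems(1)[of q] by auto
    hence "prod_list qs = M * N'" using N N' by (simp add: mult.left_commute)
    thus ?thesis using Cons.IH Cons.prems by auto
  qed auto
qed simp

lemma n9_unit: "x dvd 1 \<longleftrightarrow> \<bar>n9 x\<bar> = 1"
proof
  assume "x dvd 1"
  then obtain y where "x * y = 1" by (auto simp: dvd_def)
  moreover have "n9 1 = 1" by (simp add: n9_def n7_def one_k9_def n13_def sk13_def c13_defs numeral_c13)
  ultimately have "n9 x * n9 y = 1" using n9_mult[of x y] by simp
  hence "n9 x dvd 1" by (metis dvd_triv_left)
  thus "\<bar>n9 x\<bar> = 1" by simp
next
  assume "\<bar>n9 x\<bar> = 1"
  hence "n9 x = 1 \<or> n9 x = -1" by linarith
  thus "x dvd 1" using dvd_n9[of x] by auto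
qed

lemma exact_power:
  assumes q: "prime_elem (q::k9)" and x: "x \<noteq> 0"
  shows "\<exists>n y. x = q ^ n * y \<and> \<not> q dvd y"
  using x
proof (induction "nat \<bar>n9 x\<bar>" arbitrary: x rule: less_induct)
  case less
  show ?case
  proof (cases "q dvd x")
    case True
    then obtain y where y: "x = q * y" by (auto simp: dvd_def)
    have "\<bar>n9 q\<bar> \<noteq> 1" "n9 q \<noteq> 0" using q n9_unit n9_0_iff by (auto simp: prime_elem_def)
    hence "\<bar>n9 q\<bar> > 1" by linarith
    moreover have "\<bar>n9 y\<bar> > 0" using y less.prems by (simp add: n9_0_iff)
    ultimately have "\<bar>n9 y\<bar> < \<bar>n9 x\<bar>" by (simp add: y n9_mult abs_mult)
    hence "nat \<bar>n9 y\<bar> < nat \<bar>n9 x\<bar>" by linarith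
    then obtain n z where "y = q ^ n * z" "\<not> q dvd z" using less.hyps[of y] y less.prems by auto
    thus ?thesis using y by (intro exI[of _ "Suc n"] exI[of _ z]) (simp add: mult.assoc)
  qed (auto intro: exI[of _ 0])
qed

lemma exact_power_unique:
  assumes q: "prime_elem (q::'a::idom)" and e: "q ^ m * x = q ^ n * y" "\<not> q dvd x" "\<not> q dvd y"
  shows "m = n"
proof -
  have q0: "q \<noteq> 0" using q by auto
  have w: "i = j" if "i \<le> j" "q ^ i * u = q ^ j * v" "\<not> q dvd u" for i j :: nat and u v
  proof (rule ccontr)
    assume "i \<noteq> j"
    hence "i < j" using that(1) by simp
    then obtain k where k: "j = Suc (i + k)" using less_imp_Suc_add by blast
    have "q ^ i * u = q ^ i * (q * (q ^ k * v))"
      unfolding that(2) k power_Suc power_add by (simp only: mult_ac)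
    moreover have "q ^ i \<noteq> 0" using q0 by simp
    ultimately have "u = q * (q ^ k * v)" by (metis mult_left_cancel)
    thus False using that(3) by simp
  qed
  show ?thesis using w[of m n x y] w[of n m y x] e by (metis nat_le_linear)
qed

text \<open>At every small prime q the exponent of \<open>M\<close> is a multiple of 7: that of g is
  one because of \<open>g * h = z ^ 7\<close> and comaximality, and the other factors are seventh
  powers. Splitting off the power of q lowers the norm of \<open>M\<close>.\<close>

lemma seventh_power_part:
  fixes g :: k9
  assumes gh: "g * h = z ^ 7" "comax g h" and g0: "g \<noteq> 0" and z0: "z \<noteq> 0"
  shows "s \<noteq> 0 \<Longrightarrow> M \<noteq> 0 \<Longrightarrow> M dvd prod_list small_primes ^ k \<Longrightarrow> g ^ 3 * M * s ^ 7 = A ^ 7 \<Longrightarrow> \<exists>e t. e dvd 1 \<and> M = e * t ^ 7"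
proof (induction "nat \<bar>n9 M\<bar>" arbitrary: M s rule: less_induct)
  case less
  show ?case
  proof (cases "M dvd 1")
    case True
    thus ?thesis by (intro exI[of _ M] exI[of _ 1]) simp
  next
    case False
    have "prod_list small_primes ^ k = prod_list (concat (replicate k small_primes))" by (induction k) simp_all
    moreover have "set (concat (replicate k small_primes)) \<subseteq> set small_primes" by auto
    ultimately obtain q where q: "q \<in> set small_primes" "q dvd M"
      using prime_product_factor[of "concat (replicate k small_primes)" M] small_primes_prime less.prems(3) False by auto
    have pq: "prime_elem q" using small_primes_prime q by blast
    have ndvd: "\<not> q dvd a * b" if "\<not> q dvd a" "\<not> q dvd b" for a b using that pq by (simp add: prime_elem_dvd_mult_iff)
    have npow: "\<not> q dvd a ^ j" if "\<not> q dvd a" for a and j :: nat using that pq prime_elem_dvd_power by blast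
    obtain a g' where g: "g = q ^ a * g'" "\<not> q dvd g'" using exact_power[OF pq g0] by blast
    obtain n M' where M: "M = q ^ n * M'" "\<not> q dvd M'" using exact_power[OF pq less.prems(2)] by blast
    obtain b s' where s: "s = q ^ b * s'" "\<not> q dvd s'" using exact_power[OF pq less.prems(1)] by blast
    have A0: "A \<noteq> 0" using less.prems g0 by auto
    obtain c A' where A: "A = q ^ c * A'" "\<not> q dvd A'" using exact_power[OF pq A0] by blast
    obtain d z' where z: "z = q ^ d * z'" "\<not> q dvd z'" using exact_power[OF pq z0] by blast
    have "7 dvd a"
    proof (cases "a = 0")
      case False
      hence "q dvd g" using g by (simp add: dvd_power)
      hence "\<not> q dvd h" using gh(2) pq by (metis comax_dvd_left comax_unit prime_elem_def)
      have "q ^ a * (g' * h) = q ^ (7 * d) * z' ^ 7"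
        using gh(1) unfolding g z by (simp add: power_mult_distrib mult_ac flip: power_mult)
      hence "a = 7 * d"
        by (rule exact_power_unique[OF pq _ ndvd[OF g(2) \<open>\<not> q dvd h\<close>] npow[OF z(2)]])
      thus ?thesis by simp
    qed simp
    have "q ^ (3 * a + n + 7 * b) * (g' ^ 3 * M' * s' ^ 7) = g ^ 3 * M * s ^ 7"
      unfolding g M s power_mult_distrib power_add power_mult by (simp only: mult_ac power_mult[symmetric])
    also have "\<dots> = q ^ (7 * c) * A' ^ 7" unfolding less.prems(4) A power_mult_distrib by (simp only: mult.commute power_mult[symmetric])
    finally have "3 * a + n + 7 * b = 7 * c"
      by (rule exact_power_unique[OF pq]) (intro ndvd npow g M s A)+
    hence "7 dvd n" using \<open>7 dvd a\<close> by presburger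
    then obtain m where m: "n = 7 * m" by (auto simp: dvd_def)
    have "n \<noteq> 0" using M q(2) by (intro notI) simp
    hence m0: "m \<noteq> 0" using m by simp
    have q0: "q \<noteq> 0" using pq by auto
    have Mq: "M = (q ^ m) ^ 7 * M'" using M m by (simp add: mult.commute flip: power_mult)
    have "M' \<noteq> 0" using M(2) by auto
    have "\<exists>e t. e dvd 1 \<and> M' = e * t ^ 7"
    proof (rule less.hyps[of M' "q ^ m * s"])
      have "\<bar>n9 q\<bar> \<noteq> 1" "n9 q \<noteq> 0" using pq n9_unit n9_0_iff by (auto simp: prime_elem_def)
      have "\<not> q ^ m dvd 1" using pq m0 by (meson dvd_power dvd_trans not_gr_zero prime_elem_not_unit)
      hence "\<not> (q ^ m) ^ 7 dvd 1" by (metis dvd_power dvd_trans zero_less_numeral)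
      hence "\<bar>n9 ((q ^ m) ^ 7)\<bar> \<noteq> 1" "n9 ((q ^ m) ^ 7) \<noteq> 0" using n9_unit n9_0_iff q0 by auto
      hence "\<bar>n9 ((q ^ m) ^ 7)\<bar> > 1" by linarith
      moreover have "\<bar>n9 M'\<bar> > 0" using \<open>M' \<noteq> 0\<close> by (simp add: n9_0_iff)
      ultimately have "\<bar>n9 M'\<bar> < \<bar>n9 M\<bar>" unfolding Mq by (simp add: n9_mult abs_mult)
      thus "nat \<bar>n9 M'\<bar> < nat \<bar>n9 M\<bar>" by linarith
      show "q ^ m * s \<noteq> 0" using q0 less.prems(1) by simp
      show "M' \<noteq> 0" by fact
      show "M' dvd prod_list small_primes ^ k" using less.prems(3) unfolding Mq by (rule dvd_mult_right)
      show "g ^ 3 * M' * (q ^ m * s) ^ 7 = A ^ 7" using less.prems(4) unfolding Mq by (simp add: power_mult_distrib mult_ac)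
    qed
    then obtain e t where "e dvd 1" "M' = e * t ^ 7" by blast
    thus ?thesis using Mq by (intro exI[of _ e] exI[of _ "q ^ m * t"]) (simp add: power_mult_distrib mult_ac)
  qed
qed

text \<open>The four relative norms of g and its rational norm are seventh powers up to divisors of
  powers of 20! * 91. By \<open>norms_identity\<close> the same holds for g^3, and
  \<open>seventh_power_part\<close> turns the error into a unit times a seventh power.\<close>

theorem coprime_seventh_power:
  fixes g h z :: k9
  assumes gh: "g * h = z ^ 7" "comax g h" and g0: "g \<noteq> 0"
  shows "\<exists>e w. e dvd 1 \<and> g = e * w ^ 7"
proof (cases "z = 0")
  case True
  hence "h = 0" using gh(1) g0 by (simp add: zero_power)
  hence "g dvd 1" using gh(2) by (simp add: comax_def dvd_def) (metis mult.commute)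
  thus ?thesis by (intro exI[of _ g] exI[of _ 1]) simp
next
  case False
  define m :: k9 where "m = of_nat (fact 20 * 91)"
  obtain a1 m1 where 1: "a1 \<noteq> 0" "g * sa g * sa (sa g) * m1 = a1 ^ 7" "m1 dvd m ^ 7"
    using A.norm_seventh_power[OF gh g0] unfolding m_def by blast
  obtain a2 m2 where 2: "a2 \<noteq> 0" "g * sk g * sk (sk g) * m2 = a2 ^ 7" "m2 dvd m ^ 7"
    using B.norm_seventh_power[OF gh g0] unfolding m_def by blast
  obtain a3 m3 where 3: "a3 \<noteq> 0" "g * sc g * sc (sc g) * m3 = a3 ^ 7" "m3 dvd m ^ 7"
    using C.norm_seventh_power[OF gh g0] unfolding m_def by blast
  obtain a4 m4 where 4: "a4 \<noteq> 0" "g * sd g * sd (sd g) * m4 = a4 ^ 7" "m4 dvd m ^ 7"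
    using D.norm_seventh_power[OF gh g0] unfolding m_def by blast
  define aG mG where "aG = a1 * sk a1 * sk (sk a1)" and "mG = m1 * sk m1 * sk (sk m1)"
  have skm: "sk m = m" by (simp add: m_def rhom_of_nat[OF rhom_sk] del: of_nat_mult)
  have G: "of_int (n9 g) * mG = aG ^ 7"
  proof -
    let ?N = "g * sa g * sa (sa g)"
    have "of_int (n9 g) * mG = (?N * m1) * sk (?N * m1) * sk (sk (?N * m1))"
      unfolding n9_eq' mG_def by (simp only: rhom_mult[OF rhom_sk] mult_ac)
    thus ?thesis unfolding 1(2) aG_def by (simp add: rhom_power[OF rhom_sk] power_mult_distrib)
  qed
  have "sk m1 dvd m ^ 7" "sk (sk m1) dvd m ^ 7"
    using rhom_dvd[OF rhom_sk 1(3)] rhom_dvd[OF rhom_sk rhom_dvd[OF rhom_sk 1(3)]]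
    by (simp_all add: rhom_power[OF rhom_sk] skm)
  hence mG: "mG dvd m ^ 7 * m ^ 7 * m ^ 7" unfolding mG_def by (intro mult_dvd_mono 1)
  \<comment> \<open>The rational norm becomes a seventh power after multiplication by
    \<open>mG\<close>; the factor \<open>mG ^ 6\<close> then completes \<open>mG ^ 7\<close> in
    \<open>A ^ 7\<close>.\<close>
  define M where "M = (m1 * m2 * m3 * m4) * mG ^ 6"
  have Md: "M dvd (prod_list small_primes) ^ (480 * 154)"
  proof -
    have "M dvd (m ^ 7 * m ^ 7 * m ^ 7 * m ^ 7) * (m ^ 7 * m ^ 7 * m ^ 7) ^ 6"
      unfolding M_def by (intro mult_dvd_mono dvd_power_same mG 1 2 3 4)
    also have "\<dots> = m ^ 154" by (simp flip: power_add power_mult)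
    also have "m ^ 154 dvd (prod_list small_primes ^ 480) ^ 154" unfolding m_def by (intro dvd_power_same small_primes_dvd)
    finally show ?thesis by (simp flip: power_mult)
  qed
  define A where "A = mG * (a1 * a2 * a3 * a4)"
  have sk0: "sk x = 0 \<longleftrightarrow> x = 0" for x using sk_cube[of x] rhom_0[OF rhom_sk] by metis
  have aG0: "aG \<noteq> 0" using 1(1) by (simp add: aG_def sk0)
  have main: "g ^ 3 * M * aG ^ 7 = A ^ 7"
  proof -
    have "A ^ 7 = mG ^ 7 * (a1 ^ 7 * a2 ^ 7 * a3 ^ 7 * a4 ^ 7)" by (simp add: A_def power_mult_distrib mult_ac)
    also have "\<dots> = mG ^ 7 * (((g * sa g * sa (sa g)) * (g * sk g * sk (sk g)) * (g * sc g * sc (sc g)) * (g * sd g * sd (sd g))) * (m1 * m2 * m3 * m4))"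
      unfolding 1(2)[symmetric] 2(2)[symmetric] 3(2)[symmetric] 4(2)[symmetric] by (simp only: mult_ac)
    also have "\<dots> = mG ^ 7 * (g ^ 3 * of_int (n9 g) * (m1 * m2 * m3 * m4))" unfolding norms_identity ..
    also have "\<dots> = g ^ 3 * M * (of_int (n9 g) * mG)" unfolding M_def by (simp add: eval_nat_numeral mult_ac)
    finally show ?thesis unfolding G ..
  qed
  have nz: "m1 \<noteq> 0" "m2 \<noteq> 0" "m3 \<noteq> 0" "m4 \<noteq> 0" using 1 2 3 4 by (auto simp: zero_power)
  hence M0: "M \<noteq> 0" by (simp add: M_def mG_def sk0)
  obtain e t where et: "e dvd 1" "M = e * t ^ 7"
    using seventh_power_part[OF gh g0 False aG0 M0 Md main] by blast
  obtain e' where e': "e * e' = 1" using et(1) by (auto simp: dvd_def)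
  have t0: "t \<noteq> 0" using et M0 by auto
  have eq: "(g ^ 3 * e) * (t * aG) ^ 7 = A ^ 7" using main et(2) by (simp add: power_mult_distrib mult_ac)
  hence "(t * aG) ^ 7 dvd A ^ 7" by (metis dvd_triv_right)
  hence "t * aG dvd A" by (rule root7_k9)
  then obtain w where "A = (t * aG) * w" by (auto simp: dvd_def)
  hence "(g ^ 3 * e) * (t * aG) ^ 7 = w ^ 7 * (t * aG) ^ 7" using eq by (simp add: power_mult_distrib mult.commute)
  hence g3: "g ^ 3 * e = w ^ 7" using t0 aG0 by simp
  have g3': "g ^ 3 = e' * w ^ 7" using e' g3 by (metis mult.assoc mult.commute mult.right_neutral)
  \<comment> \<open>The cube is undone by 3 * 5 = 1 + 2 * 7.\<close>
  have "g * (g ^ 2) ^ 7 = (g ^ 3) ^ 5" by (simp flip: power_mult power_Suc)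
  also have "\<dots> = e' ^ 5 * (w ^ 5) ^ 7" unfolding g3' by (simp add: power_mult_distrib mult.commute flip: power_mult)
  finally have g15: "g * (g ^ 2) ^ 7 = e' ^ 5 * (w ^ 5) ^ 7" .
  have ee: "e ^ 5 * e' ^ 5 = 1" using e' by (simp flip: power_mult_distrib)
  have "(w ^ 5) ^ 7 = (e ^ 5 * e' ^ 5) * (w ^ 5) ^ 7" using ee by simp
  also have "\<dots> = (e ^ 5 * g) * (g ^ 2) ^ 7" using g15 by (simp only: mult.assoc)
  finally have "(g ^ 2) ^ 7 dvd (w ^ 5) ^ 7" by (metis dvd_triv_right)
  hence "g ^ 2 dvd w ^ 5" by (rule root7_k9)
  then obtain x where x: "w ^ 5 = g ^ 2 * x" by (auto simp: dvd_def)
  have "g * (g ^ 2) ^ 7 = (e' ^ 5 * x ^ 7) * (g ^ 2) ^ 7" using g15 unfolding x by (simp add: power_mult_distrib mult_ac)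
  hence "g = e' ^ 5 * x ^ 7" using g0 by simp
  moreover have "e' ^ 5 dvd 1" using ee by (metis dvd_triv_right)
  ultimately show ?thesis by blast
qed

section \<open>Kummer's lemma in degree nine\<close>

lemma dvd_diff_mult:
  "(q::'a::comm_ring_1) dvd x - x' \<Longrightarrow> q dvd y - y' \<Longrightarrow> q dvd x * y - x' * y'"
proof -
  assume "q dvd x - x'" "q dvd y - y'"
  hence "q dvd (x - x') * y + x' * (y - y')" by simp
  thus ?thesis by (simp add: algebra_simps)
qed

lemma dvd_diff_sym: "(q::'a::comm_ring_1) dvd x - y \<longleftrightarrow> q dvd y - x"
  by (metis dvd_minus_iff minus_diff_eq)

lemma dvd_diff_chain: "(q::'a::comm_ring_1) dvd x - y \<Longrightarrow> q dvd y - z \<Longrightarrow> q dvd x - z"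
  by (metis (no_types, opaque_lifting) diff_add_cancel dvd_add add_diff_eq)

lemma seventh_powers_mod_49:
  assumes "(7::'a::comm_ring_1) dvd x - y" shows "49 dvd x ^ 7 - y ^ 7"
proof -
  have "x ^ 7 - y ^ 7 = (x - y) * (\<Sum>i<7. y ^ (7 - Suc i) * x ^ i)" by (rule power_diff_sumr2)
  moreover have "7 dvd (\<Sum>i<7. y ^ (7 - Suc i) * x ^ i)"
  proof -
    have "7 dvd (\<Sum>i<7. y ^ (7 - Suc i) * x ^ i) - (\<Sum>i<(7::nat). y ^ 6)"
      unfolding sum_subtractf[symmetric]
    proof (rule dvd_sum)
      fix i :: nat assume "i \<in> {..<7}"
      hence "y ^ 6 = y ^ (7 - Suc i) * y ^ i" by (simp flip: power_add)
      moreover have "7 dvd y ^ (7 - Suc i) * (x ^ i - y ^ i)" using dvd_power_diff[OF assms] by (rule dvd_mult)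
      ultimately show "7 dvd y ^ (7 - Suc i) * x ^ i - y ^ 6" by (simp add: right_diff_distrib)
    qed
    moreover have "7 dvd (\<Sum>i<(7::nat). y ^ 6)" by simp
    ultimately show ?thesis by (metis dvd_diff_trans)
  qed
  ultimately have "7 * 7 dvd x ^ 7 - y ^ 7" using assms by (simp only: mult_dvd_mono)
  thus ?thesis by simp
qed

lemma fermat7: "7 dvd a ^ 7 - (a::int)"
proof -
  have "[a ^ 7 = (a mod 7) ^ 7] (mod 7)" by (intro cong_pow) (simp add: cong_def)
  moreover have "[(a mod 7) ^ 7 = a mod 7] (mod 7)"
  proof -
    have "a mod 7 = 0 \<or> a mod 7 = 1 \<or> a mod 7 = 2 \<or> a mod 7 = 3 \<or> a mod 7 = 4 \<or> a mod 7 = 5 \<or> a mod 7 = 6"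
      by presburger
    thus ?thesis by (elim disjE) (simp_all add: cong_def)
  qed
  moreover have "[a mod 7 = a] (mod 7)" by (simp add: cong_def)
  ultimately show ?thesis by (meson cong_iff_dvd_diff cong_trans)
qed

text \<open>Multiplicative conditions satisfied by seventh powers: \<open>coeffs_7\<close> holds because the seventh power map sends
  \<open>\<alpha>\<close> to an element of \<open>\<int>[\<kappa>]\<close> modulo 7, and \<open>frobenius_49\<close> compares \<open>x\<^sup>7\<close> with the Frobenius automorphism
  of \<open>\<int>[\<kappa>]\<close> modulo 49. The variants with suffix \<open>_exec\<close> follow from them and can be evaluated.\<close>

definition coeffs_7 :: "k9 \<Rightarrow> bool" where "coeffs_7 x \<longleftrightarrow> 7 dvd a1 x \<and> 7 dvd a2 x"

lemma coeffs_7_mult: "coeffs_7 x \<Longrightarrow> coeffs_7 y \<Longrightarrow> coeffs_7 (x * y)"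
  unfolding coeffs_7_def times_k9_def Let_def k9.sel
  by (intro conjI dvd_add dvd_diff) (auto intro: dvd_mult dvd_mult2)

lemma coeffs_7_cong: "7 dvd x - y \<Longrightarrow> coeffs_7 y \<Longrightarrow> coeffs_7 x"
proof -
  assume "7 dvd x - y" and T: "coeffs_7 y"
  hence "C7 7 0 0 dvd x - y" by (simp add: numeral_k9)
  hence "7 dvd a1 x - a1 y" "7 dvd a2 x - a2 y" by (auto simp: C7_dvd_k9 minus_k9_def)
  thus "coeffs_7 x" using T unfolding coeffs_7_def by (metis dvd_diff_trans)
qed

lemma coeffs_7_add: "coeffs_7 x \<Longrightarrow> coeffs_7 y \<Longrightarrow> coeffs_7 (x + y)"
  by (simp add: coeffs_7_def plus_k9_def)

lemma coeffs_7_C7: "coeffs_7 (C7 q 0 0)" by (simp add: coeffs_7_def)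

text \<open>Seventh powers are additive modulo 7, so it suffices that \<alpha>^7 is congruent to the
  integer 2.\<close>

lemma coeffs_7_seventh_power: "coeffs_7 (v ^ 7)"
proof -
  let ?x = "C7 (a0 v) 0 0" and ?y = "C7 (a1 v) 0 0 * al" and ?z = "C7 (a2 v) 0 0 * (al * al)"
  have v: "v = ?x + ?y + ?z" by (cases v) (simp add: k9_defs)
  have "(7::k9) dvd (?x + ?y + ?z) ^ (7 ^ 1) - (?x ^ (7 ^ 1) + ?y ^ (7 ^ 1) + ?z ^ (7 ^ 1))"
    by (rule freshman3) simp_all
  hence d: "7 dvd v ^ 7 - (?x ^ 7 + ?y ^ 7 + ?z ^ 7)" using v by simp
  have al7: "al ^ 7 = C7 9 14 (-14)" 
    by (simp add: eval_nat_numeral k9_defs numeral_k9 numeral_c13 c13_defs)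
  have c7: "(7::c13) dvd 14" "(7::c13) dvd -14" using of_int_dvd_c13[of 7 14] of_int_dvd_c13[of 7 "-14"] by (simp_all add: numeral_c13 c13_defs)
  have T: "coeffs_7 (al ^ 7)" unfolding al7 coeffs_7_def using c7 by simp
  have "coeffs_7 (?x ^ 7 + ?y ^ 7 + ?z ^ 7)"
    unfolding power_mult_distrib rhom_power[OF rhom_C7, symmetric]
    by (intro coeffs_7_add coeffs_7_mult T coeffs_7_C7)
  thus ?thesis by (rule coeffs_7_cong[OF d])
qed

definition coeffs_7_exec :: "k9 \<Rightarrow> bool" where
  "coeffs_7_exec x \<longleftrightarrow> c0 (a1 x) mod 7 = 0 \<and> c1 (a1 x) mod 7 = 0 \<and> c2 (a1 x) mod 7 = 0 \<and>
     c0 (a2 x) mod 7 = 0 \<and> c1 (a2 x) mod 7 = 0 \<and> c2 (a2 x) mod 7 = 0"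

lemma coeffs_7_Tb: "coeffs_7 x \<Longrightarrow> coeffs_7_exec x"
  using of_int_dvd_c13[of 7] unfolding coeffs_7_def coeffs_7_exec_def by (simp add: dvd_eq_mod_eq_0)

text \<open>The eight elements y and x y^j represent the eight lines of a plane over the field with
  7 elements. If a multiplicative condition that holds for seventh powers fails on all of them, no
  nontrivial combination of x and y satisfies it.\<close>

definition rules_out_seventh :: "(k9 \<Rightarrow> bool) \<Rightarrow> k9 \<Rightarrow> k9 \<Rightarrow> bool" where
  "rules_out_seventh P x y \<longleftrightarrow> \<not> P y \<and> list_all (\<lambda>j. \<not> P (x * y ^ j)) [0,1,2,3,4,5,6]"

lemma test7D:
  assumes "rules_out_seventh P x y" shows "\<not> P y" "j < 7 \<Longrightarrow> \<not> P (x * y ^ j)"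
proof -
  show "\<not> P y" using assms by (simp add: rules_out_seventh_def)
  assume "j < 7"
  hence "j \<in> set [0,1,2,3,4,5,6]" by auto
  thus "\<not> P (x * y ^ j)" using assms unfolding rules_out_seventh_def list_all_iff by blast
qed

lemma test_B: "rules_out_seventh coeffs_7_exec al (C7 1 1 0)" by code_simp
lemma test_C: "rules_out_seventh coeffs_7_exec (C7 (C13 5 8 2) (C13 10 (-6) (-4)) (C13 4 (-6) (-2))) (C7 (C13 (-3) 2 4) (C13 (-4) 6 2) (C13 6 0 (-2)))"
  by code_simp
lemma test_D: "rules_out_seventh coeffs_7_exec (C7 (C13 9 (-4) (-3)) (C13 (-2) 3 1) (C13 (-5) 3 2)) (C7 (C13 (-2) (-1) 1) (C13 5 (-3) (-2)) (C13 3 0 (-1)))"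
  by code_simp

lemma inverse_mod_7: "0 < i \<Longrightarrow> i < 7 \<Longrightarrow> \<exists>i' q. i * i' = 1 + 7 * (q::nat)"
proof -
  assume "0 < i" "i < 7"
  hence "i = 1 \<or> i = 2 \<or> i = 3 \<or> i = 4 \<or> i = 5 \<or> i = 6" by linarith
  moreover have "1 * 1 = 1 + 7 * (0::nat)" "2 * 4 = 1 + 7 * (1::nat)" "3 * 5 = 1 + 7 * (2::nat)"
    "4 * 2 = 1 + 7 * (1::nat)" "5 * 3 = 1 + 7 * (2::nat)" "6 * 6 = 1 + 7 * (5::nat)" by simp_all
  ultimately show ?thesis by metis
qed

text \<open>All elements of \<open>\<int>[\<kappa>]\<close> satisfy \<open>coeffs_7\<close>, so for
  that subfield the obstruction has to be found modulo 49.\<close>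

definition frobenius_49 :: "k9 \<Rightarrow> bool" where "frobenius_49 x \<longleftrightarrow> 49 dvd x ^ 7 - sk (sk x)"

lemma frobenius_49_mult: "frobenius_49 x \<Longrightarrow> frobenius_49 y \<Longrightarrow> frobenius_49 (x * y)"
  unfolding frobenius_49_def rhom_mult[OF rhom_sk] power_mult_distrib by (rule dvd_diff_mult)

lemma frob_c13: "7 dvd q ^ 7 - sk13 (sk13 q)"
proof -
  let ?x = "of_int (c0 q) :: c13" and ?y = "of_int (c1 q) * kap" and ?z = "of_int (c2 q) * (kap * kap)"
  have q: "q = ?x + ?y + ?z" by (cases q) (simp add: c13_defs of_int_c13)
  have "(7::c13) dvd (?x + ?y + ?z) ^ (7 ^ 1) - (?x ^ (7 ^ 1) + ?y ^ (7 ^ 1) + ?z ^ (7 ^ 1))"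
    by (rule freshman3) simp_all
  hence d: "7 dvd q ^ 7 - (?x ^ 7 + ?y ^ 7 + ?z ^ 7)" using q by simp
  have f: "(7::c13) dvd of_int a ^ 7 - of_int a" for a
    using fermat7[of a] of_int_dvd_c13[of 7 "of_int a ^ 7 - of_int a"]
    by (simp flip: of_int_power of_int_diff) (simp add: of_int_c13)
  have k: "(7::c13) dvd kap ^ 7 - sk13 (sk13 kap)"
    using of_int_dvd_c13[of 7 "kap ^ 7 - sk13 (sk13 kap)"] by (simp add: eval_nat_numeral sk13_def c13_defs)
  have k2: "(7::c13) dvd (kap * kap) ^ 7 - sk13 (sk13 kap) * sk13 (sk13 kap)"
    unfolding power_mult_distrib by (rule dvd_diff_mult[OF k k])
  have "7 dvd (?x ^ 7 - ?x) + (?y ^ 7 - of_int (c1 q) * sk13 (sk13 kap)) + (?z ^ 7 - of_int (c2 q) * (sk13 (sk13 kap) * sk13 (sk13 kap)))"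
    unfolding power_mult_distrib[of "of_int _"] by (intro dvd_add f dvd_diff_mult k k2)
  moreover have "sk13 (sk13 q) = ?x + of_int (c1 q) * sk13 (sk13 kap) + of_int (c2 q) * (sk13 (sk13 kap) * sk13 (sk13 kap))"
    by (subst q) (simp only: rhom_simps[OF rhom_sk13])
  ultimately have "7 dvd (?x ^ 7 + ?y ^ 7 + ?z ^ 7) - sk13 (sk13 q)"
    by (simp add: algebra_simps)
  with d show ?thesis by (rule dvd_diff_chain)
qed

lemma sa_fixed_C7: "sa v = v \<Longrightarrow> v = C7 (a0 v) 0 0"
proof -
  assume a: "sa v = v"
  obtain p q r where v: "v = C7 p q r" by (cases v)
  have e: "- r = q" "q - r = r" using a unfolding v by (auto simp: sa_def)
  have "r = 0" using e by (cases r; cases q) (auto simp: c13_defs)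
  thus ?thesis using v e(1) by simp
qed

lemma frobenius_49_seventh_power:
  assumes "sa v = v" shows "frobenius_49 (v ^ 7)"
proof -
  obtain q where v: "v = C7 q 0 0" using sa_fixed_C7[OF assms] by blast
  have "C7 7 0 0 dvd C7 (q ^ 7 - sk13 (sk13 q)) 0 0" by (rule rhom_dvd[OF rhom_C7 frob_c13])
  moreover have "C7 (q ^ 7 - sk13 (sk13 q)) 0 0 = v ^ 7 - sk (sk v)"
    unfolding v rhom_diff[OF rhom_C7] rhom_power[OF rhom_C7] by (simp add: sk_def rhom_0[OF rhom_sk13])
  ultimately have "7 dvd v ^ 7 - sk (sk v)" by (simp add: numeral_k9)
  hence "49 dvd (v ^ 7) ^ 7 - (sk (sk v)) ^ 7" by (rule seventh_powers_mod_49)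
  thus ?thesis by (simp add: frobenius_49_def rhom_power[OF rhom_sk])
qed

definition frobenius_49_exec :: "k9 \<Rightarrow> bool" where
  "frobenius_49_exec x \<longleftrightarrow> (let y = (a0 x) ^ 7 - sk13 (sk13 (a0 x)) in c0 y mod 49 = 0 \<and> c1 y mod 49 = 0 \<and> c2 y mod 49 = 0)"

lemma frobenius_49_Sb:
  assumes "frobenius_49 x" "sa x = x" shows "frobenius_49_exec x"
proof -
  obtain q where v: "x = C7 q 0 0" using sa_fixed_C7[OF assms(2)] by blast
  have "C7 (a0 x ^ 7 - sk13 (sk13 (a0 x))) 0 0 = x ^ 7 - sk (sk x)"
    unfolding v k9.sel rhom_diff[OF rhom_C7] rhom_power[OF rhom_C7] by (simp add: sk_def rhom_0[OF rhom_sk13])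
  hence "C7 49 0 0 dvd C7 (a0 x ^ 7 - sk13 (sk13 (a0 x))) 0 0" using assms(1) by (simp add: frobenius_49_def numeral_k9)
  hence "of_int 49 dvd a0 x ^ 7 - sk13 (sk13 (a0 x))" by (simp add: C7_dvd_k9)
  thus ?thesis unfolding of_int_dvd_c13 by (simp add: frobenius_49_exec_def Let_def dvd_eq_mod_eq_0)
qed

lemma test_A: "rules_out_seventh frobenius_49_exec kap9 (C7 (C13 (-1) 1 0) 0 0)"
proof -
  let ?e = "C7 (C13 (-1) 1 0) 0 0"
  have "\<not> frobenius_49_exec ?e" by (simp add: frobenius_49_exec_def eval_nat_numeral k9_defs c13_defs numeral_c13 sk13_def)
  moreover have "\<not> frobenius_49_exec (kap9 * ?e ^ 0)" by (simp add: frobenius_49_exec_def eval_nat_numeral k9_defs c13_defs numeral_c13 sk13_def)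
  moreover have "\<not> frobenius_49_exec (kap9 * ?e ^ 1)" by (simp add: frobenius_49_exec_def eval_nat_numeral k9_defs c13_defs numeral_c13 sk13_def)
  moreover have "\<not> frobenius_49_exec (kap9 * ?e ^ 2)" by (simp add: frobenius_49_exec_def eval_nat_numeral k9_defs c13_defs numeral_c13 sk13_def)
  moreover have "\<not> frobenius_49_exec (kap9 * ?e ^ 3)" by (simp add: frobenius_49_exec_def eval_nat_numeral k9_defs c13_defs numeral_c13 sk13_def)
  moreover have "\<not> frobenius_49_exec (kap9 * ?e ^ 4)" by (simp add: frobenius_49_exec_def eval_nat_numeral k9_defs c13_defs numeral_c13 sk13_def)
  moreover have "\<not> frobenius_49_exec (kap9 * ?e ^ 5)" by (simp add: frobenius_49_exec_def eval_nat_numeral k9_defs c13_defs numeral_c13 sk13_def)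
  moreover have "\<not> frobenius_49_exec (kap9 * ?e ^ 6)" by (simp add: frobenius_49_exec_def eval_nat_numeral k9_defs c13_defs numeral_c13 sk13_def)
  ultimately show ?thesis unfolding rules_out_seventh_def by (intro conjI) (simp_all only: list.pred_inject simp_thms if_True not_False_eq_True conj_assoc)
qed

context cubic_subfield
begin

text \<open>The test is used twice: it makes \<eta>0 and \<eta>1 independent modulo seventh powers,
  so that they generate by \<open>U_generated\<close>, and it excludes every nontrivial combination
  of them for \<open>u\<close>.\<close>

lemma seventh_power_by_test:
  assumes eta: "\<eta>0 \<in> U" "\<eta>1 \<in> U" and T: "\<And>x y. T x \<Longrightarrow> T y \<Longrightarrow> T (x * y)" "\<And>v. v \<in> U \<Longrightarrow> T (v ^ 7)"
    and test: "\<not> T \<eta>1" "\<And>j. j < (7::nat) \<Longrightarrow> \<not> T (\<eta>0 * \<eta>1 ^ j)"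
    and u: "u \<in> U" "T u"
  shows "\<exists>v\<in>U. u = v ^ 7"
proof -
  have U_pow: "x ^ k \<in> U" if "x \<in> U" for x k using that by (induction k) (auto intro: U_1 U_mult)
  have T_pow: "T (x ^ k)" if "T x" for x k
    using that T(2)[OF U_1] by (induction k) (auto intro: T)
  have T_div: "T x" if xv: "T (x * v ^ 7)" "v \<in> U" for x v
  proof -
    obtain w where w: "w \<in> U" "v * w = 1" using U_inv[OF xv(2)] by blast
    have "x * v ^ 7 * w ^ 7 = x * (v * w) ^ 7" by (simp add: power_mult_distrib mult_ac)
    hence "x * v ^ 7 * w ^ 7 = x" by (simp only: w) simp
    thus ?thesis using T(1)[OF xv(1) T(2)[OF w(1)]] by (simp only:)
  qed
  have test': "i = 0 \<and> j = 0" if ij: "i < 7" "j < 7" "T (\<eta>0 ^ i * \<eta>1 ^ j)" for i j :: nat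
  proof (rule ccontr)
    assume n: "\<not> (i = 0 \<and> j = 0)"
    show False
    proof (cases "i = 0")
      case True
      then obtain j' q where q: "j * j' = 1 + 7 * q" using inverse_mod_7[of j] ij n by auto
      have "(\<eta>1 ^ j) ^ j' = \<eta>1 * (\<eta>1 ^ q) ^ 7" using q by (simp add: mult.commute flip: power_mult)
      hence "T (\<eta>1 * (\<eta>1 ^ q) ^ 7)" using T_pow[OF ij(3), of j'] True by simp
      thus False using T_div U_pow eta test by blast
    next
      case False
      \<comment> \<open>Raising to the inverse of \<open>i\<close> modulo 7 brings the exponent pair
        into the form (1, k), up to seventh powers.\<close>
      then obtain i' q where q: "i * i' = 1 + 7 * q" using inverse_mod_7[of i] ij by auto
      define k r where "k = (j * i') mod 7" and "r = (j * i') div 7"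
      have kr: "j * i' = k + 7 * r" by (simp add: k_def r_def)
      have "(\<eta>0 ^ i * \<eta>1 ^ j) ^ i' = (\<eta>0 * \<eta>1 ^ k) * (\<eta>0 ^ q * \<eta>1 ^ r) ^ 7"
      proof -
        have "(\<eta>0 ^ i * \<eta>1 ^ j) ^ i' = \<eta>0 ^ (i * i') * \<eta>1 ^ (j * i')"
          by (simp only: power_mult_distrib power_mult)
        also have "\<dots> = (\<eta>0 * (\<eta>0 ^ q) ^ 7) * (\<eta>1 ^ k * (\<eta>1 ^ r) ^ 7)"
          unfolding q kr power_add by (simp only: power_one_right mult.commute[of 7] power_mult)
        finally show ?thesis by (simp only: power_mult_distrib mult_ac)
      qed
      hence "T ((\<eta>0 * \<eta>1 ^ k) * (\<eta>0 ^ q * \<eta>1 ^ r) ^ 7)" using T_pow[OF ij(3), of i'] by simp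
      hence "T (\<eta>0 * \<eta>1 ^ k)" using T_div U_pow U_mult eta by blast
      moreover have "k < 7" by (simp add: k_def)
      ultimately show False using test by blast
    qed
  qed
  have ind: "m0 = 0 \<and> m1 = 0" if "m0 < 7" "m1 < 7" "v \<in> U" "\<eta>0 ^ m0 * \<eta>1 ^ m1 = v ^ 7" for m0 m1 :: nat and v
    using test'[OF that(1,2)] T(2)[OF that(3)] that(4) by simp
  obtain m0 m1 v where m: "m0 < (7::nat)" "m1 < (7::nat)" "v \<in> U" "u = \<eta>0 ^ m0 * \<eta>1 ^ m1 * v ^ 7"
  proof -
    have "\<exists>m0 m1 v. m0 < 7 \<and> m1 < 7 \<and> v \<in> U \<and> u = \<eta>0 ^ m0 * \<eta>1 ^ m1 * v ^ 7"
      by (rule U_generated[OF eta _ u(1)]) (rule ind)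
    thus ?thesis using that by (elim exE conjE)
  qed
  have "T (\<eta>0 ^ m0 * \<eta>1 ^ m1)" using T_div[of "\<eta>0 ^ m0 * \<eta>1 ^ m1" v] m(3,4) u(2) by simp
  hence "m0 = 0" "m1 = 0" using test'[OF m(1,2)] by simp_all
  hence "u = v ^ 7" using m(4) by simp
  thus ?thesis using m(3) by blast
qed

lemma norm_in_U: "u dvd 1 \<Longrightarrow> u * \<tau> u * \<tau> (\<tau> u) \<in> U"
proof -
  assume u: "u dvd 1"
  have "\<tau> u dvd 1" "\<tau> (\<tau> u) dvd 1" using rhom_dvd[OF hom(1), of _ 1] rhom_1[OF hom(1)] u by metis+
  hence "u * \<tau> u * \<tau> (\<tau> u) dvd 1" using u by (metis mult_1 mult_dvd_mono)
  thus ?thesis unfolding U_def by (simp add: rhom_simps[OF hom(1)] cube mult_ac)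
qed

lemma norm_cong:
  assumes "49 dvd u - t ^ 7"
  shows "49 dvd u * \<tau> u * \<tau> (\<tau> u) - (t * \<tau> t * \<tau> (\<tau> t)) ^ 7"
proof -
  have 1: "49 dvd \<tau> u - \<tau> t ^ 7" if "49 dvd u - t ^ 7" for u t
    using rhom_dvd[OF hom(1) that] by (simp add: rhom_simps[OF hom(1)])
  show ?thesis unfolding power_mult_distrib
    by (intro dvd_diff_mult assms 1)
qed

end

lemma dvd_49_7: "(49::'a::comm_ring_1) dvd x \<Longrightarrow> 7 dvd x"
  by (rule dvd_trans[OF dvdI[of _ _ 7]]) simp_all

text \<open>The norms of \<open>u\<close> to the four cubic subfields are units satisfying the conditions above, hence seventh
  powers, and by \<open>norms_identity\<close> so is \<open>u\<^sup>3\<close> up to sign.\<close>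

theorem kummer_unit:
  assumes u: "u dvd (1::k9)" and t: "49 dvd u - t ^ 7"
  shows "\<exists>v. v dvd 1 \<and> u = v ^ (7::nat)"
proof -
  have T_norm: "coeffs_7 N" if "49 dvd N - x ^ 7" for N x
    by (rule coeffs_7_cong[OF dvd_49_7[OF that] coeffs_7_seventh_power])
  obtain v1 where v1: "u * sa u * sa (sa u) = v1 ^ 7"
  proof -
    let ?N = "u * sa u * sa (sa u)" and ?t = "t * sa t * sa (sa t)"
    have tf: "sa ?t = ?t" by (simp add: rhom_simps[OF rhom_sa] sa_cube mult_ac)
    have Nf: "sa ?N = ?N" by (simp add: rhom_simps[OF rhom_sa] sa_cube mult_ac)
    have SN: "frobenius_49 ?N"
    proof -
      note c = A.norm_cong[OF t]
      have "49 dvd ?N ^ 7 - (?t ^ 7) ^ 7" by (rule dvd_power_diff[OF c])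
      moreover have "49 dvd (?t ^ 7) ^ 7 - sk (sk (?t ^ 7))" using frobenius_49_seventh_power[OF tf] by (simp add: frobenius_49_def)
      moreover have "49 dvd sk (sk (?t ^ 7)) - sk (sk ?N)"
        using rhom_dvd[OF rhom_sk rhom_dvd[OF rhom_sk c[unfolded dvd_diff_sym[of _ ?N]]]]
        by (simp only: rhom_diff[OF rhom_sk] rhom_numeral[OF rhom_sk])
      ultimately show ?thesis unfolding frobenius_49_def by (blast intro: dvd_diff_chain)
    qed
    have "\<exists>v\<in>A.U. ?N = v ^ 7"
    proof (rule A.seventh_power_by_test[of kap9 "C7 (C13 (-1) 1 0) 0 0" frobenius_49])
      have f: "sa (C7 q 0 0) = C7 q 0 0" for q by (simp add: sa_def)
      have "kap9 * C7 (C13 4 (-1) (-1)) 0 0 = 1" "C7 (C13 (-1) 1 0) 0 0 * C7 (C13 (-2) 2 1) 0 0 = 1"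
        by (simp_all add: k9_defs c13_defs)
      hence "kap9 dvd 1" "C7 (C13 (-1) 1 0) 0 0 dvd 1" by (metis dvd_triv_left)+
      thus "kap9 \<in> A.U" "C7 (C13 (-1) 1 0) 0 0 \<in> A.U" by (simp_all add: A.U_def f)
      show "\<not> frobenius_49 (C7 (C13 (-1) 1 0) 0 0)"
        using test7D(1)[OF test_A] frobenius_49_Sb f by blast
      show "\<not> frobenius_49 (kap9 * C7 (C13 (-1) 1 0) 0 0 ^ j)" if "j < 7" for j
      proof
        assume "frobenius_49 (kap9 * C7 (C13 (-1) 1 0) 0 0 ^ j)"
        moreover have "sa (kap9 * C7 (C13 (-1) 1 0) 0 0 ^ j) = kap9 * C7 (C13 (-1) 1 0) 0 0 ^ j"
          by (simp only: rhom_mult[OF rhom_sa] rhom_power[OF rhom_sa] f)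
        ultimately show False using frobenius_49_Sb test7D(2)[OF test_A that] by blast
      qed
      show "frobenius_49 (v ^ 7)" if "v \<in> A.U" for v using that frobenius_49_seventh_power by (simp add: A.U_def)
      show "?N \<in> A.U" by (rule A.norm_in_U[OF u])
      show "frobenius_49 ?N" by (rule SN)
    qed (rule frobenius_49_mult)
    thus ?thesis using that by blast
  qed
  obtain v2 where v2: "u * sk u * sk (sk u) = v2 ^ 7"
  proof -
    let ?a = "al" and ?b = "C7 1 1 0"
    have "?a * (C7 (-2) 1 1) = 1" "?b * (C7 2 0 (-1)) = 1"
      by (simp_all add: k9_defs c13_defs numeral_c13)
    hence d: "?a dvd 1" "?b dvd 1" by (metis dvd_triv_left)+
    have f: "sk ?a = ?a" "sk ?b = ?b"
      by (simp_all add: sc_def sd_def sk_def sa_def sk13_def c13_defs numeral_c13)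
    have "\<exists>v\<in>B.U. u * sk u * sk (sk u) = v ^ 7"
    proof (rule B.seventh_power_by_test[of ?a ?b coeffs_7])
      show "?a \<in> B.U" "?b \<in> B.U" using d f by (simp_all add: B.U_def)
      show "\<not> coeffs_7 ?b" using test7D(1)[OF test_B] coeffs_7_Tb by blast
      show "\<not> coeffs_7 (?a * ?b ^ j)" if "j < 7" for j using test7D(2)[OF test_B that] coeffs_7_Tb by blast
      show "u * sk u * sk (sk u) \<in> B.U" by (rule B.norm_in_U[OF u])
      show "coeffs_7 (u * sk u * sk (sk u))" by (rule T_norm[OF B.norm_cong[OF t]])
    qed (rule coeffs_7_mult coeffs_7_seventh_power; assumption?)+
    thus ?thesis using that by blast
  qed
  obtain v3 where v3: "u * sc u * sc (sc u) = v3 ^ 7"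
  proof -
    let ?a = "C7 (C13 5 8 2) (C13 10 (-6) (-4)) (C13 4 (-6) (-2))" and ?b = "C7 (C13 (-3) 2 4) (C13 (-4) 6 2) (C13 6 0 (-2))"
    have "?a * (C7 (C13 13 0 (-14)) (C13 26 (-30) (-12)) (C13 (-20) (-6) 6)) = 1" "?b * (C7 (C13 (-99) 42 28) (C13 20 6 (-6)) (C13 46 (-24) (-18))) = 1"
      by (simp_all add: k9_defs c13_defs numeral_c13)
    hence d: "?a dvd 1" "?b dvd 1" by (metis dvd_triv_left)+
    have f: "sc ?a = ?a" "sc ?b = ?b"
      by (simp_all add: sc_def sd_def sk_def sa_def sk13_def c13_defs numeral_c13)
    have "\<exists>v\<in>C.U. u * sc u * sc (sc u) = v ^ 7"
    proof (rule C.seventh_power_by_test[of ?a ?b coeffs_7])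
      show "?a \<in> C.U" "?b \<in> C.U" using d f by (simp_all add: C.U_def)
      show "\<not> coeffs_7 ?b" using test7D(1)[OF test_C] coeffs_7_Tb by blast
      show "\<not> coeffs_7 (?a * ?b ^ j)" if "j < 7" for j using test7D(2)[OF test_C that] coeffs_7_Tb by blast
      show "u * sc u * sc (sc u) \<in> C.U" by (rule C.norm_in_U[OF u])
      show "coeffs_7 (u * sc u * sc (sc u))" by (rule T_norm[OF C.norm_cong[OF t]])
    qed (rule coeffs_7_mult coeffs_7_seventh_power; assumption?)+
    thus ?thesis using that by blast
  qed
  obtain v4 where v4: "u * sd u * sd (sd u) = v4 ^ 7"
  proof -
    let ?a = "C7 (C13 9 (-4) (-3)) (C13 (-2) 3 1) (C13 (-5) 3 2)" and ?b = "C7 (C13 (-2) (-1) 1) (C13 5 (-3) (-2)) (C13 3 0 (-1))"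
    have "?a * (C7 (C13 6 (-7) 0) (C13 13 (-6) (-5)) (C13 4 3 (-1))) = 1" "?b * (C7 (C13 (-8) 14 7) (C13 (-4) (-3) 1) (C13 9 (-9) (-4))) = 1"
      by (simp_all add: k9_defs c13_defs numeral_c13)
    hence d: "?a dvd 1" "?b dvd 1" by (metis dvd_triv_left)+
    have f: "sd ?a = ?a" "sd ?b = ?b"
      by (simp_all add: sc_def sd_def sk_def sa_def sk13_def c13_defs numeral_c13)
    have "\<exists>v\<in>D.U. u * sd u * sd (sd u) = v ^ 7"
    proof (rule D.seventh_power_by_test[of ?a ?b coeffs_7])
      show "?a \<in> D.U" "?b \<in> D.U" using d f by (simp_all add: D.U_def)
      show "\<not> coeffs_7 ?b" using test7D(1)[OF test_D] coeffs_7_Tb by blast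
      show "\<not> coeffs_7 (?a * ?b ^ j)" if "j < 7" for j using test7D(2)[OF test_D that] coeffs_7_Tb by blast
      show "u * sd u * sd (sd u) \<in> D.U" by (rule D.norm_in_U[OF u])
      show "coeffs_7 (u * sd u * sd (sd u))" by (rule T_norm[OF D.norm_cong[OF t]])
    qed (rule coeffs_7_mult coeffs_7_seventh_power; assumption?)+
    thus ?thesis using that by blast
  qed
  have pm: "n9 u = 1 \<or> n9 u = -1" using u n9_unit by (simp add: abs_eq_iff')
  define s :: k9 where "s = of_int (n9 u)"
  have s7: "s * s = 1" "s ^ 7 = s" using pm by (auto simp: s_def)
  have "u ^ 3 * s = (v1 * v2 * v3 * v4) ^ 7"
    unfolding s_def norms_identity[symmetric] v1 v2 v3 v4 by (simp add: power_mult_distrib)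
  hence "u ^ 3 * (s * s) = (v1 * v2 * v3 * v4) ^ 7 * s ^ 7" by (simp add: s7(2) flip: mult.assoc)
  hence u3: "u ^ 3 = (v1 * v2 * v3 * v4 * s) ^ 7" by (simp add: s7 power_mult_distrib)
  obtain w where w: "u * w = 1" using u by (auto simp: dvd_def)
  \<comment> \<open>u^15 is a fifth power of u^3, and the surplus exponent 14 is a multiple of
    7.\<close>
  have "u = u * (u * w) ^ 14" by (simp add: w)
  also have "\<dots> = (u ^ 3) ^ 5 * (w ^ 2) ^ 7" by (simp add: power_mult_distrib flip: power_mult power_Suc mult.assoc)
  also have "\<dots> = ((v1 * v2 * v3 * v4 * s) ^ 5 * w ^ 2) ^ 7" unfolding u3 by (simp add: power_mult_distrib flip: power_mult)
  finally have U: "u = ((v1 * v2 * v3 * v4 * s) ^ 5 * w ^ 2) ^ 7" .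
  moreover have "(v1 * v2 * v3 * v4 * s) ^ 5 * w ^ 2 dvd 1"
    using u by (subst (asm) U) (meson dvd_power dvd_trans zero_less_numeral)
  ultimately show ?thesis by blast
qed

section \<open>The descent\<close>

lemma dvd_sum3:
  "(q::'a::comm_ring_1) dvd x - x' \<Longrightarrow> q dvd y - y' \<Longrightarrow> q dvd z - z' \<Longrightarrow> q dvd (x + y + z) - (x' + y' + z')"
proof -
  assume "q dvd x - x'" "q dvd y - y'" "q dvd z - z'"
  hence "q dvd (x - x') + (y - y') + (z - z')" by (intro dvd_add)
  thus ?thesis by (simp add: algebra_simps)
qed

section \<open>Frobenius congruences modulo 3 and modulo the prime above 13\<close>

lemma frobenius_fixed_c13:
  assumes p: "prime (p::nat)" and q: "q dvd of_nat p"
    and k: "q dvd kap ^ (p ^ m) - kap" and i: "\<And>n. int p dvd n ^ (p ^ m) - n"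
  shows "q dvd x ^ (p ^ m) - x"
proof -
  let ?n = "p ^ m"
  let ?x = "of_int (c0 x) :: c13" and ?y = "of_int (c1 x) * kap" and ?z = "of_int (c2 x) * (kap * kap)"
  have x: "x = ?x + ?y + ?z" by (cases x) (simp add: c13_defs of_int_c13)
  have a: "q dvd (?x + ?y + ?z) ^ ?n - (?x ^ ?n + ?y ^ ?n + ?z ^ ?n)" by (rule freshman3[OF p q])
  have b: "q dvd of_int n ^ ?n - of_int n" for n
  proof -
    obtain t where "n ^ ?n - n = int p * t" using i[of n] by (rule dvdE)
    hence "of_int (n ^ ?n - n) = (of_nat p * of_int t :: c13)" by simp
    thus ?thesis using dvd_mult2[OF q, of "of_int t"] by simp
  qed
  have kk: "q dvd (kap * kap) ^ ?n - kap * kap"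
    unfolding power_mult_distrib by (rule dvd_diff_mult[OF k k])
  have "q dvd (?x ^ ?n + ?y ^ ?n + ?z ^ ?n) - (?x + ?y + ?z)"
    unfolding power_mult_distrib[of "of_int _"]
    by (rule dvd_sum3[OF b dvd_diff_mult[OF b k] dvd_diff_mult[OF b kk]])
  hence "q dvd (?x + ?y + ?z) ^ ?n - (?x + ?y + ?z)" by (rule dvd_diff_chain[OF a])
  thus ?thesis using x by simp
qed

lemma frobenius_fixed_k9:
  assumes p: "prime (p::nat)" and q: "q dvd of_nat p"
    and k: "C7 q 0 0 dvd al ^ (p ^ m) - al" and i: "\<And>x. q dvd x ^ (p ^ m) - x"
  shows "C7 q 0 0 dvd x ^ (p ^ m) - x"
proof -
  let ?n = "p ^ m" and ?q = "C7 q 0 0"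
  let ?x = "C7 (a0 x) 0 0" and ?y = "C7 (a1 x) 0 0 * al" and ?z = "C7 (a2 x) 0 0 * (al * al)"
  have x: "x = ?x + ?y + ?z" by (cases x) (simp add: k9_defs)
  have q': "?q dvd of_nat p" using rhom_dvd[OF rhom_C7 q] by (simp add: of_nat_k9)
  have a: "?q dvd (?x + ?y + ?z) ^ ?n - (?x ^ ?n + ?y ^ ?n + ?z ^ ?n)" by (rule freshman3[OF p q'])
  have b: "?q dvd C7 y 0 0 ^ ?n - C7 y 0 0" for y
    using rhom_dvd[OF rhom_C7 i[of y]] by (simp only: rhom_diff[OF rhom_C7] rhom_power[OF rhom_C7])
  have kk: "?q dvd (al * al) ^ ?n - al * al"
    unfolding power_mult_distrib by (rule dvd_diff_mult[OF k k])
  have "?q dvd (?x ^ ?n + ?y ^ ?n + ?z ^ ?n) - (?x + ?y + ?z)"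
    unfolding power_mult_distrib[of "C7 _ 0 0"]
    by (rule dvd_sum3[OF b dvd_diff_mult[OF b k] dvd_diff_mult[OF b kk]])
  hence "?q dvd (?x + ?y + ?z) ^ ?n - (?x + ?y + ?z)" by (rule dvd_diff_chain[OF a])
  thus ?thesis using x by simp
qed

lemma fermat_int:
  fixes n :: int
  assumes p: "prime p" shows "int p dvd n ^ p - n"
proof -
  have nat: "int p dvd int m ^ p - int m" for m :: nat
  proof (induction m)
    case 0
    show ?case using prime_gt_0_nat[OF p] by (simp add: zero_power)
  next
    case (Suc m)
    have "int p dvd (int m + 1) ^ p - int m ^ p - 1 ^ p"
      using freshman_prime[OF p, of "int m" 1] by simp
    from dvd_add[OF this Suc.IH] show ?case by (simp add: algebra_simps)
  qed
  have "int p dvd n ^ p - (n mod int p) ^ p" by (rule dvd_power_diff) simp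
  moreover have "int p dvd (n mod int p) ^ p - n mod int p"
    using nat[of "nat (n mod int p)"] prime_gt_0_nat[OF p] by simp
  moreover have "int p dvd n mod int p - n" by (metis dvd_minus_mod dvd_diff_sym)
  ultimately show ?thesis by (meson dvd_diff_chain)
qed

lemma fermat_iterate:
  fixes n :: int
  assumes p: "prime p" shows "int p dvd n ^ (p ^ m) - n"
proof (induction m)
  case (Suc m)
  have "int p dvd (n ^ (p ^ m)) ^ p - n ^ (p ^ m)" by (rule fermat_int[OF p])
  from dvd_diff_chain[OF this Suc.IH] show ?case by (simp add: mult.commute flip: power_mult)
qed simp

lemma power27_mod_3_c13: "3 dvd (y::c13) ^ 27 - y"
proof -
  have k3: "kap ^ 3 = C13 (-1) 4 (-1)"
    by (simp add: eval_nat_numeral c13_defs numeral_c13)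
  have "of_nat 3 dvd (y::c13) ^ (3 ^ 3) - y"
  proof (rule frobenius_fixed_c13)
    have "kap ^ 27 = ((kap ^ 3) ^ 3) ^ 3" by (simp flip: power_mult)
    also have "\<dots> = C13 (-8665745556) 37931725159 (-22973697201)"
      unfolding k3 by (simp add: power3_eq_cube c13_defs)
    finally have "kap ^ 27 - kap = of_nat 3 * C13 (-2888581852) 12643908386 (-7657899067)"
      by (simp add: numeral_c13 c13_defs)
    thus "of_nat 3 dvd kap ^ 3 ^ 3 - kap" by simp
    show "int 3 dvd n ^ (3 ^ 3) - n" for n
      using fermat_iterate[of 3 n 3] by simp
  qed simp_all
  thus ?thesis by simp
qed

text \<open>All residue fields above 3 have 27 elements, because 3 is inert in both cubic
  rings.\<close>

lemma power27_mod_3: "3 dvd (x::k9) ^ 27 - x"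
proof -
  have k3: "al ^ 3 = C7 1 2 (-1)"
    by (simp add: eval_nat_numeral k9_defs c13_defs numeral_c13)
  have c: "of_nat 3 dvd (y::c13) ^ (3 ^ 3) - y" for y using power27_mod_3_c13[of y] by simp
  have "C7 (of_nat 3) 0 0 dvd x ^ (3 ^ 3) - x"
  proof (rule frobenius_fixed_k9[OF _ _ _ c])
    have "al ^ 27 = ((al ^ 3) ^ 3) ^ 3" by (simp flip: power_mult)
    also have "\<dots> = C7 1077870 1557649 (-1942071)"
      unfolding k3 by (simp add: power3_eq_cube k9_defs c13_defs numeral_c13)
    finally have "al ^ 27 - al = C7 3 0 0 * C7 359290 519216 (-647357)"
      by (simp add: numeral_c13 k9_defs c13_defs)
    thus "C7 (of_nat 3) 0 0 dvd al ^ 3 ^ 3 - al" by simp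
  qed simp_all
  thus ?thesis by (simp add: numeral_k9)
qed

abbreviation R0 :: k9 where "R0 \<equiv> C7 rho0 0 0"

lemma rho0_dvd_13: "rho0 dvd 13" by (simp add: rho0_dvd_iff psi13_def numeral_c13)

lemma power13_mod_R0: "R0 dvd x ^ 13 - x"
proof -
  have c: "rho0 dvd (y::c13) ^ (13 ^ 1) - y" for y
  proof -
    have "13 dvd psi13 (y ^ 13) - psi13 y ^ 13" by (rule psi13_power)
    moreover have "int 13 dvd psi13 y ^ 13 - psi13 y" using fermat_iterate[of 13 "psi13 y" 1] by simp
    ultimately have "13 dvd psi13 (y ^ 13) - psi13 y" by (auto intro: dvd_diff_chain)
    moreover have "psi13 (y ^ 13 - y) = psi13 (y ^ 13) - psi13 y" by (simp add: psi13_def c13_defs)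
    ultimately show ?thesis by (simp add: rho0_dvd_iff)
  qed
  have k3: "al ^ 3 = C7 1 2 (-1)"
    by (simp add: eval_nat_numeral k9_defs c13_defs numeral_c13)
  have "R0 dvd x ^ (13 ^ 1) - x"
  proof (rule frobenius_fixed_k9[OF _ _ _ c])
    show "rho0 dvd of_nat 13" using rho0_dvd_13 by simp
    have "al ^ 13 = ((al ^ 3) ^ 2) ^ 2 * al" by (simp flip: power_mult power_Suc2)
    also have "\<dots> = C7 286 417 (-507)"
      unfolding k3 by (simp add: power2_eq_square k9_defs c13_defs numeral_c13)
    finally have "al ^ 13 - al = C7 13 0 0 * C7 22 32 (-39)"
      by (simp add: numeral_c13 k9_defs c13_defs)
    hence "C7 13 0 0 dvd al ^ 13 - al" by simp
    thus "R0 dvd al ^ 13 ^ 1 - al" using rhom_dvd[OF rhom_C7 rho0_dvd_13] by (auto intro: dvd_trans)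
  qed simp_all
  thus ?thesis by simp
qed

text \<open>As 7 * 15 = 1 + 4 * 26, the 15th power inverts the seventh power on a field with 27
  elements.\<close>

lemma seventh_power_cancel_mod_3:
  assumes a27: "\<And>z. (3::'a::comm_ring_1) dvd z ^ 27 - z" and xy: "3 dvd x ^ 7 - (y::'a) ^ 7"
  shows "3 dvd x - y"
proof -
  have a: "3 dvd z ^ 105 - z" for z :: 'a
  proof -
    have "3 dvd (z ^ 27) ^ 3 * z ^ 24 - z ^ 3 * z ^ 24"
      by (intro dvd_diff_mult dvd_power_diff a27) simp
    hence "3 dvd z ^ 105 - z ^ 27" by (simp flip: power_mult power_add)
    from dvd_diff_chain[OF this a27] show ?thesis .
  qed
  have "3 dvd (x ^ 7) ^ 15 - (y ^ 7) ^ 15" by (rule dvd_power_diff[OF xy])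
  hence b: "3 dvd x ^ 105 - y ^ 105" by (simp flip: power_mult)
  have "3 dvd x - x ^ 105" using a[of x] dvd_diff_sym by blast
  from dvd_diff_chain[OF dvd_diff_chain[OF this b] a] show ?thesis .
qed

text \<open>As 7 * 7 = 1 + 4 * 12, the seventh power is its own inverse on a field with 13
  elements.\<close>

lemma seventh_power_cancel_mod_R0:
  assumes "R0 dvd x ^ 7 - y ^ 7" shows "R0 dvd x - y"
proof -
  have a: "R0 dvd z ^ 49 - z" for z
  proof -
    have "R0 dvd (z ^ 13) ^ 3 * z ^ 10 - z ^ 3 * z ^ 10"
      by (intro dvd_diff_mult dvd_power_diff power13_mod_R0) simp
    hence "R0 dvd z ^ 49 - z ^ 13" by (simp flip: power_mult power_add)
    from dvd_diff_chain[OF this power13_mod_R0] show ?thesis .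
  qed
  have "R0 dvd (x ^ 7) ^ 7 - (y ^ 7) ^ 7" by (rule dvd_power_diff[OF assms])
  hence b: "R0 dvd x ^ 49 - y ^ 49" by (simp flip: power_mult)
  have "R0 dvd x - x ^ 49" using a[of x] dvd_diff_sym by blast
  from dvd_diff_chain[OF dvd_diff_chain[OF this b] a] show ?thesis .
qed

text \<open>The conjugates \<open>2 - \<alpha>\<^sub>k\<close>, whose product is 7. They enter through
  \<open>x\<^sup>7 - y\<^sup>7 = (x - y) \<Prod>\<^sub>k ((x - y)\<^sup>2 + (2 - \<alpha>\<^sub>k) x y)\<close>.\<close>

abbreviation p1 :: k9 where "p1 \<equiv> C7 2 (- 1) 0"
abbreviation p2 :: k9 where "p2 \<equiv> C7 4 0 (- 1)"
abbreviation p3 :: k9 where "p3 \<equiv> C7 1 1 1"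

lemma p_sums: "p1 + p2 + p3 = 7" "p1 * p2 + p1 * p3 + p2 * p3 = 14" "p1 * p2 * p3 = 7"
  by (simp_all add: k9_defs c13_defs numeral_k9 numeral_c13)

lemma p_assoc: "p1 = p2 * C7 0 (- 1) 1" "p1 = p3 * C7 3 (- 1) (- 1)"
  by (simp_all add: k9_defs c13_defs numeral_c13)

text \<open>The conjugates of 2 - \<alpha> and their differences are all associates of the prime
  above 7, whose cube is 7 up to a unit.\<close>

lemma p_diffs_dvd: "p3 * (p2 - p1) dvd 7" "p2 * (p3 - p1) dvd 7" "p1 * (p3 - p2) dvd 7"
proof -
  have "p3 * (p2 - p1) * C7 7 (- 1) (- 3) = 7" "p2 * (p3 - p1) * C7 0 2 (- 1) = 7" "p1 * (p3 - p2) * C7 0 3 2 = 7"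
    by (simp_all add: k9_defs c13_defs numeral_k9 numeral_c13)
  thus "p3 * (p2 - p1) dvd 7" "p2 * (p3 - p1) dvd 7" "p1 * (p3 - p2) dvd 7" by (metis dvd_triv_left)+
qed

text \<open>Valuations at the prime \<open>p1\<close>: 7 has valuation 3 and
  \<open>p3 * (p2 - p1)\<close> has valuation 2, which gives 5; twice this exceeds the valuation 9
  of 343.\<close>

lemma p1_powers: "p1 ^ 5 dvd 7 * (p3 * (p2 - p1))" "343 dvd p1 ^ 10" "p1 dvd 7" "(p1::k9) \<noteq> 0"
proof -
  have 5: "p1 ^ 5 = C7 (- 21) (- 175) 154"
    by (simp add: eval_nat_numeral k9_defs c13_defs numeral_c13)
  have "7 * (p3 * (p2 - p1)) = p1 ^ 5 * C7 29 81 36"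
    unfolding 5 by (simp add: k9_defs c13_defs numeral_k9 numeral_c13)
  thus "p1 ^ 5 dvd 7 * (p3 * (p2 - p1))" by (rule dvdI)
  have "p1 ^ 10 = p1 ^ 5 * p1 ^ 5" by (simp flip: power_add)
  also have "\<dots> = 343 * C7 (-225) (-362) 435"
    unfolding 5 by (simp add: k9_defs c13_defs numeral_k9 numeral_c13)
  finally show "343 dvd p1 ^ 10" by (rule dvdI)
  show "p1 dvd 7" unfolding p_sums(3)[symmetric] mult.assoc by (rule dvd_triv_left)
  show "(p1::k9) \<noteq> 0" by (simp add: k9_defs c13_defs numeral_c13)
qed

lemma seventh_power_diff_cubic:
  "(x - y) * (((x - y)^2)^3 + 7 * (((x - y)^2)^2 * (x * y)) + 14 * ((x - y)^2 * (x * y)^2) + 7 * (x * y)^3)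
    = x ^ 7 - (y::'a::comm_ring_1) ^ 7"
  by (simp add: algebra_simps eval_nat_numeral)

lemma cubic_factors:
  "(T + p1 * P) * (T + p2 * P) * (T + p3 * P) = T^3 + 7 * (T^2 * P) + 14 * (T * P^2) + 7 * P^3"
proof -
  have "(T + a * P) * (T + b * P) * (T + c * P) = T^3 + (a + b + c) * (T^2 * P) + (a * b + a * c + b * c) * (T * P^2)
      + (a * b * c) * P^3" for a b c :: k9
    by (simp add: algebra_simps power2_eq_square power3_eq_cube)
  from this[of p1 p2 p3] show ?thesis unfolding p_sums .
qed

lemma seventh_power_diff:
  "(x::k9) ^ 7 - y ^ 7 = (x - y) * (((x - y)^2 + p1 * (x * y)) * ((x - y)^2 + p2 * (x * y)) * ((x - y)^2 + p3 * (x * y)))"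
  unfolding cubic_factors seventh_power_diff_cubic ..

section \<open>Real embeddings and comparison of norms\<close>

definition emb :: "nat \<Rightarrow> nat \<Rightarrow> k9 \<Rightarrow> real" where "emb i j x = e9 ((sk ^^ j) ((sa ^^ i) x))"

lemma rhom_emb: "rhom (emb i j)"
  unfolding emb_def by (intro rhom_comp[OF rhom_e9] rhom_comp[OF rhom_funpow[OF rhom_sk]] rhom_funpow[OF rhom_sa])

lemma n9_emb: "real_of_int (n9 x) = (\<Prod>i<3. \<Prod>j<3. emb i j x)"
proof -
  have "real_of_int (n9 x) = e9 (of_int (n9 x))" by (simp add: rhom_of_int[OF rhom_e9])
  also have "\<dots> = (\<Prod>i<3. \<Prod>j<3. emb i j x)"
    unfolding n9_eq' emb_def
    by (simp add: numeral_3_eq_3 rhom_mult[OF rhom_e9] rhom_mult[OF rhom_sk] mult_ac)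
  finally show ?thesis .
qed

lemma n9_mono:
  assumes "\<And>i j. i < 3 \<Longrightarrow> j < 3 \<Longrightarrow> 0 \<le> emb i j x \<and> emb i j x \<le> emb i j y"
  shows "0 \<le> n9 x" "n9 x \<le> n9 y"
proof -
  have "0 \<le> real_of_int (n9 x)" unfolding n9_emb using assms by (intro prod_nonneg) auto
  thus "0 \<le> n9 x" by simp
  have "real_of_int (n9 x) \<le> real_of_int (n9 y)"
    unfolding n9_emb using assms by (intro prod_mono) (auto intro!: prod_mono prod_nonneg)
  thus "n9 x \<le> n9 y" by simp
qed

text \<open>\<open>4 - p1\<close> is 2 + \<alpha> = (2 cos(\<pi> / 7))^2, the square of a conjugate
  of \<alpha>.\<close>

lemma emb_p1: "i < 3 \<Longrightarrow> 0 \<le> emb i j p1" "0 \<le> emb i j (4 - p1)"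
proof -
  assume "i < 3"
  have "(sk ^^ j) p1 = p1" "(sk ^^ j) p2 = p2" "(sk ^^ j) p3 = p3"
    by (induction j) (simp_all add: sk_def sk13_def c13_defs numeral_c13)
  moreover have "sa p1 = p2" "sa p2 = p3" by (simp_all add: sa_def c13_defs numeral_c13)
  moreover have "0 \<le> e9 p1" "0 \<le> e9 p2" "0 \<le> e9 p3"
  proof -
    have "e9 p1 = 2 - ar" "e9 p2 = 4 - ar^2" "e9 p3 = 1 + ar + ar^2"
      by (simp_all add: e9_def rhom_simps[OF rhom_e13])
    moreover have "ar^2 \<le> 2^2" using ar by (intro power_mono) auto
    ultimately show "0 \<le> e9 p1" "0 \<le> e9 p2" "0 \<le> e9 p3" using ar by auto
  qed
  moreover have "i = 0 \<or> i = 1 \<or> i = 2" using \<open>i < 3\<close> by auto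
  ultimately show "0 \<le> emb i j p1" by (auto simp: emb_def numeral_2_eq_2)
next
  have "4 - p1 = (sa (sa al))^2"
    by (simp add: sa_def power2_eq_square k9_defs c13_defs numeral_k9 numeral_c13)
  thus "0 \<le> emb i j (4 - p1)" by (simp add: rhom_power[OF rhom_emb])
qed

text \<open>A state stands for a pair \<open>X = 7 Z\<close> and \<open>Y\<close>, thought of as \<open>(x - y)\<^sup>2\<close> and \<open>x y\<close>, such that
  \<open>X \<Prod>\<^sub>k (X / (2 - \<alpha>\<^sub>k) + Y)\<^sup>2\<close> is a seventh power up to divisors of powers of \<open>21 q\<close>.\<close>

definition state :: "k9 \<Rightarrow> k9 \<Rightarrow> k9 \<Rightarrow> bool" where
  "state q Z Y \<longleftrightarrow> (q = 1 \<or> q = R0) \<and> Z \<noteq> 0 \<and> comax Z Y \<and> 49 dvd Z \<and> 3 dvd Z \<and> q dvd Z \<and>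
    (\<forall>i<3. \<forall>j<3. 0 \<le> emb i j Z \<and> 0 \<le> emb i j (7 * Z + 4 * Y)) \<and>
    (\<exists>c w k. c dvd (21 * q) ^ k \<and>
      c * Z * ((p2 * p3 * Z + Y) * (p1 * p3 * Z + Y) * (p1 * p2 * Z + Y))^2 = w ^ 7)"

text \<open>Since \<open>4 (2 - \<alpha>) g = (2 + \<alpha>) X + (2 - \<alpha>) (X + 4 Y)\<close> with all conjugates nonnegative, the norm of
  \<open>g\<close> is at least a constant multiple of that of \<open>X\<close>.\<close>

lemma state_not_unit:
  assumes "state q Z Y" shows "\<not> p2 * p3 * Z + Y dvd 1"
proof
  let ?g = "p2 * p3 * Z + Y"
  assume u: "?g dvd 1"
  have Z: "Z \<noteq> 0" "49 dvd Z" and pos: "\<And>i j. i < 3 \<Longrightarrow> j < 3 \<Longrightarrow> 0 \<le> emb i j Z \<and> 0 \<le> emb i j (7 * Z + 4 * Y)"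
    using assms by (auto simp: state_def)
  have e: "4 * p1 * ?g = (4 - p1) * (7 * Z) + p1 * (7 * Z + 4 * Y)"
  proof -
    have "4 * p1 * ?g = 4 * (p1 * p2 * p3) * Z + 4 * p1 * Y" by (simp only: distrib_left mult.assoc)
    also have "\<dots> = (4 - p1) * (7 * Z) + p1 * (7 * Z + 4 * Y)" unfolding p_sums by (simp add: algebra_simps)
    finally show ?thesis .
  qed
  have "n9 ((4 - p1) * (7 * Z)) \<le> n9 (4 * p1 * ?g)"
  proof (rule n9_mono)
    fix i j :: nat assume ij: "i < 3" "j < 3"
    note h = rhom_simps[OF rhom_emb]
    have "0 \<le> emb i j (4 - p1) * emb i j (7 * Z)" "0 \<le> emb i j p1 * emb i j (7 * Z + 4 * Y)"
      using pos[OF ij] emb_p1[of i j] ij by (simp_all add: h(4) h(10))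
    thus "0 \<le> emb i j ((4 - p1) * (7 * Z)) \<and> emb i j ((4 - p1) * (7 * Z)) \<le> emb i j (4 * p1 * ?g)"
      unfolding e h(3)[of i j "(4 - p1) * (7 * Z)"] h(4)[of i j "4 - p1"] h(4)[of i j p1] by simp
  qed
  moreover have "n9 (4 - p1) = 1" by (simp add: n9_def n7_def n13_def sk13_def k9_defs c13_defs numeral_k9 numeral_c13)
  moreover have "n9 p1 = 343" by (simp add: n9_def n7_def n13_def sk13_def k9_defs c13_defs numeral_k9 numeral_c13)
  moreover have "n9 4 = 4 ^ 9" "n9 7 = 7 ^ 9" "n9 49 = 49 ^ 9"
    by (simp_all add: n9_def n7_def n13_def sk13_def k9_defs c13_defs numeral_k9 numeral_c13)
  \<comment> \<open>The divisibility by 49 matters: 7^9 alone is smaller than 4^9 * 343.\<close>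
  moreover obtain t where t: "Z = 49 * t" using Z(2) by (rule dvdE)
  ultimately have le: "7 ^ 9 * (49 ^ 9 * n9 t) \<le> 4 ^ 9 * 343 * n9 ?g" by (simp only: n9_mult)
  have "0 \<le> n9 Z" by (rule n9_mono(1)[of _ Z]) (use pos in auto)
  hence "0 \<le> n9 t" unfolding t n9_mult \<open>n9 49 = 49 ^ 9\<close> by (simp add: zero_le_mult_iff)
  moreover have "n9 t \<noteq> 0" using Z(1) t by (auto simp: n9_0_iff)
  ultimately have "1 \<le> n9 t" by linarith
  moreover have "n9 ?g \<le> 1" using u n9_unit[of ?g] by linarith
  ultimately show False using le by (simp add: eval_nat_numeral)
qed

lemma dvd_7_powers: "(a::k9) dvd 7 \<Longrightarrow> a ^ n dvd (21 * q) ^ n"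
proof (rule dvd_power_same)
  assume "a dvd 7"
  moreover have "7 dvd 21 * q" by (rule dvdI[of _ _ "3 * q"]) simp
  ultimately show "a dvd 21 * q" by (rule dvd_trans)
qed

text \<open>The fourth power of g^2 is g times g^7, and \<open>root7_k9\<close> permits the division
  by g^7.\<close>

lemma square_seventh_power_root:
  fixes g :: k9
  assumes "g^2 * h = w ^ 7" "comax (g^2) h" "g \<noteq> 0"
  shows "\<exists>e t. e dvd 1 \<and> g = e * t ^ 7"
proof -
  obtain e v where e: "e dvd 1" "g^2 = e * v ^ 7" using coprime_seventh_power[OF assms(1,2)] assms(3) by auto
  obtain f where f: "e * f = 1" using e(1) by (metis dvdE)
  have 8: "g ^ 7 * g = e ^ 4 * (v ^ 4) ^ 7"
  proof -
    have "g ^ 7 * g = (g^2) ^ 4" by (simp flip: power_mult power_Suc2)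
    also have "\<dots> = e ^ 4 * (v ^ 4) ^ 7" unfolding e(2) by (simp add: power_mult_distrib flip: power_mult)
    finally show ?thesis .
  qed
  hence "f ^ 4 * (g ^ 7 * g) = (e * f) ^ 4 * (v ^ 4) ^ 7" by (simp add: power_mult_distrib mult_ac)
  hence "(v ^ 4) ^ 7 = g ^ 7 * (f ^ 4 * g)" unfolding f by (simp add: mult_ac)
  hence "g ^ 7 dvd (v ^ 4) ^ 7" by (rule dvdI)
  hence "g dvd v ^ 4" by (rule root7_k9)
  then obtain t where t: "v ^ 4 = g * t" by (rule dvdE)
  have "g ^ 7 * g = g ^ 7 * (e ^ 4 * t ^ 7)" unfolding 8 t by (simp add: power_mult_distrib mult_ac)
  hence "g = e ^ 4 * t ^ 7" using assms(3) by simp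
  moreover have "e ^ 4 dvd 1" using e(1) dvd_power_same[of e 1 4] by simp
  ultimately show ?thesis by blast
qed

text \<open>Each factor is comaximal with Z, hence with 3, 7, q and c. The factors differ by Z times
  divisors of 7, so they are pairwise comaximal, and \<open>coprime_seventh_power\<close> applies to
  them and to \<open>c * Z\<close>.\<close>

lemma state_decomposition:
  assumes "state q Z Y"
  defines "g1 \<equiv> p2 * p3 * Z + Y" and "g2 \<equiv> p1 * p3 * Z + Y" and "g3 \<equiv> p1 * p2 * Z + Y"
  shows "comax g1 Z" "comax g2 Z" "comax g1 g2" "comax g1 7" "comax g2 7"
    "\<exists>e t. e dvd 1 \<and> g1 = e * t ^ 7" "\<exists>e t. e dvd 1 \<and> g2 = e * t ^ 7"
    "\<exists>e c k t. e dvd 1 \<and> c dvd (21 * q) ^ k \<and> c * Z = e * t ^ 7"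
proof -
  have Z: "Z \<noteq> 0" "comax Z Y" "49 dvd Z" "3 dvd Z" "q dvd Z" using assms(1) by (auto simp: state_def)
  obtain c w k where c: "c dvd (21 * q) ^ k" "c * Z * (g1 * g2 * g3)^2 = w ^ 7"
    using assms(1) unfolding state_def g1_def g2_def g3_def by blast
  have 7: "7 dvd Z" by (rule dvd_49_7[OF Z(3)])
  have gZ: "comax (a * b * Z + Y) Z" for a b
    using comax_add[OF Z(2), of "a * b"] by (simp add: comax_sym add.commute mult.commute)
  have g7: "comax g 7" and gq: "comax g q" and g3': "comax g 3" if "comax g Z" for g
    using comax_dvd[OF that 7] comax_dvd[OF that Z(5)] comax_dvd[OF that Z(4)] by auto
  have gc: "comax g c" if "comax g Z" for g
  proof -
    have "comax g (3 * 7 * q)" using that by (intro comax_mult g7 gq g3')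
    hence "comax g (21 * q)" by simp
    thus ?thesis using comax_dvd[OF comax_power c(1)] by blast
  qed
  have Zg: "comax g1 Z" "comax g2 Z" "comax g3 Z" unfolding g1_def g2_def g3_def by (rule gZ)+
  have pair: "comax a b" if "comax a Z" "a - b = s * Z" "s dvd 7" for a b s
  proof -
    have "comax a (s * Z)" using that g7 by (intro comax_mult) (auto intro: comax_dvd)
    hence "comax a (- b)" by (rule comax_cong) (simp flip: that(2))
    thus ?thesis by (rule comax_dvd) simp
  qed
  have 12: "comax g1 g2" by (rule pair[OF Zg(1) _ p_diffs_dvd(1)]) (simp add: g1_def g2_def algebra_simps)
  have c13g: "comax g1 g3" by (rule pair[OF Zg(1) _ p_diffs_dvd(2)]) (simp add: g1_def g3_def algebra_simps)
  have 23: "comax g2 g3" by (rule pair[OF Zg(2) _ p_diffs_dvd(3)]) (simp add: g2_def g3_def algebra_simps)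
  show "comax g1 Z" "comax g2 Z" "comax g1 g2" "comax g1 7" "comax g2 7" using Zg 12 g7 by auto
  have nz: "g \<noteq> 0" if "comax g Z" for g
  proof
    assume "g = 0"
    hence "7 dvd (1::k9)" using that 7 unfolding comax_def by (metis add_0 mult_zero_right dvd_mult)
    hence "\<bar>n9 7\<bar> = 1" by (simp only: n9_unit)
    thus False by (simp add: n9_def n7_def n13_def sk13_def k9_defs c13_defs numeral_k9 numeral_c13)
  qed
  have root: "\<exists>e t. e dvd 1 \<and> a = e * t ^ 7"
    if "comax a Z" "comax a b" "comax a b'" "c * Z * (a * b * b')^2 = w ^ 7" for a b b'
  proof (rule square_seventh_power_root)
    show "a^2 * (c * (Z * (b * b')^2)) = w ^ 7" unfolding that(4)[symmetric] by (simp add: power_mult_distrib mult_ac)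
    have "comax a (c * (Z * (b * b')^2))" using that gc by (intro comax_mult comax_power) auto
    thus "comax (a^2) (c * (Z * (b * b')^2))" using comax_powers[of a _ 2 1] by simp
  qed (rule nz[OF that(1)])
  show "\<exists>e t. e dvd 1 \<and> g1 = e * t ^ 7" by (rule root[OF Zg(1) 12 c13g c(2)])
  show "\<exists>e t. e dvd 1 \<and> g2 = e * t ^ 7"
    by (rule root[OF Zg(2) comax_sym[OF 12] 23]) (use c(2) in \<open>simp add: mult_ac\<close>)
  have "\<exists>e t. e dvd 1 \<and> c * Z = e * t ^ 7"
  proof (rule coprime_seventh_power[OF c(2)])
    have "comax g (c * Z)" if "comax g Z" for g using that gc by (intro comax_mult) auto
    hence "comax (c * Z) (g1 * g2 * g3)" using Zg by (intro comax_mult) (auto intro: comax_sym)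
    thus "comax (c * Z) ((g1 * g2 * g3)^2)" by (rule comax_power)
    have "(21::k9) \<noteq> 0" "q \<noteq> 0"
      using Z(1,5) by (auto simp: numeral_k9 zero_k9_def zero_c13_def numeral_c13)
    hence "c \<noteq> 0" using c(1) by auto
    thus "c * Z \<noteq> 0" using Z(1) by simp
  qed
  thus "\<exists>e c k t. e dvd 1 \<and> c dvd (21 * q) ^ k \<and> c * Z = e * t ^ 7" using c(1) by blast
qed

text \<open>The factors \<open>g\<^sub>1\<close> and \<open>g\<^sub>2\<close> are units times seventh powers and agree modulo 49, so by Kummer's lemma
  \<open>g\<^sub>1 = e x\<^sup>7\<close> and \<open>g\<^sub>2 = e y\<^sup>7\<close> with the same unit. As \<open>g\<^sub>1 - g\<^sub>2\<close> is \<open>Z\<close> times a divisor of 7, the pair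
  \<open>(x - y)\<^sup>2\<close>, \<open>x y\<close> yields a new state.\<close>

lemma state_step:
  assumes st: "state q Z Y"
  shows "\<exists>Z' Y'. state q Z' Y' \<and> Z' dvd Z ^ 4 \<and> p2 * p3 * Z' + Y' dvd Z ^ 2"
proof -
  let ?g1 = "p2 * p3 * Z + Y" and ?g2 = "p1 * p3 * Z + Y"
  let ?s = "p3 * (p2 - p1)"
  have Z: "Z \<noteq> 0" "49 dvd Z" "3 dvd Z" "q dvd Z" using st by (auto simp: state_def)
  note D = state_decomposition[OF st]
  obtain e1 w1 where e1: "e1 dvd 1" "?g1 = e1 * w1 ^ 7" using D(6) by blast
  obtain e2 w2 where e2: "e2 dvd 1" "?g2 = e2 * w2 ^ 7" using D(7) by blast
  obtain e c k t where e: "e dvd 1" "c dvd (21 * q) ^ k" "c * Z = e * t ^ 7" using D(8) by blast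
  obtain f where f: "1 = e2 * f" using e2(1) by (rule dvdE)
  have f1: "f dvd 1" using f by (metis dvd_triv_right)
  have diff: "?g1 - ?g2 = ?s * Z" by (simp add: algebra_simps)
  have "comax 7 (w1 ^ 7)" using comax_dvd[OF comax_sym[OF D(4)], of "w1 ^ 7"] e1(2) by simp
  hence "comax 49 w1" using comax_powers[of 7 "w1" 2 1] comax_dvd[of 7 "w1 ^ 7" w1] by (simp add: dvd_power)
  then obtain r b where b: "r * 49 + b * w1 = 1" unfolding comax_def by blast
  \<comment> \<open>Modulo 49, \<open>b\<close> inverts \<open>w1\<close> and g1 agrees with g2, so
    the unit e1 / e2 is the seventh power of w2 / w1.\<close>
  have "49 dvd e1 * f - (b * w2) ^ 7"
  proof -
    have "49 dvd b * w1 - 1" using b dvdI[of "b * w1 - 1" 49 "- r"] by (simp add: algebra_simps)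
    from dvd_power_diff[OF this, of 7] have i: "49 dvd (b * w1) ^ 7 - 1" by simp
    have "49 dvd ?g1 - ?g2" unfolding diff using Z(2) by (rule dvd_mult)
    hence "49 dvd f * b ^ 7 * (e1 * w1 ^ 7 - e2 * w2 ^ 7)" unfolding e1(2) e2(2) by (rule dvd_mult)
    also have "f * b ^ 7 * (e1 * w1 ^ 7 - e2 * w2 ^ 7) = e1 * f * (b * w1) ^ 7 - (e2 * f) * (b * w2) ^ 7"
      by (simp add: algebra_simps power_mult_distrib)
    finally have ii: "49 dvd e1 * f * (b * w1) ^ 7 - (b * w2) ^ 7" unfolding f[symmetric] by simp
    have "49 dvd e1 * f * ((b * w1) ^ 7 - 1)" using i by (rule dvd_mult)
    hence "49 dvd e1 * f - e1 * f * (b * w1) ^ 7"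
      unfolding dvd_diff_sym[of 49 "e1 * f"] by (simp add: algebra_simps)
    from dvd_diff_chain[OF this ii] show ?thesis .
  qed
  moreover have "e1 * f dvd 1" using mult_dvd_mono[OF e1(1) f1] by simp
  ultimately obtain v where v: "v dvd 1" "e1 * f = v ^ 7" using kummer_unit by blast
  define x where "x = v * w1"
  define y where "y = w2"
  have gx: "?g1 = e2 * x ^ 7"
  proof -
    have "e2 * x ^ 7 = (e2 * f) * e1 * w1 ^ 7" unfolding x_def power_mult_distrib v(2)[symmetric] by (simp add: mult_ac)
    thus ?thesis unfolding f[symmetric] e1(2) by simp
  qed
  have gy: "?g2 = e2 * y ^ 7" unfolding y_def by (rule e2(2))
  have xdvd: "x dvd ?g1" and ydvd: "y dvd ?g2" unfolding gx gy by (simp_all add: dvd_power)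
  have xy: "comax x y"
    using comax_dvd[OF comax_dvd_left[OF D(3) xdvd] ydvd] .
  have xy7: "comax 7 (x * y)"
    using comax_dvd[OF comax_sym[OF D(4)] xdvd] comax_dvd[OF comax_sym[OF D(5)] ydvd] by (rule comax_mult)
  have dxy: "e2 * (x ^ 7 - y ^ 7) = ?s * Z" using diff unfolding gx gy by (simp add: right_diff_distrib)
  have xyZ: "q dvd x ^ 7 - y ^ 7" if "q dvd Z" for q
  proof -
    have "q dvd f * (e2 * (x ^ 7 - y ^ 7))" unfolding dxy using that by (intro dvd_mult)
    also have "f * (e2 * (x ^ 7 - y ^ 7)) = (e2 * f) * (x ^ 7 - y ^ 7)" by (simp add: mult_ac)
    finally show ?thesis unfolding f[symmetric] by simp
  qed
  define d where "d = x - y"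
  have "p1 dvd d"
  proof -
    have p1: "prime (7::nat)" "p1 dvd of_nat 7" using p1_powers(3) by simp_all
    have "p1 dvd (x + (- y)) ^ 7 - x ^ 7 - (- y) ^ 7" using freshman[OF p1, of x "- y" 1] by simp
    hence "p1 dvd d ^ 7 - (x ^ 7 - y ^ 7)" by (simp add: d_def algebra_simps)
    moreover have "p1 dvd x ^ 7 - y ^ 7"
      by (rule xyZ[OF dvd_trans[OF p1_powers(3) dvd_49_7[OF Z(2)]]])
    ultimately have "p1 dvd d ^ 7" by (rule iffD2[OF dvd_diff_trans])
    from reduced_modD[OF reduced_pi0 this] show ?thesis by simp
  qed
  then obtain d0 where d0: "d = p1 * d0" by (rule dvdE)
  \<comment> \<open>These are the quotients of \<open>d^2\<close> by the three conjugates
    \<open>p1\<close>, \<open>p2\<close>, \<open>p3\<close>, which are associates.\<close>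
  define m1 where "m1 = p1 * d0^2"
  define m2 where "m2 = p1 * C7 0 (- 1) 1 * d0^2"
  define m3 where "m3 = p1 * C7 3 (- 1) (- 1) * d0^2"
  have m: "d^2 = p1 * m1" "d^2 = p2 * m2" "d^2 = p3 * m3"
  proof -
    show "d^2 = p1 * m1" by (simp add: d0 m1_def power2_eq_square mult_ac)
    have "d^2 = p1 * (p2 * C7 0 (- 1) 1) * d0^2" "d^2 = p1 * (p3 * C7 3 (- 1) (- 1)) * d0^2"
      unfolding p_assoc[symmetric] by (simp_all add: d0 power2_eq_square mult_ac)
    thus "d^2 = p2 * m2" "d^2 = p3 * m3" unfolding m2_def m3_def by (simp_all only: mult_ac)
  qed
  define H where "H = (m1 + x * y) * (m2 + x * y) * (m3 + x * y)"
  have prod: "x ^ 7 - y ^ 7 = 7 * (d * H)"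
  proof -
    have "x ^ 7 - y ^ 7 = d * (p1 * (m1 + x * y) * (p2 * (m2 + x * y)) * (p3 * (m3 + x * y)))"
      unfolding seventh_power_diff d_def[symmetric] using m by (simp add: distrib_left)
    also have "\<dots> = (p1 * p2 * p3) * (d * H)" unfolding H_def by (simp only: mult_ac)
    finally show ?thesis unfolding p_sums .
  qed
  have rel: "e2 * (7 * (d * H)) = ?s * Z" using dxy unfolding prod .
  have cm: "comax p1 (m + x * y)" if "p1 dvd m" for m
  proof -
    have "comax p1 (x * y)" by (rule comax_dvd_left[OF xy7 p1_powers(3)])
    thus ?thesis by (rule comax_cong) (use that in \<open>simp add: dvd_diff\<close>)
  qed
  have cH: "comax (p1 ^ 5) H"
  proof -
    have "p1 dvd m1" "p1 dvd m2" "p1 dvd m3" unfolding m1_def m2_def m3_def mult.assoc by (rule dvd_triv_left)+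
    hence "comax p1 H" unfolding H_def by (intro comax_mult cm)
    from comax_powers[OF this, of 5 1] show ?thesis by simp
  qed
  \<comment> \<open>H is prime to \<open>p1\<close>, so in e2 * 7 * d * H = s * Z the factor d
    receives at least the valuation of 49 s / 7, which is 5. Then d^2 is divisible by 343, and Z' =
    d^2 / 7 by 49 again.\<close>
  have "p1 ^ 5 dvd d"
  proof -
    obtain z where z: "Z = 49 * z" using Z(2) by (rule dvdE)
    have "7 * (e2 * (d * H)) = 7 * (7 * ?s * z)" using rel unfolding z by (simp add: mult_ac)
    moreover have "(7::k9) \<noteq> 0" by (simp add: numeral_k9 zero_k9_def zero_c13_def numeral_c13)
    ultimately have "e2 * (d * H) = 7 * ?s * z" by (metis mult_left_cancel)
    hence "p1 ^ 5 dvd e2 * (d * H)" using dvd_mult2[OF p1_powers(1), of z] by simp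
    hence "p1 ^ 5 dvd f * (e2 * (d * H))" by (rule dvd_mult)
    also have "f * (e2 * (d * H)) = (e2 * f) * (H * d)" by (simp add: mult_ac)
    finally have "p1 ^ 5 dvd H * d" unfolding f[symmetric] by simp
    thus ?thesis by (rule comax_cancel[OF cH])
  qed
  hence "(p1 ^ 5)^2 dvd d^2" by (rule dvd_power_same)
  hence "343 dvd d^2" using p1_powers(2) by (auto simp flip: power_mult intro: dvd_trans)
  then obtain z where z: "d^2 = 343 * z" by (rule dvdE)
  define Z' where "Z' = 49 * z"
  define Y' where "Y' = x * y"
  have dZ: "d^2 = 7 * Z'" unfolding z Z'_def by simp
  have p_nz: "(p1::k9) \<noteq> 0" "(p2::k9) \<noteq> 0" "(p3::k9) \<noteq> 0" by (simp_all add: zero_k9_def zero_c13_def numeral_c13 one_c13_def)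
  have g: "m1 = p2 * p3 * Z'" "m2 = p1 * p3 * Z'" "m3 = p1 * p2 * Z'"
  proof -
    have "p1 * m1 = p1 * (p2 * p3 * Z')" "p2 * m2 = p2 * (p1 * p3 * Z')" "p3 * m3 = p3 * (p1 * p2 * Z')"
      using m unfolding dZ p_sums(3)[symmetric] by (simp_all only: mult_ac)
    thus "m1 = p2 * p3 * Z'" "m2 = p1 * p3 * Z'" "m3 = p1 * p2 * Z'"
      using p_nz mult_left_cancel by blast+
  qed
  have s7: "?s dvd 7" by (rule p_diffs_dvd)
  have sZ: "?s dvd Z" by (rule dvd_trans[OF s7 dvd_49_7[OF Z(2)]])
  have s0: "?s \<noteq> 0" using p_nz by (auto simp: k9_defs c13_defs numeral_c13)
  have d_nz: "d \<noteq> 0" using rel s0 Z(1) by auto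
  have sq: "e2^2 * 343 * Z' * H^2 = ?s^2 * Z^2"
  proof -
    have "(e2 * (7 * (d * H)))^2 = e2^2 * 49 * d^2 * H^2" by (simp add: power2_eq_square mult_ac)
    also have "\<dots> = e2^2 * 343 * Z' * H^2" unfolding dZ by (simp add: mult_ac)
    finally show ?thesis unfolding rel by (simp add: power_mult_distrib)
  qed
  have cancel7: "q dvd Z'" if "q dvd d" "comax q 7" for q
  proof (rule comax_cancel[OF that(2)])
    show "q dvd 7 * Z'" unfolding dZ[symmetric] power2_eq_square using that(1) by (rule dvd_mult2)
  qed
  have "state q Z' Y'" unfolding state_def
  proof (intro conjI allI impI)
    show "Z' \<noteq> 0" using d_nz dZ by auto
    have "comax x (- d)" using xy by (rule comax_cong) (simp add: d_def)
    hence "comax x d" by (rule comax_dvd) simp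
    moreover have "comax y d" using comax_cong[OF comax_sym[OF xy], of d] by (simp add: d_def)
    ultimately have "comax d (x * y)" by (intro comax_mult) (auto intro: comax_sym)
    hence "comax (d^2) (x * y)" using comax_powers[of d "x * y" 2 1] by simp
    thus "comax Z' Y'" unfolding Y'_def dZ by (rule comax_dvd_left) simp
    show "49 dvd Z'" unfolding Z'_def by simp
    show "3 dvd Z'"
    proof (rule cancel7)
      show "3 dvd d" unfolding d_def by (rule seventh_power_cancel_mod_3[OF power27_mod_3 xyZ[OF Z(3)]])
      have "(-2) * 3 + 1 * 7 = (1::k9)" by simp
      thus "comax (3::k9) 7" by (rule comaxI)
    qed
    show "q = 1 \<or> q = R0" using st by (simp add: state_def)
    thus "q dvd Z'"
    proof
      assume q: "q = R0"
      show ?thesis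
      proof (rule cancel7)
        show "q dvd d" unfolding d_def q by (rule seventh_power_cancel_mod_R0[OF xyZ[OF Z(4)[unfolded q]]])
        have "(-1) * 13 + 2 * 7 = (1::k9)" by simp
        hence "comax (13::k9) 7" by (rule comaxI)
        moreover have "q dvd 13" using rhom_dvd[OF rhom_C7 rho0_dvd_13] by (simp add: numeral_k9 q)
        ultimately show "comax q 7" by (rule comax_dvd_left)
      qed
    qed simp
    fix i j :: nat
    have "0 \<le> emb i j (d^2)" by (simp add: rhom_power[OF rhom_emb])
    thus "0 \<le> emb i j Z'" unfolding dZ by (simp add: rhom_mult[OF rhom_emb] rhom_numeral[OF rhom_emb])
    have "7 * Z' + 4 * Y' = (x + y)^2"
      unfolding dZ[symmetric] Y'_def d_def by (simp add: power2_eq_square algebra_simps)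
    thus "0 \<le> emb i j (7 * Z' + 4 * Y')" by (simp add: rhom_power[OF rhom_emb])
  next
    \<comment> \<open>In \<open>sq\<close> multiplied by c^2, the factors s^12 and e^12 raise s^2
      and e^2 to the fourteenth powers, and the square of c * Z = e * t^7 supplies t^14.\<close>
    have "c^2 * (343 * e2^2 * ?s ^ 12 * e ^ 12) * Z' * H^2 = (?s^2 * e^2 * t^2) ^ 7"
    proof -
      have "c^2 * (343 * e2^2 * ?s ^ 12 * e ^ 12) * Z' * H^2 = ?s ^ 12 * e ^ 12 * c^2 * (e2^2 * 343 * Z' * H^2)"
        by (simp only: mult_ac)
      also have "\<dots> = ?s ^ 12 * e ^ 12 * ?s^2 * (c * Z)^2" unfolding sq by (simp only: mult_ac power_mult_distrib)
      also have "\<dots> = (?s ^ 12 * ?s^2) * (e ^ 12 * e^2) * (t ^ 7)^2" unfolding e(3) by (simp only: mult_ac power_mult_distrib)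
      also have "\<dots> = (?s^2 * e^2 * t^2) ^ 7"
      proof -
        have "q ^ 12 * q^2 = (q^2) ^ 7" for q :: k9 by (simp flip: power_mult power_add)
        thus ?thesis unfolding power_mult_distrib[of _ "t^2"] power_mult_distrib[of "?s^2" "e^2"]
          by (simp flip: power_mult)
      qed
      finally show ?thesis .
    qed
    moreover have "c^2 * (343 * e2^2 * ?s ^ 12 * e ^ 12) dvd (21 * q) ^ (k * 2 + 15)"
    proof -
      have "c^2 dvd (21 * q) ^ (k * 2)" unfolding power_mult by (rule dvd_power_same[OF e(2)])
      moreover have "343 * e2^2 * ?s ^ 12 * e ^ 12 dvd (21 * q) ^ 3 * 1 ^ 2 * (21 * q) ^ 12 * 1 ^ 12"
      proof (intro mult_dvd_mono dvd_7_powers[OF s7] dvd_power_same[OF e(1)] dvd_power_same[OF e2(1)])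
        have "(7::k9) ^ 3 dvd (21 * q) ^ 3" by (rule dvd_7_powers) simp
        thus "(343::k9) dvd (21 * q) ^ 3" by simp
      qed
      ultimately have "c^2 * (343 * e2^2 * ?s ^ 12 * e ^ 12) dvd (21 * q) ^ (k * 2) * ((21 * q) ^ 3 * 1 ^ 2 * (21 * q) ^ 12 * 1 ^ 12)"
        by (rule mult_dvd_mono)
      thus ?thesis by (simp only: power_one mult_1_right mult_1_left power_add[symmetric]) simp
    qed
    ultimately show "\<exists>c w k. c dvd (21 * q) ^ k \<and>
      c * Z' * ((p2 * p3 * Z' + Y') * (p1 * p3 * Z' + Y') * (p1 * p2 * Z' + Y'))^2 = w ^ 7"
      unfolding H_def g Y'_def by blast
  qed
  moreover have "Z' dvd Z ^ 4"
  proof -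
    have "Z' dvd ?s^2 * Z^2" unfolding sq[symmetric] by (simp add: mult.assoc)
    also have "\<dots> dvd Z^2 * Z^2" by (rule mult_dvd_mono[OF dvd_power_same[OF sZ] dvd_refl])
    finally show ?thesis by (simp flip: power_add)
  qed
  moreover have "p2 * p3 * Z' + Y' dvd Z^2"
  proof -
    have "m1 + x * y dvd ?s * Z" unfolding rel[symmetric] H_def by (simp add: mult.assoc)
    also have "\<dots> dvd Z * Z" by (rule mult_dvd_mono[OF sZ dvd_refl])
    finally show ?thesis unfolding g Y'_def by (simp add: power2_eq_square)
  qed
  ultimately show ?thesis by blast
qed

section \<open>Residues modulo n and termination of the descent\<close>

definition residues_c13 :: "int \<Rightarrow> c13 set" where
  "residues_c13 n = (\<lambda>(a, b, c). C13 a b c) ` ({0..<n} \<times> {0..<n} \<times> {0..<n})"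

definition residues :: "int \<Rightarrow> k9 set" where
  "residues n = (\<lambda>(a, b, c). C7 a b c) ` (residues_c13 n \<times> residues_c13 n \<times> residues_c13 n)"

lemma finite_residues: "finite (residues n)"
  unfolding residues_def residues_c13_def by (intro finite_imageI finite_cartesian_product) auto

lemma residue_exists:
  assumes "n > 0" shows "\<exists>r\<in>residues n. of_int n dvd x - r"
proof -
  define red where "red y = C13 (c0 y mod n) (c1 y mod n) (c2 y mod n)" for y
  have 1: "red y \<in> residues_c13 n" for y
    unfolding red_def residues_c13_def using assms by (intro image_eqI[of _ _ "(c0 y mod n, c1 y mod n, c2 y mod n)"]) auto
  have 2: "of_int n dvd y - red y" for y
    unfolding of_int_dvd_c13 by (simp add: red_def minus_c13_def)
  have "C7 (red (a0 x)) (red (a1 x)) (red (a2 x)) \<in> residues n"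
    unfolding residues_def by (intro image_eqI[of _ _ "(red (a0 x), red (a1 x), red (a2 x))"]) (auto simp: 1)
  moreover have "of_int n dvd x - C7 (red (a0 x)) (red (a1 x)) (red (a2 x))"
    unfolding of_int_k9[of n] C7_dvd_k9 using 2 by (simp add: minus_k9_def of_int_c13)
  ultimately show ?thesis by blast
qed

lemma residue_unique:
  assumes "r \<in> residues n" "r' \<in> residues n" "of_int n dvd r - r'" shows "r = r'"
proof -
  have 1: "q = q'" if "q \<in> residues_c13 n" "q' \<in> residues_c13 n" "of_int n dvd q - q'" for q q'
  proof -
    have "a = b" if "0 \<le> a" "a < n" "0 \<le> b" "b < n" "n dvd a - b" for a b
      using that by (metis mod_eq_dvd_iff mod_pos_pos_trivial)
    moreover have "n dvd c0 q - c0 q'" "n dvd c1 q - c1 q'" "n dvd c2 q - c2 q'"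
      using that(3) unfolding of_int_dvd_c13 by (simp_all add: minus_c13_def)
    ultimately show ?thesis using that(1,2) unfolding residues_c13_def by (cases q; cases q') auto
  qed
  have "of_int n dvd a0 r - a0 r'" "of_int n dvd a1 r - a1 r'" "of_int n dvd a2 r - a2 r'"
    using assms(3) unfolding of_int_k9[of n] C7_dvd_k9 by (simp_all add: minus_k9_def of_int_c13)
  thus ?thesis using assms(1,2) 1 unfolding residues_def by (cases r; cases r') auto
qed

text \<open>Multiplication by a nonzerodivisor is injective on the finite residue ring, hence
  surjective.\<close>

lemma regular_mod_comax:
  assumes "n > 0" "\<And>r. of_int n dvd r * g \<Longrightarrow> of_int n dvd r"
  shows "comax g (of_int n :: k9)"
proof -
  have "\<forall>x. \<exists>r. r \<in> residues n \<and> of_int n dvd x - r" using residue_exists[OF assms(1)] by blast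
  then obtain red where red: "red x \<in> residues n" "of_int n dvd x - red x" for x by metis
  have "inj_on (\<lambda>r. red (r * g)) (residues n)"
  proof (rule inj_onI)
    fix r r' assume r: "r \<in> residues n" "r' \<in> residues n" "red (r * g) = red (r' * g)"
    have "of_int n dvd red (r' * g) - r' * g" using red(2)[of "r' * g"] dvd_diff_sym by blast
    hence "of_int n dvd r * g - r' * g" using red(2)[of "r * g"] r(3) by (auto intro: dvd_diff_chain)
    hence "of_int n dvd (r - r') * g" by (simp add: left_diff_distrib)
    from assms(2)[OF this] residue_unique r show "r = r'" by blast
  qed
  hence "(\<lambda>r. red (r * g)) ` residues n = residues n"
    using finite_residues red(1) by (intro endo_inj_surj) auto
  then obtain r where r: "red 1 = red (r * g)" using red(1)[of 1] by blast
  have "of_int n dvd red 1 - r * g" using red(2)[of "r * g"] r dvd_diff_sym by metis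
  from dvd_diff_chain[OF red(2) this] obtain q where "1 - r * g = of_int n * q" by (rule dvdE)
  hence "r * g + q * of_int n = 1" by (simp add: algebra_simps)
  thus ?thesis by (rule comaxI)
qed

text \<open>The descent terminates because it loses the primes dividing the nonunit \<open>g\<^sub>1\<close>. Counting residues modulo \<open>n\<close> killed
  by a power of \<open>Z\<close> measures this without unique factorisation.\<close>

definition torsion :: "int \<Rightarrow> k9 \<Rightarrow> k9 set" where
  "torsion n Z = {r \<in> residues n. \<exists>k. of_int n dvd r * Z ^ k}"

text \<open>A nonunit g that divides Z^2 is a zero divisor modulo n. A nonzero residue killed by g
  is killed by Z^2, but by no power of Z', since Z' and g are comaximal.\<close>

lemma torsion_decreases:
  assumes "n > 0" "Z dvd of_int n ^ m" "comax Z' g" "\<not> g dvd 1" "Z' dvd Z ^ 4" "g dvd Z ^ 2"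
  shows "torsion n Z' \<subset> torsion n Z"
proof
  have "Z' ^ k dvd Z ^ (4 * k)" for k unfolding power_mult by (rule dvd_power_same[OF assms(5)])
  thus "torsion n Z' \<subseteq> torsion n Z"
    unfolding torsion_def by (blast intro: dvd_trans mult_dvd_mono[OF dvd_refl])
  have "\<not> comax g (of_int n)"
  proof
    assume "comax g (of_int n)"
    hence "comax g Z" using comax_dvd[OF comax_power assms(2)] by blast
    hence "comax g (Z ^ 2)" by (rule comax_power)
    from comax_unit[OF this assms(6)] assms(4) show False by blast
  qed
  then obtain r where r: "of_int n dvd r * g" "\<not> of_int n dvd r" using regular_mod_comax[OF assms(1)] by blast
  obtain r' where r': "r' \<in> residues n" "of_int n dvd r - r'" using residue_exists[OF assms(1)] by blast
  have "of_int n dvd r * g - r' * g" using dvd_mult2[OF r'(2), of g] by (simp add: left_diff_distrib)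
  hence r'g: "of_int n dvd r' * g" using r(1) by (rule iffD1[OF dvd_diff_trans])
  have r'n: "\<not> of_int n dvd r'" using r(2) dvd_diff_trans[OF r'(2)] by blast
  have "r' \<in> torsion n Z"
    unfolding torsion_def using r'(1) dvd_trans[OF r'g mult_dvd_mono[OF dvd_refl assms(6)]] by blast
  moreover have "r' \<notin> torsion n Z'"
  proof
    assume "r' \<in> torsion n Z'"
    then obtain k where k: "of_int n dvd r' * Z' ^ k" unfolding torsion_def by blast
    obtain a b where ab: "a * Z' ^ k + b * g = 1"
      using comax_powers[OF assms(3), of k 1] unfolding comax_def by auto
    have "of_int n dvd a * (r' * Z' ^ k) + b * (r' * g)" by (rule dvd_add[OF dvd_mult[OF k] dvd_mult[OF r'g]])
    also have "a * (r' * Z' ^ k) + b * (r' * g) = r' * (a * Z' ^ k + b * g)" by (simp add: algebra_simps)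
    finally have "of_int n dvd r'" unfolding ab by simp
    thus False using r'n by blast
  qed
  ultimately show "torsion n Z' \<noteq> torsion n Z" by blast
qed

theorem no_state: "\<not> state q Z Y"
proof
  assume st: "state q Z Y"
  \<comment> \<open>The modulus stays fixed during the descent: every later Z still divides a power
    of n.\<close>
  define n where "n = \<bar>n9 Z\<bar>"
  have n: "n > 0" using st unfolding n_def state_def by (simp add: n9_0_iff)
  have "Z dvd of_int n ^ 1"
    using dvd_n9[of Z] unfolding n_def by (auto simp: abs_if)
  then obtain m where "Z dvd of_int n ^ m" by blast
  with st show False
  proof (induction "card (torsion n Z)" arbitrary: Z Y m rule: less_induct)
    case less
    obtain Z' Y' where st': "state q Z' Y'" "Z' dvd Z ^ 4" "p2 * p3 * Z' + Y' dvd Z ^ 2"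
      using state_step[OF less.prems(1)] by blast
    have "torsion n Z' \<subset> torsion n Z"
      by (rule torsion_decreases[OF n less.prems(2) comax_sym[OF state_decomposition(1)[OF st'(1)]]
            state_not_unit[OF st'(1)] st'(2,3)])
    hence "card (torsion n Z') < card (torsion n Z)"
      by (intro psubset_card_mono) (auto simp: torsion_def finite_residues)
    moreover have "Z' dvd of_int n ^ (m * 4)"
      unfolding power_mult by (rule dvd_trans[OF st'(2) dvd_power_same[OF less.prems(2)]])
    ultimately show False using less.hyps st'(1) by blast
  qed
qed

section \<open>The sextic ring is a principal ideal domain\<close>

abbreviation th :: fq where "th \<equiv> Fq 0 1"

definition th_real :: real where "th_real = (kr + sqrt (kr^2 - 4 * e13 kap2)) / 2"

lemma th_real: "th_real^2 = kr * th_real - e13 kap2"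
proof -
  have "kr * (kr + 1) \<le> 1 * (1 + 1)" using kr by (intro mult_mono) auto
  hence "kr + kr^2 \<le> 2" by (simp add: power2_eq_square algebra_simps)
  hence "e13 kap2 \<le> 0" by (simp add: e13_def)
  hence "sqrt (kr^2 - 4 * e13 kap2)^2 = kr^2 - 4 * e13 kap2"
    using zero_le_power2[of kr] by (intro real_sqrt_pow2) linarith
  moreover have "2 * th_real - kr = sqrt (kr^2 - 4 * e13 kap2)" by (simp add: th_real_def field_simps)
  ultimately have "(2 * th_real - kr)^2 = kr^2 - 4 * e13 kap2" by simp
  thus ?thesis by (simp add: power2_eq_square algebra_simps)
qed

definition ef :: "fq \<Rightarrow> real" where "ef x = e13 (f0 x) + e13 (f1 x) * th_real"

lemma rhom_ef: "rhom ef"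
proof (rule rhomI)
  note h = rhom_simps[OF rhom_e13]
  show "ef 1 = 1" "\<And>x y. ef (x + y) = ef x + ef y" by (simp_all add: ef_def fq_defs h algebra_simps)
  fix x y
  have k: "e13 kap = kr" by (simp add: e13_def)
  have "ef x * ef y = e13 (f0 x) * e13 (f0 y) + (e13 (f0 x) * e13 (f1 y) + e13 (f1 x) * e13 (f0 y)) * th_real
      + e13 (f1 x) * e13 (f1 y) * th_real^2" by (simp add: ef_def power2_eq_square algebra_simps)
  also have "\<dots> = ef (x * y)" unfolding th_real by (simp add: ef_def times_fq_def h k algebra_simps)
  finally show "ef (x * y) = ef x * ef y" by simp
qed

definition emb_fq :: "nat \<Rightarrow> fq \<Rightarrow> real" where "emb_fq j x = ef ((sf ^^ j) x)"

lemma rhom_sf_pow: "rhom (sf ^^ j)" by (rule rhom_funpow[OF rhom_sf])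

lemma rhom_emb6: "rhom (emb_fq j)"
  unfolding emb_fq_def by (rule rhom_comp[OF rhom_ef rhom_sf_pow])

lemma sf_Fq: "(sf ^^ j) (Fq y 0) = Fq ((sk13 ^^ j) y) 0"
  by (induction j) (simp_all add: sf_def rhom_simps[OF rhom_sk13])

lemma emb_fq_Fq: "emb_fq j (Fq y 0) = e13 ((sk13 ^^ j) y)"
  unfolding emb_fq_def sf_Fq by (simp add: ef_def rhom_simps[OF rhom_e13])

definition nF :: "fq \<Rightarrow> int" where "nF x = n13 (nf13 x)"

lemma fbar_fbar: "fbar (fbar x) = x"
  by (cases x) (simp add: fbar_def)

lemma sf_six: "sf (sf (sf (sf (sf (sf x))))) = x"
  unfolding sf_sq_fbar fbar_fbar by (rule refl)

lemma nF_prod: "(\<Prod>j<6. (sf ^^ j) x) = of_int (nF x)"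
proof -
  have "(\<Prod>j<6. (sf ^^ j) x) = (x * fbar x) * sf (x * fbar x) * sf (sf (x * fbar x))"
    by (simp add: eval_nat_numeral rhom_mult[OF rhom_sf] mult_ac flip: sf_sq_fbar)
  also have "\<dots> = Fq (nf13 x * sk13 (nf13 x) * sk13 (sk13 (nf13 x))) 0"
    unfolding fbar_mult using sf_Fq[of 1] sf_Fq[of 2] by (simp add: numeral_2_eq_2 fq_embed)
  also have "\<dots> = of_int (nF x)" by (simp add: n13_C13 nF_def of_int_fq)
  finally show ?thesis .
qed

lemma nF_emb6: "real_of_int (nF x) = (\<Prod>j<6. emb_fq j x)"
proof -
  have "real_of_int (nF x) = ef (of_int (nF x))" by (simp add: rhom_of_int[OF rhom_ef])
  also have "\<dots> = (\<Prod>j<6. emb_fq j x)" unfolding nF_prod[symmetric] emb_fq_def by (rule rhom_prod[OF rhom_ef])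
  finally show ?thesis .
qed

lemma nF_mult: "nF (x * y) = nF x * nF y"
proof -
  have "real_of_int (nF (x * y)) = real_of_int (nF x * nF y)"
    unfolding of_int_mult nF_emb6 by (simp add: rhom_mult[OF rhom_emb6] prod.distrib)
  thus ?thesis by linarith
qed

lemma nf13_zero: "nf13 0 = 0" by (simp add: nf13_def zero_fq_def)

lemma nF_0_iff: "nF x = 0 \<longleftrightarrow> x = 0"
  unfolding nF_def n13_0_iff using nf13_0 nf13_zero by blast

lemma nF_1: "nF 1 = 1"
  by (simp add: nF_def nf13_def n13_def sk13_def fq_defs c13_defs)

lemma nF_minus: "nF (- x) = nF x"
  by (simp add: nF_def nf13_def uminus_fq_def)

lemma dvd_nF: "x dvd of_int (nF x)"
  unfolding nF_prod[symmetric] using dvd_prodI[of "{..<6}" 0 "\<lambda>j. (sf ^^ j) x"] by simp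

lemma nF_unit: "x dvd 1 \<longleftrightarrow> \<bar>nF x\<bar> = 1"
proof
  assume "x dvd 1"
  then obtain y where "1 = x * y" by (rule dvdE)
  hence "nF x * nF y = 1" using nF_mult[of x y] nF_1 by simp
  thus "\<bar>nF x\<bar> = 1" using zmult_eq_1_iff by auto
next
  assume "\<bar>nF x\<bar> = 1"
  hence "of_int (nF x) dvd (1::fq)" by (auto simp: abs_if split: if_splits)
  thus "x dvd 1" using dvd_nF dvd_trans by blast
qed

lemma emb_fq_0_iff: "j < 6 \<Longrightarrow> emb_fq j x = 0 \<longleftrightarrow> x = 0"
proof
  assume j: "j < 6" and "emb_fq j x = 0"
  hence "real_of_int (nF x) = 0" unfolding nF_emb6 by (auto simp: prod_zero_iff)
  thus "x = 0" by (simp add: nF_0_iff)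
qed (simp add: rhom_0[OF rhom_emb6])

definition trF :: "fq \<Rightarrow> c13" where "trF x = 2 * f0 x + kap * f1 x"

lemma trF_eq: "x + (sf ^^ 3) x = Fq (trF x) 0"
  by (simp add: numeral_3_eq_3 sf_sq_fbar fbar_def trF_def plus_fq_def)

text \<open>The discriminant of \<theta> over the cubic ring is not zero, so x is determined by the
  relative traces of x and \<theta> x. This carries finiteness over from the cubic ring.\<close>

lemma trF_inj:
  assumes "trF x = 0" "trF (th * x) = 0" shows "x = 0"
proof -
  have "2 * f0 x = - (kap * f1 x)" using assms(1) by (simp add: trF_def eq_neg_iff_add_eq_0)
  moreover have "kap * (2 * f0 x) + 2 * (kap * kap * f1 x) - 4 * (kap2 * f1 x) = 2 * trF (th * x)"
    by (simp add: trF_def times_fq_def algebra_simps)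
  ultimately have "(kap * kap - 4 * kap2) * f1 x = 0" using assms(2) by (simp add: algebra_simps)
  moreover have "kap * kap - 4 * kap2 = C13 12 (- 4) (- 3)" by (simp add: c13_defs numeral_c13)
  moreover have "C13 12 (- 4) (- 3) \<noteq> 0" by (simp add: zero_c13_def)
  ultimately have 1: "f1 x = 0" by (metis mult_eq_0_iff)
  hence "2 * f0 x = 0" using assms(1) by (simp add: trF_def)
  moreover have "(2::c13) \<noteq> 0" by (simp add: numeral_c13 zero_c13_def)
  ultimately have "f0 x = 0" by (metis mult_eq_0_iff)
  thus ?thesis using 1 by (cases x) (simp add: zero_fq_def)
qed

lemma finite_fq_bounded: "finite {x. \<forall>j<6. \<bar>emb_fq j x\<bar> \<le> C}"
proof -
  define M where "M = (\<Sum>j<6. \<bar>emb_fq j th\<bar>) + 1"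
  define B where "B = 2 * M * \<bar>C\<bar>"
  let ?F = "{y. \<forall>j<3. \<bar>e13 ((sk13 ^^ j) y)\<bar> \<le> B}" and ?S = "{x. \<forall>j<6. \<bar>emb_fq j x\<bar> \<le> C}"
  have M1: "1 \<le> M" unfolding M_def by (simp add: sum_nonneg)
  have tr: "\<bar>e13 ((sk13 ^^ j) (trF x))\<bar> \<le> B" if "j < 3" "\<And>j. j < 6 \<Longrightarrow> \<bar>emb_fq j x\<bar> \<le> M * \<bar>C\<bar>" for x j
  proof -
    have "e13 ((sk13 ^^ j) (trF x)) = emb_fq j x + emb_fq (j + 3) x"
      unfolding emb_fq_Fq[symmetric] trF_eq[symmetric] rhom_add[OF rhom_emb6] by (simp add: emb_fq_def funpow_add)
    thus ?thesis using that(2)[of j] that(2)[of "j + 3"] that(1) by (simp add: B_def)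
  qed
  have C: "\<bar>C\<bar> \<le> M * \<bar>C\<bar>" using mult_right_mono[OF M1, of "\<bar>C\<bar>"] by simp
  have "(\<lambda>x. (trF x, trF (th * x))) ` ?S \<subseteq> ?F \<times> ?F"
  proof
    fix v assume "v \<in> (\<lambda>x. (trF x, trF (th * x))) ` ?S"
    then obtain x where v: "v = (trF x, trF (th * x))" and x: "\<And>j. j < 6 \<Longrightarrow> \<bar>emb_fq j x\<bar> \<le> C" by blast
    have 1: "\<bar>emb_fq j x\<bar> \<le> M * \<bar>C\<bar>" if "j < 6" for j using x[OF that] C by linarith
    have 2: "\<bar>emb_fq j (th * x)\<bar> \<le> M * \<bar>C\<bar>" if j: "j < 6" for j
    proof -
      have "\<bar>emb_fq j th\<bar> \<le> (\<Sum>j<6. \<bar>emb_fq j th\<bar>)" using j by (intro member_le_sum) auto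
      hence "\<bar>emb_fq j th\<bar> \<le> M" by (simp add: M_def)
      thus ?thesis unfolding rhom_mult[OF rhom_emb6] abs_mult using x[OF j] by (intro mult_mono) auto
    qed
    show "v \<in> ?F \<times> ?F" unfolding v using tr[OF _ 1] tr[OF _ 2] by auto
  qed
  moreover have "finite (?F \<times> ?F)" using finite_c13_bounded by auto
  ultimately have "finite ((\<lambda>x. (trF x, trF (th * x))) ` ?S)" by (rule finite_subset)
  moreover have "inj_on (\<lambda>x. (trF x, trF (th * x))) ?S"
  proof (rule inj_onI)
    fix x y assume "(trF x, trF (th * x)) = (trF y, trF (th * y))"
    moreover have "trF (x - y) = trF x - trF y" for x y
      by (simp add: trF_def minus_fq_def algebra_simps)
    ultimately have "trF (x - y) = 0" "trF (th * (x - y)) = 0" by (simp_all add: right_diff_distrib)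
    from trF_inj[OF this] show "x = y" by simp
  qed
  ultimately show ?thesis by (rule finite_imageD)
qed

lemma units_fq_dependent:
  assumes "\<And>j. j < 6 \<Longrightarrow> u j dvd 1"
  shows "\<exists>d :: nat \<Rightarrow> int. (\<exists>j<6. d j \<noteq> 0) \<and> (\<Prod>j<6. ef (u j) powi d j) = 1"
proof -
  have "\<exists>d :: nat \<Rightarrow> int. (\<exists>j<6. d j \<noteq> 0) \<and> (\<Prod>j<6. emb_fq 0 (u j) powi d j) = 1"
  proof (rule units_dependent[where U = "{x. x dvd 1}" and e = emb_fq])
    show "(\<Prod>i<6. \<bar>emb_fq i x\<bar>) = 1" if "x \<in> {x. x dvd 1}" for x
    proof -
      have "\<bar>real_of_int (nF x)\<bar> = 1" using that nF_unit[of x] by simp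
      thus ?thesis unfolding nF_emb6 abs_prod .
    qed
    show "finite {x \<in> {x. x dvd 1}. \<forall>i<6. \<bar>emb_fq i x\<bar> \<le> C}" for C
      by (rule finite_subset[OF _ finite_fq_bounded[of C]]) auto
    show "\<exists>y\<in>{x. x dvd 1}. x * y = 1" if x: "x \<in> {x. x dvd 1}" for x :: fq
    proof -
      obtain y where "1 = x * y" using x by (auto elim: dvdE)
      moreover have "y dvd x * y" by (rule dvd_triv_right)
      ultimately show ?thesis by auto
    qed
    show "x * y \<in> {x. x dvd 1}" if "x \<in> {x. x dvd 1}" "y \<in> {x. x dvd 1}" for x y :: fq
      using that mult_dvd_mono[of x 1 y 1] by simp
  qed (use assms in \<open>simp_all add: rhom_simps[OF rhom_emb6]\<close>)
  thus ?thesis by (simp add: emb_fq_def)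
qed

text \<open>Subtracting row z from the other rows and adding all columns to column z makes the
  matrix triangular.\<close>

lemma det_diag_plus_const:
  fixes a b :: real
  shows "det ((\<chi> i j. (if i = j then a else 0) + b) :: real^'n::{finite,wellorder}^'n::{finite,wellorder}) = a ^ (CARD('n::{finite,wellorder}) - 1) * (a + CARD('n::{finite,wellorder}) * b)"
proof -
  let ?M = "(\<chi> i j. (if i = j then a else 0) + b) :: real^'n::{finite,wellorder}^'n::{finite,wellorder}"
  define z :: "'n::{finite,wellorder}" where "z = (LEAST x. True)"
  have z: "z \<le> i" for i unfolding z_def by (rule Least_le) simp
  define L :: "real^'n::{finite,wellorder}^'n::{finite,wellorder}" where "L = (\<chi> i j. if i = j then 1 else if j = z then -1 else 0)"
  define A :: "real^'n::{finite,wellorder}^'n::{finite,wellorder}" where "A = (\<chi> i j. if i = j then 1 else if j = z then 1 else 0)"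
  have "det L = prod (\<lambda>i. L$i$i) UNIV"
    by (rule det_lowerdiagonal) (use z in \<open>auto simp: L_def not_less[symmetric]\<close>)
  moreover have "det A = prod (\<lambda>i. A$i$i) UNIV"
    by (rule det_lowerdiagonal) (use z in \<open>auto simp: A_def not_less[symmetric]\<close>)
  moreover have "L$i$i = 1" "A$i$i = 1" for i by (simp_all add: L_def A_def)
  ultimately have det1: "det L = 1" "det A = 1" by simp_all
  have LM: "(L ** ?M) $ i $ j = (if i = z then (if i = j then a else 0) + b else (if i = j then a else 0) - (if j = z then a else 0))" for i j
  proof -
    have "(L ** ?M) $ i $ j = (\<Sum>k\<in>UNIV. (if k = i then ?M $ i $ j else 0) - (if k = z then if i = z then 0 else ?M $ z $ j else 0))"
    proof -
      have "L $ i $ k * ?M $ k $ j = (if k = i then ?M $ i $ j else 0) - (if k = z then if i = z then 0 else ?M $ z $ j else 0)" for k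
        by (cases "k = i"; cases "k = z"; simp add: L_def)
      thus ?thesis by (simp add: matrix_matrix_mult_def)
    qed
    also have "\<dots> = ?M $ i $ j - (if i = z then 0 else ?M $ z $ j)" by (simp add: sum_subtractf)
    finally show ?thesis by auto
  qed
  define T where "T = L ** ?M ** A"
  have T: "T $ i $ j = (if j = z then if i = z then a + CARD('n::{finite,wellorder}) * b else 0 else (L ** ?M) $ i $ j)" for i j
  proof -
    have e: "T $ i $ j = (\<Sum>k\<in>UNIV. (L ** ?M) $ i $ k * A $ k $ j)"
      unfolding T_def by (simp add: matrix_matrix_mult_def)
    show ?thesis
    proof (cases "j = z")
      case True
      have "T $ i $ j = (\<Sum>k\<in>UNIV. (L ** ?M) $ i $ k)"
        unfolding e using True by (intro sum.cong) (auto simp: A_def)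
      thus ?thesis using True unfolding LM by (simp add: sum.distrib sum_subtractf)
    next
      case False
      have "T $ i $ j = (\<Sum>k\<in>UNIV. if k = j then (L ** ?M) $ i $ j else 0)"
        unfolding e using False by (intro sum.cong) (auto simp: A_def)
      thus ?thesis using False by simp
    qed
  qed
  have "det T = prod (\<lambda>i. T$i$i) UNIV"
  proof (rule det_upperdiagonal)
    fix i j :: "'n::{finite,wellorder}" assume "j < i"
    hence "i \<noteq> z" "i \<noteq> j" using z[of j] by auto
    thus "T $ i $ j = 0" unfolding T LM by simp
  qed
  also have "\<dots> = T$z$z * prod (\<lambda>i. T$i$i) (UNIV - {z})" by (simp add: prod.remove[of UNIV z])
  also have "prod (\<lambda>i. T$i$i) (UNIV - {z}) = (\<Prod>i\<in>UNIV - {z}. a)"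
    by (intro prod.cong) (auto simp: T LM)
  also have "\<dots> = a ^ (CARD('n::{finite,wellorder}) - 1)" by (simp add: card_Diff_subset)
  also have "T$z$z = a + CARD('n::{finite,wellorder}) * b" by (simp add: T)
  finally show ?thesis using det1 by (simp add: T_def det_mul)
qed

text \<open>Lenstra's criterion: pairwise differences of these ten elements are units and \<open>10 \<cdot> 6\<^sup>6 / 6!\<close> exceeds the square root
  of the discriminant \<open>13\<^sup>5\<close>.\<close>

definition euclid_list :: "fq list" where
  "euclid_list = [0, 1, Fq 0 1, Fq (C13 1 1 0) (C13 (- 1) 0 0), Fq (C13 (- 1) 1 0) (C13 (- 1) 1 0),
    Fq (C13 (- 2) 1 0) (C13 0 1 0), Fq (C13 (- 2) 0 0) (C13 1 1 0), Fq (C13 (- 3) 2 1) (C13 (- 1) 0 0),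
    Fq (C13 (- 1) 3 1) (C13 0 (- 2) (- 1)), Fq (C13 0 (- 2) (- 1)) (C13 (- 1) 3 1)]"

lemma euclid_list_units:
  assumes "i < 10" "j < 10" "i \<noteq> j"
  shows "euclid_list ! i - euclid_list ! j dvd 1"
proof -
  have "list_all (\<lambda>i. list_all (\<lambda>j. i = j \<or> \<bar>nF (euclid_list ! i - euclid_list ! j)\<bar> = 1) [0..<10]) [0..<10]"
    by code_simp
  hence "\<bar>nF (euclid_list ! i - euclid_list ! j)\<bar> = 1"
    using assms unfolding list_all_iff set_upt by (meson atLeastLessThan_iff le0)
  thus ?thesis by (simp add: nF_unit)
qed

definition th_conjugates :: "fq list" where
  "th_conjugates = [Fq 0 1, Fq (C13 1 (- 1) (- 1)) (C13 0 1 0), Fq (C13 (- 2) 2 1) (C13 1 (- 2) (- 1)),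
    Fq (C13 0 1 0) (C13 (- 1) 0 0), Fq (C13 1 (- 1) 0) (C13 0 (- 1) 0), Fq (C13 (- 1) (- 1) 0) (C13 (- 1) 2 1)]"

lemma funpow_mod6: "(sf ^^ j) x = (sf ^^ (j mod 6)) x"
proof -
  have "(sf ^^ (6 * q)) y = y" for q y
    by (induction q) (simp_all add: funpow_add eval_nat_numeral sf_six)
  hence "(sf ^^ (j mod 6 + 6 * (j div 6))) x = (sf ^^ (j mod 6)) x" by (simp only: funpow_add comp_apply)
  thus ?thesis by simp
qed

lemma sf_th: "(sf ^^ j) th = th_conjugates ! (j mod 6)"
proof -
  have s: "sf (th_conjugates ! n) = th_conjugates ! Suc n" if "n < 5" for n
  proof -
    have "n = 0 \<or> n = 1 \<or> n = 2 \<or> n = 3 \<or> n = 4" using that by linarith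
    thus ?thesis by (elim disjE) (simp_all add: th_conjugates_def sf_def sk13_def c13_defs numeral_c13)
  qed
  have "(sf ^^ n) th = th_conjugates ! n" if "n < 6" for n
    using that by (induction n) (simp_all add: s, simp add: th_conjugates_def)
  hence "(sf ^^ (j mod 6)) th = th_conjugates ! (j mod 6)" by simp
  thus ?thesis by (subst funpow_mod6)
qed

text \<open>The conjugates of \<theta> have Gram matrix 13 I - 2 J with J the all-ones matrix, so
  its determinant is 13^5 * (13 - 12), the discriminant: they form a normal integral basis.\<close>

lemma th_traces:
  assumes "k < 6" "l < 6"
  shows "(\<Sum>m<6. (sf ^^ (k + m)) th * (sf ^^ (m + l)) th) = of_int ((if k = l then 13 else 0) - 2)"
proof -
  have "list_all (\<lambda>k. list_all (\<lambda>l. sum_list (map (\<lambda>m. th_conjugates ! ((k + m) mod 6) * th_conjugates ! ((m + l) mod 6)) [0..<6])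
      = Fq (C13 ((if k = l then 13 else 0) - 2) 0 0) 0) [0..<6]) [0..<6]"
    by code_simp
  hence "sum_list (map (\<lambda>m. th_conjugates ! ((k + m) mod 6) * th_conjugates ! ((m + l) mod 6)) [0..<6])
      = Fq (C13 ((if k = l then 13 else 0) - 2) 0 0) 0" using assms by (auto simp: list_all_iff)
  thus ?thesis unfolding sf_th by (simp add: sum_list_distinct_conv_sum_set atLeast0LessThan of_int_fq of_int_c13)
qed

text \<open>For the points \<omega> z / d with \<omega> in \<open>euclid_list\<close>, two differ
  from a lattice element by a vector of norm below 1. As the differences of the \<omega> are units,
  this is division with remainder up to a unit multiplier.\<close>

lemma euclid_step:
  assumes d: "d \<noteq> 0"
  shows "\<exists>u c. u dvd 1 \<and> \<bar>nF (u * z - c * d)\<bar> < \<bar>nF d\<bar>"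
proof -
  have "card (UNIV :: 6 set) = 6" by simp
  then obtain idx :: "6 \<Rightarrow> nat" where idx: "bij_betw idx UNIV {..<6}"
    using ex_bij_betw_finite_nat[of "UNIV :: 6 set"] by (auto simp: atLeast0LessThan)
  have idx_less: "idx k < 6" for k using idx by (auto simp: bij_betw_def)
  have idx_eq: "idx k = idx l \<longleftrightarrow> k = l" for k l using idx by (auto simp: bij_betw_def inj_on_def)
  have idx_prod: "(\<Prod>k\<in>UNIV. f (idx k)) = (\<Prod>j<6. f j :: real)" for f
    using prod.reindex_bij_betw[OF idx] .
  have idx_sum: "(\<Sum>k\<in>UNIV. f (idx k)) = (\<Sum>j<6. f j :: real)" for f
    using sum.reindex_bij_betw[OF idx] .
  define W :: "real^6^6" where "W = (\<chi> k l. emb_fq (idx k) ((sf ^^ idx l) th))"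
  have "(W ** W) $ k $ l = (if k = l then 13 else 0) + (-2)" for k l
  proof -
    have "(W ** W) $ k $ l = (\<Sum>m<6. emb_fq (idx k) ((sf ^^ m) th) * emb_fq m ((sf ^^ idx l) th))"
      unfolding matrix_matrix_mult_def W_def using idx_sum[of "\<lambda>m. emb_fq (idx k) ((sf ^^ m) th) * emb_fq m ((sf ^^ idx l) th)"] by simp
    also have "\<dots> = ef (\<Sum>m<6. (sf ^^ (idx k + m)) th * (sf ^^ (m + idx l)) th)"
      by (simp add: rhom_sum[OF rhom_ef] rhom_mult[OF rhom_ef] emb_fq_def funpow_add)
    also have "\<dots> = (if k = l then 13 else 0) + (-2)"
      unfolding th_traces[OF idx_less idx_less] rhom_of_int[OF rhom_ef] idx_eq by simp
    finally show ?thesis .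
  qed
  hence WW: "W ** W = (\<chi> k l. (if k = l then 13 else 0) + (-2))" by (simp add: vec_eq_iff)
  have "(det W)^2 = det (W ** W)" by (simp add: det_mul power2_eq_square)
  also have "\<dots> = 371293" unfolding WW det_diag_plus_const by simp
  finally have det2: "(det W)^2 = 371293" .
  hence det0: "det W \<noteq> 0" by auto
  have "\<bar>det W\<bar>^2 < 648^2" using det2 by simp
  hence "\<bar>det W\<bar> < 648" by (rule power2_less_imp_less) simp
  hence det_less: "\<bar>det W\<bar> < real 10 * (real CARD(6) ^ CARD(6) / fact CARD(6))" by (simp add: fact_numeral)
  define p :: "nat \<Rightarrow> real^6" where
    "p i = (\<chi> k. emb_fq (idx k) (euclid_list ! i) * emb_fq (idx k) z / emb_fq (idx k) d)" for i
  obtain i j c where ij: "i < 10" "j < 10" and c: "c \<in> zvec" "i \<noteq> j \<or> c \<noteq> 0"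
    and P: "(\<Prod>k\<in>UNIV. \<bar>(p i - p j - W *v c) $ k\<bar>) < 1"
    using minkowski_approx[OF det0 det_less, of p] by blast
  have "\<forall>k. \<exists>b. c $ k = of_int b"
  proof
    fix k
    have "c $ k \<in> \<int>" using c(1) by (simp add: zvec_def)
    thus "\<exists>b. c $ k = of_int b" by (rule Ints_cases) blast
  qed
  then obtain f where f: "\<And>k. c $ k = of_int (f k)" by metis
  define C where "C = (\<Sum>l\<in>UNIV. of_int (f l) * (sf ^^ idx l) th)"
  have Wc: "(W *v c) $ k = emb_fq (idx k) C" for k
    unfolding C_def rhom_sum[OF rhom_emb6] rhom_mult[OF rhom_emb6] rhom_of_int[OF rhom_emb6] matrix_vector_mult_def W_def
    by (simp add: f mult.commute)
  define u where "u = euclid_list ! i - euclid_list ! j"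
  have "(\<Prod>k\<in>UNIV. \<bar>(p i - p j - W *v c) $ k\<bar>) = (\<Prod>k\<in>UNIV. \<bar>emb_fq (idx k) (u * z - C * d)\<bar> / \<bar>emb_fq (idx k) d\<bar>)"
  proof (rule prod.cong[OF refl])
    fix k
    have nz: "emb_fq (idx k) d \<noteq> 0" using d emb_fq_0_iff[OF idx_less] by blast
    have "(p i - p j - W *v c) $ k = emb_fq (idx k) (u * z - C * d) / emb_fq (idx k) d"
      unfolding vector_minus_component Wc p_def u_def using nz
      by (simp add: rhom_simps[OF rhom_emb6] field_simps)
    thus "\<bar>(p i - p j - W *v c) $ k\<bar> = \<bar>emb_fq (idx k) (u * z - C * d)\<bar> / \<bar>emb_fq (idx k) d\<bar>" by simp
  qed
  also have "\<dots> = \<bar>real_of_int (nF (u * z - C * d))\<bar> / \<bar>real_of_int (nF d)\<bar>"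
    using idx_prod[of "\<lambda>j. \<bar>emb_fq j (u * z - C * d)\<bar> / \<bar>emb_fq j d\<bar>"] by (simp add: nF_emb6 abs_prod prod_dividef)
  finally have "\<bar>real_of_int (nF (u * z - C * d))\<bar> / \<bar>real_of_int (nF d)\<bar> < 1" using P by simp
  moreover have "\<bar>real_of_int (nF d)\<bar> > 0" using d nF_0_iff by simp
  ultimately have "\<bar>real_of_int (nF (u * z - C * d))\<bar> < \<bar>real_of_int (nF d)\<bar>" by (simp add: divide_less_eq)
  hence less: "\<bar>nF (u * z - C * d)\<bar> < \<bar>nF d\<bar>" by linarith
  have "i \<noteq> j"
  proof
    assume e: "i = j"
    hence "\<bar>nF C\<bar> * \<bar>nF d\<bar> < \<bar>nF d\<bar>"
      using less by (simp add: u_def nF_mult abs_mult nF_minus)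
    hence "\<bar>nF C\<bar> = 0" by (simp add: mult_less_cancel_right2)
    hence "C = 0" by (simp add: nF_0_iff)
    hence "W *v c = 0" using Wc by (simp add: vec_eq_iff rhom_0[OF rhom_emb6])
    moreover have "c \<noteq> 0" using c e by simp
    ultimately show False using det0 by (metis invertible_det_nz invertible_left_inverse matrix_left_invertible_ker)
  qed
  thus ?thesis using less euclid_list_units[OF ij] u_def by blast
qed

theorem bezout_fq: "\<exists>d r s. d dvd x \<and> d dvd y \<and> d = r * x + s * (y::fq)"
proof (cases "x = 0 \<and> y = 0")
  case True
  thus ?thesis by (intro exI[of _ 0]) simp
next
  case False
  define I where "I = {z. \<exists>r s. z = r * x + s * y}"
  have xy: "x \<in> I" "y \<in> I" unfolding I_def by (force intro: exI[of _ 1] exI[of _ 0])+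
  obtain d where d: "d \<in> I" "d \<noteq> 0" and min: "\<And>z. z \<in> I \<Longrightarrow> z \<noteq> 0 \<Longrightarrow> nat \<bar>nF d\<bar> \<le> nat \<bar>nF z\<bar>"
  proof -
    have "\<exists>z. z \<in> I \<and> z \<noteq> 0" using False xy by blast
    thus thesis using ex_has_least_nat[of "\<lambda>z. z \<in> I \<and> z \<noteq> 0" _ "\<lambda>z. nat \<bar>nF z\<bar>"] that by blast
  qed
  have dvd: "d dvd z" if z: "z \<in> I" for z
  proof -
    obtain u c where u: "u dvd 1" "\<bar>nF (u * z - c * d)\<bar> < \<bar>nF d\<bar>" using euclid_step[OF d(2)] by blast
    have "u * z - c * d \<in> I"
    proof -
      obtain r s r' s' where "z = r * x + s * y" "d = r' * x + s' * y" using z d(1) unfolding I_def by blast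
      hence "u * z - c * d = (u * r - c * r') * x + (u * s - c * s') * y" by (simp add: algebra_simps)
      thus ?thesis unfolding I_def by blast
    qed
    hence "u * z - c * d = 0" using min[of "u * z - c * d"] u(2) by linarith
    hence 1: "d dvd u * z" by simp
    obtain v where "1 = u * v" using u(1) by (rule dvdE)
    hence "z = v * (u * z)" by (simp add: mult_ac flip: mult.assoc)
    thus ?thesis using 1 by (metis dvd_mult)
  qed
  obtain r s where "d = r * x + s * y" using d(1) unfolding I_def by blast
  thus ?thesis using dvd xy by blast
qed

text \<open>Up to a unit, g is the seventh power of the greatest common divisor of g and z.\<close>

theorem coprime_seventh_power_fq:
  fixes g h z :: fq
  assumes gh: "g * h = z ^ 7" and cop: "comax g h" and g0: "g \<noteq> 0"
  shows "\<exists>e w. e dvd 1 \<and> g = e * w ^ 7"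
proof -
  obtain d r s where d: "d dvd g" "d dvd z" "d = r * g + s * z" using bezout_fq by blast
  have "g dvd d ^ 7 - (s * z) ^ 7"
  proof (rule dvd_power_diff)
    show "g dvd d - s * z" unfolding d(3) by simp
  qed
  moreover have "g dvd (s * z) ^ 7" unfolding power_mult_distrib gh[symmetric] by simp
  ultimately have 1: "g dvd d ^ 7" by (rule iffD2[OF dvd_diff_trans])
  have "d ^ 7 dvd h * g" using dvd_power_same[OF d(2), of 7] gh by (simp add: mult.commute)
  moreover have "comax (d ^ 7) h" using comax_powers[OF comax_dvd_left[OF cop d(1)], of 7 1] by simp
  ultimately have "d ^ 7 dvd g" by (rule comax_cancel[rotated])
  then obtain e where e: "g = d ^ 7 * e" by (rule dvdE)
  obtain f where f: "d ^ 7 = g * f" using 1 by (rule dvdE)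
  have "g * (f * e) = g * 1" using e f by (metis mult.assoc mult_1_right)
  hence "f * e = 1" using g0 mult_left_cancel by blast
  hence "e dvd 1" by (metis dvd_triv_right)
  thus ?thesis using e by (metis mult.commute)
qed

section \<open>Kummer's lemma in degree six\<close>

text \<open>The Frobenius automorphism at 7, mapping \<open>\<theta> = 2 cos(2 \<pi> / 13)\<close> to \<open>2 cos(14 \<pi> / 13)\<close>.\<close>

definition phi :: "fq \<Rightarrow> fq" where "phi x = (sf ^^ 5) x"

lemma rhom_phi: "rhom phi"
proof -
  have "phi = sf ^^ 5" by (rule ext) (simp add: phi_def)
  thus ?thesis using rhom_sf_pow[of 5] by simp
qed

lemma phi_Fq: "phi (Fq y 0) = Fq (sk13 (sk13 y)) 0"
  unfolding phi_def sf_Fq by (simp add: eval_nat_numeral sk13_cube)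

lemma rhom_Fq: "rhom (\<lambda>y. Fq y 0)"
  by (rule rhomI) (simp_all add: fq_defs)

lemma phi_sf: "phi (sf x) = sf (phi x)"
  by (simp add: phi_def eval_nat_numeral)

lemma th_power7: "th ^ 7 = Fq (C13 20 (- 15) 0) (C13 27 (- 19) 1)"
proof -
  have "th ^ 3 = Fq (C13 1 (- 1) 0) (C13 3 (- 1) 0)" by (simp add: power3_eq_cube fq_defs c13_defs)
  hence "th ^ 3 * th ^ 3 * th = Fq (C13 20 (- 15) 0) (C13 27 (- 19) 1)" by (simp add: fq_defs c13_defs)
  thus ?thesis by (simp flip: power_add power_Suc2)
qed

lemma phi_th: "phi th = Fq (C13 (- 1) (- 1) 0) (C13 (- 1) 2 1)"
  unfolding phi_def sf_th by (simp add: th_conjugates_def)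

lemma frobenius7_fq: "7 dvd x ^ 7 - phi x"
proof -
  let ?x = "Fq (f0 x) 0" and ?y = "Fq (f1 x) 0 * th"
  have x: "x = ?x + ?y" by (cases x) (simp add: fq_defs)
  have p: "prime (7::nat)" "(7::fq) dvd of_nat 7" by simp_all
  have a: "7 dvd (?x + ?y) ^ 7 - ?x ^ 7 - ?y ^ 7" using freshman[OF p, of ?x ?y 1] by simp
  have c: "7 dvd Fq y 0 ^ 7 - phi (Fq y 0)" for y
  proof -
    have "Fq 7 0 dvd Fq (y ^ 7 - sk13 (sk13 y)) 0" by (rule rhom_dvd[OF rhom_Fq frob_c13])
    moreover have "Fq (y ^ 7 - sk13 (sk13 y)) 0 = Fq y 0 ^ 7 - phi (Fq y 0)"
      by (simp only: rhom_diff[OF rhom_Fq] rhom_power[OF rhom_Fq] phi_Fq)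
    ultimately show ?thesis by (simp only: numeral_fq)
  qed
  have t: "7 dvd th ^ 7 - phi th"
  proof (rule dvdI)
    show "th ^ 7 - phi th = 7 * Fq (C13 3 (- 2) 0) (C13 4 (- 3) 0)"
      unfolding th_power7 phi_th by (simp add: fq_defs c13_defs numeral_fq numeral_c13)
  qed
  have "7 dvd ?x ^ 7 - phi ?x" "7 dvd ?y ^ 7 - phi ?y"
    unfolding power_mult_distrib rhom_mult[OF rhom_phi] by (rule c dvd_diff_mult[OF c t])+
  from dvd_add[OF this] have "7 dvd (?x ^ 7 + ?y ^ 7) - phi (?x + ?y)"
    unfolding rhom_add[OF rhom_phi] by (simp add: algebra_simps)
  with a have "7 dvd (?x + ?y) ^ 7 - phi (?x + ?y)"
    by (metis (no_types) dvd_diff_chain diff_diff_eq)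
  thus ?thesis using x by simp
qed

text \<open>A multiplicative condition satisfied by rational integers and by seventh powers. Among products of the five units
  \<open>\<theta>\<^sub>i\<close> with exponents below 7 only the trivial one satisfies it.\<close>

definition rational_frobenius :: "fq \<Rightarrow> bool" where "rational_frobenius x \<longleftrightarrow> (\<exists>m::int. 49 dvd x ^ 7 - phi x * of_int m)"

lemma rational_frobenius_mult: "rational_frobenius x \<Longrightarrow> rational_frobenius y \<Longrightarrow> rational_frobenius (x * y)"
proof -
  assume "rational_frobenius x" "rational_frobenius y"
  then obtain m n where "49 dvd x ^ 7 - phi x * of_int m" "49 dvd y ^ 7 - phi y * of_int n"
    unfolding rational_frobenius_def by blast
  from dvd_diff_mult[OF this] have "49 dvd (x * y) ^ 7 - phi (x * y) * of_int (m * n)"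
    by (simp add: power_mult_distrib rhom_mult[OF rhom_phi] mult_ac)
  thus ?thesis unfolding rational_frobenius_def by blast
qed

lemma rational_frobenius_seventh_power: "rational_frobenius (v ^ 7)"
proof -
  have "49 dvd (v ^ 7) ^ 7 - phi v ^ 7" by (rule seventh_powers_mod_49[OF frobenius7_fq])
  hence "49 dvd (v ^ 7) ^ 7 - phi (v ^ 7) * of_int 1" by (simp add: rhom_power[OF rhom_phi])
  thus ?thesis unfolding rational_frobenius_def by blast
qed

lemma rational_frobenius_of_int: "rational_frobenius (of_int a)"
proof -
  have "of_int a ^ 7 - phi (of_int a) * of_int (a ^ 6) = 49 * (0::fq)"
    by (simp add: rhom_of_int[OF rhom_phi] flip: power_Suc)
  thus ?thesis unfolding rational_frobenius_def by (metis dvd_triv_left)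
qed

lemma rational_frobenius_cong: "49 dvd x - y \<Longrightarrow> rational_frobenius y \<Longrightarrow> rational_frobenius x"
proof -
  assume xy: "49 dvd x - y" and "rational_frobenius y"
  then obtain m where m: "49 dvd y ^ 7 - phi y * of_int m" unfolding rational_frobenius_def by blast
  have "49 dvd phi x - phi y" using rhom_dvd[OF rhom_phi xy] by (simp add: rhom_simps[OF rhom_phi])
  hence "49 dvd phi y * of_int m - phi x * of_int m"
    unfolding left_diff_distrib[symmetric] by (intro dvd_mult2) (simp only: dvd_diff_sym)
  from dvd_diff_chain[OF dvd_diff_chain[OF dvd_power_diff[OF xy] m] this] show ?thesis unfolding rational_frobenius_def by blast
qed

text \<open>A Fermat quotient relative to Frobenius. On units it sends products to sums modulo 7,
  which makes independence modulo seventh powers a linear problem over the field with 7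
  elements.\<close>

definition fermat_quotient :: "fq \<Rightarrow> fq \<Rightarrow> bool" where
  "fermat_quotient x l \<longleftrightarrow> 49 dvd x ^ 7 - phi x * (1 + 7 * l)"

lemma fermat_quotient_mult:
  assumes "fermat_quotient x l" "fermat_quotient y k" shows "fermat_quotient (x * y) (l + k)"
proof -
  have "49 dvd x ^ 7 * y ^ 7 - (phi x * (1 + 7 * l)) * (phi y * (1 + 7 * k))"
    using assms unfolding fermat_quotient_def by (rule dvd_diff_mult)
  moreover have "49 dvd (phi x * (1 + 7 * l)) * (phi y * (1 + 7 * k)) - phi x * phi y * (1 + 7 * (l + k))"
    by (rule dvdI[of _ _ "phi x * phi y * (l * k)"]) (simp add: algebra_simps)
  ultimately show ?thesis unfolding fermat_quotient_def power_mult_distrib rhom_mult[OF rhom_phi]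
    by (rule dvd_diff_chain)
qed

lemma fermat_quotient_power: "fermat_quotient x l \<Longrightarrow> fermat_quotient (x ^ n) (of_nat n * l)"
proof (induction n)
  case 0
  show ?case by (simp add: fermat_quotient_def rhom_1[OF rhom_phi])
next
  case (Suc n)
  from fermat_quotient_mult[OF Suc.prems Suc.IH[OF Suc.prems]] show ?case by (simp add: algebra_simps)
qed

lemma fermat_quotient_sf: "fermat_quotient x l \<Longrightarrow> fermat_quotient (sf x) (sf l)"
  unfolding fermat_quotient_def using rhom_dvd[OF rhom_sf, of 49 "x ^ 7 - phi x * (1 + 7 * l)"]
  by (simp add: rhom_simps[OF rhom_sf] phi_sf)

definition th_quotient :: "nat \<Rightarrow> fq" where "th_quotient j = (sf ^^ j) (Fq (C13 1 2 3) (C13 (- 1) 1 (- 2)))"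

lemma fermat_quotient_th: "fermat_quotient ((sf ^^ j) th) (th_quotient j)"
proof (induction j)
  case 0
  have "th ^ 7 - phi th * (1 + 7 * th_quotient 0) = 49 * Fq (C13 0 2 0) (C13 1 (- 2) (- 1))"
    unfolding th_power7 phi_th th_quotient_def by (simp add: fq_defs c13_defs numeral_fq numeral_c13)
  thus ?case by (simp add: fermat_quotient_def)
next
  case (Suc j)
  from fermat_quotient_sf[OF Suc.IH] show ?case by (simp add: th_quotient_def)
qed

lemma th_quotient_eval:
  "th_quotient 0 = Fq (C13 1 2 3) (C13 (- 1) 1 (- 2))" "th_quotient 1 = Fq (C13 (- 1) 27 11) (C13 3 (- 13) (- 5))"
  "th_quotient 2 = Fq (C13 47 (- 18) (- 12)) (C13 (- 8) 4 3)" "th_quotient 3 = Fq (C13 3 (- 7) 6) (C13 1 (- 1) 2)"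
  "th_quotient 4 = Fq (C13 4 10 3) (C13 (- 3) 13 5)"
  by (simp_all add: th_quotient_def eval_nat_numeral sf_def sk13_def c13_defs numeral_c13)

lemma Fq_dvd: "Fq q 0 dvd x \<longleftrightarrow> q dvd f0 x \<and> q dvd f1 x"
proof
  assume "Fq q 0 dvd x"
  then obtain y where "x = Fq q 0 * y" by (rule dvdE)
  thus "q dvd f0 x \<and> q dvd f1 x" by (simp add: times_fq_def)
next
  assume "q dvd f0 x \<and> q dvd f1 x"
  then obtain u v where "f0 x = q * u" "f1 x = q * v" by (auto elim!: dvdE)
  hence "x = Fq q 0 * Fq u v" by (cases x) (simp add: times_fq_def)
  thus "Fq q 0 dvd x" by (rule dvdI)
qed

lemma of_int_dvd_fq: "of_int n dvd x \<longleftrightarrow> n dvd c0 (f0 x) \<and> n dvd c1 (f0 x) \<and> n dvd c2 (f0 x)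
    \<and> n dvd c0 (f1 x) \<and> n dvd c1 (f1 x) \<and> n dvd c2 (f1 x)"
proof -
  have "of_int n = Fq (of_int n) 0" by (simp add: of_int_fq)
  thus ?thesis by (simp add: Fq_dvd of_int_dvd_c13)
qed

lemma th_unit: "(sf ^^ j) th dvd 1"
proof -
  have "th * Fq (C13 (- 1) 3 1) (C13 1 (- 2) (- 1)) = 1" by (simp add: fq_defs c13_defs)
  hence "th dvd 1" by (metis dvd_triv_left)
  from rhom_dvd[OF rhom_sf_pow this] show ?thesis by (simp add: rhom_1[OF rhom_sf_pow])
qed

lemma unit_cancel: "u dvd 1 \<Longrightarrow> (d::'a::comm_ring_1) dvd u * x \<Longrightarrow> d dvd x"
proof -
  assume u: "u dvd 1" and d: "d dvd u * x"
  from u obtain v where v: "1 = u * v" by (rule dvdE)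
  have "v * (u * x) = (u * v) * x" by (simp add: mult_ac)
  hence "x = v * (u * x)" unfolding v[symmetric] by simp
  thus "d dvd x" using dvd_mult[OF d, of v] by simp
qed

text \<open>The condition forces the Fermat quotient to be an integer modulo 7, so its five
  nonconstant coordinates vanish. These are five linear equations for the five exponents, with a
  matrix invertible modulo 7.\<close>

lemma rational_frobenius_independent:
  assumes n: "n0 < 7" "n1 < 7" "n2 < 7" "n3 < 7" "n4 < (7::nat)"
    and T: "rational_frobenius (th ^ n0 * (sf ^^ 1) th ^ n1 * (sf ^^ 2) th ^ n2 * (sf ^^ 3) th ^ n3 * (sf ^^ 4) th ^ n4)" (is "rational_frobenius ?u")
  shows "n0 = 0 \<and> n1 = 0 \<and> n2 = 0 \<and> n3 = 0 \<and> n4 = 0"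
proof -
  define l where "l = of_nat n0 * th_quotient 0 + of_nat n1 * th_quotient 1 + of_nat n2 * th_quotient 2 + of_nat n3 * th_quotient 3 + of_nat n4 * th_quotient 4"
  have "fermat_quotient ?u l"
    unfolding l_def using fermat_quotient_th[of 0]
    by (intro fermat_quotient_mult fermat_quotient_power fermat_quotient_th) simp
  hence q: "49 dvd ?u ^ 7 - phi ?u * (1 + 7 * l)" unfolding fermat_quotient_def .
  obtain m where m: "49 dvd ?u ^ 7 - phi ?u * of_int m" using T unfolding rational_frobenius_def by blast
  have "49 dvd phi ?u * (1 + 7 * l) - ?u ^ 7" using q dvd_diff_sym by blast
  from dvd_diff_chain[OF this m] have d: "49 dvd phi ?u * (1 + 7 * l - of_int m)" by (simp add: right_diff_distrib)
  have up: "x ^ n dvd 1" if "x dvd 1" for x :: fq and n using dvd_power_same[OF that, of n] by simp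
  have um: "x * y dvd 1" if "x dvd 1" "y dvd 1" for x y :: fq using mult_dvd_mono[OF that] by simp
  have "?u dvd 1" using th_unit[of 0] by (intro um up th_unit) simp
  hence "phi ?u dvd 1" using rhom_dvd[OF rhom_phi, of ?u 1] by (simp add: rhom_1[OF rhom_phi])
  from unit_cancel[OF this d] have "of_int 49 dvd 1 + 7 * l - of_int m" by simp
  hence e: "49 dvd c1 (f0 (1 + 7 * l - of_int m))" "49 dvd c2 (f0 (1 + 7 * l - of_int m))"
    "49 dvd c0 (f1 (1 + 7 * l - of_int m))" "49 dvd c1 (f1 (1 + 7 * l - of_int m))" "49 dvd c2 (f1 (1 + 7 * l - of_int m))"
    unfolding of_int_dvd_fq by blast+
  let ?a = "int n0" and ?b = "int n1" and ?c = "int n2" and ?d = "int n3" and ?e = "int n4"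
  have 7: "7 dvd x" if "49 dvd 7 * x" for x :: int using that by presburger
  have E: "7 dvd 2 * ?a + 27 * ?b - 18 * ?c - 7 * ?d + 10 * ?e" "7 dvd 3 * ?a + 11 * ?b - 12 * ?c + 6 * ?d + 3 * ?e"
    "7 dvd - ?a + 3 * ?b - 8 * ?c + ?d - 3 * ?e" "7 dvd ?a - 13 * ?b + 4 * ?c - ?d + 13 * ?e"
    "7 dvd - 2 * ?a - 5 * ?b + 3 * ?c + 2 * ?d + 5 * ?e"
    using e unfolding l_def th_quotient_eval
    by (intro 7; simp add: fq_defs c13_defs numeral_fq numeral_c13 of_int_fq of_int_c13 of_nat_fq of_nat_c13 algebra_simps)+
  \<comment> \<open>The multipliers used below are the rows of the inverse matrix modulo 7, and
    \<open>z\<close> collects the multiples of 7.\<close>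
  have combine: "7 dvd y" if "ka * ua + kb * ub + kc * uc + kd * ud + ke * ue = y + 7 * z"
    "7 dvd ua" "7 dvd ub" "7 dvd uc" "7 dvd ud" "7 dvd ue" for ka kb kc kd ke ua ub uc ud ue y z :: int
  proof -
    have "7 dvd y + 7 * z" unfolding that(1)[symmetric] using that(2-) by (intro dvd_add dvd_mult)
    thus ?thesis by (simp add: dvd_add_left_iff)
  qed
  have "7 dvd ?a"
    by (rule combine[where ka = 0 and kb = 4 and kc = 1 and kd = 3 and ke = 3 and z = "1 * ?a + (- 1) * ?b + (- 5) * ?c + 4 * ?d + 9 * ?e", OF _ E]) simp
  moreover have "7 dvd ?b"
    by (rule combine[where ka = 4 and kb = 3 and kc = 2 and kd = 0 and ke = 4 and z = "1 * ?a + 18 * ?b + (- 16) * ?c + 0 * ?d + 9 * ?e", OF _ E]) simp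
  moreover have "7 dvd ?c"
    by (rule combine[where ka = 0 and kb = 0 and kc = 6 and kd = 1 and ke = 1 and z = "(- 1) * ?a + 0 * ?b + (- 6) * ?c + 1 * ?d + 0 * ?e", OF _ E]) simp
  moreover have "7 dvd ?d"
    by (rule combine[where ka = 0 and kb = 4 and kc = 5 and kd = 2 and ke = 1 and z = "1 * ?a + 4 * ?b + (- 11) * ?c + 4 * ?d + 4 * ?e", OF _ E]) simp
  moreover have "7 dvd ?e"
    by (rule combine[where ka = 4 and kb = 3 and kc = 1 and kd = 4 and ke = 3 and z = "2 * ?a + 11 * ?b + (- 13) * ?c + (- 1) * ?d + 16 * ?e", OF _ E]) simp
  moreover have "m = 0" if "7 dvd int m" "m < 7" for m using that zdvd_imp_le[of 7 "int m"] by (cases "m = 0") auto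
  ultimately show ?thesis using n by (intro conjI) simp_all
qed

lemma ef_inj: "ef x = ef y \<longleftrightarrow> x = y"
  using emb_fq_0_iff[of 0 "x - y"] by (simp add: emb_fq_def rhom_diff[OF rhom_ef])

lemma prod_less_5: "(\<Prod>i<(5::nat). f i) = f 0 * f 1 * f 2 * f 3 * (f 4 :: 'a::comm_monoid_mult)"
  by (simp add: eval_nat_numeral mult.assoc)

text \<open>The unit rank is at most 5 by \<open>units_fq_dependent\<close>, and five conjugates of
  \<theta> are independent modulo seventh powers. The sign is absorbed, being a seventh
  power.\<close>

lemma units_fq_generated:
  assumes u: "u dvd 1"
  shows "\<exists>m v. v dvd 1 \<and> (\<forall>i. m i < (7::nat)) \<and> u = (\<Prod>i<5. (sf ^^ i) th ^ m i) * v ^ 7"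
proof -
  define G where "G = ef ` {x. x dvd 1}"
  define \<eta> where "\<eta> i = ef ((sf ^^ i) th)" for i
  have \<eta>_prod: "(\<Prod>i<5. \<eta> i ^ m i) = ef (\<Prod>i<5. (sf ^^ i) th ^ m i)" for m
    unfolding \<eta>_def by (simp add: rhom_prod[OF rhom_ef] rhom_power[OF rhom_ef])
  have um: "x * y dvd 1" if "x dvd 1" "y dvd 1" for x y :: fq using mult_dvd_mono[OF that] by simp
  have ui: "\<exists>y. y dvd 1 \<and> x * y = 1" if x: "x dvd 1" for x :: fq
  proof -
    obtain y where "1 = x * y" using x by (rule dvdE)
    moreover have "y dvd x * y" by (rule dvd_triv_right)
    ultimately show ?thesis by auto
  qed
  have "\<exists>m g. (\<forall>i. m i < (7::nat)) \<and> g \<in> G \<and> ef u = (\<Prod>i<5. \<eta> i ^ m i) * g ^ 7"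
  proof (rule generates_mod_seventh_powers)
    show "0 \<notin> G"
    proof
      assume "0 \<in> G"
      then obtain x where "x dvd 1" "ef x = ef 0" unfolding G_def by (auto simp: rhom_0[OF rhom_ef])
      thus False by (simp add: ef_inj)
    qed
    have "ef 1 \<in> G" unfolding G_def by (rule imageI) simp
    thus "1 \<in> G" by (simp add: rhom_1[OF rhom_ef])
    show "x * y \<in> G" if "x \<in> G" "y \<in> G" for x y
      using that um unfolding G_def by (auto simp flip: rhom_mult[OF rhom_ef])
    show "inverse x \<in> G" if x: "x \<in> G" for x
    proof -
      obtain y where y: "y dvd 1" "x = ef y" using x unfolding G_def by auto
      obtain y' where y': "y' dvd 1" "y * y' = 1" using ui[OF y(1)] by blast
      have "x * ef y' = 1" using y' y by (simp add: rhom_1[OF rhom_ef] flip: rhom_mult[OF rhom_ef])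
      hence "inverse x = ef y'" by (rule inverse_unique)
      thus ?thesis using y' unfolding G_def by auto
    qed
    show "\<exists>d :: nat \<Rightarrow> int. (\<exists>j<Suc 5. d j \<noteq> 0) \<and> (\<Prod>j<Suc 5. f j powi d j) = 1"
      if f: "\<And>j. j < Suc 5 \<Longrightarrow> f j \<in> G" for f
    proof -
      have "\<forall>j. \<exists>x. j < Suc 5 \<longrightarrow> x dvd 1 \<and> f j = ef x" using f unfolding G_def by blast
      then obtain w where w: "\<And>j. j < Suc 5 \<Longrightarrow> w j dvd 1 \<and> f j = ef (w j)" by metis
      obtain d :: "nat \<Rightarrow> int" where d: "\<exists>j<6. d j \<noteq> 0" "(\<Prod>j<6. ef (w j) powi d j) = 1"
        using units_fq_dependent[of w] w by auto
      have "(\<Prod>j<Suc 5. f j powi d j) = (\<Prod>j<6. ef (w j) powi d j)"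
        by (intro prod.cong) (use w in auto)
      thus ?thesis using d by auto
    qed
    show "\<eta> i \<in> G" for i unfolding \<eta>_def G_def using th_unit by blast
    show "\<forall>i<5. m i = 0" if m: "\<And>i. i < 5 \<Longrightarrow> m i < (7::nat)" "g \<in> G" "(\<Prod>i<5. \<eta> i ^ m i) = g ^ 7" for m g
    proof -
      obtain v where "g = ef v" using m(2) unfolding G_def by auto
      hence "(\<Prod>i<5. (sf ^^ i) th ^ m i) = v ^ 7"
        using m(3) unfolding \<eta>_prod by (simp add: ef_inj flip: rhom_power[OF rhom_ef])
      hence "rational_frobenius (\<Prod>i<5. (sf ^^ i) th ^ m i)" by (simp add: rational_frobenius_seventh_power)
      hence "rational_frobenius (th ^ m 0 * (sf ^^ 1) th ^ m 1 * (sf ^^ 2) th ^ m 2 * (sf ^^ 3) th ^ m 3 * (sf ^^ 4) th ^ m 4)"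
        by (simp only: prod_less_5 funpow_0)
      from rational_frobenius_independent[OF _ _ _ _ _ this] m(1) have "m 0 = 0 \<and> m 1 = 0 \<and> m 2 = 0 \<and> m 3 = 0 \<and> m 4 = 0" by simp
      moreover have "i = 0 \<or> i = 1 \<or> i = 2 \<or> i = 3 \<or> i = 4" if "i < 5" for i :: nat using that by linarith
      ultimately show ?thesis by blast
    qed
    show "ef u \<in> G" unfolding G_def using u by blast
  qed
  then obtain m g where m: "\<forall>i. m i < (7::nat)" "g \<in> G" "ef u = (\<Prod>i<5. \<eta> i ^ m i) * g ^ 7" by blast
  obtain v where v: "v dvd 1" "g = ef v" using m(2) unfolding G_def by auto
  have "u = (\<Prod>i<5. (sf ^^ i) th ^ m i) * v ^ 7"
    using m(3) unfolding \<eta>_prod v(2) by (simp add: ef_inj flip: rhom_power[OF rhom_ef] rhom_mult[OF rhom_ef])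
  thus ?thesis using m(1) v(1) by blast
qed

text \<open>The integer factor is essential for the application: when 49 divides a + b, the relevant
  element is only known to be a square of an integer modulo 49.\<close>

theorem kummer_unit_fq:
  assumes u: "u dvd (1::fq)" and a: "49 dvd u - of_int a * t ^ 7"
  shows "\<exists>v. v dvd 1 \<and> u = v ^ 7"
proof -
  obtain m v where mv: "v dvd 1" "\<And>i. m i < (7::nat)" "u = (\<Prod>i<5. (sf ^^ i) th ^ m i) * v ^ 7"
    using units_fq_generated[OF u] by blast
  obtain w where w: "1 = v * w" using mv(1) by (rule dvdE)
  have "rational_frobenius u" using a rational_frobenius_cong rational_frobenius_mult rational_frobenius_of_int rational_frobenius_seventh_power by blast
  hence "rational_frobenius (u * w ^ 7)" using rational_frobenius_mult rational_frobenius_seventh_power by blast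
  also have "u * w ^ 7 = (\<Prod>i<5. (sf ^^ i) th ^ m i) * (v * w) ^ 7"
    unfolding mv(3) by (simp add: power_mult_distrib mult_ac)
  finally have "rational_frobenius (\<Prod>i<5. (sf ^^ i) th ^ m i)" unfolding w[symmetric] by simp
  hence "rational_frobenius (th ^ m 0 * (sf ^^ 1) th ^ m 1 * (sf ^^ 2) th ^ m 2 * (sf ^^ 3) th ^ m 3 * (sf ^^ 4) th ^ m 4)"
    by (simp only: prod_less_5 funpow_0)
  from rational_frobenius_independent[OF _ _ _ _ _ this] mv(2) have "m 0 = 0 \<and> m 1 = 0 \<and> m 2 = 0 \<and> m 3 = 0 \<and> m 4 = 0" by simp
  hence "u = v ^ 7" unfolding mv(3) prod_less_5 by simp
  thus ?thesis using mv(1) by blast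
qed

section \<open>A sieve over the quadratic subfield\<close>

text \<open>The quadratic ring \<open>\<int>[W]\<close> with \<open>W\<^sup>2 = 3 - W\<close>, where \<open>W\<close> is a Gaussian period of degree two and
  conductor 13.\<close>

datatype q13 = Q13 (b0: int) (b1: int)

instantiation q13 :: comm_ring_1
begin
definition "0 = Q13 0 0"
definition "1 = Q13 1 0"
definition "x + y = Q13 (b0 x + b0 y) (b1 x + b1 y)"
definition "x - y = Q13 (b0 x - b0 y) (b1 x - b1 y)"
definition "- x = Q13 (- b0 x) (- b1 x)"
definition "x * y = Q13 (b0 x * b0 y + 3 * (b1 x * b1 y)) (b0 x * b1 y + b1 x * b0 y - b1 x * b1 y)"
instance
  by standard (simp_all add: zero_q13_def one_q13_def plus_q13_def minus_q13_def uminus_q13_def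
      times_q13_def algebra_simps)
end

lemmas q13_defs = zero_q13_def one_q13_def plus_q13_def minus_q13_def uminus_q13_def times_q13_def

definition embed_q13 :: "q13 \<Rightarrow> fq" where
  "embed_q13 x = of_int (b0 x) + of_int (b1 x) * Fq (C13 (- 1) 1 1) (C13 2 (- 3) (- 1))"

lemma rhom_jq: "rhom embed_q13"
proof (rule rhomI)
  show "embed_q13 1 = 1" "\<And>x y. embed_q13 (x + y) = embed_q13 x + embed_q13 y" by (simp_all add: embed_q13_def q13_defs algebra_simps)
  fix x y
  let ?W = "Fq (C13 (- 1) 1 1) (C13 2 (- 3) (- 1))"
  have W: "?W * ?W = 3 - ?W" by (simp add: fq_defs c13_defs numeral_fq numeral_c13)
  have "embed_q13 x * embed_q13 y = of_int (b0 x * b0 y) + of_int (b0 x * b1 y + b1 x * b0 y) * ?W + of_int (b1 x * b1 y) * (?W * ?W)"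
    by (simp add: embed_q13_def algebra_simps)
  also have "\<dots> = embed_q13 (x * y)" unfolding W by (simp add: embed_q13_def times_q13_def algebra_simps)
  finally show "embed_q13 (x * y) = embed_q13 x * embed_q13 y" by simp
qed

lemma embed_q13_inj: "embed_q13 x = embed_q13 y \<Longrightarrow> x = y"
  by (cases x; cases y) (simp add: embed_q13_def of_int_fq of_int_c13 fq_defs c13_defs)

definition rel_norm :: "fq \<Rightarrow> fq" where "rel_norm x = x * sf (sf x) * sf (sf (sf (sf x)))"

lemma rel_norm_mult: "rel_norm (x * y) = rel_norm x * rel_norm y"
  by (simp add: rel_norm_def rhom_mult[OF rhom_sf] mult_ac)

lemma rel_norm_1: "rel_norm 1 = 1" by (simp add: rel_norm_def rhom_1[OF rhom_sf])

lemma rel_norm_power: "rel_norm (x ^ n) = rel_norm x ^ n"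
  by (induction n) (simp_all add: rel_norm_1 rel_norm_mult)

lemma fixed_jq: "sf (sf x) = x \<Longrightarrow> \<exists>z. x = embed_q13 z"
proof -
  assume f: "sf (sf x) = x"
  obtain a b c d e g where x: "x = Fq (C13 a b c) (C13 d e g)"
    by (metis fq.exhaust c13.exhaust)
  have "d = - 2 * g \<and> e = 3 * g \<and> b = - g \<and> c = - g"
    using f unfolding x by (auto simp: sf_def sk13_def c13_defs numeral_c13)
  hence "x = embed_q13 (Q13 (a - g) (- g))"
    unfolding x by (simp add: embed_q13_def of_int_fq of_int_c13 fq_defs c13_defs)
  thus ?thesis by blast
qed

lemma rel_norm_jq: "\<exists>z. rel_norm x = embed_q13 z"
  by (rule fixed_jq) (simp add: rel_norm_def rhom_mult[OF rhom_sf] sf_six mult_ac)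

abbreviation pith :: fq where "pith \<equiv> Fq 2 (- 1)"

text \<open>The factor \<open>a\<^sup>2 + \<theta> a b + b\<^sup>2 = (a + \<zeta> b) (a + \<zeta>\<^sup>-\<^sup>1 b)\<close> of \<open>a\<^sup>1\<^sup>3 + b\<^sup>1\<^sup>3\<close>.\<close>

definition qf :: "int \<Rightarrow> int \<Rightarrow> fq" where "qf a b = Fq (of_int (a^2 + b^2)) (of_int (a * b))"

lemma qf_alt: "qf a b = of_int ((a + b)^2) - pith * of_int (a * b)"
  by (simp add: qf_def of_int_fq of_int_c13 fq_defs c13_defs numeral_c13 power2_eq_square algebra_simps)

definition norm_form :: "int \<Rightarrow> int \<Rightarrow> q13" where
  "norm_form a b = (let x = a^2 + b^2; y = a * b in Q13 (x^3 - x * y^2 + y^3) (x^2 * y - y^3))"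

lemma rel_norm_qf: "rel_norm (qf a b) = embed_q13 (norm_form a b)"
proof -
  have "rel_norm (Fq (of_int x) (of_int y)) = embed_q13 (Q13 (x^3 - x * y^2 + y^3) (x^2 * y - y^3))" for x y
    by (simp add: rel_norm_def embed_q13_def sf_def sk13_def of_int_fq of_int_c13 fq_defs c13_defs numeral_c13
        power2_eq_square power3_eq_cube algebra_simps)
  thus ?thesis unfolding qf_def norm_form_def Let_def .
qed

text \<open>The fundamental unit (3 - sqrt 13) / 2 up to conjugation; its norm is -1.\<close>

abbreviation eta :: q13 where "eta \<equiv> Q13 1 (- 1)"

lemma rel_norm_values: "rel_norm th = embed_q13 eta" "rel_norm (sf th) = embed_q13 (Q13 2 1)" "rel_norm pith = embed_q13 (Q13 5 (- 3))"
  by (simp_all add: rel_norm_def embed_q13_def sf_def sk13_def of_int_fq of_int_c13 fq_defs c13_defs numeral_c13)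

lemma rel_norm_unit:
  assumes "u dvd 1" shows "\<exists>k<7. \<exists>g. rel_norm (u * w ^ 7) = embed_q13 (eta ^ k * g ^ 7)"
proof -
  obtain m v where m: "u = (\<Prod>i<5. (sf ^^ i) th ^ m i) * v ^ 7" using units_fq_generated[OF assms] by blast
  obtain z where z: "rel_norm (v * w) = embed_q13 z" using rel_norm_jq by blast
  have s2: "rel_norm (sf (sf x)) = rel_norm x" for x by (simp add: rel_norm_def sf_six mult_ac)
  have c: "rel_norm ((sf ^^ 0) th) = embed_q13 eta" "rel_norm ((sf ^^ 1) th) = embed_q13 (Q13 2 1)" "rel_norm ((sf ^^ 2) th) = embed_q13 eta"
    "rel_norm ((sf ^^ 3) th) = embed_q13 (Q13 2 1)" "rel_norm ((sf ^^ 4) th) = embed_q13 eta"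
    by (simp_all add: eval_nat_numeral s2 rel_norm_values)
  define K where "K = m 0 + m 2 + m 4 + 6 * (m 1 + m 3)"
  \<comment> \<open>\<open>eta * Q13 2 1\<close> is -1, so the sixth power of this product is
    1.\<close>
  have i: "Q13 2 1 = eta ^ 6 * Q13 2 1 ^ 7"
    by (simp add: eval_nat_numeral q13_defs)
  have "u * w ^ 7 = (\<Prod>i<5. (sf ^^ i) th ^ m i) * (v * w) ^ 7" unfolding m by (simp add: power_mult_distrib mult_ac)
  hence "rel_norm (u * w ^ 7) = embed_q13 eta ^ m 0 * embed_q13 (Q13 2 1) ^ m 1 * embed_q13 eta ^ m 2 * embed_q13 (Q13 2 1) ^ m 3 * embed_q13 eta ^ m 4 * embed_q13 z ^ 7"
    by (simp only: prod_less_5 rel_norm_mult rel_norm_power c z[unfolded rel_norm_mult])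
  also have "\<dots> = embed_q13 (eta ^ m 0 * eta ^ m 2 * eta ^ m 4 * (Q13 2 1 ^ m 1 * Q13 2 1 ^ m 3) * z ^ 7)"
    by (simp add: rhom_mult[OF rhom_jq] rhom_power[OF rhom_jq] mult_ac)
  also have "Q13 2 1 ^ m 1 * Q13 2 1 ^ m 3 = (eta ^ 6 * Q13 2 1 ^ 7) ^ (m 1 + m 3)"
    unfolding i[symmetric] by (simp add: power_add)
  also have "eta ^ m 0 * eta ^ m 2 * eta ^ m 4 * (eta ^ 6 * Q13 2 1 ^ 7) ^ (m 1 + m 3) * z ^ 7
      = eta ^ K * (Q13 2 1 ^ (m 1 + m 3) * z) ^ 7"
    unfolding K_def by (simp add: power_add power_mult power_mult_distrib mult_ac flip: power_mult)
  also have "eta ^ K = eta ^ (K mod 7) * (eta ^ (K div 7)) ^ 7"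
    by (simp flip: power_mult power_add)
  finally have "rel_norm (u * w ^ 7) = embed_q13 (eta ^ (K mod 7) * (eta ^ (K div 7) * (Q13 2 1 ^ (m 1 + m 3) * z)) ^ 7)"
    by (simp add: power_mult_distrib mult_ac)
  moreover have "K mod 7 < 7" by simp
  ultimately show ?thesis by blast
qed

section \<open>Residue computations in the quadratic ring\<close>

fun mulm :: "int \<Rightarrow> int \<times> int \<Rightarrow> int \<times> int \<Rightarrow> int \<times> int" where
  "mulm n (a, b) (c, d) = ((a * c + 3 * (b * d)) mod n, (a * d + b * c - b * d) mod n)"

fun sqm :: "int \<Rightarrow> int \<times> int \<Rightarrow> int \<times> int" where
  "sqm n (a, b) = mulm n (a, b) (a, b)"

definition residue_pair :: "int \<Rightarrow> q13 \<Rightarrow> int \<times> int" where "residue_pair n x = (b0 x mod n, b1 x mod n)"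

lemma residue_pair_mult: "residue_pair n (x * y) = mulm n (residue_pair n x) (residue_pair n y)"
proof -
  have "[a * c + 3 * (b * d) = (a mod n) * (c mod n) + 3 * ((b mod n) * (d mod n))] (mod n)"
    "[a * d + b * c - b * d = (a mod n) * (d mod n) + (b mod n) * (c mod n) - (b mod n) * (d mod n)] (mod n)" for a b c d
    by (intro cong_add cong_diff cong_mult cong_refl; simp add: cong_def)+
  thus ?thesis by (simp add: residue_pair_def times_q13_def cong_def)
qed

text \<open>7 is inert in \<open>\<int>[W]\<close>, and 48 is the order of the unit group of the
  residue field. The power is computed as a cube followed by four squarings.\<close>

definition power48_mod :: "int \<Rightarrow> int \<times> int \<Rightarrow> int \<times> int" where
  "power48_mod n x = sqm n (sqm n (sqm n (sqm n (mulm n x (sqm n x)))))"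

lemma residue_pair_power48: "residue_pair n (x ^ 48) = power48_mod n (residue_pair n x)"
proof -
  have sq: "sqm n (residue_pair n y) = residue_pair n (y * y)" for y
    unfolding residue_pair_mult by (cases "residue_pair n y") simp
  have "x * (x * x) = x ^ 3" by (simp add: power3_eq_cube mult_ac)
  moreover have "x ^ 3 * x ^ 3 = x ^ 6" "x ^ 6 * x ^ 6 = x ^ 12" "x ^ 12 * x ^ 12 = x ^ 24" "x ^ 24 * x ^ 24 = x ^ 48"
    by (simp_all flip: power_add)
  ultimately show ?thesis by (simp only: power48_mod_def sq residue_pair_mult[symmetric])
qed

lemma residue_pair_eq_iff: "residue_pair n x = residue_pair n y \<longleftrightarrow> n dvd b0 x - b0 y \<and> n dvd b1 x - b1 y"
  by (simp add: residue_pair_def mod_eq_dvd_iff)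

lemma of_int_q13: "(of_int k :: q13) = Q13 k 0"
proof -
  have "of_nat m = Q13 (int m) 0" for m by (induction m) (simp_all add: q13_defs)
  thus ?thesis by (cases k) (simp_all add: q13_defs)
qed

lemma of_int_dvd_q13: "of_int n dvd x \<longleftrightarrow> n dvd b0 x \<and> n dvd b1 x"
proof -
  note o = of_int_q13
  show ?thesis
  proof
    assume "of_int n dvd x"
    then obtain y where "x = of_int n * y" by (rule dvdE)
    thus "n dvd b0 x \<and> n dvd b1 x" by (simp add: o times_q13_def)
  next
    assume "n dvd b0 x \<and> n dvd b1 x"
    then obtain u v where "b0 x = n * u" "b1 x = n * v" by (auto elim!: dvdE)
    hence "x = of_int n * Q13 u v" by (cases x) (simp add: o times_q13_def)
    thus "of_int n dvd x" by (rule dvdI)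
  qed
qed

lemma residue_pair_cong: "residue_pair n x = residue_pair n y \<longleftrightarrow> of_int n dvd x - y"
  unfolding residue_pair_eq_iff of_int_dvd_q13 by (simp add: minus_q13_def)

definition check7 :: "int \<times> int \<Rightarrow> bool" where "check7 x \<longleftrightarrow> x = (0, 0) \<or> power48_mod 7 x = (1, 0)"

lemma check7: "list_all check7 (List.product [0,1,2,3,4,5,6] [0,1,2,3,4,5,6])"
  by (simp add: check7_def power48_mod_def)

lemma power48_mod_7: "\<not> of_int 7 dvd g \<Longrightarrow> of_int 7 dvd (g::q13) ^ 48 - 1"
proof -
  assume g: "\<not> of_int 7 dvd g"
  have "k mod 7 \<in> set [0,1,2,3,4,5,6]" for k :: int
  proof -
    have "0 \<le> k mod 7" "k mod 7 < 7" by simp_all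
    hence "k mod 7 = 0 \<or> k mod 7 = 1 \<or> k mod 7 = 2 \<or> k mod 7 = 3 \<or> k mod 7 = 4 \<or> k mod 7 = 5 \<or> k mod 7 = 6" by linarith
    thus ?thesis by simp
  qed
  hence "residue_pair 7 g \<in> set (List.product [0,1,2,3,4,5,6] [0,1,2,3,4,5,6])"
    unfolding set_product residue_pair_def by blast
  hence "check7 (residue_pair 7 g)" using check7 unfolding list_all_iff by blast
  moreover have "residue_pair 7 g \<noteq> (0, 0)" using g unfolding of_int_dvd_q13 by (simp add: residue_pair_def dvd_eq_mod_eq_0)
  ultimately have "power48_mod 7 (residue_pair 7 g) = (1, 0)" unfolding check7_def by blast
  hence "residue_pair 7 (g ^ 48) = residue_pair 7 1" unfolding residue_pair_power48 by (simp add: residue_pair_def one_q13_def)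
  thus ?thesis unfolding residue_pair_cong .
qed

lemma residue_pair_of_int_mult: "n dvd s - 1 \<Longrightarrow> residue_pair n (of_int s * x) = residue_pair n x"
proof -
  assume "n dvd s - 1"
  then obtain q where q: "s - 1 = n * q" by (rule dvdE)
  have "of_int s * x - x = of_int (s - 1) * x" by (simp add: algebra_simps)
  also have "\<dots> = of_int n * (of_int q * x)" unfolding q by (simp add: mult_ac)
  finally have "of_int n dvd of_int s * x - x" by simp
  thus ?thesis unfolding residue_pair_cong .
qed

lemma norm_form_cong: "n dvd a - a' \<Longrightarrow> n dvd b - b' \<Longrightarrow> residue_pair n (norm_form a b) = residue_pair n (norm_form a' b')"
proof -
  assume "n dvd a - a'" "n dvd b - b'"
  hence h: "[a = a'] (mod n)" "[b = b'] (mod n)" by (simp_all add: cong_iff_dvd_diff)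
  show ?thesis
    unfolding residue_pair_eq_iff norm_form_def Let_def q13.sel cong_iff_dvd_diff[symmetric]
    by (intro conjI cong_add cong_diff cong_mult cong_pow h)
qed

lemma norm_form_homogeneous: "norm_form (s * a) (s * b) = of_int (s ^ 6) * norm_form a b"
  by (simp add: norm_form_def Let_def of_int_q13 times_q13_def algebra_simps eval_nat_numeral)

text \<open>The form has degree 6, so dividing a and b by d^7 changes it by d^42, which is 1 modulo
  n. Only the residue t of a / d^7 remains.\<close>

lemma norm_form_normalise:
  assumes "n > 0" "n dvd d ^ 42 - 1" "a + b = c * d ^ 7"
  shows "\<exists>t. 0 \<le> t \<and> t < n \<and> residue_pair n (norm_form a b) = residue_pair n (norm_form t (c - t))"
proof -
  define t where "t = (a * d ^ 35) mod n"
  have "n dvd a * d ^ 35 - t" unfolding t_def by simp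
  hence "n dvd d ^ 7 * (a * d ^ 35 - t)" by (rule dvd_mult)
  moreover have "d ^ 7 * (a * d ^ 35) = a * d ^ 42" by (simp flip: power_add)
  ultimately have "n dvd a * d ^ 42 - d ^ 7 * t" by (simp add: right_diff_distrib)
  moreover have "n dvd a - a * d ^ 42" using dvd_mult[OF assms(2), of "- a"] by (simp add: algebra_simps)
  ultimately have at: "n dvd a - d ^ 7 * t" using dvd_diff_chain by blast
  have "b - d ^ 7 * (c - t) = - (a - d ^ 7 * t)" using assms(3) by (simp add: algebra_simps)
  hence bt: "n dvd b - d ^ 7 * (c - t)" using at by (simp only: dvd_minus_iff)
  have "residue_pair n (norm_form a b) = residue_pair n (of_int ((d ^ 7) ^ 6) * norm_form t (c - t))"
    unfolding norm_form_homogeneous[symmetric] by (rule norm_form_cong[OF at bt])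
  also have "\<dots> = residue_pair n (norm_form t (c - t))" using assms(2) by (intro residue_pair_of_int_mult) (simp flip: power_mult)
  finally show ?thesis using assms(1) unfolding t_def by (intro exI[of _ t]) (simp add: t_def)
qed

text \<open>Modulo 49 the 48th power only depends on the exponent of the fundamental unit, and determines it.\<close>

definition eta_table :: "(int \<times> int) list" where
  "eta_table = [(1, 0), (22, 42), (43, 35), (15, 28), (36, 21), (8, 14), (29, 7)]"

lemma eta_table: "k < 7 \<Longrightarrow> residue_pair 49 ((eta ^ k) ^ 48) = eta_table ! k"
proof -
  assume k: "k < 7"
  have 1: "residue_pair 49 (eta ^ 48) = (22, 42)" unfolding residue_pair_power48 by (simp add: residue_pair_def power48_mod_def)
  have "n < 7 \<Longrightarrow> residue_pair 49 ((eta ^ 48) ^ n) = eta_table ! n" for n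
  proof (induction n)
    case 0
    show ?case by (simp add: residue_pair_def one_q13_def eta_table_def)
  next
    case (Suc n)
    hence "residue_pair 49 ((eta ^ 48) ^ Suc n) = mulm 49 (22, 42) (eta_table ! n)" by (simp add: residue_pair_mult 1)
    moreover have "n = 0 \<or> n = 1 \<or> n = 2 \<or> n = 3 \<or> n = 4 \<or> n = 5" using Suc.prems by linarith
    ultimately show ?case by (elim disjE) (simp_all add: eta_table_def)
  qed
  from this[OF k] show ?thesis by (simp add: mult.commute flip: power_mult)
qed

text \<open>The set omits \<open>eta_table ! 2\<close>: the exponent 2 is the only one that survives
  modulo 49 in the unramified case.\<close>

definition check49a :: "int \<Rightarrow> bool" where
  "check49a t \<longleftrightarrow> power48_mod 49 (residue_pair 49 (norm_form t (3 - t))) \<notin> {(0, 0), (1, 0), (22, 42), (15, 28), (36, 21), (8, 14), (29, 7)}"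

text \<open>45 is 3 * 13^6 modulo 49. The nonzero entries are those of \<open>eta_table\<close>
  multiplied by (29, 42), the 48th power of the norm of 2 - \<theta>, with the surviving exponent 3
  omitted.\<close>

definition check49b :: "int \<Rightarrow> bool" where
  "check49b t \<longleftrightarrow> power48_mod 49 (residue_pair 49 (norm_form t (45 - t))) \<notin> {(0, 0), (29, 42), (1, 35), (22, 28), (15, 14), (36, 7), (8, 0)}"

lemma upto_48: "[0..48] = [0,1,2,3,4,5,6,7,8,9,10,11,12,13,14,15,16,17,18,19,20,21,22,23,24,25,26,27,28,29,30,31,32,33,34,35,36,37,38,39,40,41,42,43,44,45,46,47,48::int]"
  by (simp add: upto_rec1)

lemma check49: "list_all check49a [0..48]" "list_all check49b [0..48]"
  unfolding upto_48 by (simp_all add: check49a_def check49b_def residue_pair_def norm_form_def Let_def power48_mod_def)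

lemma sieve49:
  assumes e: "norm_form a b = c * eta ^ k * g ^ 7" and ab: "a + b = s0 * d ^ 7" and d: "\<not> 7 dvd d" and k: "k < 7"
  shows "\<exists>t. 0 \<le> t \<and> t < 49 \<and> (power48_mod 49 (residue_pair 49 (norm_form t (s0 - t))) = (0, 0) \<or>
    power48_mod 49 (residue_pair 49 (norm_form t (s0 - t))) = mulm 49 (residue_pair 49 (c ^ 48)) (eta_table ! k))"
proof -
  have "int 7 dvd d ^ 7 - d" by (rule fermat_int) simp
  hence "7 dvd d * (d ^ 6 - 1)" by (simp add: right_diff_distrib flip: power_Suc)
  hence "7 dvd d ^ 6 - 1" using d prime_dvd_mult_iff[of "7::int" d "d ^ 6 - 1"] by simp
  from seventh_powers_mod_49[OF this] have "49 dvd d ^ 42 - 1" by (simp flip: power_mult)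
  then obtain t where t: "0 \<le> t" "t < 49" "residue_pair 49 (norm_form a b) = residue_pair 49 (norm_form t (s0 - t))"
    using norm_form_normalise[of 49 d a b s0] ab by auto
  have p: "power48_mod 49 (residue_pair 49 (norm_form t (s0 - t))) = residue_pair 49 (((c * eta ^ k) * g ^ 7) ^ 48)"
    unfolding t(3)[symmetric] residue_pair_power48[symmetric] e by (rule refl)
  have "power48_mod 49 (residue_pair 49 (norm_form t (s0 - t))) = (0, 0) \<or>
    power48_mod 49 (residue_pair 49 (norm_form t (s0 - t))) = mulm 49 (residue_pair 49 (c ^ 48)) (eta_table ! k)"
  proof (cases "of_int 7 dvd g")
    case True
    hence "of_int 7 dvd g ^ 7" by (rule dvd_trans) (simp add: dvd_power)
    hence "of_int 7 dvd (c * eta ^ k) * g ^ 7" by (rule dvd_mult)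
    hence "of_int 7 ^ 2 dvd ((c * eta ^ k) * g ^ 7) ^ 2" by (rule dvd_power_same)
    also have "\<dots> dvd ((c * eta ^ k) * g ^ 7) ^ 48" by (rule le_imp_power_dvd) simp
    finally have "of_int 49 dvd ((c * eta ^ k) * g ^ 7) ^ 48 - 0" by simp
    hence "residue_pair 49 (((c * eta ^ k) * g ^ 7) ^ 48) = residue_pair 49 0" unfolding residue_pair_cong by simp
    thus ?thesis using p by (simp add: residue_pair_def zero_q13_def)
  next
    case False
    from seventh_powers_mod_49[of "g ^ 48" 1] power48_mod_7[OF False] have "of_int 49 dvd (g ^ 48) ^ 7 - 1" by simp
    hence "of_int 49 dvd (c * eta ^ k) ^ 48 * ((g ^ 48) ^ 7 - 1)" by (rule dvd_mult)
    moreover have "(c * eta ^ k) ^ 48 * ((g ^ 48) ^ 7 - 1) = ((c * eta ^ k) * g ^ 7) ^ 48 - (c * eta ^ k) ^ 48"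
      by (simp add: power_mult_distrib right_diff_distrib flip: power_mult)
    ultimately have "residue_pair 49 (((c * eta ^ k) * g ^ 7) ^ 48) = residue_pair 49 ((c * eta ^ k) ^ 48)" unfolding residue_pair_cong by simp
    also have "\<dots> = mulm 49 (residue_pair 49 (c ^ 48)) (eta_table ! k)"
      unfolding power_mult_distrib residue_pair_mult eta_table[OF k] by (rule refl)
    finally show ?thesis using p by simp
  qed
  thus ?thesis using t by blast
qed

lemma sieve49_cases:
  assumes "a + b = s0 * d ^ 7" "\<not> 7 dvd d" "k < 7" "norm_form a b = c * eta ^ k * g ^ 7"
  shows "s0 = 3 \<Longrightarrow> c = 1 \<Longrightarrow> k = 2" "s0 = 3 * 13 ^ 6 \<Longrightarrow> c = Q13 5 (- 3) \<Longrightarrow> k = 3"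
proof -
  have k: "k = 0 \<or> k = 1 \<or> k = 2 \<or> k = 3 \<or> k = 4 \<or> k = 5 \<or> k = 6" using assms(3) by linarith
  obtain t where t: "0 \<le> t" "t < 49" "power48_mod 49 (residue_pair 49 (norm_form t (s0 - t))) = (0, 0) \<or>
    power48_mod 49 (residue_pair 49 (norm_form t (s0 - t))) = mulm 49 (residue_pair 49 (c ^ 48)) (eta_table ! k)"
    using sieve49[OF assms(4,1,2,3)] by blast
  have "t \<in> set [0..48]" using t by simp
  hence ch: "check49a t" "check49b t" using check49 unfolding list_all_iff by blast+
  show "k = 2" if "s0 = 3" "c = 1"
  proof -
    have "residue_pair 49 (1 ^ 48) = (1, 0)" unfolding power_one by (simp add: residue_pair_def one_q13_def)
    thus ?thesis using t(3) ch(1) k unfolding that check49a_def by (elim disjE) (auto simp: eta_table_def)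
  qed
  show "k = 3" if "s0 = 3 * 13 ^ 6" "c = Q13 5 (- 3)"
  proof -
    have "residue_pair 49 (Q13 5 (- 3) ^ 48) = (29, 42)" unfolding residue_pair_power48 by (simp add: residue_pair_def power48_mod_def)
    moreover have "residue_pair 49 (norm_form t (3 * 13 ^ 6 - t)) = residue_pair 49 (norm_form t (45 - t))" by (rule norm_form_cong) simp_all
    ultimately show ?thesis using t(3) ch(2) k unfolding that check49b_def by (elim disjE) (auto simp: eta_table_def)
  qed
qed

section \<open>The sieve modulo 43\<close>

definition eval_root :: "int \<Rightarrow> q13 \<Rightarrow> int" where "eval_root r x = b0 x + b1 x * r"

definition sixth :: "int \<Rightarrow> int \<Rightarrow> bool" where
  "sixth h v \<longleftrightarrow> v = 0 \<or> (v\<^sup>2 mod 43) ^ 3 mod 43 = h"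

text \<open>Modulo 43 the ring \<open>\<int>[W]\<close> has the two residue maps \<open>W \<mapsto> 11\<close> and \<open>W \<mapsto> 31\<close>, and sixth powers of
  seventh powers are 0 or 1.\<close>

fun hit :: "int \<Rightarrow> int \<Rightarrow> int \<times> int \<Rightarrow> bool" where
  "hit r h (a, b) \<longleftrightarrow> sixth h ((a + b * r) mod 43)"

lemma sixth_mod: "sixth h (v mod 43) \<longleftrightarrow> v mod 43 = 0 \<or> v ^ 6 mod 43 = h"
proof -
  have "((v mod 43)\<^sup>2 mod 43) ^ 3 mod 43 = (v\<^sup>2) ^ 3 mod 43" by (simp only: power_mod)
  thus ?thesis unfolding sixth_def by (simp flip: power_mult)
qed

definition miss :: "int \<Rightarrow> int \<Rightarrow> int \<times> int \<Rightarrow> bool" where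
  "miss h h' z \<longleftrightarrow> \<not> (hit 11 h z \<and> hit 31 h' z)"

text \<open>21 and 41 are the values of \<open>eta ^ 12\<close> under the two residue maps, for the
  exponent 2 left over by the modulus 49.\<close>

definition check43a :: "int \<Rightarrow> bool" where
  "check43a t \<longleftrightarrow> miss 21 41 (residue_pair 43 (norm_form t (3 - t))) \<and> (t = 0 \<or> miss 21 41 (residue_pair 43 (norm_form t (- t))))"

text \<open>5 is 3 * 13^6 modulo 43, and 1 and 16 are the values of
  \<open>Q13 5 (- 3) ^ 6 * eta ^ 18\<close> under the two residue maps.\<close>

definition check43b :: "int \<Rightarrow> bool" where
  "check43b t \<longleftrightarrow> miss 1 16 (residue_pair 43 (norm_form t (5 - t))) \<and> (t = 0 \<or> miss 1 16 (residue_pair 43 (norm_form t (- t))))"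

lemma upto_42: "[0..42] = [0,1,2,3,4,5,6,7,8,9,10,11,12,13,14,15,16,17,18,19,20,21,22,23,24,25,26,27,28,29,30,31,32,33,34,35,36,37,38,39,40,41,42::int]"
  by (simp add: upto_rec1)

lemma check43: "list_all check43a [0..42]" "list_all check43b [0..42]"
  unfolding upto_42 by (simp_all add: check43a_def check43b_def miss_def sixth_def residue_pair_def norm_form_def Let_def)

lemma eval_root_mult: "r\<^sup>2 + r - 3 = 43 * q \<Longrightarrow> 43 dvd eval_root r (x * y) - eval_root r x * eval_root r y"
proof -
  assume "r\<^sup>2 + r - 3 = 43 * q"
  hence r: "r * r = 43 * q + 3 - r" by (simp add: power2_eq_square)
  have "eval_root r x * eval_root r y = b0 x * b0 y + (b0 x * b1 y + b1 x * b0 y) * r + b1 x * b1 y * (r * r)"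
    by (simp add: eval_root_def algebra_simps)
  hence "eval_root r (x * y) - eval_root r x * eval_root r y = 43 * (- (b1 x * b1 y * q))"
    unfolding r by (simp add: eval_root_def times_q13_def algebra_simps)
  thus ?thesis by (metis dvd_triv_left)
qed

lemma eval_root_power: "r\<^sup>2 + r - 3 = 43 * q \<Longrightarrow> 43 dvd eval_root r (x ^ n) - eval_root r x ^ n"
proof (induction n)
  case (Suc n)
  have "43 dvd eval_root r x * eval_root r (x ^ n) - eval_root r x * eval_root r x ^ n"
    using dvd_mult[OF Suc.IH[OF Suc.prems], of "eval_root r x"] by (simp add: right_diff_distrib)
  from dvd_diff_chain[OF eval_root_mult[OF Suc.prems] this] show ?case by simp
qed (simp add: eval_root_def one_q13_def)

lemma sieve43:
  assumes r: "r\<^sup>2 + r - 3 = 43 * q" and x: "x = c * eta ^ k * g ^ 7" and h: "(eval_root r c) ^ 6 * eval_root r eta ^ (6 * k) mod 43 = h"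
    and z: "residue_pair 43 x = z"
  shows "hit r h z"
proof -
  obtain z0 z1 where zz: "z = (z0, z1)" by fastforce
  let ?v = "z0 + z1 * r"
  have v: "[?v = eval_root r x] (mod 43)"
    using z unfolding zz residue_pair_def eval_root_def by (intro cong_add cong_mult cong_refl) (auto simp: cong_def)
  have "[eval_root r x = eval_root r (c * eta ^ k) * eval_root r (g ^ 7)] (mod 43)"
    unfolding x cong_iff_dvd_diff by (rule eval_root_mult[OF r])
  also have "[eval_root r (c * eta ^ k) * eval_root r (g ^ 7) = (eval_root r c * eval_root r (eta ^ k)) * eval_root r g ^ 7] (mod 43)"
    by (intro cong_mult) (simp_all add: cong_iff_dvd_diff eval_root_mult[OF r] eval_root_power[OF r])
  also have "[(eval_root r c * eval_root r (eta ^ k)) * eval_root r g ^ 7 = (eval_root r c * eval_root r eta ^ k) * eval_root r g ^ 7] (mod 43)"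
    by (intro cong_mult cong_refl) (simp add: cong_iff_dvd_diff eval_root_power[OF r])
  finally have e: "[?v = eval_root r c * eval_root r eta ^ k * eval_root r g ^ 7] (mod 43)" using v cong_trans by blast
  have p: "prime (43::nat)" "prime (43::int)" by simp_all
  have "?v mod 43 = 0 \<or> ?v ^ 6 mod 43 = h"
  proof (cases "43 dvd eval_root r g")
    case True
    hence "43 dvd eval_root r c * eval_root r eta ^ k * eval_root r g ^ 7" by (intro dvd_mult) (auto intro: dvd_trans dvd_power)
    hence "43 dvd ?v" using e cong_dvd_iff by blast
    thus ?thesis by (simp add: dvd_eq_mod_eq_0)
  next
    case False
    have "int 43 dvd eval_root r g ^ 43 - eval_root r g" by (rule fermat_int[OF p(1)])
    hence "43 dvd eval_root r g * (eval_root r g ^ 42 - 1)" by (simp add: right_diff_distrib flip: power_Suc)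
    hence "43 dvd eval_root r g ^ 42 - 1" using False prime_dvd_mult_iff[OF p(2)] by blast
    hence g: "[eval_root r g ^ 42 = 1] (mod 43)" by (simp add: cong_iff_dvd_diff)
    have "[?v ^ 6 = (eval_root r c * eval_root r eta ^ k * eval_root r g ^ 7) ^ 6] (mod 43)" by (rule cong_pow[OF e])
    also have "(eval_root r c * eval_root r eta ^ k * eval_root r g ^ 7) ^ 6 = (eval_root r c ^ 6 * eval_root r eta ^ (6 * k)) * eval_root r g ^ 42"
      by (simp add: power_mult_distrib mult.commute[of 6] flip: power_mult)
    also have "[\<dots> = (eval_root r c ^ 6 * eval_root r eta ^ (6 * k)) * 1] (mod 43)" by (rule cong_mult[OF cong_refl g])
    finally show ?thesis using h by (simp add: cong_def)
  qed
  thus ?thesis unfolding zz hit.simps sixth_mod .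
qed

text \<open>If 43 divides \<open>d\<close> then \<open>b \<equiv> -a\<close>, which is why \<open>check43a\<close> and \<open>check43b\<close> have a second clause.\<close>

theorem sieve:
  assumes ab: "coprime a b" "a + b = s0 * d ^ 7" and d: "\<not> 7 dvd d"
    and cs: "(s0 = 3 \<and> c = 1) \<or> (s0 = 3 * 13 ^ 6 \<and> c = Q13 5 (- 3))"
  shows "\<not> (\<exists>k<7. \<exists>g. norm_form a b = c * eta ^ k * g ^ 7)"
proof
  assume "\<exists>k<7. \<exists>g. norm_form a b = c * eta ^ k * g ^ 7"
  then obtain k g where k: "k < 7" and e: "norm_form a b = c * eta ^ k * g ^ 7" by blast
  define s where "s = (if 43 dvd d then 0 else s0)"
  have p: "prime (43::nat)" "prime (43::int)" by simp_all
  obtain t where t: "0 \<le> t" "t < 43" "residue_pair 43 (norm_form a b) = residue_pair 43 (norm_form t (s - t))" "s = 0 \<Longrightarrow> t \<noteq> 0"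
  proof (cases "43 dvd d")
    case True
    define t where "t = a mod 43"
    have "43 dvd d ^ 7" using True by (auto intro: dvd_trans dvd_power)
    hence ab': "43 dvd a + b" unfolding ab(2) by (rule dvd_mult)
    have "t \<noteq> 0"
    proof
      assume "t = 0"
      hence "43 dvd a" by (simp add: t_def dvd_eq_mod_eq_0)
      moreover from this ab' have "43 dvd b" by (simp add: dvd_add_right_iff)
      ultimately have "is_unit (43::int)" using ab(1) coprime_common_divisor by blast
      thus False by simp
    qed
    moreover have "43 dvd a - t" unfolding t_def by simp
    moreover have "43 dvd b - (0 - t)" using dvd_diff[OF ab' \<open>43 dvd a - t\<close>] by (simp add: algebra_simps)
    ultimately show thesis using that[of t] norm_form_cong[of 43 a t b "0 - t"] True by (simp add: s_def t_def)
  next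
    case False
    have "int 43 dvd d ^ 43 - d" by (rule fermat_int[OF p(1)])
    hence "43 dvd d * (d ^ 42 - 1)" by (simp add: right_diff_distrib flip: power_Suc)
    hence "43 dvd d ^ 42 - 1" using False prime_dvd_mult_iff[OF p(2)] by blast
    moreover have "s \<noteq> 0" using False cs by (auto simp: s_def)
    ultimately show thesis using that norm_form_normalise[of 43 d a b s0] ab(2) False by (auto simp: s_def)
  qed
  have tt: "t \<in> set [0..42]" using t by simp
  hence ch: "check43a t" "check43b t" using check43 unfolding list_all_iff by blast+
  have roots: "11\<^sup>2 + 11 - 3 = 43 * (3::int)" "31\<^sup>2 + 31 - 3 = 43 * (23::int)" by simp_all
  have sv: "hit 11 ((eval_root 11 c) ^ 6 * eval_root 11 eta ^ (6 * k) mod 43) (residue_pair 43 (norm_form t (s - t)))"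
    "hit 31 ((eval_root 31 c) ^ 6 * eval_root 31 eta ^ (6 * k) mod 43) (residue_pair 43 (norm_form t (s - t)))"
    by (rule sieve43[OF roots(1) e refl t(3)], rule sieve43[OF roots(2) e refl t(3)])
  show False
  proof (cases "s0 = 3 \<and> c = 1")
    case True
    hence "k = 2" using sieve49_cases(1)[OF ab(2) d k e] by simp
    hence "\<not> miss 21 41 (residue_pair 43 (norm_form t (s - t)))"
      unfolding miss_def using sv True by (simp add: eval_root_def one_q13_def)
    thus False using ch(1) t(4) True unfolding check43a_def s_def by (auto split: if_splits)
  next
    case False
    hence c: "s0 = 3 * 13 ^ 6" "c = Q13 5 (- 3)" using cs by auto
    hence "k = 3" using sieve49_cases(2)[OF ab(2) d k e] by simp
    hence "\<not> miss 1 16 (residue_pair 43 (norm_form t (s - t)))"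
      unfolding miss_def using sv c by (simp add: eval_root_def)
    moreover have "residue_pair 43 (norm_form t (3 * 13 ^ 6 - t)) = residue_pair 43 (norm_form t (5 - t))" by (rule norm_form_cong) simp_all
    ultimately show False using ch(2) t(4) c unfolding check43b_def s_def by (auto split: if_splits)
  qed
qed

section \<open>Initial states of the descent\<close>

lemma emb_C7: "emb i j (C7 y 0 0) = e13 ((sk13 ^^ j) y)"
proof -
  have "(sa ^^ i) (C7 y 0 0) = C7 y 0 0" by (induction i) (simp_all add: sa_def)
  thus ?thesis unfolding emb_def by (simp add: sk_C7 e9_C7)
qed

text \<open>For X = (x - y)^2 and Y = x y the left side is A times (x^7 - y^7)^2. Dividing X by 7
  turns the relation into that of a \<open>state\<close>, with A and B contributing to the smooth
  factor.\<close>

theorem no_initial_state: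
  fixes X Y A B q :: c13 and d :: int
  assumes q: "q = 1 \<or> q = rho0" "q dvd X" and X: "X \<noteq> 0" "comax X Y" "3 dvd X"
    and pos: "\<And>j. j < 3 \<Longrightarrow> 0 \<le> e13 ((sk13 ^^ j) X) \<and> 0 \<le> e13 ((sk13 ^^ j) (X + 4 * Y))"
    and rel: "A * X * (X^3 + 7 * (X^2 * Y) + 14 * (X * Y^2) + 7 * Y^3)^2 = B * of_int d ^ 28"
    and d: "7 dvd d" and A: "comax 7 A" and smooth: "A dvd (21 * q) ^ k" "B dvd (21 * q) ^ k"
  shows False
proof -
  let ?P = "X^3 + 7 * (X^2 * Y) + 14 * (X * Y^2) + 7 * Y^3"
  obtain d' where d': "d = 7 * d'" using d by (rule dvdE)
  have "7 dvd (of_int d :: c13)" unfolding d' by simp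
  hence "7 dvd (of_int d :: c13) ^ 28" by (rule dvd_trans) (simp add: dvd_power)
  hence "7 dvd B * of_int d ^ 28" by (rule dvd_mult)
  hence "7 dvd A * (X * ?P^2)" unfolding rel[symmetric] by (simp only: mult.assoc)
  hence "7 dvd X * ?P^2" by (rule comax_cancel[OF A])
  moreover have "7 dvd X * ?P^2 - X ^ 7"
  proof -
    have "7 dvd ?P - X^3" by (rule dvdI[of _ _ "X^2 * Y + 2 * (X * Y^2) + Y^3"]) (simp add: algebra_simps)
    hence "7 dvd X * (?P^2 - (X^3)^2)" by (intro dvd_mult dvd_power_diff)
    moreover have "X * (?P^2 - (X^3)^2) = X * ?P^2 - X ^ 7"
      by (simp add: right_diff_distrib flip: power_mult power_Suc)
    ultimately show ?thesis by simp
  qed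
  ultimately have X7: "7 dvd X ^ 7" by (rule iffD1[OF dvd_diff_trans, rotated])
  have "reduced_mod (of_nat 7 :: c13)" by (rule reduced_c13) simp_all
  from reduced_modD[OF this, of X 7] X7 have "7 dvd X" by simp
  then obtain Z where Z: "X = 7 * Z" by (rule dvdE)
  let ?G = "49 * Z^3 + 49 * (Z^2 * Y) + 14 * (Z * Y^2) + Y^3"
  have PG: "?P = 7 * ?G" unfolding Z by (simp add: algebra_simps power2_eq_square power3_eq_cube)
  have rel': "343 * A * Z * ?G^2 = B * of_int d ^ 28"
  proof -
    have "343 * a * z * g^2 = a * (7 * z) * (7 * g)^2" for a z g :: c13
      by (simp add: power2_eq_square mult_ac)
    thus ?thesis unfolding rel[symmetric] unfolding PG unfolding Z .
  qed
  have "comax 7 Y" by (rule comax_dvd_left[OF X(2) \<open>7 dvd X\<close>])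
  hence "comax 7 (Y^3)" by (rule comax_power)
  hence "comax 7 ?G"
  proof (rule comax_cong)
    have "Y^3 - ?G = 7 * (- (7 * Z^3 + 7 * (Z^2 * Y) + 2 * (Z * Y^2)))" by (simp add: algebra_simps)
    thus "7 dvd Y^3 - ?G" by (rule dvdI)
  qed
  hence "comax 7 (A * ?G^2)" using A by (intro comax_mult comax_power)
  hence c49: "comax 49 (A * ?G^2)" using comax_powers[of 7 "A * ?G^2" 2 1] by simp
  \<comment> \<open>The factor d^28 contains 7^28, while X = 7 Z and the square of the cubic use up
    only 343. The remaining factors on the left are prime to 7.\<close>
  have "49 dvd (A * ?G^2) * Z"
  proof -
    have "B * of_int d ^ 28 = 343 * (49 * (B * 7 ^ 23 * of_int d' ^ 28))"
      unfolding d' by (simp add: power_mult_distrib mult_ac)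
    hence "343 * ((A * ?G^2) * Z) = 343 * (49 * (B * 7 ^ 23 * of_int d' ^ 28))"
      using rel' by (simp add: mult_ac)
    moreover have "(343::c13) \<noteq> 0" by (simp add: numeral_c13 zero_c13_def)
    ultimately have "(A * ?G^2) * Z = 49 * (B * 7 ^ 23 * of_int d' ^ 28)" by (metis mult_left_cancel)
    thus ?thesis by (rule dvdI)
  qed
  hence Z49: "49 dvd Z" by (rule comax_cancel[OF c49])
  have cancel7: "r dvd Z" if "r dvd X" "comax r 7" for r
    by (rule comax_cancel[OF that(2)]) (use that(1) Z in simp)
  let ?h = "\<lambda>x. C7 x 0 0"
  note h = rhom_simps[OF rhom_C7]
  have num: "?h (numeral n) = numeral n" for n by (rule rhom_numeral[OF rhom_C7])
  have "state (?h q) (?h Z) (?h Y)" unfolding state_def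
  proof (intro conjI allI impI)
    show "?h q = 1 \<or> ?h q = R0" using q(1) rhom_1[OF rhom_C7] by auto
    show "?h Z \<noteq> 0" using X(1) unfolding Z zero_k9_def by auto
    show "comax (?h Z) (?h Y)" by (rule comax_rhom[OF rhom_C7 comax_dvd_left[OF X(2)]]) (simp add: Z)
    show "49 dvd ?h Z" using rhom_dvd[OF rhom_C7 Z49] by (simp only: num)
    have "(-2) * 3 + 1 * 7 = (1::c13)" by simp
    hence "comax (3::c13) 7" by (rule comaxI)
    hence "3 dvd Z" by (rule cancel7[OF X(3)])
    from rhom_dvd[OF rhom_C7 this] show "3 dvd ?h Z" by (simp only: num)
    have "q dvd Z"
    proof (cases "q = 1")
      case False
      have "(-1) * 13 + 2 * 7 = (1::c13)" by simp
      hence "comax (13::c13) 7" by (rule comaxI)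
      hence "comax q 7" using q(1) False rho0_dvd_13 comax_dvd_left by blast
      thus ?thesis by (rule cancel7[OF q(2)])
    qed simp
    thus "?h q dvd ?h Z" by (rule rhom_dvd[OF rhom_C7])
    fix i j :: nat assume "j < 3"
    have r: "rhom (\<lambda>x. e13 ((sk13 ^^ j) x))" by (rule rhom_comp[OF rhom_e13 rhom_funpow[OF rhom_sk13]])
    show "0 \<le> emb i j (?h Z)" using pos[OF \<open>j < 3\<close>] unfolding Z emb_C7 by (simp add: rhom_simps[OF r])
    have "7 * ?h Z + 4 * ?h Y = ?h (X + 4 * Y)" unfolding Z by (simp only: h num)
    thus "0 \<le> emb i j (7 * ?h Z + 4 * ?h Y)" using pos[OF \<open>j < 3\<close>] by (simp only: emb_C7)
  next
    have cub: "(p2 * p3 * z + y) * (p1 * p3 * z + y) * (p1 * p2 * z + y) = 49 * z^3 + 49 * (z^2 * y) + 14 * (z * y^2) + y^3" for z y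
    proof -
      have "(b * c * z + y) * (a * c * z + y) * (a * b * z + y) = (a * b * c)^2 * z^3 + (a * b * c) * (a + b + c) * (z^2 * y)
          + (a * b + a * c + b * c) * (z * y^2) + y^3" for a b c :: k9
        by (simp add: algebra_simps power2_eq_square power3_eq_cube)
      from this[of p2 p3 p1] show ?thesis unfolding p_sums by simp
    qed
    \<comment> \<open>\<open>B ^ 6\<close> completes B d^28 to the seventh power of B d^4.\<close>
    have "343 * A * B ^ 6 * Z * ?G^2 = (B * of_int d ^ 4) ^ 7"
    proof -
      have "343 * A * B ^ 6 * Z * ?G^2 = B ^ 6 * (343 * A * Z * ?G^2)" by (simp only: mult_ac)
      also have "\<dots> = B ^ 7 * of_int d ^ 28" unfolding rel' by (simp flip: power_Suc2 mult.assoc)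
      finally show ?thesis by (simp add: power_mult_distrib flip: power_mult)
    qed
    hence "?h (343 * A * B ^ 6 * Z * ?G^2) = ?h ((B * of_int d ^ 4) ^ 7)" by (rule arg_cong)
    hence "?h (343 * A * B ^ 6) * ?h Z * ((p2 * p3 * ?h Z + ?h Y) * (p1 * p3 * ?h Z + ?h Y) * (p1 * p2 * ?h Z + ?h Y))^2 = ?h (B * of_int d ^ 4) ^ 7"
      unfolding cub by (simp only: h num)
    moreover have "?h (343 * A * B ^ 6) dvd (21 * ?h q) ^ (3 + k + k * 6)"
    proof -
      have "343 * A * B ^ 6 dvd (21 * q) ^ 3 * (21 * q) ^ k * ((21 * q) ^ k) ^ 6"
      proof (intro mult_dvd_mono smooth dvd_power_same)
        have "7 dvd 21 * q" by (rule dvdI[of _ _ "3 * q"]) simp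
        from dvd_power_same[OF this, of 3] show "343 dvd (21 * q) ^ 3" by simp
      qed
      hence "343 * A * B ^ 6 dvd (21 * q) ^ (3 + k + k * 6)" by (simp only: power_add power_mult)
      from rhom_dvd[OF rhom_C7 this] show ?thesis by (simp only: rhom_power[OF rhom_C7] rhom_mult[OF rhom_C7] num)
    qed
    ultimately show "\<exists>c w k. c dvd (21 * ?h q) ^ k \<and>
      c * ?h Z * ((p2 * p3 * ?h Z + ?h Y) * (p1 * p3 * ?h Z + ?h Y) * (p1 * p2 * ?h Z + ?h Y))^2 = w ^ 7" by blast
  qed
  with no_state show False by blast
qed

lemma diff_fbar: "(x - fbar x)^2 = Fq (f1 x ^ 2 * C13 12 (- 4) (- 3)) 0"
proof -
  have k: "C13 12 (- 4) (- 3) = kap * kap - 4 * kap2" by (simp add: c13_defs numeral_c13)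
  show ?thesis unfolding k by (simp add: fbar_def fq_defs power2_eq_square algebra_simps)
qed

lemma sum_fbar: "x + fbar x = Fq (trF x) 0"
  by (simp add: fbar_def trF_def plus_fq_def)

lemma sextic_relation:
  fixes x :: fq
  defines "X \<equiv> f1 x ^ 2 * C13 12 (- 4) (- 3)" and "Y \<equiv> nf13 x"
  shows "(x ^ 7 - fbar x ^ 7)^2 = Fq (X * (X^3 + 7 * (X^2 * Y) + 14 * (X * Y^2) + 7 * Y^3)^2) 0"
    and "Fq (X + 4 * Y) 0 = Fq (trF x) 0 ^ 2" and "Fq X 0 = (x - fbar x)^2"
proof -
  note h = rhom_simps[OF rhom_Fq]
  have num: "Fq (numeral n) 0 = numeral n" for n by (rule rhom_numeral[OF rhom_Fq])
  show X: "Fq X 0 = (x - fbar x)^2" unfolding diff_fbar X_def by (rule refl)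
  have Y: "Fq Y 0 = x * fbar x" unfolding fbar_mult Y_def by (rule refl)
  have "x ^ 7 - fbar x ^ 7 = (x - fbar x) * Fq (X^3 + 7 * (X^2 * Y) + 14 * (X * Y^2) + 7 * Y^3) 0"
    unfolding seventh_power_diff_cubic[symmetric] by (simp only: h num X Y)
  hence "(x ^ 7 - fbar x ^ 7)^2 = Fq X 0 * Fq (X^3 + 7 * (X^2 * Y) + 14 * (X * Y^2) + 7 * Y^3) 0 ^ 2"
    unfolding X by (simp only: power_mult_distrib)
  thus "(x ^ 7 - fbar x ^ 7)^2 = Fq (X * (X^3 + 7 * (X^2 * Y) + 14 * (X * Y^2) + 7 * Y^3)^2) 0"
    by (simp only: h num)
  have "Fq (X + 4 * Y) 0 = (x - fbar x)^2 + 4 * (x * fbar x)" by (simp only: h num X Y)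
  also have "\<dots> = (x + fbar x)^2" by (simp add: power2_eq_square algebra_simps)
  finally show "Fq (X + 4 * Y) 0 = Fq (trF x) 0 ^ 2" unfolding sum_fbar .
qed

lemma square_positive: "Fq y 0 = t ^ 2 \<Longrightarrow> 0 \<le> e13 ((sk13 ^^ j) y)"
  unfolding emb_fq_Fq[symmetric] by (simp add: rhom_power[OF rhom_emb6])

lemma power27_mod_3_fq: "3 dvd (x::fq) ^ 27 - x"
proof -
  let ?x = "Fq (f0 x) 0" and ?y = "Fq (f1 x) 0 * th"
  have x: "x = ?x + ?y" by (cases x) (simp add: fq_defs)
  have p: "prime (3::nat)" "(3::fq) dvd of_nat 3" by simp_all
  have a: "3 dvd (?x + ?y) ^ 27 - ?x ^ 27 - ?y ^ 27" using freshman[OF p, of ?x ?y 3] by simp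
  have c: "3 dvd Fq y 0 ^ 27 - Fq y 0" for y
  proof -
    have "Fq 3 0 dvd Fq (y ^ 27 - y) 0" by (rule rhom_dvd[OF rhom_Fq power27_mod_3_c13])
    thus ?thesis by (simp only: rhom_diff[OF rhom_Fq] rhom_power[OF rhom_Fq] numeral_fq)
  qed
  have t3: "th ^ 3 = Fq (C13 1 (- 1) 0) (C13 3 (- 1) 0)" by (simp add: power3_eq_cube fq_defs c13_defs)
  have "th ^ 27 = ((th ^ 3) ^ 3) ^ 3" by (simp flip: power_mult)
  also have "\<dots> = Fq (C13 3687411 (- 5778201) 2251470) (C13 3331228 (- 7495566) 3686280)"
    unfolding t3 by (simp add: power3_eq_cube fq_defs c13_defs)
  finally have "th ^ 27 - th = 3 * Fq (C13 1229137 (- 1926067) 750490) (C13 1110409 (- 2498522) 1228760)"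
    by (simp add: fq_defs c13_defs numeral_fq numeral_c13)
  hence t: "3 dvd th ^ 27 - th" by (rule dvdI)
  have "3 dvd ?x ^ 27 - ?x" "3 dvd ?y ^ 27 - ?y"
    unfolding power_mult_distrib by (rule c dvd_diff_mult[OF c t])+
  from dvd_add[OF this] have "3 dvd (?x ^ 27 + ?y ^ 27) - (?x + ?y)" by (simp add: algebra_simps)
  moreover have "3 dvd (?x + ?y) ^ 27 - (?x ^ 27 + ?y ^ 27)" using a by (simp add: algebra_simps)
  ultimately have "3 dvd (?x + ?y) ^ 27 - (?x + ?y)" by (rule dvd_diff_chain[rotated])
  thus ?thesis using x by simp
qed

section \<open>Factorisation of a^13 + b^13 over the integers\<close>

lemma coprime_seventh_power_int:
  fixes x y z :: int
  assumes "coprime x y" "x * y = z ^ 7" shows "\<exists>d. x = d ^ 7"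
proof (cases "x = 0 \<or> y = 0")
  case True
  thus ?thesis
  proof
    assume "x = 0"
    thus ?thesis by (intro exI[of _ 0]) simp
  next
    assume "y = 0"
    hence "\<bar>x\<bar> = 1" using assms(1) by simp
    hence "x = 1 ^ 7 \<or> x = (- 1) ^ 7" by (auto simp: abs_if split: if_splits)
    thus ?thesis by blast
  qed
next
  case False
  have "nat \<bar>x\<bar> * nat \<bar>y\<bar> = nat \<bar>z\<bar> ^ 7"
    unfolding nat_abs_mult_distrib[symmetric] assms(2) power_abs by (rule nat_power_eq) simp
  hence pw: "is_nth_power 7 (nat \<bar>x\<bar> * nat \<bar>y\<bar>)" by simp
  have cp: "coprime (nat \<bar>x\<bar>) (nat \<bar>y\<bar>)" using assms(1) by simp
  have "is_nth_power 7 (nat \<bar>x\<bar>)" by (rule is_nth_power_mult_coprime_natD(1)[OF cp pw]) (use False in auto)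
  then obtain k where "nat \<bar>x\<bar> = k ^ 7" by (rule is_nth_powerE)
  hence "\<bar>x\<bar> = int k ^ 7" by (metis abs_ge_zero int_nat_eq of_nat_power)
  hence "x = int k ^ 7 \<or> x = (- int k) ^ 7" by (auto simp: abs_if split: if_splits)
  thus ?thesis by blast
qed

text \<open>The homogenised minimal polynomial of 2 - \<theta>, evaluated at (a + b)^2 and a b. It
  is Eisenstein at 13, which controls the common factor with a + b.\<close>

lemma nF_qf: "nF (qf a b) = ((a + b)^2)^6 - 13 * (((a + b)^2)^5 * (a * b)) + 65 * (((a + b)^2)^4 * (a * b)^2)
    - 156 * (((a + b)^2)^3 * (a * b)^3) + 182 * (((a + b)^2)^2 * (a * b)^4) - 91 * ((a + b)^2 * (a * b)^5) + 13 * (a * b)^6"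
proof -
  have "nF (Fq (of_int (s - 2 * m)) (of_int m)) = s^6 - 13 * (s^5 * m) + 65 * (s^4 * m^2) - 156 * (s^3 * m^3)
      + 182 * (s^2 * m^4) - 91 * (s * m^5) + 13 * m^6" for s m
    by (simp add: nF_def nf13_def n13_def sk13_def of_int_c13 c13_defs algebra_simps eval_nat_numeral)
  from this[of "(a + b)^2" "a * b"] show ?thesis by (simp add: qf_def power2_eq_square algebra_simps)
qed

lemma thirteenth_powers_factor: "a ^ 13 + b ^ 13 = (a + b) * nF (qf a b)" for a b :: int
  unfolding nF_qf by (simp add: algebra_simps eval_nat_numeral)

lemma common_prime_13:
  assumes "coprime a b" "prime p" "p dvd a + b" "p dvd nF (qf a b)"
  shows "p = (13::int)"
proof -
  let ?S = "(a + b)^2"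
  have "nF (qf a b) = ?S * (?S^5 - 13 * (?S^4 * (a * b)) + 65 * (?S^3 * (a * b)^2)
    - 156 * (?S^2 * (a * b)^3) + 182 * (?S * (a * b)^4) - 91 * (a * b)^5) + 13 * (a * b)^6"
    unfolding nF_qf by (simp add: algebra_simps eval_nat_numeral)
  moreover have "p dvd ?S" using assms(3) by (simp add: power2_eq_square)
  ultimately have "p dvd 13 * (a * b)^6" using assms(4) by (simp add: dvd_add_right_iff)
  hence "p dvd 13 \<or> p dvd (a * b)^6" using assms(2) prime_dvd_mult_iff by blast
  hence "p dvd 13 \<or> p dvd a \<or> p dvd b"
    using assms(2) prime_dvd_power prime_dvd_mult_iff by blast
  moreover have "\<not> p dvd a" "\<not> p dvd b"
  proof -
    have "\<not> (p dvd a \<and> p dvd b)"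
      using assms(1,2) by (meson coprime_common_divisor not_prime_unit)
    thus "\<not> p dvd a" "\<not> p dvd b" using assms(3) by (auto simp: dvd_add_right_iff dvd_add_left_iff)
  qed
  moreover have "prime (13::int)" by simp
  ultimately show ?thesis using primes_dvd_imp_eq assms(2) by blast
qed

lemma common_prime_exists:
  fixes x y :: int
  assumes "\<not> coprime x y" "x \<noteq> 0" shows "\<exists>p. prime p \<and> p dvd x \<and> p dvd y"
proof -
  have "gcd x y \<noteq> 0" "\<not> is_unit (gcd x y)" using assms by (auto simp: coprime_iff_gcd_eq_1)
  then obtain p where "p dvd gcd x y" "prime p" using prime_divisor_exists by blast
  thus ?thesis by auto
qed

text \<open>Since x^13 and x agree modulo 3, the factor 3 belongs to a + b. The norm shares only the
  prime 13 with a + b and contains it at most once, so if 13 divides c the remaining 13^6 goes to a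
  + b.\<close>

lemma integer_cases:
  fixes a b c :: int
  assumes cop: "coprime a b" and eq: "a ^ 13 + b ^ 13 = 3 * c ^ 7" and c: "c \<noteq> 0"
  shows "(\<exists>d e. a + b = 3 * d ^ 7 \<and> nF (qf a b) = e ^ 7 \<and> \<not> 13 dvd e \<and> d \<noteq> 0) \<or>
    (\<exists>d e. a + b = 3 * 13 ^ 6 * d ^ 7 \<and> nF (qf a b) = 13 * e ^ 7 \<and> d \<noteq> 0)"
proof -
  let ?N = "nF (qf a b)" and ?S = "(a + b)^2"
  have p13: "prime (13::int)" by simp
  have sN: "(a + b) * ?N = 3 * c ^ 7" using eq thirteenth_powers_factor by simp
  have f: "3 dvd x ^ 13 - x" for x :: int
  proof -
    have 3: "3 dvd y ^ 3 - y" for y :: int using fermat_int[of 3 y] by simp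
    have "3 dvd (x ^ 3) ^ 4 * x - x ^ 4 * x" by (intro dvd_diff_mult dvd_power_diff 3) simp
    moreover have "3 dvd x ^ 3 * x ^ 2 - x * x ^ 2" by (intro dvd_diff_mult 3) simp
    ultimately have "3 dvd x ^ 13 - x ^ 5" "3 dvd x ^ 5 - x ^ 3" by (simp_all add: eval_nat_numeral mult_ac)
    thus ?thesis using 3[of x] dvd_diff_chain by blast
  qed
  have "3 dvd (a ^ 13 + b ^ 13) - (a + b)" using dvd_add[OF f[of a] f[of b]] by (simp add: algebra_simps)
  hence "3 dvd a + b" unfolding eq using dvd_diff_trans[of 3 "3 * c ^ 7" "a + b"] by simp
  then obtain m where m: "a + b = 3 * m" by (rule dvdE)
  have mN: "m * ?N = c ^ 7" using sN m by simp
  show ?thesis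
  proof (cases "13 dvd c")
    case False
    have "coprime m ?N"
    proof (rule ccontr)
      assume "\<not> coprime m ?N"
      moreover have "m \<noteq> 0" using mN c by auto
      ultimately obtain p where p: "prime p" "p dvd m" "p dvd ?N" using common_prime_exists by blast
      hence "p = 13" using common_prime_13[OF cop] m by auto
      hence "13 dvd c ^ 7" using p mN by (metis dvd_mult2)
      thus False using False p13 prime_dvd_power by blast
    qed
    then obtain d e where d: "m = d ^ 7" "?N = e ^ 7"
      using coprime_seventh_power_int[of m ?N c] coprime_seventh_power_int[of ?N m c] mN
      by (metis coprime_commute mult.commute)
    have "\<not> 13 dvd e"
    proof
      assume "13 dvd e"
      hence "13 dvd m * e ^ 7" by (intro dvd_mult) (auto intro: dvd_trans dvd_power)
      thus False using False p13 mN d(2) prime_dvd_power by metis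
    qed
    moreover have "d \<noteq> 0" using d(1) mN c by auto
    ultimately show ?thesis using d m by blast
  next
    case True
    then obtain c' where c': "c = 13 * c'" by (rule dvdE)
    define R where "R = ?S^5 * (a * b) - 5 * (?S^4 * (a * b)^2) + 12 * (?S^3 * (a * b)^3) - 14 * (?S^2 * (a * b)^4) + 7 * (?S * (a * b)^5)"
    have NR: "?N = ?S^6 + 13 * ((a * b)^6 - R)" unfolding nF_qf R_def by (simp add: algebra_simps)
    have "13 dvd m * ?N" unfolding mN c' by (simp add: power_mult_distrib)
    hence "13 dvd m \<or> 13 dvd ?N" using p13 prime_dvd_mult_iff by blast
    hence "13 dvd a + b"
    proof
      assume "13 dvd ?N"
      hence "13 dvd ?S^6" unfolding NR by (simp add: dvd_add_left_iff)
      hence "13 dvd (a + b) ^ 12" by (simp flip: power_mult)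
      thus ?thesis using p13 prime_dvd_power by blast
    qed (simp add: m)
    then obtain n where n: "a + b = 13 * n" by (rule dvdE)
    have "13 dvd R" unfolding R_def n by (simp add: power_mult_distrib dvd_add dvd_diff)
    have nab: "\<not> 13 dvd a * b"
    proof
      assume "13 dvd a * b"
      hence "13 dvd a \<or> 13 dvd b" using p13 prime_dvd_mult_iff by blast
      hence "13 dvd a \<and> 13 dvd b" using \<open>13 dvd a + b\<close> by (auto simp: dvd_add_right_iff dvd_add_left_iff)
      hence "is_unit (13::int)" using cop coprime_common_divisor by blast
      thus False by simp
    qed
    define M where "M = 13 * (13 ^ 10 * n ^ 12) + (a * b)^6 - R"
    have NM: "?N = 13 * M" unfolding NR M_def n by (simp add: power_mult_distrib algebra_simps flip: power_mult)
    have M13: "\<not> 13 dvd M"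
    proof
      assume "13 dvd M"
      hence "13 dvd M - 13 * (13 ^ 10 * n ^ 12) + R" using \<open>13 dvd R\<close> by (intro dvd_add dvd_diff) auto
      hence "13 dvd (a * b)^6" by (simp add: M_def)
      thus False using nab p13 prime_dvd_power by blast
    qed
    have "13 * (m * M) = 13 * (13 ^ 6 * c' ^ 7)" using mN unfolding NM c' by (simp add: power_mult_distrib)
    hence mM: "m * M = 13 ^ 6 * c' ^ 7" by (simp only: mult_cancel_left) simp
    have "coprime 13 M" using p13 M13 by (rule prime_imp_coprime)
    hence "coprime (13 ^ 6) M" by (simp only: coprime_power_left_iff) simp
    moreover have "13 ^ 6 dvd M * m" unfolding mult.commute[of M] mM by (rule dvd_triv_left)
    ultimately have "13 ^ 6 dvd m" by (simp only: coprime_dvd_mult_right_iff)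
    then obtain m' where m': "m = 13 ^ 6 * m'" by (rule dvdE)
    have m'M: "m' * M = c' ^ 7" using mM unfolding m' by simp
    have "coprime m' M"
    proof (rule ccontr)
      assume "\<not> coprime m' M"
      moreover have "m' \<noteq> 0" using m'M c c' by auto
      ultimately obtain p where p: "prime p" "p dvd m'" "p dvd M" using common_prime_exists by blast
      have "p dvd a + b" "p dvd ?N" unfolding m m' NM using p by auto
      hence "p = 13" using common_prime_13[OF cop p(1)] by simp
      thus False using p M13 by simp
    qed
    then obtain d e where d: "m' = d ^ 7" "M = e ^ 7"
      using coprime_seventh_power_int[of m' M c'] coprime_seventh_power_int[of M m' c'] m'M
      by (metis coprime_commute mult.commute)
    moreover have "d \<noteq> 0" using d(1) m'M c c' by auto
    ultimately show ?thesis using m m' NM by (metis mult.assoc)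
  qed
qed

section \<open>The two cases\<close>

lemma comax_prod: "(\<And>j. j < (n::nat) \<Longrightarrow> comax x (f j)) \<Longrightarrow> comax x (\<Prod>j<n. f j)"
  by (induction n) (simp_all add: comax_one comax_mult)

lemma root_fq:
  assumes "\<And>j. 0 < j \<Longrightarrow> j < 6 \<Longrightarrow> comax x ((sf ^^ j) x)" "nF x = e ^ 7" "x \<noteq> 0"
  shows "\<exists>u w. u dvd 1 \<and> x = u * w ^ 7"
proof (rule coprime_seventh_power_fq)
  have "x * (\<Prod>j<5. (sf ^^ Suc j) x) = (\<Prod>j<Suc 5. (sf ^^ j) x)"
    unfolding prod.lessThan_Suc_shift by (simp del: funpow.simps(2))
  also have "\<dots> = of_int e ^ 7" using nF_prod[of x] assms(2) by simp
  finally show "x * (\<Prod>j<5. (sf ^^ Suc j) x) = of_int e ^ 7" .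
  show "comax x (\<Prod>j<5. (sf ^^ Suc j) x)" by (rule comax_prod, rule assms(1)) simp_all
qed fact

section \<open>Comaximality of the conjugate factors\<close>

lemma pi_conj: "(sf ^^ j) pith = 2 - th_conjugates ! (j mod 6)"
proof -
  have "pith = 2 - th" by (simp add: fq_defs numeral_fq)
  hence "(sf ^^ j) pith = 2 - (sf ^^ j) th"
    by (simp only: rhom_diff[OF rhom_sf_pow] rhom_numeral[OF rhom_sf_pow])
  thus ?thesis unfolding sf_th .
qed

text \<open>Differences of distinct conjugates of \<theta> are associates of the prime 2 - \<theta>
  above 13; the cofactors are explicit.\<close>

lemma pi_diff_dvd: "0 < j \<Longrightarrow> j < 6 \<Longrightarrow> (sf ^^ j) pith - pith dvd 13"
proof -
  assume "0 < j" "j < 6"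
  hence j: "j = 1 \<or> j = 2 \<or> j = 3 \<or> j = 4 \<or> j = 5" by linarith
  have "(2 - th_conjugates ! 1 - pith) * Fq (C13 6 (- 3) 2) (C13 10 (- 5) (- 1)) = 13"
    "(2 - th_conjugates ! 2 - pith) * Fq (C13 22 (- 11) (- 10)) (C13 (- 11) 12 5) = 13"
    "(2 - th_conjugates ! 3 - pith) * Fq (C13 4 (- 15) (- 3)) (C13 (- 2) 14 8) = 13"
    "(2 - th_conjugates ! 4 - pith) * Fq (C13 (- 1) 7 4) (C13 7 (- 10) (- 2)) = 13"
    "(2 - th_conjugates ! 5 - pith) * Fq (C13 (- 11) 12 5) (C13 12 (- 19) (- 9)) = 13"
    by (simp_all add: th_conjugates_def fq_defs c13_defs numeral_fq numeral_c13)
  hence "2 - th_conjugates ! 1 - pith dvd 13" "2 - th_conjugates ! 2 - pith dvd 13" "2 - th_conjugates ! 3 - pith dvd 13"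
    "2 - th_conjugates ! 4 - pith dvd 13" "2 - th_conjugates ! 5 - pith dvd 13"
    by (metis dvd_triv_left)+
  thus ?thesis unfolding pi_conj using j by (elim disjE) simp_all
qed

lemma qf_conj: "(sf ^^ j) (qf a b) = of_int ((a + b)^2) - (sf ^^ j) pith * of_int (a * b)"
  unfolding qf_alt by (simp only: rhom_simps[OF rhom_sf_pow])

lemma comax_qf_ab: "coprime a b \<Longrightarrow> comax (qf a b) (of_int (a * b))"
proof -
  assume ab: "coprime a b"
  have "coprime (a * b) (a^2 + b^2)"
  proof (rule ccontr)
    assume nc: "\<not> coprime (a * b) (a^2 + b^2)"
    have "a * b \<noteq> 0 \<or> a^2 + b^2 = 1" using ab by (cases "a = 0"; cases "b = 0"; auto simp: power2_eq_square abs_mult[symmetric] zmult_eq_1_iff abs_if split: if_splits)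
    hence "a * b \<noteq> 0" using nc by auto
    then obtain p where p: "prime p" "p dvd a * b" "p dvd a^2 + b^2" using common_prime_exists nc by blast
    have "p dvd a \<or> p dvd b" using p prime_dvd_mult_iff by blast
    hence "p dvd a \<and> p dvd b"
    proof
      assume "p dvd a"
      hence "p dvd b^2" using p(3) by (simp add: power2_eq_square dvd_add_right_iff)
      thus ?thesis using \<open>p dvd a\<close> p(1) prime_dvd_power by blast
    next
      assume "p dvd b"
      hence "p dvd a^2" using p(3) by (simp add: power2_eq_square dvd_add_left_iff)
      thus ?thesis using \<open>p dvd b\<close> p(1) prime_dvd_power by blast
    qed
    thus False using ab p(1) by (meson coprime_common_divisor not_prime_unit)
  qed
  from comax_of_int[OF this] have "comax (of_int (a * b)) (of_int (a^2 + b^2) :: fq)" .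
  moreover have "of_int (a * b) dvd of_int (a^2 + b^2) - qf a b"
    by (rule dvdI[of _ _ "- th"]) (simp add: qf_def of_int_fq of_int_c13 fq_defs c13_defs)
  ultimately show ?thesis using comax_cong comax_sym by blast
qed

lemma comax_qf_conj:
  assumes "coprime a b" "comax (qf a b) 13" "0 < j" "j < 6"
  shows "comax (qf a b) ((sf ^^ j) (qf a b))"
proof -
  have "comax (qf a b) ((sf ^^ j) pith - pith)" by (rule comax_dvd[OF assms(2) pi_diff_dvd[OF assms(3,4)]])
  hence "comax (qf a b) (((sf ^^ j) pith - pith) * of_int (a * b))" using comax_qf_ab[OF assms(1)] by (rule comax_mult)
  moreover have "((sf ^^ j) pith - pith) * of_int (a * b) = qf a b - (sf ^^ j) (qf a b)"
    unfolding qf_conj unfolding qf_alt by (simp add: algebra_simps)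
  ultimately have "comax (qf a b) (qf a b - (sf ^^ j) (qf a b))" by simp
  hence "comax (qf a b) (- (sf ^^ j) (qf a b))" by (rule comax_cong) simp
  thus ?thesis by (rule comax_dvd) simp
qed

abbreviation picof :: fq where "picof \<equiv> Fq (C13 31 (- 9) (- 7)) (C13 17 (- 2) (- 3))"

lemma picof: "pith * picof = 13"
  by (simp add: fq_defs c13_defs numeral_fq numeral_c13)

definition qf13 :: "int \<Rightarrow> int \<Rightarrow> fq" where "qf13 n m = of_int (13 * n^2) * picof - of_int m"

lemma qf13: "a + b = 13 * n \<Longrightarrow> pith * qf13 n (a * b) = qf a b"
proof -
  assume ab: "a + b = 13 * n"
  have "pith * qf13 n (a * b) = of_int (13 * n^2) * (pith * picof) - pith * of_int (a * b)"
    by (simp add: qf13_def algebra_simps)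
  also have "\<dots> = qf a b" unfolding picof qf_alt ab by (simp add: power_mult_distrib)
  finally show ?thesis .
qed

lemma comax_qf13:
  assumes "coprime a b" and n: "a + b = 13 * n"
  shows "comax (qf13 n (a * b)) (of_int (a + b))"
proof -
  have "coprime (a + b) (a * b)"
  proof -
    have ab: "gcd a b = 1" using assms(1) by (simp only: coprime_iff_gcd_eq_1)
    have "gcd (a + b) b = 1" unfolding gcd_add1 by (rule ab)
    moreover have "gcd (a + b) a = 1" unfolding gcd.commute[of "a + b"] gcd_add2 by (rule ab)
    ultimately show ?thesis by (simp only: coprime_iff_gcd_eq_1[symmetric] coprime_mult_right_iff)
  qed
  from comax_of_int[OF this] have "comax (of_int (a + b)) (of_int (a * b) :: fq)" .
  moreover have "of_int (a + b) dvd of_int (a * b) - (- qf13 n (a * b))"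
    by (rule dvdI[of _ _ "of_int n * picof"]) (simp add: qf13_def n power2_eq_square)
  ultimately have "comax (of_int (a + b)) (- qf13 n (a * b))" by (rule comax_cong)
  hence "comax (of_int (a + b)) (qf13 n (a * b))" by (rule comax_dvd) simp
  thus ?thesis by (rule comax_sym)
qed

lemma comax_qf13_13: "coprime a b \<Longrightarrow> a + b = 13 * n \<Longrightarrow> comax (qf13 n (a * b)) 13"
  using comax_qf13[of a b n] comax_dvd[of "qf13 n (a * b)" "of_int (a + b)" 13] by simp

lemma comax_qf13_conj:
  assumes ab: "coprime a b" and n: "a + b = 13 * n" and j: "0 < j" "j < 6"
  shows "comax (qf13 n (a * b)) ((sf ^^ j) (qf13 n (a * b)))"
proof -
  let ?q = "qf13 n (a * b)" and ?s = "of_int ((a + b)^2) :: fq" and ?pj = "(sf ^^ j) pith"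
  have "comax ?q (of_int (a + b) ^ 2)" using comax_qf13[OF ab n] by (rule comax_power)
  hence 1: "comax ?q (?s * (?pj - pith))"
    using comax_dvd[OF comax_qf13_13[OF ab n] pi_diff_dvd[OF j]] by (intro comax_mult) simp_all
  have e: "?pj * (sf ^^ j) ?q = ?s - ?pj * of_int (a * b)"
    unfolding qf_conj[symmetric] qf13[OF n, symmetric] rhom_mult[OF rhom_sf_pow] by (rule refl)
  have e0: "pith * ?q = ?s - pith * of_int (a * b)" unfolding qf13[OF n] qf_alt by (rule refl)
  have "?s * (?pj - pith) - (- (pith * (?pj * (sf ^^ j) ?q))) = ?pj * (pith * ?q)"
    unfolding e e0 by (simp add: algebra_simps)
  hence "?s * (?pj - pith) - (- (pith * (?pj * (sf ^^ j) ?q))) = ?q * (?pj * pith)" by (simp only: mult_ac)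
  hence "?q dvd ?s * (?pj - pith) - (- (pith * (?pj * (sf ^^ j) ?q)))" by (rule dvdI)
  from comax_cong[OF 1 this] have "comax ?q (- (pith * (?pj * (sf ^^ j) ?q)))" .
  thus ?thesis by (rule comax_dvd) (simp add: dvd_mult)
qed

text \<open>w is invertible modulo 49, so the congruence for x passes to the unit u, and Kummer's
  lemma absorbs u.\<close>

lemma unit_part_seventh_power:
  assumes u: "u dvd (1::fq)" and x: "x = u * w ^ 7" and c: "comax 7 x" and t: "49 dvd x - of_int m * t ^ 7"
  shows "\<exists>y. x = y ^ 7"
proof -
  have "comax 7 w" by (rule comax_dvd[OF c]) (simp add: x dvd_power)
  hence "comax 49 w" using comax_powers[of 7 w 2 1] by simp
  then obtain r s where "r * 49 + s * w = 1" unfolding comax_def by blast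
  hence "1 - s * w = 49 * r" by (simp add: algebra_simps)
  hence "49 dvd 1 - s * w" by (rule dvdI)
  from dvd_power_diff[OF this, of 7] have "49 dvd u * (1 - (s * w) ^ 7)" by (simp add: dvd_mult)
  moreover have "u * (1 - (s * w) ^ 7) = u - s ^ 7 * x" unfolding x by (simp add: algebra_simps power_mult_distrib)
  ultimately have 1: "49 dvd u - s ^ 7 * x" by simp
  have "49 dvd s ^ 7 * (x - of_int m * t ^ 7)" using t by (rule dvd_mult)
  hence "49 dvd s ^ 7 * x - of_int m * (s * t) ^ 7" by (simp add: algebra_simps power_mult_distrib)
  from dvd_diff_chain[OF 1 this] kummer_unit_fq[OF u] obtain v where "u = v ^ 7" by blast
  hence "x = (v * w) ^ 7" using x by (simp add: power_mult_distrib)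
  thus ?thesis by blast
qed

lemma comax_Fq: "comax (Fq x 0) (Fq y 0) \<Longrightarrow> comax x y"
proof -
  assume "comax (Fq x 0) (Fq y 0)"
  then obtain r s where "r * Fq x 0 + s * Fq y 0 = 1" unfolding comax_def by blast
  hence "f0 r * x + f0 s * y = 1" by (simp add: fq_defs)
  thus ?thesis by (rule comaxI)
qed

lemma comax_diff_fbar:
  assumes "comax x (fbar x)"
  shows "comax (f1 x ^ 2 * C13 12 (- 4) (- 3)) (nf13 x)"
proof -
  have "comax x (- (x - fbar x))" using assms by (rule comax_cong) simp
  hence 1: "comax x (x - fbar x)" by (rule comax_dvd) (simp only: dvd_minus_iff dvd_refl)
  have "comax (fbar x) (x - fbar x)" using comax_sym[OF assms] by (rule comax_cong) simp
  hence "comax (x - fbar x) (x * fbar x)" using 1 by (intro comax_mult) (auto intro: comax_sym)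
  hence "comax ((x - fbar x)^2) (x * fbar x)" using comax_powers[of "x - fbar x" "x * fbar x" 2 1] by simp
  thus ?thesis unfolding diff_fbar fbar_mult by (rule comax_Fq)
qed

lemma rho0_cube: "13 dvd (21 * rho0) ^ 3"
proof -
  have "rho0 ^ 3 = 13 * C13 3 (- 13) 8" by (simp add: power3_eq_cube c13_defs numeral_c13)
  hence "13 dvd rho0 ^ 3" by (rule dvdI)
  thus ?thesis unfolding power_mult_distrib by (rule dvd_mult)
qed

lemma of_int_c13_nonzero: "(of_int k :: c13) \<noteq> 0 \<longleftrightarrow> k \<noteq> 0"
  by (simp add: of_int_c13 zero_c13_def)

text \<open>Here \<open>(a + b)\<^sup>2 - (2 - \<theta>) a b\<close> is \<open>2 - \<theta>\<close> times a seventh power \<open>x\<^sup>7\<close>, and dividing the difference with its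
  conjugate by \<open>2 - \<theta>\<close> expresses \<open>x\<^sup>7 - fbar x\<^sup>7\<close> through \<open>(a + b)\<^sup>2\<close>.\<close>

lemma ramified_case:
  assumes ab: "coprime a b" and s: "a + b = 3 * 13 ^ 6 * d ^ 7" and N: "nF (qf a b) = 13 * e ^ 7"
    and d: "d \<noteq> 0"
  shows False
proof -
  define n where "n = 3 * 13 ^ 5 * d ^ 7"
  have n: "a + b = 13 * n" unfolding s n_def by simp
  let ?q = "qf13 n (a * b)"
  have "nF pith = 13" by (simp add: nF_def nf13_def n13_def sk13_def c13_defs numeral_c13)
  hence "13 * nF ?q = 13 * e ^ 7" using N unfolding qf13[OF n, symmetric] nF_mult by simp
  hence Nq: "nF ?q = e ^ 7" by simp
  have cj: "comax ?q ((sf ^^ j) ?q)" if "0 < j" "j < 6" for j by (rule comax_qf13_conj[OF ab n that])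
  have q0: "?q \<noteq> 0"
  proof
    assume "?q = 0"
    hence "13 dvd (1::fq)" using comax_qf13_13[OF ab n] unfolding comax_def
      by (metis add_0 mult_zero_right dvd_triv_right)
    hence "\<bar>nF 13\<bar> = 1" by (simp only: nF_unit)
    thus False by (simp add: nF_def nf13_def n13_def sk13_def c13_defs numeral_c13 numeral_fq)
  qed
  obtain u w where uw: "u dvd 1" "?q = u * w ^ 7" using root_fq[OF cj Nq q0] by blast
  have d7: "7 dvd d"
  proof (rule ccontr)
    assume "\<not> 7 dvd d"
    obtain k g where k: "k < 7" "rel_norm (u * w ^ 7) = embed_q13 (eta ^ k * g ^ 7)" using rel_norm_unit[OF uw(1)] by blast
    have "embed_q13 (norm_form a b) = embed_q13 (Q13 5 (- 3) * eta ^ k * g ^ 7)"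
      unfolding rel_norm_qf[symmetric] qf13[OF n, symmetric] rel_norm_mult uw(2) k(2)[unfolded rel_norm_mult] rel_norm_values
      by (simp only: rhom_mult[OF rhom_jq] mult.assoc)
    hence "norm_form a b = Q13 5 (- 3) * eta ^ k * g ^ 7" by (rule embed_q13_inj)
    thus False using sieve[OF ab s \<open>\<not> 7 dvd d\<close>] k(1) by blast
  qed
  have "7 dvd d ^ 7" using d7 by (rule dvd_trans) simp
  have n49: "49 dvd n"
  proof -
    have "7 ^ 7 dvd d ^ 7" using d7 by (rule dvd_power_same)
    moreover have "7 ^ 2 dvd (7::int) ^ 7" by (rule le_imp_power_dvd) simp
    ultimately have "7 ^ 2 dvd d ^ 7" using dvd_trans by blast
    thus ?thesis unfolding n_def by (simp add: dvd_mult)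
  qed
  \<comment> \<open>As 49 divides n, the element is congruent to -a b, and b to -a, so the residue
    a^2 is rational.\<close>
  have q49: "49 dvd ?q - of_int (a^2) * 1 ^ 7"
  proof -
    obtain n' where n': "n = 49 * n'" using n49 by (rule dvdE)
    have b: "b = 13 * n - a" using n by simp
    have "?q - of_int (a^2) * 1 ^ 7 = 49 * (of_int n' * (of_int (13 * n) * picof - of_int (13 * a)))"
      unfolding qf13_def b n' by (simp add: algebra_simps power2_eq_square)
    thus ?thesis by (rule dvdI)
  qed
  have "comax (of_int 7) (of_int (a^2) :: fq)"
  proof (rule comax_of_int)
    have "\<not> 7 dvd a"
    proof
      assume "7 dvd a"
      moreover have "7 dvd a + b" unfolding n using n49 by (intro dvd_mult) (auto intro: dvd_trans)
      ultimately have "7 dvd b" by (simp add: dvd_add_right_iff)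
      thus False using ab \<open>7 dvd a\<close> coprime_common_divisor by fastforce
    qed
    hence "coprime 7 a" by (intro prime_imp_coprime) simp_all
    thus "coprime 7 (a^2)" by simp
  qed
  moreover have "of_int 7 dvd of_int (a^2) - ?q"
  proof -
    have "49 dvd of_int (a^2) - ?q" using iffD1[OF dvd_diff_sym q49] by simp
    from dvd_49_7[OF this] show ?thesis by simp
  qed
  ultimately have "comax (of_int 7) ?q" by (rule comax_cong)
  then obtain x where x: "?q = x ^ 7" using unit_part_seventh_power[OF uw _ q49] by auto
  have xb: "fbar x ^ 7 = fbar ?q" unfolding x by (simp add: rhom_power[OF rhom_fbar])
  have df: "x ^ 7 - fbar x ^ 7 = of_int (13 * n^2) * (picof - fbar picof)"
    unfolding x[symmetric] xb qf13_def by (simp add: rhom_simps[OF rhom_fbar] right_diff_distrib)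
  define X where "X = f1 x ^ 2 * C13 12 (- 4) (- 3)"
  define Y where "Y = nf13 x"
  \<comment> \<open>The square of the difference of \<open>picof\<close>, that is 13 / (2 -
    \<theta>), and its conjugate.\<close>
  define K where "K = C13 3172 (- 1079) (- 858)"
  have Kd: "K dvd 169"
  proof (rule dvdI)
    show "169 = K * C13 2 (- 9) 7" by (simp add: K_def c13_defs numeral_c13)
  qed
  have "Fq (X * (X^3 + 7 * (X^2 * Y) + 14 * (X * Y^2) + 7 * Y^3)^2) 0 = Fq (of_int ((13 * n^2)^2) * K) 0"
  proof -
    have "f1 picof ^ 2 * C13 12 (- 4) (- 3) = K" by (simp add: power2_eq_square K_def c13_defs)
    hence "(x ^ 7 - fbar x ^ 7)^2 = of_int ((13 * n^2)^2) * Fq K 0"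
      unfolding df power_mult_distrib diff_fbar by simp
    also have "\<dots> = Fq (of_int ((13 * n^2)^2) * K) 0" by (simp only: rhom_mult[OF rhom_Fq] rhom_of_int[OF rhom_Fq])
    finally show ?thesis unfolding sextic_relation(1) X_def Y_def .
  qed
  hence "X * (X^3 + 7 * (X^2 * Y) + 14 * (X * Y^2) + 7 * Y^3)^2 = of_int ((13 * n^2)^2) * K" by simp
  also have "(13 * n^2)^2 = 81 * 13 ^ 22 * d ^ 28"
    unfolding n_def by (simp add: power_mult_distrib flip: power_mult)
  finally have rel: "1 * X * (X^3 + 7 * (X^2 * Y) + 14 * (X * Y^2) + 7 * Y^3)^2 = (81 * 13 ^ 22 * K) * of_int d ^ 28"
    by (simp add: mult_ac)
  show False
  proof (rule no_initial_state[where q = rho0, OF _ _ _ _ _ _ rel d7])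
    have kap0: "C13 12 (- 4) (- 3) = rho0 * C13 15 (- 5) (- 4)" by (simp add: c13_defs)
    show "rho0 dvd X" unfolding X_def kap0 by simp
    show "X \<noteq> 0"
    proof
      assume "X = 0"
      hence "(81 * 13 ^ 22 * K) * of_int d ^ 28 = 0" using rel by simp
      moreover have "K \<noteq> 0" by (simp add: K_def zero_c13_def)
      moreover have "(81 * 13 ^ 22 :: c13) \<noteq> 0" using of_int_c13_nonzero[of "81 * 13 ^ 22"] by simp
      moreover have "(of_int d :: c13) \<noteq> 0" using d by (simp add: of_int_c13_nonzero)
      ultimately show False by (metis mult_eq_0_iff power_not_zero)
    qed
    have cxq: "comax ?q (fbar ?q)" using cj[of 3] by (simp add: eval_nat_numeral sf_sq_fbar)
    have "x dvd ?q" "fbar x dvd fbar ?q" unfolding xb[symmetric] unfolding x by (simp_all add: dvd_power)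
    hence "comax x (fbar x)" using cxq comax_dvd comax_dvd_left by blast
    thus "comax X Y" unfolding X_def Y_def by (rule comax_diff_fbar)
    have "3 dvd x - fbar x"
    proof (rule seventh_power_cancel_mod_3[OF power27_mod_3_fq])
      have "of_int (13 * n^2) = 3 * (of_int (13 * 13 ^ 5 * d ^ 7 * n) :: fq)" by (simp add: n_def power2_eq_square)
      thus "3 dvd x ^ 7 - fbar x ^ 7" unfolding df by (simp only: mult.assoc dvd_triv_left)
    qed
    hence "3 dvd (x - fbar x)^2" by (simp add: power2_eq_square)
    hence "Fq 3 0 dvd Fq X 0" unfolding diff_fbar X_def by (simp only: numeral_fq)
    thus "3 dvd X" by (simp add: Fq_dvd)
    show "0 \<le> e13 ((sk13 ^^ j) X) \<and> 0 \<le> e13 ((sk13 ^^ j) (X + 4 * Y))" for j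
      using square_positive[of X "x - fbar x"] square_positive[of "X + 4 * Y" "Fq (trF x) 0"] sextic_relation(2,3)[of x]
      unfolding X_def Y_def by blast
    show "comax 7 (1::c13)" by (rule comax_one)
    show "1 dvd (21 * rho0) ^ 76" by simp
    have "81 * 13 ^ 22 * K dvd (21 * rho0) ^ 4 * ((21 * rho0) ^ 3) ^ 22 * ((21 * rho0) ^ 3) ^ 2"
    proof (intro mult_dvd_mono dvd_power_same rho0_cube)
      have "3 dvd 21 * rho0" by (rule dvdI[of _ _ "7 * rho0"]) simp
      from dvd_power_same[OF this, of 4] show "81 dvd (21 * rho0) ^ 4" by simp
      show "K dvd ((21 * rho0) ^ 3) ^ 2" by (rule dvd_trans[OF Kd]) (use dvd_power_same[OF rho0_cube, of 2] in simp)
    qed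
    also have "(21 * rho0) ^ 4 * ((21 * rho0) ^ 3) ^ 22 * ((21 * rho0) ^ 3) ^ 2 = (21 * rho0) ^ 76"
      by (simp flip: power_mult power_add)
    finally show "81 * 13 ^ 22 * K dvd (21 * rho0) ^ 76" .
  qed simp
qed

text \<open>Modulo 49 the unit is only known to be \<open>2 - \<theta>\<close> times a rational number and a seventh power. As
  \<open>(2 - \<theta>)\<^sup>6\<close> is a unit times 13, multiplying by \<open>ups\<^sup>8\<close> replaces \<open>2 - \<theta>\<close> by \<open>(2 - \<theta>)\<^sup>4\<^sup>9 / 13\<^sup>8\<close>.\<close>

lemma unramified_case:
  assumes ab: "coprime a b" and s: "a + b = 3 * d ^ 7" and N: "nF (qf a b) = e ^ 7"
    and e: "\<not> 13 dvd e" and d: "d \<noteq> 0"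
  shows False
proof -
  let ?q = "qf a b"
  have "prime (13::int)" by simp
  hence "coprime 13 e" using e by (rule prime_imp_coprime)
  hence "coprime (e ^ 7) 13" by (simp add: coprime_commute)
  from comax_of_int[OF this] have "comax (of_int (nF ?q)) (13::fq)" unfolding N by simp
  hence q13: "comax ?q 13" using dvd_nF comax_dvd_left by blast
  have cj: "comax ?q ((sf ^^ j) ?q)" if "0 < j" "j < 6" for j by (rule comax_qf_conj[OF ab q13 that])
  have q0: "?q \<noteq> 0"
  proof
    assume "?q = 0"
    hence "nF ?q = 0" by (simp only: nF_0_iff)
    hence "e = 0" using N by simp
    thus False using e by simp
  qed
  obtain u w where uw: "u dvd 1" "?q = u * w ^ 7" using root_fq[OF cj N q0] by blast
  have d7: "7 dvd d"
  proof (rule ccontr)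
    assume "\<not> 7 dvd d"
    obtain k g where k: "k < 7" "rel_norm (u * w ^ 7) = embed_q13 (eta ^ k * g ^ 7)" using rel_norm_unit[OF uw(1)] by blast
    have "embed_q13 (norm_form a b) = embed_q13 (1 * eta ^ k * g ^ 7)"
      unfolding rel_norm_qf[symmetric] uw(2) k(2) by simp
    hence "norm_form a b = 1 * eta ^ k * g ^ 7" by (rule embed_q13_inj)
    thus False using sieve[OF ab s \<open>\<not> 7 dvd d\<close>] k(1) by blast
  qed
  have s49: "49 dvd a + b"
  proof -
    have "7 ^ 7 dvd d ^ 7" using d7 by (rule dvd_power_same)
    moreover have "7 ^ 2 dvd (7::int) ^ 7" by (rule le_imp_power_dvd) simp
    ultimately have "7 ^ 2 dvd d ^ 7" using dvd_trans by blast
    thus ?thesis unfolding s by (simp add: dvd_mult)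
  qed
  define ups where "ups = Fq (C13 82 (- 12) (- 33)) (C13 (- 55) 45 (- 5))"
  have pi6: "pith ^ 6 = 13 * ups"
  proof -
    have "pith ^ 3 = Fq (C13 25 (- 5) (- 6)) (C13 (- 15) 7 0)"
      by (simp add: power3_eq_cube fq_defs c13_defs numeral_c13)
    hence "pith ^ 3 * pith ^ 3 = 13 * ups" by (simp add: ups_def fq_defs c13_defs numeral_fq numeral_c13)
    thus ?thesis by (simp flip: power_add)
  qed
  have "ups * Fq (C13 46612 (- 16267) (- 12768)) (C13 31130 (- 10845) (- 8520)) = 1"
    by (simp add: ups_def fq_defs c13_defs)
  hence ups_unit: "ups dvd 1" by (metis dvd_triv_left)
  have pi48: "pith ^ 48 = 13 ^ 8 * ups ^ 8"
  proof -
    have "pith ^ 48 = (pith ^ 6) ^ 8" by (simp flip: power_mult)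
    thus ?thesis unfolding pi6 power_mult_distrib .
  qed
  define z where "z = ?q * ups ^ 8"
  have q49: "49 dvd ?q - pith * of_int (a^2)"
  proof -
    obtain t where t: "a + b = 49 * t" using s49 by (rule dvdE)
    have b: "b = 49 * t - a" using t by simp
    have "?q - pith * of_int (a^2) = of_int ((a + b)^2) - pith * of_int (a * (a + b))"
      unfolding qf_alt by (simp add: algebra_simps power2_eq_square)
    also have "\<dots> = 49 * (of_int (t * (a + b)) - pith * of_int (a * t))"
      unfolding t by (simp add: algebra_simps power2_eq_square)
    finally show ?thesis by (rule dvdI)
  qed
  have z49: "49 dvd z - of_int (13 ^ 34 * a^2) * (pith ^ 7) ^ 7"
  proof -
    \<comment> \<open>42 is the order of the unit group modulo 49, so 13^34 inverts 13^8.\<close>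
    have "(13 ^ 42 :: int) mod 49 = 1" by simp
    hence "49 dvd (13 ^ 42 - 1 :: int)" by (simp add: mod_eq_dvd_iff[symmetric])
    then obtain t where "13 ^ 42 - 1 = 49 * (t::int)" by (rule dvdE)
    hence "of_int (13 ^ 42 - 1) = of_int (49 * t) * (1::fq)" by simp
    hence t: "(13::fq) ^ 42 = 1 + 49 * of_int t" by (simp add: algebra_simps)
    have "z - 13 ^ 42 * z = 49 * (- (of_int t * z))" unfolding t by (simp add: algebra_simps)
    hence 1: "49 dvd z - 13 ^ 42 * z" by (rule dvdI)
    have "13 ^ 42 * z = 13 ^ 34 * (13 ^ 8 * ups ^ 8) * ?q" unfolding z_def by (simp add: mult_ac flip: power_add mult.assoc)
    also have "\<dots> = 13 ^ 34 * pith ^ 48 * ?q" unfolding pi48 ..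
    finally have "13 ^ 42 * z - of_int (13 ^ 34 * a^2) * (pith ^ 7) ^ 7 = (13 ^ 34 * pith ^ 48) * (?q - pith * of_int (a^2))"
      by (simp add: algebra_simps flip: power_mult power_Suc)
    hence "49 dvd 13 ^ 42 * z - of_int (13 ^ 34 * a^2) * (pith ^ 7) ^ 7" using q49 by simp
    from dvd_diff_chain[OF 1 this] show ?thesis .
  qed
  have u8: "ups ^ 8 dvd 1" using dvd_power_same[OF ups_unit, of 8] by simp
  have "comax 7 z"
  proof -
    have "comax (of_int 7) (of_int (a^2) :: fq)"
    proof (rule comax_of_int)
      have "\<not> 7 dvd a"
      proof
        assume "7 dvd a"
        moreover have "7 dvd a + b" using s49 by (auto intro: dvd_trans)
        ultimately have "7 dvd b" by (simp add: dvd_add_right_iff)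
        thus False using ab \<open>7 dvd a\<close> coprime_common_divisor by fastforce
      qed
      hence "coprime 7 a" by (intro prime_imp_coprime) simp_all
      thus "coprime 7 (a^2)" by simp
    qed
    moreover have "comax 7 pith"
    proof -
      have "2 * 7 + (- 1) * 13 = (1::fq)" by simp
      hence "comax 7 (13::fq)" by (rule comaxI)
      thus ?thesis by (rule comax_dvd) (simp flip: picof)
    qed
    ultimately have "comax 7 (pith * of_int (a^2))" by (intro comax_mult) simp_all
    moreover have "7 dvd pith * of_int (a^2) - ?q" by (rule dvd_49_7[OF iffD1[OF dvd_diff_sym q49]])
    ultimately have "comax 7 ?q" by (rule comax_cong)
    moreover have "comax 7 (ups ^ 8)" by (rule comax_sym[OF unit_comax[OF u8]])
    ultimately show ?thesis unfolding z_def by (rule comax_mult)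
  qed
  moreover have "z = (u * ups ^ 8) * w ^ 7" unfolding z_def uw(2) by (simp add: mult_ac)
  moreover have "u * ups ^ 8 dvd 1" using mult_dvd_mono[OF uw(1) u8] by simp
  ultimately obtain g where g: "z = g ^ 7" using unit_part_seventh_power z49 by blast
  \<comment> \<open>The prime 2 - \<theta> is ramified over \<open>\<int>[\<kappa>]\<close>, hence
    associated to its conjugate; \<open>mu\<close> is the quotient.\<close>
  define mu where "mu = Fq (C13 8 (- 3) (- 2)) (C13 5 (- 1) (- 1))"
  have mu: "pith * mu = fbar pith" "mu * fbar mu = 1"
    by (simp_all add: mu_def fbar_def fq_defs c13_defs numeral_c13)
  \<comment> \<open>The exponent 3 makes x = g (2 - \<theta>) mu^4, so that the power of 2 -
    \<theta> and mu in \<open>x7\<close> combines to rho0^28. This is fixed by \<open>fbar\<close>,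
    so the conjugate relation carries the same factor.\<close>
  define g2 where "g2 = g * mu ^ 3"
  define x where "x = g2 * fbar pith"
  have rho: "pith * fbar pith = Fq rho0 0"
    unfolding fbar_mult by (simp add: nf13_def c13_defs numeral_c13)
  have x7: "pith * (13 ^ 8 * x ^ 7) = ?q * Fq rho0 0 ^ 28"
  proof -
    have "Fq rho0 0 ^ 28 = (pith ^ 2 * mu) ^ 28" unfolding rho[symmetric] mu(1)[symmetric] by (simp add: power2_eq_square mult_ac)
    also have "\<dots> = pith ^ 48 * pith ^ 8 * mu ^ 28" by (simp add: power_mult_distrib flip: power_mult power_add)
    also have "\<dots> = 13 ^ 8 * ups ^ 8 * pith ^ 8 * mu ^ 28" unfolding pi48 ..
    finally have r: "Fq rho0 0 ^ 28 = 13 ^ 8 * ups ^ 8 * pith ^ 8 * mu ^ 28" .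
    have "x = g * pith * mu ^ 4" unfolding x_def g2_def mu(1)[symmetric] by (simp add: eval_nat_numeral mult_ac)
    hence "x ^ 7 = z * (pith ^ 7 * mu ^ 28)" unfolding g by (simp add: power_mult_distrib mult_ac flip: power_mult)
    hence "pith * (13 ^ 8 * x ^ 7) = ?q * (13 ^ 8 * ups ^ 8 * (pith * pith ^ 7) * mu ^ 28)"
      unfolding z_def by (simp only: mult_ac)
    also have "pith * pith ^ 7 = pith ^ 8" by (simp flip: power_Suc)
    finally show ?thesis unfolding r .
  qed
  have fb13: "fbar 13 = 13" "fbar (Fq rho0 0) = Fq rho0 0" by (simp_all add: fbar_def numeral_fq)
  have y7: "fbar pith * (13 ^ 8 * fbar x ^ 7) = fbar ?q * Fq rho0 0 ^ 28"
    using arg_cong[OF x7, of fbar] by (simp only: rhom_mult[OF rhom_fbar] rhom_power[OF rhom_fbar] fb13)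
  define del where "del = fbar pith - pith"
  have qd: "?q * fbar pith - fbar ?q * pith = of_int ((a + b)^2) * del"
    unfolding qf_alt del_def by (simp add: rhom_simps[OF rhom_fbar] algebra_simps)
  have rr: "Fq rho0 0 * (13 ^ 8 * (x ^ 7 - fbar x ^ 7)) = Fq rho0 0 ^ 28 * (of_int ((a + b)^2) * del)"
  proof -
    have "Fq rho0 0 * (13 ^ 8 * (x ^ 7 - fbar x ^ 7)) = fbar pith * (pith * (13 ^ 8 * x ^ 7)) - pith * (fbar pith * (13 ^ 8 * fbar x ^ 7))"
      unfolding rho[symmetric] by (simp add: algebra_simps)
    also have "\<dots> = Fq rho0 0 ^ 28 * (?q * fbar pith - fbar ?q * pith)"
      unfolding x7 y7 by (simp add: algebra_simps)
    finally show ?thesis unfolding qd .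
  qed
  define U where "U = Fq (C13 28 (- 8) (- 7)) 0"
  have U: "13 = Fq rho0 0 ^ 3 * U" by (simp add: U_def power3_eq_cube fq_defs c13_defs numeral_fq numeral_c13)
  have r0: "Fq rho0 0 \<noteq> 0" by (simp add: zero_fq_def zero_c13_def)
  have rel7: "U ^ 8 * (x ^ 7 - fbar x ^ 7) = Fq rho0 0 ^ 3 * (of_int ((a + b)^2) * del)"
  proof -
    have "Fq rho0 0 ^ 25 * (U ^ 8 * (x ^ 7 - fbar x ^ 7)) = Fq rho0 0 * (13 ^ 8 * (x ^ 7 - fbar x ^ 7))"
    proof -
      have "r ^ 25 * (v ^ 8 * y) = r * ((r ^ 3 * v) ^ 8 * y)" for r v y :: fq
      proof -
        have "r * ((r ^ 3 * v) ^ 8 * y) = (r * r ^ 24) * (v ^ 8 * y)" by (simp only: power_mult_distrib mult_ac power_mult[symmetric]) simp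
        moreover have "r * r ^ 24 = r ^ 25" by (simp flip: power_Suc)
        ultimately show ?thesis by (simp only:)
      qed
      from this[of "Fq rho0 0" U] show ?thesis unfolding U[symmetric] .
    qed
    also have "\<dots> = Fq rho0 0 ^ 25 * (Fq rho0 0 ^ 3 * (of_int ((a + b)^2) * del))"
      unfolding rr by (simp flip: power_add mult.assoc)
    finally show ?thesis using r0 by (metis mult_left_cancel power_not_zero)
  qed
  define kap0 where "kap0 = C13 15 (- 5) (- 4)"
  have kap0: "C13 12 (- 4) (- 3) = rho0 * kap0" by (simp add: kap0_def c13_defs)
  \<comment> \<open>x is divisible by the conjugate of 2 - \<theta>, so rho0 divides both (x - fbar
    x)^2 and x fbar x. Removing it makes the pair comaximal and cancels rho0^7 in the
    relation.\<close>
  define X where "X = f1 x ^ 2 * kap0"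
  define Y where "Y = nf13 g2"
  have rX: "f1 x ^ 2 * C13 12 (- 4) (- 3) = rho0 * X" unfolding kap0 X_def by (simp add: mult_ac)
  have rY: "nf13 x = rho0 * Y"
  proof -
    have "Fq (nf13 x) 0 = (g2 * fbar g2) * (pith * fbar pith)"
      unfolding fbar_mult[symmetric] x_def by (simp add: rhom_mult[OF rhom_fbar] fbar_fbar mult_ac)
    also have "\<dots> = Fq (rho0 * Y) 0" unfolding rho fbar_mult[of g2] Y_def by (simp add: fq_embed mult_ac)
    finally show ?thesis by simp
  qed
  let ?P = "X^3 + 7 * (X^2 * Y) + 14 * (X * Y^2) + 7 * Y^3"
  have rP: "rho0 * X * ((rho0 * X)^3 + 7 * ((rho0 * X)^2 * (rho0 * Y)) + 14 * (rho0 * X * (rho0 * Y)^2) + 7 * (rho0 * Y)^3)^2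
      = rho0 ^ 7 * (X * ?P^2)"
  proof -
    have "(r * X)^3 + 7 * ((r * X)^2 * (r * Y)) + 14 * (r * X * (r * Y)^2) + 7 * (r * Y)^3 = r^3 * ?P" for r
      by (simp add: algebra_simps power2_eq_square power3_eq_cube)
    moreover have "r * X * (r^3 * Q)^2 = r ^ 7 * (X * Q^2)" for r Q :: c13
      by (simp add: power_mult_distrib eval_nat_numeral mult_ac)
    ultimately show ?thesis by simp
  qed
  define V where "V = C13 28 (- 8) (- 7)"
  have sq: "V ^ 16 * (rho0 ^ 7 * (X * ?P^2)) = rho0 ^ 7 * (81 * kap0 * of_int d ^ 28)"
  proof -
    have "f1 pith ^ 2 * C13 12 (- 4) (- 3) = C13 12 (- 4) (- 3)" by (simp add: power2_eq_square c13_defs)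
    hence "(pith - fbar pith)^2 = Fq (rho0 * kap0) 0" unfolding diff_fbar kap0 by simp
    hence dsq: "del^2 = Fq (rho0 * kap0) 0" unfolding del_def by (simp add: power2_commute)
    have "Fq (V ^ 16 * (rho0 ^ 7 * (X * ?P^2))) 0 = (U ^ 8 * (x ^ 7 - fbar x ^ 7))^2"
    proof -
      have "(U ^ 8 * (x ^ 7 - fbar x ^ 7))^2 = U ^ 16 * (x ^ 7 - fbar x ^ 7)^2" by (simp add: power_mult_distrib flip: power_mult)
      also have "\<dots> = Fq V 0 ^ 16 * Fq (rho0 ^ 7 * (X * ?P^2)) 0"
        unfolding sextic_relation(1) rX rY rP U_def V_def by (rule refl)
      finally show ?thesis by (simp only: rhom_mult[OF rhom_Fq] rhom_power[OF rhom_Fq])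
    qed
    also have "\<dots> = (Fq rho0 0 ^ 3)^2 * (of_int ((a + b)^2)^2 * del^2)" unfolding rel7 by (simp only: power_mult_distrib)
    also have "\<dots> = Fq (rho0 ^ 7 * (81 * kap0 * of_int d ^ 28)) 0"
    proof -
      have "of_int ((a + b)^2)^2 = (81 * of_int d ^ 28 :: fq)"
        unfolding s by (simp add: power_mult_distrib flip: power_mult)
      also have "\<dots> = Fq (81 * of_int d ^ 28) 0"
        by (simp only: rhom_mult[OF rhom_Fq] rhom_power[OF rhom_Fq] rhom_of_int[OF rhom_Fq] rhom_numeral[OF rhom_Fq])
      finally have 1: "of_int ((a + b)^2)^2 = Fq (81 * of_int d ^ 28) 0" .
      have "(r ^ 3)^2 * ((81 * D) * (r * k)) = r ^ 7 * (81 * k * D)" for r D k :: c13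
      proof -
        have "(r ^ 3)^2 * r = r ^ 7" by (simp flip: power_mult power_Suc2)
        moreover have "(r ^ 3)^2 * ((81 * D) * (r * k)) = ((r ^ 3)^2 * r) * (81 * k * D)" by (simp only: mult_ac)
        ultimately show ?thesis by (simp only:)
      qed
      from this[of rho0 "of_int d ^ 28" kap0]
      have "(rho0 ^ 3)^2 * ((81 * of_int d ^ 28) * (rho0 * kap0)) = rho0 ^ 7 * (81 * kap0 * of_int d ^ 28)" .
      moreover have "(Fq rho0 0 ^ 3)^2 * (of_int ((a + b)^2)^2 * del^2) = Fq ((rho0 ^ 3)^2 * ((81 * of_int d ^ 28) * (rho0 * kap0))) 0"
        unfolding 1 dsq by (simp only: rhom_mult[OF rhom_Fq] rhom_power[OF rhom_Fq])
      ultimately show ?thesis by (simp only:)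
    qed
    finally show ?thesis by simp
  qed
  have rel: "V ^ 16 * X * ?P^2 = (81 * kap0) * of_int d ^ 28"
  proof -
    have "rho0 ^ 7 * (V ^ 16 * X * ?P^2) = rho0 ^ 7 * (81 * kap0 * of_int d ^ 28)" using sq by (simp only: mult_ac)
    moreover have "rho0 ^ 7 \<noteq> 0" by (rule power_not_zero) (simp add: zero_c13_def)
    ultimately show ?thesis by (metis mult_left_cancel)
  qed
  have "V * C13 3 (- 13) 8 = 1" "kap0 * C13 0 0 1 = 1" by (simp_all add: V_def kap0_def c13_defs)
  hence units: "V dvd 1" "kap0 dvd 1" by (metis dvd_triv_left)+
  have V16: "V ^ 16 dvd 1" using dvd_power_same[OF units(1), of 16] by simp
  show False
  proof (rule no_initial_state[where q = 1, OF _ _ _ _ _ _ rel d7])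
    show "X \<noteq> 0"
    proof
      assume "X = 0"
      hence "(81 * kap0) * of_int d ^ 28 = 0" using rel by simp
      moreover have "kap0 \<noteq> 0" by (simp add: kap0_def zero_c13_def)
      moreover have "(81 :: c13) \<noteq> 0" using of_int_c13_nonzero[of 81] by simp
      moreover have "(of_int d :: c13) \<noteq> 0" using d by (simp add: of_int_c13_nonzero)
      ultimately show False by (metis mult_eq_0_iff power_not_zero)
    qed
    have Xx: "Fq rho0 0 * Fq X 0 = (x - fbar x)^2" unfolding diff_fbar rX by (simp add: fq_embed)
    show "comax X Y"
    proof -
      define M where "M = ups ^ 8 * mu ^ 21"
      have "mu dvd 1" using mu(2) by (metis dvd_triv_left)
      hence "mu ^ 21 dvd 1" using dvd_power_same[of mu 1 21] by simp
      hence M: "M dvd 1" unfolding M_def using mult_dvd_mono[OF u8] by fastforce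
      hence fM: "fbar M dvd 1" using rhom_dvd[OF rhom_fbar M] by (simp add: rhom_1[OF rhom_fbar])
      have g27: "g2 ^ 7 = ?q * M" unfolding g2_def M_def power_mult_distrib g[symmetric] z_def by (simp add: mult_ac flip: power_mult)
      have "comax ?q (fbar ?q)" using cj[of 3] by (simp add: eval_nat_numeral sf_sq_fbar)
      hence c1: "comax (?q * M) (fbar ?q)" using unit_comax[OF M] comax_mult comax_sym by blast
      hence c2: "comax (?q * M) (fbar ?q * fbar M)" using unit_comax[OF fM] comax_mult comax_sym by blast
      have c3: "comax (?q * M) 13" using q13 unit_comax[OF M] comax_mult comax_sym by blast
      have gd: "g2 dvd ?q * M" unfolding g27[symmetric] by (simp add: dvd_power)
      have gbd: "fbar g2 dvd fbar ?q * fbar M" using rhom_dvd[OF rhom_fbar gd] by (simp add: rhom_mult[OF rhom_fbar])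
      have cg: "comax g2 (fbar g2)" by (rule comax_dvd[OF comax_dvd_left[OF c2 gd] gbd])
      have "comax g2 13" by (rule comax_dvd_left[OF c3 gd])
      hence cp: "comax g2 pith" by (rule comax_dvd) (simp flip: picof)
      have main: "comax g2 (Fq X 0)"
      proof -
        have "comax g2 (fbar g2 * pith)" using cg cp by (rule comax_mult)
        hence "comax g2 (- (x - fbar x))"
          by (rule comax_cong) (simp add: x_def rhom_mult[OF rhom_fbar] fbar_fbar)
        hence "comax g2 (x - fbar x)" by (rule comax_dvd) (simp only: dvd_minus_iff dvd_refl)
        hence "comax g2 ((x - fbar x)^2)" by (rule comax_power)
        thus ?thesis unfolding Xx[symmetric] by (rule comax_dvd) simp
      qed
      have "fbar (Fq X 0) = Fq X 0" by (simp add: fbar_def)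
      with comax_rhom[OF rhom_fbar main] have "comax (fbar g2) (Fq X 0)" by simp
      with main have "comax (Fq X 0) (g2 * fbar g2)" by (intro comax_mult) (auto intro: comax_sym)
      thus ?thesis unfolding Y_def fbar_mult by (rule comax_Fq)
    qed
    show "3 dvd X"
    proof -
      have "U dvd 1" using rhom_dvd[OF rhom_Fq units(1)] unfolding U_def V_def by (simp add: one_fq_def)
      hence U8: "U ^ 8 dvd 1" using dvd_power_same[of U 1 8] by simp
      have "of_int ((a + b)^2) = 3 * (of_int (3 * d ^ 14) :: fq)"
        unfolding s by (simp add: power_mult_distrib flip: power_mult)
      hence "3 dvd (of_int ((a + b)^2) :: fq)" by (rule dvdI)
      hence "3 dvd U ^ 8 * (x ^ 7 - fbar x ^ 7)" unfolding rel7 by (intro dvd_mult dvd_mult2)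
      from unit_cancel[OF U8 this] have "3 dvd x ^ 7 - fbar x ^ 7" .
      from seventh_power_cancel_mod_3[OF power27_mod_3_fq this]
      have "3 dvd (x - fbar x)^2" by (simp add: power2_eq_square)
      hence "Fq 3 0 dvd Fq (rho0 * X) 0" unfolding diff_fbar rX by (simp only: numeral_fq)
      hence "3 dvd rho0 * X" by (simp add: Fq_dvd)
      moreover have "comax 3 rho0"
      proof -
        have "(- 4) * 3 + 1 * 13 = (1::c13)" by simp
        hence "comax 3 (13::c13)" by (rule comaxI)
        thus ?thesis by (rule comax_dvd[OF _ rho0_dvd_13])
      qed
      ultimately show ?thesis using comax_cancel by blast
    qed
    show "0 \<le> e13 ((sk13 ^^ j) X) \<and> 0 \<le> e13 ((sk13 ^^ j) (X + 4 * Y))" for j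
    proof -
      have r: "rhom (\<lambda>x. e13 ((sk13 ^^ j) x))" by (rule rhom_comp[OF rhom_e13 rhom_funpow[OF rhom_sk13]])
      let ?E = "\<lambda>y. e13 ((sk13 ^^ j) y)"
      \<comment> \<open>rho0 is totally positive, so dividing by it preserves the signs of all
        conjugates.\<close>
      have "4 * rho0 = (2 * kap - 1)^2 + 3" by (simp add: power2_eq_square c13_defs numeral_c13)
      hence "4 * ?E rho0 = (2 * ?E kap - 1)^2 + 3"
        using rhom_simps[OF r] by (metis (no_types, lifting))
      moreover have "0 \<le> (2 * ?E kap - 1)^2" by simp
      ultimately have pos: "0 < ?E rho0" by linarith
      have "0 \<le> ?E (rho0 * X)" "0 \<le> ?E (rho0 * X + 4 * (rho0 * Y))"
        using square_positive[of "rho0 * X" "x - fbar x"] square_positive[of "rho0 * X + 4 * (rho0 * Y)" "Fq (trF x) 0"]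
          sextic_relation(2,3)[of x] unfolding rX rY by blast+
      moreover have "rho0 * X + 4 * (rho0 * Y) = rho0 * (X + 4 * Y)" by (simp add: algebra_simps)
      ultimately have "0 \<le> ?E rho0 * ?E X" "0 \<le> ?E rho0 * ?E (X + 4 * Y)" by (simp_all only: rhom_mult[OF r])
      thus ?thesis using pos by (simp add: zero_le_mult_iff)
    qed
    show "comax 7 (V ^ 16)" by (rule comax_sym[OF unit_comax[OF V16]])
    show "V ^ 16 dvd (21 * 1) ^ 4" by (rule dvd_trans[OF V16]) simp
    have "3 dvd (21::c13)" by (rule dvdI[of _ _ 7]) simp
    from dvd_power_same[OF this, of 4] have "81 dvd (21::c13) ^ 4" by simp
    from mult_dvd_mono[OF this units(2)] show "81 * kap0 dvd (21 * 1) ^ 4" by simp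
  qed simp_all
qed

theorem theorem1p1:
  shows "\<not> (\<exists>a b c :: int. a * b * c \<noteq> 0 \<and> gcd a (gcd b c) = 1 \<and> a ^ 13 + b ^ 13 = 3 * c ^ 7)"
proof
  assume "\<exists>a b c :: int. a * b * c \<noteq> 0 \<and> gcd a (gcd b c) = 1 \<and> a ^ 13 + b ^ 13 = 3 * c ^ 7"
  then obtain a b c :: int where nz: "a * b * c \<noteq> 0" and g: "gcd a (gcd b c) = 1" and eq: "a ^ 13 + b ^ 13 = 3 * c ^ 7"
    by (elim exE conjE) (rule that)
  have "coprime a b"
  proof (rule ccontr)
    assume "\<not> coprime a b"
    then obtain p where p: "prime p" "p dvd a" "p dvd b" using common_prime_exists nz by (metis mult_eq_0_iff)
    have "p ^ 13 dvd a ^ 13" "p ^ 13 dvd b ^ 13" using p by (auto intro: dvd_power_same)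
    hence pd: "p ^ 13 dvd 3 * c ^ 7" unfolding eq[symmetric] by (rule dvd_add)
    \<comment> \<open>p^13 exceeds 3, so a common prime of a and b must divide c as well.\<close>
    have "p dvd c"
    proof (rule ccontr)
      assume "\<not> p dvd c"
      hence "\<not> p dvd c ^ 7" using p(1) prime_dvd_power by blast
      hence "coprime p (c ^ 7)" by (rule prime_imp_coprime[OF p(1)])
      hence "coprime (p ^ 13) (c ^ 7)" by simp
      hence "p ^ 13 dvd 3" using pd by (simp only: coprime_dvd_mult_left_iff)
      hence "p ^ 13 \<le> 3" by (rule zdvd_imp_le) simp
      moreover have "2 ^ 13 \<le> p ^ 13" using prime_ge_2_int[OF p(1)] by (intro power_mono) auto
      ultimately show False by simp
    qed
    hence "p dvd gcd a (gcd b c)" using p by simp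
    hence "p dvd 1" unfolding g .
    thus False using p(1) not_prime_unit by blast
  qed
  moreover have "c \<noteq> 0" using nz by auto
  ultimately show False using integer_cases[OF _ eq] unramified_case ramified_case by blast
qed

end
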